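(* There exist universal constants $\mathbf{k}\ge 1$ and $\alpha\in(0,1)$ such that the following holds. Fix $0<r_0\le 1$ such that $\Omega^{r_0}$ is nonempty and let $0<r<r_0/4$. For all $x_0\in\Omega^{4r}$, all $V\in\mathscr{V}$ and all $u\in W^{2,p}(\Omega)$ satisfying $(-\Delta+V)u=0$ in $\Omega$, $$\|u\|_{L^2(B(x_0,2r))}\le q_V\,r^{-1}\,\|u\|_{L^2(B(x_0,3r))}^{1-\alpha}\,\|u\|_{L^2(B(x_0,r))}^{\alpha},$$ where $q_V:=\mathbf{k}\,\vartheta_V\,(1+\kappa_V^{(1)})$.
   Context: $n\ge 3$ is an integer, $\Omega\subset\mathbb{R}^n$ is a bounded Lipschitz domain, $p:=2n/(n+2)$, $p':=2n/(n-2)$. For $r>0$, $\Omega^r:=\{x\in\Omega:\ \mathrm{dist}(x,\mathbb{R}^n\setminus\Omega)>r\}$; $B(x_0,r)$ is the open ball. A universal constant depends on none of the data. $\sigma:=\sup\{\|w\|_{L^{p'}(\Omega)}:\ w\in H^1_0(\Omega),\ \|\nabla w\|_{L^2(\Omega)}=1\}$. Let $\Lambda:=\{\lambda>0:\ \mathrm{dist}(\lambda,\mathbb{N}+(n-2)/2)=1/2\}$. The constant $\vartheta=\vartheta(n)\ge 1$ is a fixed constant for which the (known, Jerison–Kenig) Carleman inequality $\||x|^{-\lambda}u\|_{L^{p'}(B)}\le\vartheta\||x|^{-\lambda}\Delta u\|_{L^p(B)}$ holds for every ball $B$ centered at $0$, every $\lambda\in\Lambda$ and every $u\in W^{2,p}(B)$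 with $\mathrm{supp}(u)\subset B\setminus\{0\}$. For $V\in L^{n/2}(\Omega)$ put $\kappa_V:=\|V\|_{L^{n/2}(\Omega)}$, and $\mathscr{V}:=\{V\in L^{n/2}(\Omega):\ 2\sigma^2\kappa_V<1\ \text{and}\ \vartheta\kappa_V<1\}$. For $V\in\mathscr{V}$: $\mathbf{I}_V:=(1-2\sigma^2\kappa_V)^{-1/2}$, $\kappa_V^{(1)}:=2(1+\sigma)\mathbf{I}_V^2+2\sigma\sqrt{\kappa_V}\,\mathbf{I}_V+\sigma/\sqrt{1+\sigma^2}$, and $\vartheta_V:=\vartheta(1-\vartheta\kappa_V)^{-1}$. *)

theory Defs
  imports "HOL-Analysis.Analysis"
begin

text \<open>
  The constants of the theorem depend on no data, hence not on the dimension either, so the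
  dimension has to be quantified inside the statement. The space of dimension \<open>n\<close> is therefore
  the set of extensional functions on \<open>{..<n}\<close>: it is at once the topspace of
  \<open>powertop_real {..<n}\<close> and the space of the product measure, and \<open>x(i := t)\<close> stays in it
  for \<open>i < n\<close>.
\<close>

definition Rn :: "nat \<Rightarrow> (nat \<Rightarrow> real) set" where
  "Rn n = (\<Pi>\<^sub>E i\<in>{..<n}. UNIV)"

abbreviation top_Rn :: "nat \<Rightarrow> (nat \<Rightarrow> real) topology" where
  "top_Rn n \<equiv> powertop_real {..<n}"

definition leb :: "nat \<Rightarrow> (nat \<Rightarrow> real) measure" where
  "leb n = completion (\<Pi>\<^sub>M i\<in>{..<n}. lborel)"

definition origin :: "nat \<Rightarrow> nat \<Rightarrow> real" where
  "origin n = (\<lambda>i\<in>{..<n}. 0)"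

definition inner_n :: "nat \<Rightarrow> (nat \<Rightarrow> real) \<Rightarrow> (nat \<Rightarrow> real) \<Rightarrow> real" where
  "inner_n n x y = (\<Sum>i<n. x i * y i)"

definition norm_n :: "nat \<Rightarrow> (nat \<Rightarrow> real) \<Rightarrow> real" where
  "norm_n n x = L2_set x {..<n}"

definition dist_n :: "nat \<Rightarrow> (nat \<Rightarrow> real) \<Rightarrow> (nat \<Rightarrow> real) \<Rightarrow> real" where
  "dist_n n x y = norm_n n (\<lambda>i. x i - y i)"

definition ball_n :: "nat \<Rightarrow> (nat \<Rightarrow> real) \<Rightarrow> real \<Rightarrow> (nat \<Rightarrow> real) set" where
  "ball_n n x r = {y \<in> Rn n. dist_n n x y < r}"


section \<open>Bounded Lipschitz domains\<close>

text \<open>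
  Near each boundary point the domain is the strict epigraph, in some unit direction \<open>\<nu>\<close>, of a
  Lipschitz function \<open>\<gamma>\<close> on the hyperplane orthogonal to \<open>\<nu>\<close>. Only the values of \<open>\<gamma>\<close> on this
  hyperplane matter.
\<close>

definition lipschitz_boundary :: "nat \<Rightarrow> (nat \<Rightarrow> real) set \<Rightarrow> bool" where
  "lipschitz_boundary n U \<longleftrightarrow>
     (\<forall>x \<in> top_Rn n frontier_of U.
        \<exists>\<nu> \<in> Rn n. \<exists>\<gamma> :: (nat \<Rightarrow> real) \<Rightarrow> real. \<exists>L \<delta>. norm_n n \<nu> = 1 \<and> \<delta> > 0 \<and>
          (\<forall>y \<in> Rn n. \<forall>z \<in> Rn n. inner_n n y \<nu> = 0 \<longrightarrow> inner_n n z \<nu> = 0 \<longrightarrow>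
             \<bar>\<gamma> y - \<gamma> z\<bar> \<le> L * dist_n n y z) \<and>
          (\<forall>y \<in> ball_n n x \<delta>.
             y \<in> U \<longleftrightarrow> inner_n n y \<nu> > \<gamma> (\<lambda>i\<in>{..<n}. y i - inner_n n y \<nu> * \<nu> i)))"

definition bounded_lipschitz_domain :: "nat \<Rightarrow> (nat \<Rightarrow> real) set \<Rightarrow> bool" where
  "bounded_lipschitz_domain n U \<longleftrightarrow>
     U \<noteq> {} \<and> openin (top_Rn n) U \<and> connectedin (top_Rn n) U \<and>
     (\<exists>R. \<forall>x\<in>U. norm_n n x \<le> R) \<and> lipschitz_boundary n U"

definition inner_part :: "nat \<Rightarrow> (nat \<Rightarrow> real) set \<Rightarrow> real \<Rightarrow> (nat \<Rightarrow> real) set" where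
  "inner_part n U r = {x \<in> U. (INF y \<in> Rn n - U. dist_n n x y) > r}"


section \<open>Lebesgue and Sobolev spaces\<close>

definition Lp :: "nat \<Rightarrow> real \<Rightarrow> (nat \<Rightarrow> real) set \<Rightarrow> ((nat \<Rightarrow> real) \<Rightarrow> real) set" where
  "Lp n p U = {f. set_borel_measurable (leb n) U f \<and>
                  set_integrable (leb n) U (\<lambda>x. \<bar>f x\<bar> powr p)}"

definition Lp_norm :: "nat \<Rightarrow> real \<Rightarrow> (nat \<Rightarrow> real) set \<Rightarrow> ((nat \<Rightarrow> real) \<Rightarrow> real) \<Rightarrow> real" where
  "Lp_norm n p U f = (LINT x:U|leb n. \<bar>f x\<bar> powr p) powr (1 / p)"

definition locally_integrable ::
    "nat \<Rightarrow> (nat \<Rightarrow> real) set \<Rightarrow> ((nat \<Rightarrow> real) \<Rightarrow> real) \<Rightarrow> bool" where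
  "locally_integrable n U f \<longleftrightarrow>
     (\<forall>K. compactin (top_Rn n) K \<and> K \<subseteq> U \<longrightarrow> set_integrable (leb n) K f)"

definition partial :: "nat \<Rightarrow> ((nat \<Rightarrow> real) \<Rightarrow> real) \<Rightarrow> (nat \<Rightarrow> real) \<Rightarrow> real" where
  "partial i f = (\<lambda>x. deriv (\<lambda>t. f (x(i := t))) (x i))"

text \<open>A list of indices below \<open>n\<close> encodes the multi-index counting their occurrences.\<close>

definition partials :: "nat list \<Rightarrow> ((nat \<Rightarrow> real) \<Rightarrow> real) \<Rightarrow> (nat \<Rightarrow> real) \<Rightarrow> real" where
  "partials is f = foldr partial is f"

definition smooth :: "nat \<Rightarrow> ((nat \<Rightarrow> real) \<Rightarrow> real) \<Rightarrow> bool" where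
  "smooth n f \<longleftrightarrow>
     (\<forall>is. set is \<subseteq> {..<n} \<longrightarrow>
        continuous_map (top_Rn n) euclideanreal (partials is f) \<and>
        (\<forall>i<n. \<forall>x \<in> Rn n. (\<lambda>t. partials is f (x(i := t))) differentiable (at (x i))))"

definition test_fun :: "nat \<Rightarrow> (nat \<Rightarrow> real) set \<Rightarrow> ((nat \<Rightarrow> real) \<Rightarrow> real) set" where
  "test_fun n U = {\<phi>. smooth n \<phi> \<and>
     compactin (top_Rn n) (top_Rn n closure_of {x \<in> Rn n. \<phi> x \<noteq> 0}) \<and>
     top_Rn n closure_of {x \<in> Rn n. \<phi> x \<noteq> 0} \<subseteq> U}"

definition has_weak_deriv :: "nat \<Rightarrow> (nat \<Rightarrow> real) set \<Rightarrow> nat list \<Rightarrow>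
    ((nat \<Rightarrow> real) \<Rightarrow> real) \<Rightarrow> ((nat \<Rightarrow> real) \<Rightarrow> real) \<Rightarrow> bool" where
  "has_weak_deriv n U is u g \<longleftrightarrow>
     locally_integrable n U u \<and> locally_integrable n U g \<and>
     (\<forall>\<phi> \<in> test_fun n U.
        (LINT x:U|leb n. u x * partials is \<phi> x) = (-1) ^ length is * (LINT x:U|leb n. g x * \<phi> x))"

definition sobolev ::
    "nat \<Rightarrow> nat \<Rightarrow> real \<Rightarrow> (nat \<Rightarrow> real) set \<Rightarrow> ((nat \<Rightarrow> real) \<Rightarrow> real) set" where
  "sobolev n k p U = {u \<in> Lp n p U.
     \<forall>is. set is \<subseteq> {..<n} \<and> length is \<le> k \<longrightarrow> (\<exists>g \<in> Lp n p U. has_weak_deriv n U is u g)}"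

text \<open>A representative of the weak derivative; where one exists it is unique almost everywhere.\<close>

definition weak_deriv :: "nat \<Rightarrow> (nat \<Rightarrow> real) set \<Rightarrow> nat list \<Rightarrow>
    ((nat \<Rightarrow> real) \<Rightarrow> real) \<Rightarrow> (nat \<Rightarrow> real) \<Rightarrow> real" where
  "weak_deriv n U is u = (SOME g. has_weak_deriv n U is u g)"

definition laplacian ::
    "nat \<Rightarrow> (nat \<Rightarrow> real) set \<Rightarrow> ((nat \<Rightarrow> real) \<Rightarrow> real) \<Rightarrow> (nat \<Rightarrow> real) \<Rightarrow> real" where
  "laplacian n U u = (\<lambda>x. \<Sum>i<n. weak_deriv n U [i, i] u x)"

definition grad_L2_norm ::
    "nat \<Rightarrow> (nat \<Rightarrow> real) set \<Rightarrow> ((nat \<Rightarrow> real) \<Rightarrow> real) \<Rightarrow> real" where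
  "grad_L2_norm n U u = Lp_norm n 2 U (\<lambda>x. norm_n n (\<lambda>i. weak_deriv n U [i] u x))"

definition H1_norm :: "nat \<Rightarrow> (nat \<Rightarrow> real) set \<Rightarrow> ((nat \<Rightarrow> real) \<Rightarrow> real) \<Rightarrow> real" where
  "H1_norm n U u = sqrt ((Lp_norm n 2 U u)\<^sup>2 + (grad_L2_norm n U u)\<^sup>2)"

definition H10 :: "nat \<Rightarrow> (nat \<Rightarrow> real) set \<Rightarrow> ((nat \<Rightarrow> real) \<Rightarrow> real) set" where
  "H10 n U = {w \<in> sobolev n 1 2 U.
     \<exists>\<phi>. (\<forall>k. \<phi> k \<in> test_fun n U) \<and> (\<lambda>k. H1_norm n U (\<lambda>x. w x - \<phi> k x)) \<longlonglongrightarrow> 0}"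

text \<open>
  Support of an almost-everywhere class on \<open>U\<close>. The closure is taken in the whole space, so a
  support contained in a ball \<open>U\<close> is compact and keeps away from the boundary of \<open>U\<close>.
\<close>

definition supp :: "nat \<Rightarrow> (nat \<Rightarrow> real) set \<Rightarrow> ((nat \<Rightarrow> real) \<Rightarrow> real) \<Rightarrow> (nat \<Rightarrow> real) set" where
  "supp n U u = {x \<in> Rn n. \<forall>W. openin (top_Rn n) W \<and> x \<in> W \<longrightarrow>
                   \<not> (AE y in leb n. y \<in> W \<inter> U \<longrightarrow> u y = 0)}"


section \<open>The constants\<close>

definition exp_p :: "nat \<Rightarrow> real" where
  "exp_p n = 2 * real n / (real n + 2)"

definition exp_p' :: "nat \<Rightarrow> real" where
  "exp_p' n = 2 * real n / (real n - 2)"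

definition sigma :: "nat \<Rightarrow> (nat \<Rightarrow> real) set \<Rightarrow> real" where
  "sigma n U = Sup {Lp_norm n (exp_p' n) U w | w. w \<in> H10 n U \<and> grad_L2_norm n U w = 1}"

text \<open>The natural numbers contain 0 here, as in the degrees of spherical harmonics.\<close>

definition Lambda :: "nat \<Rightarrow> real set" where
  "Lambda n = {\<mu>. \<mu> > 0 \<and> infdist \<mu> (range (\<lambda>m::nat. real m + (real n - 2) / 2)) = 1 / 2}"

definition carleman :: "nat \<Rightarrow> real \<Rightarrow> bool" where
  "carleman n \<theta> \<longleftrightarrow>
     (\<forall>R>0. \<forall>\<mu> \<in> Lambda n. \<forall>u \<in> sobolev n 2 (exp_p n) (ball_n n (origin n) R).
        supp n (ball_n n (origin n) R) u \<subseteq> ball_n n (origin n) R - {origin n} \<longrightarrow>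
        Lp_norm n (exp_p' n) (ball_n n (origin n) R) (\<lambda>x. norm_n n x powr (-\<mu>) * u x)
          \<le> \<theta> * Lp_norm n (exp_p n) (ball_n n (origin n) R)
                 (\<lambda>x. norm_n n x powr (-\<mu>) * laplacian n (ball_n n (origin n) R) u x))"

definition kappa :: "nat \<Rightarrow> (nat \<Rightarrow> real) set \<Rightarrow> ((nat \<Rightarrow> real) \<Rightarrow> real) \<Rightarrow> real" where
  "kappa n U V = Lp_norm n (real n / 2) U V"

definition potentials ::
    "nat \<Rightarrow> (nat \<Rightarrow> real) set \<Rightarrow> real \<Rightarrow> ((nat \<Rightarrow> real) \<Rightarrow> real) set" where
  "potentials n U \<theta> = {V \<in> Lp n (real n / 2) U.
     2 * (sigma n U)\<^sup>2 * kappa n U V < 1 \<and> \<theta> * kappa n U V < 1}"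

definition I_const :: "nat \<Rightarrow> (nat \<Rightarrow> real) set \<Rightarrow> ((nat \<Rightarrow> real) \<Rightarrow> real) \<Rightarrow> real" where
  "I_const n U V = (1 - 2 * (sigma n U)\<^sup>2 * kappa n U V) powr (-1/2)"

definition kappa1 :: "nat \<Rightarrow> (nat \<Rightarrow> real) set \<Rightarrow> ((nat \<Rightarrow> real) \<Rightarrow> real) \<Rightarrow> real" where
  "kappa1 n U V =
     2 * (1 + sigma n U) * (I_const n U V)\<^sup>2
     + 2 * sigma n U * sqrt (kappa n U V) * I_const n U V
     + sigma n U / sqrt (1 + (sigma n U)\<^sup>2)"

definition theta_V ::
    "nat \<Rightarrow> (nat \<Rightarrow> real) set \<Rightarrow> real \<Rightarrow> ((nat \<Rightarrow> real) \<Rightarrow> real) \<Rightarrow> real" where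
  "theta_V n U \<theta> V = \<theta> * inverse (1 - \<theta> * kappa n U V)"

end

theory Submission
  imports Defs "HOL-Computational_Algebra.Polynomial"
begin

text \<open>
  Write \<open>A\<close>, \<open>M\<close>, \<open>B\<close> for the \<open>L\<^sup>2\<close> norms of \<open>u\<close> on the balls of radius \<open>r\<close>, \<open>2 r\<close>, \<open>3 r\<close>. The Carleman
  inequality, applied to mollifications of \<open>u\<close> cut off near the centre and near the boundary of the largest
  ball, gives \<open>M \<le> K n \<vartheta>\<^sub>V (4\<^sup>\<mu> A + (2 / \<surd>6)\<^sup>\<mu> B)\<close> for all \<open>\<mu> = (n - 1) / 2 + m\<close>: the potential
  term is absorbed because \<open>\<vartheta> \<kappa> < 1\<close>, and the commutators with the cutoffs are controlled by a Caccioppoli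
  inequality, which holds because \<open>2 \<sigma>\<^sup>2 \<kappa> < 1\<close>. Optimising \<open>\<mu>\<close> yields the claim with universal constants, as long as
  \<open>B / A\<close> is at least exponential in \<open>n\<close>. Otherwise it follows from \<open>M \<le> K e\<^bsup>-n/51\<^esup> B\<close>, a consequence of the Poincare and
  Caccioppoli inequalities with a Gaussian weight. The Sobolev constant \<open>\<sigma>\<close> is a supremum of reals, hence only meaningful
  once its set is known to be bounded; this is the Gagliardo--Nirenberg--Sobolev inequality.
\<close>

section \<open>Smooth cutoff functions of one variable\<close>

text \<open>The constants must not depend on the dimension, and this shapes the proof. Carleman
  exponents start at (n - 1) / 2, whereas balancing \<open>4 powr \<mu> * A\<close> against
  \<open>(2 / sqrt 6) powr \<mu> * B\<close> asks for \<mu> close to ln (B / A) / Q with a fixed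
  number Q; so balancing is guaranteed only if ln (B / A) is at least n Q. Below this threshold
  another mechanism must help: in high dimension the L^2 mass of a solution sits near the outer
  sphere, and the Poincare constant 2 R / n, which improves with n, makes this quantitative. All
  other losses may grow at most linearly in n. Hoelder on a ball of radius R costs ((2 R)^n)^(1/n) =
  2 R, because the exponents 1/p, 1/2 and 1/p' differ by 1/n, and the Laplacian of a radial cutoff
  contributes one factor n. The cutoffs switch at squared radii 1/4 to 1/2 and 6 to 8 in units of r,
  which leaves the annulus from r to 2 r untouched and fits into the ball of radius 3 r. A solution
  lies only in W^(2,p), so every energy computation is made for its mollifications, after an
  interior gain from L^p to L^p'.\<close>

fun bump_poly :: "nat \<Rightarrow> real poly" where
  "bump_poly 0 = 1"
| "bump_poly (Suc k) = pderiv (bump_poly k) * [:1, 0, -1:]\<^sup>2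
     + smult (4 * real k) ([:0, 1:] * bump_poly k * [:1, 0, -1:]) - smult 2 ([:0, 1:] * bump_poly k)"

text \<open>The \<open>k\<close>-th derivative of \<open>exp (- 1 / (1 - t\<^sup>2))\<close>.\<close>
definition raw_bump :: "nat \<Rightarrow> real \<Rightarrow> real" where
  "raw_bump k t = (if \<bar>t\<bar> < 1 then poly (bump_poly k) t * inverse (1 - t\<^sup>2) ^ (2 * k) * exp (- inverse (1 - t\<^sup>2)) else 0)"

text \<open>A single term of the exponential series is at most its sum, so \<open>fact m\<close>
  serves as the constant.\<close>

lemma power_exp_bound: "\<exists>C. \<forall>z>0. z ^ m * exp (- z) \<le> (C::real)"
proof (intro exI allI impI)
  fix z :: real assume "z > 0"
  have "(\<Sum>k\<in>{m}. z ^ k /\<^sub>R fact k) \<le> (\<Sum>k. z ^ k /\<^sub>R fact k)"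
    using \<open>z > 0\<close> by (intro sum_le_suminf summable_exp_generic) auto
  then have "z ^ m / fact m \<le> exp z"
    by (simp add: exp_def divide_inverse mult.commute)
  then show "z ^ m * exp (- z) \<le> fact m"
    by (simp add: exp_minus field_simps)
qed

text \<open>Second-order vanishing at the end points makes the extension by zero differentiable
  there. With z = 1 / (1 - t^2) the bound comes from \<open>power_exp_bound\<close> for the exponent
  2 k + 2: the two extra powers of z pay for the factor (1 - t^2)^2.\<close>

lemma raw_bump_quadratic: "\<exists>C. \<forall>t. \<bar>raw_bump k t\<bar> \<le> C * (1 - t\<^sup>2)\<^sup>2"
proof -
  obtain C where C: "\<And>z::real. z > 0 \<Longrightarrow> z ^ (2 * k + 2) * exp (- z) \<le> C"
    using power_exp_bound by blast
  have "bounded (poly (bump_poly k) ` {-1..1::real})"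
    by (intro compact_imp_bounded compact_continuous_image continuous_intros) auto
  then obtain P where "\<forall>x \<in> poly (bump_poly k) ` {-1..1::real}. norm x \<le> P"
    unfolding bounded_iff by blast
  then have P: "\<And>t. \<bar>t\<bar> \<le> 1 \<Longrightarrow> \<bar>poly (bump_poly k) t\<bar> \<le> P" by (auto simp: abs_le_iff)
  have P0: "P \<ge> 0" using P[of 0] by auto
  have C0: "C \<ge> 0" using C[of 1] by (auto intro: order_trans[rotated])
  have "\<bar>raw_bump k t\<bar> \<le> P * C * (1 - t\<^sup>2)\<^sup>2" for t
  proof (cases "\<bar>t\<bar> < 1")
    case True
    define w where "w = 1 - t\<^sup>2"
    have w: "w > 0" using True by (simp add: w_def abs_square_less_1)
    have "inverse w ^ (2 * k) * exp (- inverse w) = (inverse w ^ (2 * k + 2) * exp (- inverse w)) * w\<^sup>2"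
      using w by (simp add: field_simps power_add power2_eq_square)
    also have "\<dots> \<le> C * w\<^sup>2" using C[of "inverse w"] w by (intro mult_right_mono) auto
    finally have "inverse w ^ (2 * k) * exp (- inverse w) \<le> C * w\<^sup>2" .
    moreover have "\<bar>raw_bump k t\<bar> = \<bar>poly (bump_poly k) t\<bar> * (inverse w ^ (2 * k) * exp (- inverse w))"
      using True w by (simp add: raw_bump_def w_def abs_mult)
    ultimately show ?thesis using P[of t] True w P0 C0 mult_mono[of "\<bar>poly (bump_poly k) t\<bar>" P "inverse w ^ (2 * k) * exp (- inverse w)" "C * w\<^sup>2"]
      by (simp add: w_def mult.assoc)
  qed (use P0 C0 in \<open>simp add: raw_bump_def\<close>)
  then show ?thesis by blast
qed

text \<open>With w = 1 - t^2, differentiating P w^(-2k) exp (-1/w) gives (P' w^2 + 4 k t P w - 2 t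
  P) w^(-2k-2) exp (-1/w), which is the recursion of \<open>bump_poly\<close>. At |t| = 1 the
  difference quotient tends to 0 by \<open>raw_bump_quadratic\<close>.\<close>

lemma raw_bump_deriv: "(raw_bump k has_real_derivative raw_bump (Suc k) t) (at t)"
proof -
  consider "\<bar>t\<bar> < 1" | "\<bar>t\<bar> > 1" | "\<bar>t\<bar> = 1" by linarith
  then show ?thesis
  proof cases
    case 1
    define w where "w = 1 - t\<^sup>2"
    have w: "w > 0" using 1 by (simp add: w_def abs_square_less_1)
    have ev: "\<forall>\<^sub>F s in nhds t. \<bar>s\<bar> < 1"
      using 1 eventually_nhds_in_open[of "{-1<..<1}" t] by (auto simp: abs_less_iff elim!: eventually_mono)
    have "((\<lambda>t. poly (bump_poly k) t * inverse (1 - t\<^sup>2) ^ (2 * k) * exp (- inverse (1 - t\<^sup>2)))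
       has_real_derivative raw_bump (Suc k) t) (at t)"
    proof -
      have "((\<lambda>t. poly (bump_poly k) t * inverse (1 - t\<^sup>2) ^ (2 * k) * exp (- inverse (1 - t\<^sup>2)))
        has_real_derivative 
        (poly (pderiv (bump_poly k)) t * inverse w ^ (2 * k) + poly (bump_poly k) t * (real (2 * k) * inverse w ^ (2 * k - 1) * (2 * t * inverse w ^ 2))) * exp (- inverse w)
         + poly (bump_poly k) t * inverse w ^ (2 * k) * (exp (- inverse w) * (- (2 * t * inverse w ^ 2)))) (at t)"
        unfolding w_def
        by (rule derivative_eq_intros refl poly_DERIV | use w in \<open>simp add: w_def; fail\<close>)+
           (use w in \<open>simp add: w_def field_simps power2_eq_square\<close>)
      also have "(poly (pderiv (bump_poly k)) t * inverse w ^ (2 * k) + poly (bump_poly k) t * (real (2 * k) * inverse w ^ (2 * k - 1) * (2 * t * inverse w ^ 2))) * exp (- inverse w)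
         + poly (bump_poly k) t * inverse w ^ (2 * k) * (exp (- inverse w) * (- (2 * t * inverse w ^ 2)))
         = raw_bump (Suc k) t"
      proof -
        have a: "inverse w ^ (2 * k) = w ^ 2 * inverse w ^ (2 * Suc k)"
          using w by (simp add: field_simps power2_eq_square)
        have b: "real (2 * k) * inverse w ^ (2 * k - 1) = 2 * real k * w ^ 3 * inverse w ^ (2 * Suc k)"
        proof (cases k)
          case (Suc j)
          then show ?thesis using w by (simp add: field_simps power2_eq_square power3_eq_cube)
        qed simp
        have c: "inverse w ^ 2 = inverse w ^ (2 * Suc k) * w ^ (2 * k)" and d: "w ^ 3 * inverse w ^ 2 = w"
          using w by (simp_all add: field_simps power2_eq_square power3_eq_cube)
        define Y P e where "Y = inverse w ^ (2 * Suc k)" and "P = poly (bump_poly k) t" and "e = exp (- inverse w)"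
        have Y: "inverse w ^ (2 * k) * inverse w ^ 2 = Y" by (simp add: Y_def power_add[symmetric])
        have pw: "poly [:1, 0, -1:] t = w" by (simp add: w_def power2_eq_square)
        have f1: "poly (pderiv (bump_poly k)) t * inverse w ^ (2 * k) + P * (real (2 * k) * inverse w ^ (2 * k - 1) * (2 * t * inverse w ^ 2))
           = poly (pderiv (bump_poly k)) t * (w ^ 2 * Y) + P * (4 * real k * t * Y * w)"
        proof -
          have "real (2 * k) * inverse w ^ (2 * k - 1) * (2 * t * inverse w ^ 2) = 4 * real k * t * Y * (w ^ 3 * inverse w ^ 2)"
            unfolding b Y_def[symmetric] by (simp only: mult_ac)
          then show ?thesis unfolding d a Y_def by simp
        qed
        have f2: "P * inverse w ^ (2 * k) * (e * (- (2 * t * inverse w ^ 2))) = - 2 * t * P * e * Y"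
          unfolding Y[symmetric] by simp
        have f3: "raw_bump (Suc k) t = poly (bump_poly (Suc k)) t * Y * e"
          using 1 by (simp add: raw_bump_def Y_def e_def w_def del: bump_poly.simps)
        have f4: "poly (bump_poly (Suc k)) t = poly (pderiv (bump_poly k)) t * w ^ 2 + 4 * real k * t * P * w - 2 * t * P"
          unfolding bump_poly.simps poly_add poly_diff poly_mult poly_smult poly_power pw P_def by simp
        show ?thesis
          unfolding P_def[symmetric] e_def[symmetric] f1 f2 f3 f4 by (simp add: algebra_simps)
      qed
      finally show ?thesis .
    qed
    then show ?thesis
      by (rule DERIV_cong_ev[THEN iffD1, rotated -1])
         (use ev in \<open>auto simp: raw_bump_def elim!: eventually_mono\<close>)
  next
    case 2
    have ev: "\<forall>\<^sub>F s in nhds t. \<bar>s\<bar> > 1"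
      using 2 eventually_nhds_in_open[of "{s. 1 < \<bar>s\<bar>}" t]
      by (auto simp: open_Collect_less continuous_intros)
    have "((\<lambda>t. 0) has_real_derivative 0) (at t)" by simp
    then show ?thesis
      by (rule DERIV_cong_ev[THEN iffD1, rotated -1])
         (use ev 2 in \<open>auto simp: raw_bump_def elim!: eventually_mono\<close>)
  next
    case 3
    obtain C where C: "\<And>t. \<bar>raw_bump k t\<bar> \<le> C * (1 - t\<^sup>2)\<^sup>2"
      using raw_bump_quadratic by blast
    have t2: "t\<^sup>2 = 1" using 3 by (simp add: abs_square_eq_1)
    have z: "raw_bump k t = 0" "raw_bump (Suc k) t = 0" using 3 by (auto simp: raw_bump_def)
    have "((\<lambda>h. raw_bump k (t + h) / h) \<longlongrightarrow> 0) (at 0)"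
    proof (rule Lim_null_comparison)
      show "\<forall>\<^sub>F h in at 0. norm (raw_bump k (t + h) / h) \<le> C * ((2 * t + h)\<^sup>2 * \<bar>h\<bar>)"
      proof (rule eventually_at_filter[THEN iffD2], rule always_eventually, intro allI impI)
        fix h :: real assume h: "h \<noteq> 0"
        have "1 - (t + h)\<^sup>2 = - (h * (2 * t + h))" using t2 by (simp add: power2_eq_square algebra_simps)
        then have "\<bar>raw_bump k (t + h)\<bar> \<le> C * (h * (2 * t + h))\<^sup>2" using C[of "t + h"] by (simp add: power2_eq_square)
        also have "\<dots> = C * ((2 * t + h)\<^sup>2 * \<bar>h\<bar>) * \<bar>h\<bar>" by (simp add: power_mult_distrib power2_eq_square)
        finally show "norm (raw_bump k (t + h) / h) \<le> C * ((2 * t + h)\<^sup>2 * \<bar>h\<bar>)"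
          using h by (simp add: abs_divide divide_le_eq)
      qed
      show "((\<lambda>h. C * ((2 * t + h)\<^sup>2 * \<bar>h\<bar>)) \<longlongrightarrow> 0) (at 0)"
        by (auto intro!: tendsto_eq_intros)
    qed
    then show ?thesis by (simp add: DERIV_def z)
  qed
qed

lemma raw_bump_nonneg: "raw_bump 0 t \<ge> 0"
  by (simp add: raw_bump_def)

lemma raw_bump_outside: "\<bar>t\<bar> \<ge> 1 \<Longrightarrow> raw_bump k t = 0"
  by (simp add: raw_bump_def)

lemma raw_bump_continuous: "continuous_on A (raw_bump k)"
  using raw_bump_deriv DERIV_continuous_on has_field_derivative_at_within by blast

text \<open>A continuous nonnegative function with zero integral vanishes, but the value at 0 is exp
  (-1).\<close>

lemma raw_bump_integral_pos: "integral {-1..1} (raw_bump 0) > 0"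
proof -
  have "integral {-1..1} (raw_bump 0) \<noteq> 0"
  proof
    assume "integral {-1..1} (raw_bump 0) = 0"
    then have "(raw_bump 0 has_integral 0) (cbox (-1) 1)"
      by (metis box_real(2) integrable_continuous_interval integrable_integral raw_bump_continuous)
    then have "raw_bump 0 0 = 0"
      by (intro has_integral_0_cbox_imp_0[of "-1" 1]) (auto simp: raw_bump_nonneg raw_bump_continuous box_real)
    then show False by (simp add: raw_bump_def)
  qed
  moreover have "integral {-1..1} (raw_bump 0) \<ge> 0"
    by (intro integral_nonneg integrable_continuous_interval raw_bump_continuous raw_bump_nonneg)
  ultimately show ?thesis by linarith
qed

definition bump :: "nat \<Rightarrow> real \<Rightarrow> real" where
  "bump k t = raw_bump k t / integral {-1..1} (raw_bump 0)"

lemma bump_deriv: "(bump k has_real_derivative bump (Suc k) t) (at t)"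
  unfolding bump_def[abs_def] by (intro DERIV_cdivide raw_bump_deriv)

lemma bump_nonneg: "bump 0 t \<ge> 0"
  unfolding bump_def using raw_bump_integral_pos raw_bump_nonneg by (simp add: less_imp_le)

lemma bump_outside: "\<bar>t\<bar> \<ge> 1 \<Longrightarrow> bump k t = 0"
  by (simp add: bump_def raw_bump_outside)

lemma bump_continuous: "continuous_on A (bump k)"
  using bump_deriv DERIV_continuous_on has_field_derivative_at_within by blast

lemma bump_integral: "(bump 0 has_integral 1) {-1..1}"
proof -
  have "(raw_bump 0 has_integral integral {-1..1} (raw_bump 0)) {-1..1}"
    by (intro integrable_integral integrable_continuous_interval raw_bump_continuous)
  from has_integral_divide[OF this, of "integral {-1..1} (raw_bump 0)"] show ?thesis
    using raw_bump_integral_pos by (simp add: bump_def[abs_def])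
qed

lemma bump_bounded: "\<exists>C. \<forall>t. \<bar>bump k t\<bar> \<le> C"
proof -
  have "bounded (bump k ` {-1..1})"
    by (intro compact_imp_bounded compact_continuous_image bump_continuous) auto
  then obtain C where "\<forall>x \<in> bump k ` {-1..1}. norm x \<le> C"
    unfolding bounded_iff by blast
  then have "\<And>t. t \<in> {-1..1} \<Longrightarrow> \<bar>bump k t\<bar> \<le> C" by auto
  then have "\<bar>bump k t\<bar> \<le> max C 0" for t
    by (cases "\<bar>t\<bar> \<ge> 1") (simp_all add: bump_outside le_max_iff_disj abs_less_iff not_le)
  then show ?thesis by blast
qed

text \<open>\<open>step 0\<close> descends from 1 to 0 on [0, 1], and \<open>step k\<close> is its
  k-th derivative, whence the powers of 2 from the substitution 2 s - 1. Integrating from -2 rather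
  than -1 keeps the left end of the support inside the range of integration, so that no one-sided
  derivative arises there.\<close>

definition step :: "nat \<Rightarrow> real \<Rightarrow> real" where
  "step k s = (case k of 0 \<Rightarrow> 1 - integral {-2..2 * s - 1} (bump 0) | Suc j \<Rightarrow> - (2 ^ k) * bump j (2 * s - 1))"

text \<open>To the right of -2 this is the fundamental theorem of calculus; elsewhere both the
  primitive and \<open>bump\<close> vanish near x.\<close>

lemma bump_primitive:
  "((\<lambda>x. integral {-2..x} (bump 0)) has_real_derivative bump 0 x) (at x)"
proof (cases "x > - 2")
  case True
  have "((\<lambda>x. integral {-2..x} (bump 0)) has_real_derivative bump 0 x) (at x within {-2..x+1})"
    using True by (intro integral_has_real_derivative bump_continuous) auto
  moreover have "at x within {-2..x+1} = at x" using True by (intro at_within_Icc_at) auto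
  ultimately show ?thesis by simp
next
  case False
  have z: "integral {-2..y} (bump 0) = 0" if "y < -1" for y
    by (intro integral_eq_0_iff[THEN iffD2] integral_unique has_integral_is_0) (use that in \<open>auto intro: bump_outside\<close>)
  have "((\<lambda>x. 0) has_real_derivative bump 0 x) (at x)" using False by (simp add: bump_outside)
  moreover have "\<forall>\<^sub>F y in nhds x. y < -1"
    using False eventually_nhds_in_open[of "{..<-1}" x] by (auto elim!: eventually_mono)
  ultimately show ?thesis
    by (elim DERIV_cong_ev[THEN iffD1, rotated -1]) (use z in \<open>auto elim!: eventually_mono\<close>)
qed

lemma step_deriv: "(step k has_real_derivative step (Suc k) s) (at s)"
proof (cases k)
  case 0
  have "((\<lambda>s. 1 - integral {-2..2 * s - 1} (bump 0)) has_real_derivative 0 - bump 0 (2 * s - 1) * 2) (at s)"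
    by (intro derivative_intros DERIV_chain2[OF bump_primitive]) (auto intro!: derivative_eq_intros)
  then show ?thesis by (simp add: step_def[abs_def] 0 mult.commute)
next
  case (Suc j)
  have "((\<lambda>s. - (2 ^ k) * bump j (2 * s - 1)) has_real_derivative - (2 ^ k) * (bump (Suc j) (2 * s - 1) * 2)) (at s)"
    by (intro DERIV_cmult DERIV_chain2[OF bump_deriv]) (auto intro!: derivative_eq_intros)
  then show ?thesis by (simp add: step_def[abs_def] Suc mult_ac)
qed

lemma step_left: "s \<le> 0 \<Longrightarrow> step 0 s = 1"
proof -
  assume s: "s \<le> 0"
  have "integral {-2..2 * s - 1} (bump 0) = 0"
    by (intro integral_unique has_integral_is_0) (use s in \<open>auto intro: bump_outside\<close>)
  then show ?thesis by (simp add: step_def)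
qed

lemma step_right: "s \<ge> 1 \<Longrightarrow> step 0 s = 0"
proof -
  assume s: "s \<ge> 1"
  have "(bump 0 has_integral 1) {-2..2 * s - 1}"
    by (rule has_integral_on_superset[OF bump_integral]) (use s in \<open>auto intro!: bump_outside\<close>)
  then show ?thesis by (simp add: step_def integral_unique)
qed

lemma step_Suc_outside: "s \<le> 0 \<or> s \<ge> 1 \<Longrightarrow> step (Suc k) s = 0"
  by (auto simp: step_def intro!: bump_outside)

lemma step_antimono: assumes "s \<le> t" shows "step 0 t \<le> step 0 s"
proof (rule DERIV_nonpos_imp_nonincreasing[OF assms])
  fix x assume "s \<le> x" "x \<le> t" show "\<exists>y. (step 0 has_real_derivative y) (at x) \<and> y \<le> 0"
    using step_deriv[of 0 x] bump_nonneg by (intro exI[of _ "step (Suc 0) x"]) (auto simp: step_def[of "Suc 0"])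
qed

lemma step_nonneg: "0 \<le> step 0 s" and step_le_1: "step 0 s \<le> 1"
  using step_antimono[of s "max s 1"] step_antimono[of "min s 0" s] step_left[of "min s 0"] step_right[of "max s 1"]
  by auto

lemma step_bounded: "\<exists>C. \<forall>s. \<bar>step k s\<bar> \<le> C"
proof (cases k)
  case 0
  then show ?thesis using step_nonneg step_le_1 by (metis abs_of_nonneg)
next
  case (Suc j)
  obtain C where C: "\<And>t. \<bar>bump j t\<bar> \<le> C" using bump_bounded by blast
  have "\<bar>step k s\<bar> \<le> 2 ^ k * C" for s using C by (simp add: step_def Suc abs_mult)
  then show ?thesis by blast
qed

section \<open>Topology and measure on the space of dimension n\<close>

abbreviation bor :: "nat \<Rightarrow> (nat \<Rightarrow> real) measure" where
  "bor n \<equiv> (\<Pi>\<^sub>M i\<in>{..<n}. lborel)"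

interpretation lbs: product_sigma_finite "\<lambda>_::nat. lborel :: real measure"
  by standard

lemma space_bor: "space (bor n) = Rn n"
  by (simp add: space_PiM Rn_def)

lemma sigma_finite_bor: "finite (I :: nat set) \<Longrightarrow> sigma_finite_measure (\<Pi>\<^sub>M i\<in>I. lborel :: real measure)"
  by (rule lbs.sigma_finite)

lemma pair_sigma_finite_bor: "pair_sigma_finite (bor n) (bor n)"
  by (simp add: pair_sigma_finite_def sigma_finite_bor)

lemma PiE_UNIV_Rn [simp]: "(\<Pi>\<^sub>E i\<in>{..<n}. UNIV) = Rn n"
  by (simp add: Rn_def)

lemma topspace_Rn: "topspace (top_Rn n) = Rn n"
  by simp

lemma Rn_fun_upd: "i < n \<Longrightarrow> x \<in> Rn n \<Longrightarrow> x(i := t) \<in> Rn n"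
  by (auto simp: Rn_def PiE_def extensional_def simp del: PiE_UNIV_Rn)

lemma restrict_Rn [simp]: "restrict f {..<n} \<in> Rn n"
  by (simp add: Rn_def del: PiE_UNIV_Rn)

lemma restrict_Rn_id: "x \<in> Rn n \<Longrightarrow> restrict x {..<n} = x"
  by (simp add: Rn_def PiE_restrict del: PiE_UNIV_Rn)

lemma continuous_coord: "i < n \<Longrightarrow> continuous_map (top_Rn n) euclideanreal (\<lambda>x. x i)"
  by (rule continuous_map_product_projection) simp

lemma continuous_comp_real:
  "continuous_map X euclideanreal f \<Longrightarrow> continuous_on UNIV (h :: real \<Rightarrow> real) \<Longrightarrow>
    continuous_map X euclideanreal (\<lambda>x. h (f x))"
  using continuous_map_compose[of X euclideanreal f euclideanreal h] by (simp add: o_def)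

lemma continuous_fun_upd:
  assumes "i < n" "x \<in> Rn n"
  shows "continuous_map euclideanreal (top_Rn n) (\<lambda>t. x(i := t))"
  unfolding continuous_map_componentwise
  using assms by (auto simp: Rn_def PiE_def extensional_def simp del: PiE_UNIV_Rn)

lemma continuous_map_Rn_cong:
  "continuous_map (top_Rn n) Y f \<Longrightarrow> (\<And>x. x \<in> Rn n \<Longrightarrow> f x = g x) \<Longrightarrow> continuous_map (top_Rn n) Y g"
  by (erule continuous_map_eq) simp

text \<open>Composition with \<open>restrict\<close> extends f continuously to all functions on the
  naturals. There measurability is tested on countably many coordinates, and on the space of
  \<open>bor n\<close> the coordinates from n on have the constant value
  \<open>undefined\<close>.\<close>

lemma borel_measurable_continuous_Rn:
  assumes "continuous_map (top_Rn n) euclideanreal f"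
  shows "f \<in> borel_measurable (bor n)"
proof -
  define e :: "(nat \<Rightarrow> real) \<Rightarrow> nat \<Rightarrow> real" where "e x = restrict x {..<n}" for x
  have "continuous_map euclidean (top_Rn n) e"
    unfolding continuous_map_componentwise e_def
    by (auto simp: continuous_on_product_coordinates)
  from continuous_map_compose[OF this assms] have "continuous_on UNIV (f \<circ> e)" by simp
  then have 1: "f \<circ> e \<in> borel_measurable borel" by (rule borel_measurable_continuous_onI)
  have 2: "(\<lambda>x. x) \<in> measurable (bor n) borel"
  proof (rule measurable_coordinatewise_then_product)
    fix i show "(\<lambda>x. x i) \<in> borel_measurable (bor n)"
    proof (cases "i < n")
      case True then show ?thesis using measurable_component_singleton[of i "{..<n}" "\<lambda>_. lborel"] by simp
    next
      case False
      have "(\<lambda>x::nat\<Rightarrow>real. undefined :: real) \<in> borel_measurable (bor n)" by simp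
      then show ?thesis
        by (rule measurable_cong[THEN iffD1, rotated]) (use False in \<open>auto simp: space_PiM Rn_def PiE_def extensional_def simp del: PiE_UNIV_Rn\<close>)
    qed
  qed
  have "(\<lambda>x. (f \<circ> e) x) \<in> borel_measurable (bor n)"
    using measurable_compose[OF 2 1] .
  then show ?thesis
    by (rule measurable_cong[THEN iffD1, rotated]) (auto simp: e_def restrict_Rn_id space_PiM)
qed

lemma dist_n_sqrt: "dist_n n x y = sqrt (\<Sum>i<n. (x i - y i)\<^sup>2)"
  by (simp add: dist_n_def norm_n_def L2_set_def)

lemma continuous_dist_n: "continuous_map (top_Rn n) euclideanreal (\<lambda>y. dist_n n x y)"
  unfolding dist_n_sqrt
  by (intro continuous_comp_real[where h = sqrt] continuous_map_sum continuous_map_real_pow continuous_map_diff continuous_coord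
      continuous_map_const[THEN iffD2]) (auto intro: continuous_intros)

lemma dist_n_nonneg [simp]: "dist_n n x y \<ge> 0"
  by (simp add: dist_n_sqrt sum_nonneg)

lemma dist_n_commute: "dist_n n x y = dist_n n y x"
  by (simp add: dist_n_sqrt power2_commute)

lemma dist_n_triangle: "dist_n n x z \<le> dist_n n x y + dist_n n y z"
  unfolding dist_n_def norm_n_def
  using L2_set_triangle_ineq[of "\<lambda>i. x i - y i" "\<lambda>i. y i - z i" "{..<n}"] by simp

lemma dist_n_self [simp]: "dist_n n x x = 0"
  by (simp add: dist_n_sqrt)

lemma coord_le_dist_n: "i < n \<Longrightarrow> \<bar>x i - y i\<bar> \<le> dist_n n x y"
proof -
  assume "i < n"
  then have "(x i - y i)\<^sup>2 \<le> (\<Sum>i<n. (x i - y i)\<^sup>2)" by (intro member_le_sum) auto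
  then show ?thesis unfolding dist_n_sqrt by (metis real_sqrt_abs real_sqrt_le_iff)
qed

lemma dist_n_le_sum: "dist_n n x y \<le> (\<Sum>i<n. \<bar>x i - y i\<bar>)"
  unfolding dist_n_def norm_n_def by (rule L2_set_le_sum_abs)

lemma dist_n_le_cube: "(\<And>i. i < n \<Longrightarrow> \<bar>x i - y i\<bar> \<le> e) \<Longrightarrow> dist_n n x y \<le> real n * e"
  using dist_n_le_sum[of n x y] sum_bounded_above[of "{..<n}" "\<lambda>i. \<bar>x i - y i\<bar>" e] by simp

lemma openin_dist_less: "openin (top_Rn n) {y \<in> Rn n. dist_n n x y < r}"
  using openin_continuous_map_preimage[OF continuous_dist_n[of n x], of "{..<r}"] by simp

lemma closedin_dist_le: "closedin (top_Rn n) {y \<in> Rn n. dist_n n x y \<le> r}"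
  using closedin_continuous_map_preimage[OF continuous_dist_n[of n x], of "{..r}"] by simp

lemma openin_ball: "openin (top_Rn n) (ball_n n x r)"
  unfolding ball_n_def by (rule openin_dist_less)

lemma openin_measurable: "openin (top_Rn n) U \<Longrightarrow> U \<in> sets (bor n)"
proof -
  assume U: "openin (top_Rn n) U"
  define e :: "(nat \<Rightarrow> real) \<Rightarrow> nat \<Rightarrow> real" where "e x = restrict x {..<n}" for x
  have c: "continuous_map euclidean (top_Rn n) e"
    unfolding continuous_map_componentwise e_def
    by (auto simp: continuous_on_product_coordinates)
  have "open {x. e x \<in> U}"
    using openin_continuous_map_preimage[OF c U] by simp
  then have o: "{x. e x \<in> U} \<in> sets borel" by simp
  have 2: "(\<lambda>x. x) \<in> measurable (bor n) borel"
  proof (rule measurable_coordinatewise_then_product)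
    fix i show "(\<lambda>x. x i) \<in> borel_measurable (bor n)"
    proof (cases "i < n")
      case True then show ?thesis by (intro borel_measurable_continuous_Rn continuous_coord)
    next
      case False
      have "(\<lambda>x::nat\<Rightarrow>real. undefined :: real) \<in> borel_measurable (bor n)" by simp
      then show ?thesis
        by (rule measurable_cong[THEN iffD1, rotated]) (use False in \<open>auto simp: space_PiM Rn_def PiE_def extensional_def simp del: PiE_UNIV_Rn\<close>)
    qed
  qed
  have "(\<lambda>x. x) -` {x. e x \<in> U} \<inter> Rn n \<in> sets (bor n)"
    using measurable_sets[OF 2 o] by (simp add: space_PiM)
  moreover have "(\<lambda>x. x) -` {x. e x \<in> U} \<inter> Rn n = U"
    using openin_subset[OF U] by (auto simp: e_def restrict_Rn_id)
  ultimately show ?thesis by simp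
qed

lemma ball_measurable [measurable]: "ball_n n x r \<in> sets (bor n)"
  by (intro openin_measurable openin_ball)

lemma closedin_measurable: "closedin (top_Rn n) K \<Longrightarrow> K \<in> sets (bor n)"
proof -
  assume K: "closedin (top_Rn n) K"
  then have "Rn n - K \<in> sets (bor n)" by (intro openin_measurable) (auto simp: closedin_def)
  then have "Rn n - (Rn n - K) \<in> sets (bor n)" using sets.compl_sets[of _ "bor n"] by (simp add: space_bor)
  moreover have "Rn n - (Rn n - K) = K" using closedin_subset[OF K] by auto
  ultimately show ?thesis by simp
qed

text \<open>Heine-Borel through Tychonoff: the set is closed and contained in a product of compact
  intervals.\<close>

lemma compactin_closed_bounded:
  assumes "closedin (top_Rn n) K" "\<And>y. y \<in> K \<Longrightarrow> dist_n n x y \<le> r"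
  shows "compactin (top_Rn n) K"
proof (rule closed_compactin)
  show "compactin (top_Rn n) (\<Pi>\<^sub>E i\<in>{..<n}. {x i - r..x i + r})"
    by (simp add: compactin_PiE)
  show "K \<subseteq> (\<Pi>\<^sub>E i\<in>{..<n}. {x i - r..x i + r})"
  proof
    fix y assume y: "y \<in> K"
    then have "y \<in> Rn n" using closedin_subset[OF assms(1)] by auto
    moreover have "y i \<in> {x i - r..x i + r}" if "i < n" for i
      using coord_le_dist_n[OF that, of x y] assms(2)[OF y] by (auto simp: abs_le_iff)
    ultimately show "y \<in> (\<Pi>\<^sub>E i\<in>{..<n}. {x i - r..x i + r})"
      by (simp add: Rn_def PiE_iff del: PiE_UNIV_Rn)
  qed
qed (rule assms)

lemma open_contains_ball_n:
  assumes "openin (top_Rn n) U" "x \<in> U"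
  obtains e where "e > 0" "ball_n n x e \<subseteq> U"
proof -
  have "\<exists>W. finite {i \<in> {..<n}. W i \<noteq> topspace euclideanreal} \<and> (\<forall>i\<in>{..<n}. openin euclideanreal (W i)) \<and> x \<in> Pi\<^sub>E {..<n} W \<and> Pi\<^sub>E {..<n} W \<subseteq> U"
    using assms(1)[unfolded openin_product_topology_alt, rule_format, OF assms(2)] .
  then obtain W where W: "\<forall>i\<in>{..<n}. openin euclideanreal (W i)" "x \<in> Pi\<^sub>E {..<n} W" "Pi\<^sub>E {..<n} W \<subseteq> U"
    by (elim exE conjE)
  have "\<exists>e>0. \<forall>t. \<bar>t - x i\<bar> < e \<longrightarrow> t \<in> W i" if i: "i < n" for i
  proof -
    have "open (W i)" "x i \<in> W i" using W(1,2) i by (auto simp: PiE_iff)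
    then show ?thesis unfolding open_dist dist_real_def by blast
  qed
  then obtain E where E: "\<And>i. i < n \<Longrightarrow> E i > 0" "\<And>i t. i < n \<Longrightarrow> \<bar>t - x i\<bar> < E i \<Longrightarrow> t \<in> W i"
    by metis
  \<comment> \<open>The element 1 keeps the minimum meaningful for n = 0.\<close>
  define e where "e = Min (insert 1 (E ` {..<n}))"
  have e: "e > 0" "\<And>i. i < n \<Longrightarrow> e \<le> E i" using E(1) by (auto simp: e_def)
  have "ball_n n x e \<subseteq> U"
  proof
    fix y assume y: "y \<in> ball_n n x e"
    have "y i \<in> W i" if "i < n" for i
      using E(2)[OF that, of "y i"] coord_le_dist_n[OF that, of x y] y e(2)[OF that]
      by (auto simp: ball_n_def abs_minus_commute)
    then have "y \<in> Pi\<^sub>E {..<n} W" using y by (auto simp: ball_n_def Rn_def PiE_iff simp del: PiE_UNIV_Rn)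
    then show "y \<in> U" using W(3) by auto
  qed
  with e show ?thesis using that by blast
qed

lemma compactin_bounded:
  assumes "compactin (top_Rn n) K"
  obtains r where "r > 0" "\<And>y. y \<in> K \<Longrightarrow> dist_n n x y \<le> r"
proof -
  have "compactin euclideanreal ((\<lambda>y. dist_n n x y) ` K)"
    by (rule image_compactin[OF assms continuous_dist_n])
  then have "bounded ((\<lambda>y. dist_n n x y) ` K)" by (simp add: compact_imp_bounded)
  then obtain r where "\<forall>t\<in>(\<lambda>y. dist_n n x y) ` K. norm t \<le> r" unfolding bounded_iff by blast
  then have "\<And>y. y \<in> K \<Longrightarrow> dist_n n x y \<le> max r 1" by (force simp: le_max_iff_disj)
  then show ?thesis using that[of "max r 1"] by auto
qed

lemma continuous_Lipschitz:
  assumes "\<And>x y. x \<in> Rn n \<Longrightarrow> y \<in> Rn n \<Longrightarrow> \<bar>f x - f y\<bar> \<le> C * dist_n n x y"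
  shows "continuous_map (top_Rn n) euclideanreal f"
proof -
  have *: "\<exists>U. openin (top_Rn n) U \<and> x \<in> U \<and> (\<forall>y\<in>U. f y \<in> {f x - e<..<f x + e})" if "x \<in> Rn n" "e > 0" for x e
  proof (intro exI conjI ballI)
    \<comment> \<open>Adding 1 to |C| makes the radius positive whatever the value and sign of
      C.\<close>
    show "openin (top_Rn n) (ball_n n x (e / (\<bar>C\<bar> + 1)))" by (rule openin_ball)
    show "x \<in> ball_n n x (e / (\<bar>C\<bar> + 1))" using that by (simp add: ball_n_def)
    fix y assume y: "y \<in> ball_n n x (e / (\<bar>C\<bar> + 1))"
    have "\<bar>f x - f y\<bar> \<le> C * dist_n n x y" using that y by (intro assms) (auto simp: ball_n_def)
    also have "\<dots> \<le> (\<bar>C\<bar> + 1) * dist_n n x y" by (intro mult_right_mono) auto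
    also have "\<dots> < e" using y by (simp add: ball_n_def field_simps)
    finally show "f y \<in> {f x - e<..<f x + e}" by auto
  qed
  show ?thesis
    unfolding continuous_map_def
  proof (intro conjI allI impI)
    fix S assume "openin euclideanreal S"
    then have S: "open S" by simp
    show "openin (top_Rn n) {x \<in> topspace (top_Rn n). f x \<in> S}"
    proof (subst openin_subopen, intro ballI)
      fix x assume "x \<in> {x \<in> topspace (top_Rn n). f x \<in> S}"
      then have x: "x \<in> Rn n" "f x \<in> S" by auto
      then obtain e where e: "e > 0" "\<And>y. \<bar>y - f x\<bar> < e \<Longrightarrow> y \<in> S" using S by (auto simp: open_dist dist_real_def)
      obtain U where U: "openin (top_Rn n) U" "x \<in> U" "\<forall>y\<in>U. f y \<in> {f x - e<..<f x + e}"
        using *[OF x(1) e(1)] by blast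
      have "U \<subseteq> {x \<in> topspace (top_Rn n). f x \<in> S}"
        using U(3) e(2) openin_subset[OF U(1)] by (auto simp: abs_less_iff)
      then show "\<exists>T. openin (top_Rn n) T \<and> x \<in> T \<and> T \<subseteq> {x \<in> topspace (top_Rn n). f x \<in> S}"
        using U by blast
    qed
  qed auto
qed

section \<open>Translations and reflections\<close>

definition tr :: "nat \<Rightarrow> (nat \<Rightarrow> real) \<Rightarrow> (nat \<Rightarrow> real) \<Rightarrow> nat \<Rightarrow> real" where
  "tr n a x = (\<lambda>i\<in>{..<n}. x i + a i)"

definition refl :: "nat \<Rightarrow> (nat \<Rightarrow> real) \<Rightarrow> (nat \<Rightarrow> real) \<Rightarrow> nat \<Rightarrow> real" where
  "refl n a x = (\<lambda>i\<in>{..<n}. a i - x i)"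

lemma measurable_tr [measurable]: "tr n a \<in> measurable (bor n) (bor n)"
  unfolding tr_def[abs_def] by measurable

lemma measurable_refl [measurable]: "refl n a \<in> measurable (bor n) (bor n)"
  unfolding refl_def[abs_def] by measurable

lemma distr_affine_lborel: 
  fixes c a :: real assumes "\<bar>c\<bar> = 1"
  shows "distr lborel lborel (\<lambda>t. a + c * t) = lborel"
proof -
  have "c \<noteq> 0" using assms by auto
  then have "lborel = density (distr lborel borel (\<lambda>x. a + c * x)) (\<lambda>_. \<bar>c\<bar>)"
    by (rule lborel_real_affine)
  then have "lborel = distr lborel borel (\<lambda>x. a + c * x)" using assms by (simp add: density_1)
  also have "\<dots> = distr lborel lborel (\<lambda>x. a + c * x)" by (rule distr_cong) simp_all
  finally show ?thesis by simp
qed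

text \<open>A product measure is determined by its values on boxes, and each side of a box is
  handled by a one-dimensional affine substitution. The cases c = 1 and c = -1 give translations and
  reflections.\<close>

lemma distr_affine_bor:
  assumes c: "\<bar>c\<bar> = 1"
  shows "distr (bor n) (bor n) (\<lambda>x. \<lambda>i\<in>{..<n}. a i + c * x i) = bor n"
proof (rule lbs.PiM_eqI)
  fix A :: "nat \<Rightarrow> real set" assume A: "\<And>i. i \<in> {..<n} \<Longrightarrow> A i \<in> sets lborel"
  have m: "(\<lambda>x. \<lambda>i\<in>{..<n}. a i + c * x i) \<in> measurable (bor n) (bor n)" by measurable
  have "(\<lambda>x. \<lambda>i\<in>{..<n}. a i + c * x i) -` Pi\<^sub>E {..<n} A \<inter> space (bor n) = (\<Pi>\<^sub>E i\<in>{..<n}. (\<lambda>t. a i + c * t) -` A i)"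
    unfolding space_PiM by (rule set_eqI) (simp add: PiE_iff Pi_iff conj_commute del: PiE_UNIV_Rn)
  then have "emeasure (distr (bor n) (bor n) (\<lambda>x. \<lambda>i\<in>{..<n}. a i + c * x i)) (Pi\<^sub>E {..<n} A)
     = emeasure (bor n) (\<Pi>\<^sub>E i\<in>{..<n}. (\<lambda>t. a i + c * t) -` A i)"
    using sets_PiM_I_finite[OF finite_lessThan A] by (subst emeasure_distr[OF m]) simp_all
  also have "\<dots> = (\<Prod>i<n. emeasure lborel ((\<lambda>t. a i + c * t) -` A i))"
  proof (rule lbs.emeasure_PiM)
    fix i assume "i \<in> {..<n}"
    then have "(\<lambda>t. a i + c * t) -` A i \<inter> space lborel \<in> sets lborel"
      using A by (intro measurable_sets[where A = lborel]) auto
    then show "(\<lambda>t. a i + c * t) -` A i \<in> sets lborel" by simp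
  qed simp
  also have "\<dots> = (\<Prod>i<n. emeasure lborel (A i))"
  proof (rule prod.cong[OF refl])
    fix i assume "i \<in> {..<n}"
    then have "emeasure (distr lborel lborel (\<lambda>t. a i + c * t)) (A i) = emeasure lborel ((\<lambda>t. a i + c * t) -` A i)"
      using A[of i] by (subst emeasure_distr) auto
    then show "emeasure lborel ((\<lambda>t. a i + c * t) -` A i) = emeasure lborel (A i)"
      by (simp add: distr_affine_lborel[OF c])
  qed
  finally show "emeasure (distr (bor n) (bor n) (\<lambda>x. \<lambda>i\<in>{..<n}. a i + c * x i)) (Pi\<^sub>E {..<n} A)
    = (\<Prod>i<n. emeasure lborel (A i))" .
qed auto

lemma distr_tr: "distr (bor n) (bor n) (tr n a) = bor n"
  using distr_affine_bor[of 1 n a] by (simp add: tr_def[abs_def] add.commute)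

lemma distr_refl: "distr (bor n) (bor n) (refl n a) = bor n"
  using distr_affine_bor[of "-1" n a] by (simp add: refl_def[abs_def])

lemma nn_integral_refl:
  "f \<in> borel_measurable (bor n) \<Longrightarrow> (\<integral>\<^sup>+x. f (refl n a x) \<partial>bor n) = (\<integral>\<^sup>+x. f x \<partial>bor n)"
  using nn_integral_distr[of "refl n a" "bor n" "bor n" f] by (simp add: distr_refl)

lemma integral_tr:
  fixes f :: "_ \<Rightarrow> real"
  shows "f \<in> borel_measurable (bor n) \<Longrightarrow> (LINT x|bor n. f (tr n a x)) = (LINT x|bor n. f x)"
  using integral_distr[of "tr n a" "bor n" "bor n" f] by (simp add: distr_tr)

text \<open>The circumscribed cube is crude but sufficient: volumes of balls enter the estimates
  with the exponent 1/n, where (2 r)^n leaves the dimension-free factor 2 r.\<close>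

lemma emeasure_ball_le: 
  assumes "r \<ge> 0" shows "emeasure (bor n) (ball_n n x r) \<le> ennreal ((2 * r) ^ n)"
proof -
  have "ball_n n x r \<subseteq> (\<Pi>\<^sub>E i\<in>{..<n}. {x i - r..x i + r})"
  proof
    fix y assume y: "y \<in> ball_n n x r"
    have "y i \<in> {x i - r..x i + r}" if "i < n" for i
      using coord_le_dist_n[OF that, of x y] y by (auto simp: abs_le_iff ball_n_def)
    then show "y \<in> (\<Pi>\<^sub>E i\<in>{..<n}. {x i - r..x i + r})"
      using y by (simp add: ball_n_def Rn_def PiE_iff del: PiE_UNIV_Rn)
  qed
  then have "emeasure (bor n) (ball_n n x r) \<le> emeasure (bor n) (\<Pi>\<^sub>E i\<in>{..<n}. {x i - r..x i + r})"
    by (intro emeasure_mono) (auto intro!: sets_PiM_I_finite)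
  also have "\<dots> = (\<Prod>i<n. emeasure lborel {x i - r..x i + r})"
    by (rule lbs.emeasure_PiM) auto
  also have "\<dots> = ennreal ((2 * r) ^ n)" using assms by (simp add: prod_ennreal ennreal_power)
  finally show ?thesis .
qed

lemma ball_finite: "emeasure (bor n) (ball_n n x r) < \<infinity>"
proof -
  have "emeasure (bor n) (ball_n n x r) \<le> emeasure (bor n) (ball_n n x \<bar>r\<bar>)"
    by (intro emeasure_mono ball_measurable) (auto simp: ball_n_def)
  also have "\<dots> < \<infinity>" using emeasure_ball_le[of "\<bar>r\<bar>" n x] by (auto simp: less_top[symmetric] top_unique)
  finally show ?thesis .
qed

section \<open>Smooth functions and test functions\<close>

lemma partial_eqI:
  "((\<lambda>t. f (x(i := t))) has_real_derivative d) (at (x i)) \<Longrightarrow> partial i f x = d"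
  unfolding partial_def by (rule DERIV_imp_deriv)

lemma partial_cong:
  assumes "\<And>x. x \<in> Rn n \<Longrightarrow> f x = g x" "i < n" "x \<in> Rn n"
  shows "partial i f x = partial i g x"
proof -
  have "(\<lambda>t. f (x(i := t))) = (\<lambda>t. g (x(i := t)))"
    using assms by (auto simp: Rn_fun_upd)
  then show ?thesis by (simp add: partial_def)
qed

lemma smooth_continuous: "smooth n f \<Longrightarrow> continuous_map (top_Rn n) euclideanreal f"
  unfolding smooth_def by (drule spec[of _ "[]"]) (simp add: partials_def)

lemma smooth_DERIV:
  assumes "smooth n f" "i < n" "x \<in> Rn n"
  shows "((\<lambda>t. f (x(i := t))) has_real_derivative partial i f x) (at (x i))"
proof -
  have "(\<lambda>t. f (x(i := t))) differentiable (at (x i))"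
    using assms unfolding smooth_def by (elim allE[of _ "[]"]) (simp add: partials_def)
  then show ?thesis
    unfolding real_differentiable_def partial_def by (metis DERIV_imp_deriv)
qed

lemma smooth_DERIV':
  assumes "smooth n f" "i < n" "x \<in> Rn n"
  shows "((\<lambda>t. f (x(i := t))) has_real_derivative partial i f (x(i := s))) (at s)"
  using smooth_DERIV[OF assms(1,2), of "x(i := s)"] assms by (simp add: Rn_fun_upd)

text \<open>Repeated partial derivatives never leave a class that is closed under partial
  differentiation. Continuity and one derivative are therefore checked once for the whole class, not
  order by order.\<close>

lemma smooth_coinduct:
  assumes f: "P f"
    and cont: "\<And>f. P f \<Longrightarrow> continuous_map (top_Rn n) euclideanreal f"
    and deriv: "\<And>f i. P f \<Longrightarrow> i < n \<Longrightarrow>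
      \<exists>g. P g \<and> (\<forall>x\<in>Rn n. ((\<lambda>t. f (x(i := t))) has_real_derivative g x) (at (x i)))"
  shows "smooth n f"
proof -
  \<comment> \<open>Agreement is claimed on \<open>Rn n\<close> only, because \<open>partial\<close>
    of two functions that agree on \<open>Rn n\<close> is under control only at points of
    \<open>Rn n\<close>.\<close>
  have *: "\<exists>g. P g \<and> (\<forall>x\<in>Rn n. partials is f x = g x)" if "set is \<subseteq> {..<n}" for "is"
    using that
  proof (induction "is")
    case Nil
    then show ?case using f by (auto simp: partials_def)
  next
    case (Cons i "is")
    then obtain g where g: "P g" "\<And>x. x \<in> Rn n \<Longrightarrow> partials is f x = g x" by auto
    obtain h where h: "P h" "\<And>x. x \<in> Rn n \<Longrightarrow> ((\<lambda>t. g (x(i := t))) has_real_derivative h x) (at (x i))"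
      using deriv[OF g(1), of i] Cons.prems by auto
    have "partials (i # is) f x = h x" if "x \<in> Rn n" for x
      using partial_cong[of n "partials is f" g i x] g(2) partial_eqI[OF h(2)[OF that]] that Cons.prems
      by (simp add: partials_def)
    then show ?case using h(1) by auto
  qed
  show ?thesis
    unfolding smooth_def
  proof (intro allI impI conjI ballI)
    fix "is" assume "is": "set is \<subseteq> {..<n}"
    from *[OF this] obtain g where g: "P g" "\<And>x. x \<in> Rn n \<Longrightarrow> partials is f x = g x" by auto
    show "continuous_map (top_Rn n) euclideanreal (partials is f)"
      by (rule continuous_map_Rn_cong[OF cont[OF g(1)]]) (simp add: g)
    fix i x assume i: "i < n" and x: "x \<in> Rn n"
    obtain h where h: "P h" "\<And>x. x \<in> Rn n \<Longrightarrow> ((\<lambda>t. g (x(i := t))) has_real_derivative h x) (at (x i))"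
      using deriv[OF g(1) i] by auto
    have "(\<lambda>t. partials is f (x(i := t))) = (\<lambda>t. g (x(i := t)))"
      using g(2) i x by (auto simp: Rn_fun_upd)
    then show "(\<lambda>t. partials is f (x(i := t))) differentiable (at (x i))"
      using h(2)[OF x] by (auto simp: real_differentiable_def)
  qed
qed

lemma smooth_partial:
  assumes "smooth n f" "i < n" shows "smooth n (partial i f)"
proof -
  have "partials is (partial i f) = partials (is @ [i]) f" for "is"
    by (simp add: partials_def)
  then show ?thesis using assms unfolding smooth_def by (metis Un_subset_iff empty_subsetI insert_subset lessThan_iff list.set(1) list.simps(15) set_append)
qed

text \<open>The algebra generated by the smooth functions and the compositions of all
  \<open>h k\<close> with g. If \<open>h (Suc k)\<close> is the derivative of \<open>h k\<close>, it
  is closed under partial differentiation, so sums, products and compositions become smooth by a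
  single use of \<open>smooth_coinduct\<close>.\<close>

inductive smooth_span :: "nat \<Rightarrow> (nat \<Rightarrow> real \<Rightarrow> real) \<Rightarrow> ((nat \<Rightarrow> real) \<Rightarrow> real) \<Rightarrow> ((nat \<Rightarrow> real) \<Rightarrow> real) \<Rightarrow> bool"
  for n h g where
  base: "smooth n f \<Longrightarrow> smooth_span n h g f"
| comp: "smooth_span n h g (\<lambda>x. h k (g x))"
| add: "smooth_span n h g f1 \<Longrightarrow> smooth_span n h g f2 \<Longrightarrow> smooth_span n h g (\<lambda>x. f1 x + f2 x)"
| mult: "smooth_span n h g f1 \<Longrightarrow> smooth_span n h g f2 \<Longrightarrow> smooth_span n h g (\<lambda>x. f1 x * f2 x)"

lemma smooth_span_smooth:
  assumes g: "smooth n g" and h: "\<And>k s. (h k has_real_derivative h (Suc k) s) (at s)"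
    and f: "smooth_span n h g f"
  shows "smooth n f"
proof (rule smooth_coinduct[where P = "smooth_span n h g", OF f])
  fix f assume "smooth_span n h g f"
  then show "continuous_map (top_Rn n) euclideanreal f"
  proof induction
    case (comp k)
    have "continuous_on UNIV (h k)" by (rule DERIV_continuous_on[where D = "h (Suc k)"]) (use h in simp)
    then show ?case by (rule continuous_comp_real[OF smooth_continuous[OF g]])
  next
    case (base f) then show ?case by (rule smooth_continuous)
  next
    case (add f1 f2) then show ?case by (intro continuous_map_add)
  next
    case (mult f1 f2) then show ?case by (intro continuous_map_real_mult)
  qed
next
  fix f i assume "smooth_span n h g f" and i: "i < n"
  then show "\<exists>f'. smooth_span n h g f' \<and> (\<forall>x\<in>Rn n. ((\<lambda>t. f (x(i := t))) has_real_derivative f' x) (at (x i)))"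
  proof induction
    case (base f)
    then show ?case using smooth_DERIV[OF base.hyps i] smooth_span.base[OF smooth_partial[OF base.hyps i]]
      by (intro exI[of _ "partial i f"] conjI ballI) blast+
  next
    case (comp k)
    have "((\<lambda>t. h k (g (x(i := t)))) has_real_derivative h (Suc k) (g x) * partial i g x) (at (x i))" if "x \<in> Rn n" for x
      using DERIV_chain2[OF h[of k "g (x(i := x i))"] smooth_DERIV[OF g i that]] by simp
    moreover have "smooth_span n h g (\<lambda>x. h (Suc k) (g x) * partial i g x)"
      by (rule smooth_span.mult[OF smooth_span.comp smooth_span.base[OF smooth_partial[OF g i]]])
    ultimately show ?case
      by (intro exI[of _ "\<lambda>x. h (Suc k) (g x) * partial i g x"] conjI ballI) blast+
  next
    case (add f1 f2)
    then obtain g1 g2 where "smooth_span n h g g1" "smooth_span n h g g2"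
      "\<And>x. x \<in> Rn n \<Longrightarrow> ((\<lambda>t. f1 (x(i := t))) has_real_derivative g1 x) (at (x i))"
      "\<And>x. x \<in> Rn n \<Longrightarrow> ((\<lambda>t. f2 (x(i := t))) has_real_derivative g2 x) (at (x i))" by blast
    then show ?case
      by (intro exI[of _ "\<lambda>x. g1 x + g2 x"] conjI smooth_span.add ballI DERIV_add)
  next
    case (mult f1 f2)
    then obtain g1 g2 where *: "smooth_span n h g g1" "smooth_span n h g g2"
      "\<And>x. x \<in> Rn n \<Longrightarrow> ((\<lambda>t. f1 (x(i := t))) has_real_derivative g1 x) (at (x i))"
      "\<And>x. x \<in> Rn n \<Longrightarrow> ((\<lambda>t. f2 (x(i := t))) has_real_derivative g2 x) (at (x i))" by blast
    have "((\<lambda>t. f1 (x(i := t)) * f2 (x(i := t))) has_real_derivative g1 x * f2 x + g2 x * f1 x) (at (x i))"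
      if "x \<in> Rn n" for x using DERIV_mult[OF *(3,4)[OF that]] by simp
    then show ?case using * mult.hyps
      by (intro exI[of _ "\<lambda>x. g1 x * f2 x + g2 x * f1 x"] conjI smooth_span.add smooth_span.mult ballI)
  qed
qed

lemma smooth_const: "smooth n (\<lambda>x. c)"
proof (rule smooth_coinduct[where P = "\<lambda>f. \<exists>c. f = (\<lambda>x. c)"])
  fix f :: "(nat \<Rightarrow> real) \<Rightarrow> real" and i
  assume "\<exists>c. f = (\<lambda>x. c)"
  then show "\<exists>g. (\<exists>c. g = (\<lambda>x. c)) \<and> (\<forall>x\<in>Rn n. ((\<lambda>t. f (x(i := t))) has_real_derivative g x) (at (x i)))"
    by (intro exI[of _ "\<lambda>x. 0"]) auto
qed auto

lemma smooth_add: "smooth n f \<Longrightarrow> smooth n g \<Longrightarrow> smooth n (\<lambda>x. f x + g x)"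
  by (rule smooth_span_smooth[where g = "\<lambda>x. 0" and h = "\<lambda>_ _. 0", OF smooth_const _ smooth_span.add[OF smooth_span.base smooth_span.base]])
     simp_all

lemma smooth_mult: "smooth n f \<Longrightarrow> smooth n g \<Longrightarrow> smooth n (\<lambda>x. f x * g x)"
  by (rule smooth_span_smooth[where g = "\<lambda>x. 0" and h = "\<lambda>_ _. 0", OF smooth_const _ smooth_span.mult[OF smooth_span.base smooth_span.base]])
     simp_all

lemma smooth_comp: 
  "smooth n f \<Longrightarrow> (\<And>k s. (h k has_real_derivative h (Suc k) s) (at s)) \<Longrightarrow> smooth n (\<lambda>x. h k (f x))"
  by (rule smooth_span_smooth[where g = f and h = h, OF _ _ smooth_span.comp])

lemma smooth_cmult: "smooth n f \<Longrightarrow> smooth n (\<lambda>x. c * f x)"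
  by (intro smooth_mult smooth_const)

lemma smooth_diff: "smooth n f \<Longrightarrow> smooth n g \<Longrightarrow> smooth n (\<lambda>x. f x - g x)"
  using smooth_add[of n f "\<lambda>x. (-1) * g x"] smooth_cmult[of n g "-1"] by simp

lemma smooth_sum: "(\<And>i. i \<in> I \<Longrightarrow> smooth n (f i)) \<Longrightarrow> smooth n (\<lambda>x. \<Sum>i\<in>I. f i x)"
  by (induction I rule: infinite_finite_induct) (simp_all add: smooth_const smooth_add)

lemma smooth_power: "smooth n f \<Longrightarrow> smooth n (\<lambda>x. f x ^ k)"
  by (induction k) (simp_all add: smooth_const smooth_mult)

lemma smooth_coord: "i < n \<Longrightarrow> smooth n (\<lambda>x. x i)"
proof (rule smooth_coinduct[where P = "\<lambda>f. (\<exists>c. f = (\<lambda>x. c)) \<or> (\<exists>i<n. f = (\<lambda>x. x i))"])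
  fix f :: "(nat \<Rightarrow> real) \<Rightarrow> real" and i
  assume "(\<exists>c. f = (\<lambda>x. c)) \<or> (\<exists>i<n. f = (\<lambda>x. x i))" "i < n"
  then consider c where "f = (\<lambda>x. c)" | j where "j < n" "f = (\<lambda>x. x j)" by auto
  then show "\<exists>g. ((\<exists>c. g = (\<lambda>x. c)) \<or> (\<exists>i<n. g = (\<lambda>x. x i))) \<and>
      (\<forall>x\<in>Rn n. ((\<lambda>t. f (x(i := t))) has_real_derivative g x) (at (x i)))"
  proof cases
    case 1
    then show ?thesis by (intro exI[of _ "\<lambda>x. 0"]) auto
  next
    case 2
    then show ?thesis by (intro exI[of _ "\<lambda>x. if i = j then 1 else 0"]) auto
  qed
qed (auto intro: continuous_coord)

lemma continuous_tr: "continuous_map (top_Rn n) (top_Rn n) (tr n a)"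
  unfolding continuous_map_componentwise tr_def
  by (auto intro!: continuous_map_add continuous_coord)

lemma tr_fun_upd: "i < n \<Longrightarrow> tr n a (x(i := t)) = (tr n a x)(i := t + a i)"
  by (auto simp: tr_def)

lemma tr_Rn [simp]: "tr n a x \<in> Rn n"
  by (simp add: tr_def)

lemma tr_DERIV:
  assumes "smooth n f" "i < n"
  shows "((\<lambda>t. f (tr n a (x(i := t)))) has_real_derivative partial i f (tr n a x)) (at (x i))"
proof -
  have "((\<lambda>s. f ((tr n a x)(i := s))) has_real_derivative partial i f (tr n a x)) (at (x i + a i))"
    using smooth_DERIV[OF assms, of "tr n a x"] assms by (simp add: tr_def)
  then show ?thesis unfolding tr_fun_upd[OF assms(2)] by (rule DERIV_shift[THEN iffD1])
qed

lemma partial_tr: "smooth n f \<Longrightarrow> i < n \<Longrightarrow> partial i (\<lambda>x. f (tr n a x)) x = partial i f (tr n a x)"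
  by (rule partial_eqI) (rule tr_DERIV)

lemma smooth_tr: assumes "smooth n f" shows "smooth n (\<lambda>x. f (tr n a x))"
proof (rule smooth_coinduct[where P = "\<lambda>g. \<exists>f. smooth n f \<and> g = (\<lambda>x. f (tr n a x))"])
  show "\<exists>g. smooth n g \<and> (\<lambda>x. f (tr n a x)) = (\<lambda>x. g (tr n a x))" using assms by blast
next
  fix g assume "\<exists>f. smooth n f \<and> g = (\<lambda>x. f (tr n a x))"
  then show "continuous_map (top_Rn n) euclideanreal g"
    using continuous_map_compose[OF continuous_tr smooth_continuous, of n _ a] by (auto simp: o_def)
next
  fix g i assume "\<exists>f. smooth n f \<and> g = (\<lambda>x. f (tr n a x))" and i: "i < n"
  then obtain f where f: "smooth n f" "g = (\<lambda>x. f (tr n a x))" by auto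
  show "\<exists>g'. (\<exists>f. smooth n f \<and> g' = (\<lambda>x. f (tr n a x))) \<and> (\<forall>x\<in>Rn n. ((\<lambda>t. g (x(i := t))) has_real_derivative g' x) (at (x i)))"
    using tr_DERIV[OF f(1) i] smooth_partial[OF f(1) i] unfolding f(2) by blast
qed

lemma partial_add:
  "smooth n f \<Longrightarrow> smooth n g \<Longrightarrow> i < n \<Longrightarrow> x \<in> Rn n \<Longrightarrow> partial i (\<lambda>x. f x + g x) x = partial i f x + partial i g x"
  by (rule partial_eqI) (intro DERIV_add smooth_DERIV)

lemma partial_diff:
  "smooth n f \<Longrightarrow> smooth n g \<Longrightarrow> i < n \<Longrightarrow> x \<in> Rn n \<Longrightarrow> partial i (\<lambda>x. f x - g x) x = partial i f x - partial i g x"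
  by (rule partial_eqI) (intro DERIV_diff smooth_DERIV)

lemma partial_mult:
  assumes "smooth n f" "smooth n g" "i < n" "x \<in> Rn n"
  shows "partial i (\<lambda>x. f x * g x) x = partial i f x * g x + f x * partial i g x"
  using DERIV_mult[OF smooth_DERIV[OF assms(1,3,4)] smooth_DERIV[OF assms(2,3,4)]]
  by (intro partial_eqI) (simp add: mult.commute)

lemma partial_const [simp]: "partial i (\<lambda>x. c) x = 0"
  by (rule partial_eqI) simp

lemma partial_cmult:
  assumes "smooth n f" "i < n" "x \<in> Rn n"
  shows "partial i (\<lambda>x. c * f x) x = c * partial i f x"
  using DERIV_cmult[OF smooth_DERIV[OF assms]] by (rule partial_eqI)

lemma partial_comp:
  assumes "smooth n f" "i < n" "x \<in> Rn n" "(h has_real_derivative h') (at (f x))"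
  shows "partial i (\<lambda>x. h (f x)) x = h' * partial i f x"
  using DERIV_chain2[where f = h and x = "x i" and s = UNIV and g = "\<lambda>t. f (x(i := t))", OF _ smooth_DERIV[OF assms(1,2,3)]] assms(4)
  by (intro partial_eqI) simp

section \<open>Continuous functions of compact support, and test functions\<close>

definition cc :: "nat \<Rightarrow> ((nat \<Rightarrow> real) \<Rightarrow> real) \<Rightarrow> bool" where
  "cc n f \<longleftrightarrow> continuous_map (top_Rn n) euclideanreal f \<and>
     (\<exists>R. \<forall>x\<in>Rn n. dist_n n (origin n) x > R \<longrightarrow> f x = 0)"

lemma ccD: "cc n f \<Longrightarrow> continuous_map (top_Rn n) euclideanreal f"
  by (simp add: cc_def)

lemma cc_bounded:
  assumes "cc n f" obtains C where "C \<ge> 0" "\<And>x. x \<in> Rn n \<Longrightarrow> \<bar>f x\<bar> \<le> C"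
proof -
  obtain R where R: "\<And>x. x \<in> Rn n \<Longrightarrow> dist_n n (origin n) x > R \<Longrightarrow> f x = 0"
    using assms by (auto simp: cc_def)
  have "compactin (top_Rn n) {y \<in> Rn n. dist_n n (origin n) y \<le> R}"
    by (rule compactin_closed_bounded[OF closedin_dist_le]) auto
  then have "compactin euclideanreal (f ` {y \<in> Rn n. dist_n n (origin n) y \<le> R})"
    by (rule image_compactin[OF _ ccD[OF assms]])
  then have "bounded (f ` {y \<in> Rn n. dist_n n (origin n) y \<le> R})" by (simp add: compact_imp_bounded)
  then obtain C where C: "\<forall>t\<in>f ` {y \<in> Rn n. dist_n n (origin n) y \<le> R}. norm t \<le> C" unfolding bounded_iff by blast
  have "\<bar>f x\<bar> \<le> max C 0" if "x \<in> Rn n" for x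
    using C R[OF that] that by (cases "dist_n n (origin n) x \<le> R") (auto simp: le_max_iff_disj)
  then show ?thesis using that[of "max C 0"] by auto
qed

lemma cc_integrable: assumes "cc n f" shows "integrable (bor n) f"
proof -
  obtain C where C: "C \<ge> 0" "\<And>x. x \<in> Rn n \<Longrightarrow> \<bar>f x\<bar> \<le> C" using cc_bounded[OF assms] by blast
  obtain R where R: "\<And>x. x \<in> Rn n \<Longrightarrow> dist_n n (origin n) x > R \<Longrightarrow> f x = 0"
    using assms by (auto simp: cc_def)
  show ?thesis
  proof (rule integrableI_bounded_set[where A = "ball_n n (origin n) (R + 1)" and B = C])
    show "emeasure (bor n) (ball_n n (origin n) (R + 1)) < \<infinity>" by (rule ball_finite)
    show "f \<in> borel_measurable (bor n)" by (intro borel_measurable_continuous_Rn ccD assms)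
    show "AE x in bor n. x \<in> ball_n n (origin n) (R + 1) \<longrightarrow> norm (f x) \<le> C"
      using C(2) by (auto simp: ball_n_def)
    show "AE x in bor n. x \<notin> ball_n n (origin n) (R + 1) \<longrightarrow> f x = 0"
    proof (rule AE_I2, intro impI)
      fix x assume "x \<in> space (bor n)" "x \<notin> ball_n n (origin n) (R + 1)"
      then show "f x = 0" using R[of x] by (auto simp: ball_n_def space_bor)
    qed
  qed simp
qed

lemma cc_mult: assumes "cc n f" "continuous_map (top_Rn n) euclideanreal g" shows "cc n (\<lambda>x. f x * g x)"
  using assms unfolding cc_def by (auto intro: continuous_map_real_mult)

lemma cc_mult': assumes "cc n f" "continuous_map (top_Rn n) euclideanreal g" shows "cc n (\<lambda>x. g x * f x)"
  using cc_mult[OF assms] by (simp add: mult.commute)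

text \<open>Smoothness is lost under operations such as |f| powr q or the length of the gradient.
  This closure property is the reason why \<open>cc\<close> asks for continuity only.\<close>

lemma cc_comp: assumes "cc n f" "continuous_on UNIV h" "h 0 = 0" shows "cc n (\<lambda>x. h (f x))"
  using assms(1,3) continuous_comp_real[OF ccD[OF assms(1)] assms(2)] unfolding cc_def by metis

lemma cc_add: assumes "cc n f" "cc n g" shows "cc n (\<lambda>x. f x + g x)"
proof -
  obtain R S where "\<forall>x\<in>Rn n. dist_n n (origin n) x > R \<longrightarrow> f x = 0"
     "\<forall>x\<in>Rn n. dist_n n (origin n) x > S \<longrightarrow> g x = 0" using assms unfolding cc_def by blast
  then have "\<forall>x\<in>Rn n. dist_n n (origin n) x > max R S \<longrightarrow> f x + g x = 0" by simp
  then show ?thesis using assms unfolding cc_def by (blast intro: continuous_map_add)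
qed

lemma cc_zero: "cc n (\<lambda>x. 0)" by (simp add: cc_def)

lemma cc_sum: "(\<And>i. i \<in> I \<Longrightarrow> cc n (f i)) \<Longrightarrow> cc n (\<lambda>x. \<Sum>i\<in>I. f i x)"
  by (induction I rule: infinite_finite_induct) (auto intro: cc_zero cc_add)

lemma cc_cmult: "cc n f \<Longrightarrow> cc n (\<lambda>x. c * f x)"
  by (rule cc_comp[where h = "\<lambda>t. c * t"]) (auto intro: continuous_intros)

lemma cc_power2: "cc n f \<Longrightarrow> cc n (\<lambda>x. (f x)\<^sup>2)"
  by (rule cc_comp[where h = "\<lambda>t. t\<^sup>2"]) (auto intro: continuous_intros)

lemma cc_powr: "cc n f \<Longrightarrow> q > 0 \<Longrightarrow> cc n (\<lambda>x. \<bar>f x\<bar> powr q)"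
  by (rule cc_comp[where h = "\<lambda>t. \<bar>t\<bar> powr q"])
     (auto intro!: continuous_on_powr'[OF continuous_on_rabs[OF continuous_on_id] continuous_on_const])

lemma Hausdorff_Rn: "Hausdorff_space (top_Rn n)"
  by (simp add: Hausdorff_space_product_topology)

lemma test_fun_support:
  assumes "\<phi> \<in> test_fun n U"
  obtains K where "compactin (top_Rn n) K" "closedin (top_Rn n) K" "K \<subseteq> U" "\<And>x. x \<in> Rn n \<Longrightarrow> x \<notin> K \<Longrightarrow> \<phi> x = 0"
proof -
  define K where "K = top_Rn n closure_of {x \<in> Rn n. \<phi> x \<noteq> 0}"
  have "x \<in> K" if "x \<in> Rn n" "\<phi> x \<noteq> 0" for x
    using closure_of_subset[of "{x \<in> Rn n. \<phi> x \<noteq> 0}" "top_Rn n"] that by (auto simp: K_def)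
  moreover have "compactin (top_Rn n) K" "K \<subseteq> U" using assms by (auto simp: test_fun_def K_def)
  moreover have "closedin (top_Rn n) K" by (simp add: K_def)
  ultimately show ?thesis using that by blast
qed

lemma test_funI:
  assumes "smooth n \<phi>" "compactin (top_Rn n) K" "K \<subseteq> U" "\<And>x. x \<in> Rn n \<Longrightarrow> x \<notin> K \<Longrightarrow> \<phi> x = 0"
  shows "\<phi> \<in> test_fun n U"
proof -
  have K: "closedin (top_Rn n) K" using compactin_imp_closedin[OF Hausdorff_Rn assms(2)] .
  have "top_Rn n closure_of {x \<in> Rn n. \<phi> x \<noteq> 0} \<subseteq> K"
    by (rule closure_of_minimal[OF _ K]) (use assms in auto)
  moreover have "compactin (top_Rn n) (top_Rn n closure_of {x \<in> Rn n. \<phi> x \<noteq> 0})"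
    by (rule closed_compactin[OF assms(2) calculation]) simp
  ultimately show ?thesis using assms by (auto simp: test_fun_def)
qed

lemma test_funI_ball:
  assumes "smooth n \<phi>" "{y \<in> Rn n. dist_n n x0 y \<le> R} \<subseteq> U" "\<And>x. x \<in> Rn n \<Longrightarrow> dist_n n x0 x > R \<Longrightarrow> \<phi> x = 0"
  shows "\<phi> \<in> test_fun n U"
  by (rule test_funI[OF assms(1) compactin_closed_bounded[OF closedin_dist_le[of n x0 R]] assms(2)]) (use assms(3) in auto)

lemma test_fun_smooth: "\<phi> \<in> test_fun n U \<Longrightarrow> smooth n \<phi>"
  by (simp add: test_fun_def)

lemma test_fun_mono: "U \<subseteq> W \<Longrightarrow> \<phi> \<in> test_fun n U \<Longrightarrow> \<phi> \<in> test_fun n W"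
  by (auto simp: test_fun_def)

lemma test_fun_outside: "\<phi> \<in> test_fun n U \<Longrightarrow> x \<in> Rn n \<Longrightarrow> x \<notin> U \<Longrightarrow> \<phi> x = 0"
  by (erule test_fun_support) auto

lemma test_fun_cc: assumes "\<phi> \<in> test_fun n U" shows "cc n \<phi>"
proof -
  obtain K where K: "compactin (top_Rn n) K" "\<And>x. x \<in> Rn n \<Longrightarrow> x \<notin> K \<Longrightarrow> \<phi> x = 0"
    using test_fun_support[OF assms] by metis
  obtain r where "\<And>y. y \<in> K \<Longrightarrow> dist_n n (origin n) y \<le> r"
    using compactin_bounded[OF K(1)] by metis
  then have "\<forall>x\<in>Rn n. dist_n n (origin n) x > r \<longrightarrow> \<phi> x = 0"
    using K(2) by (meson not_le)
  then show ?thesis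
    using smooth_continuous[OF test_fun_smooth[OF assms]] by (auto simp: cc_def)
qed

text \<open>A point off the closed support has a ball around it, hence a short segment in direction
  i, on which \<phi> vanishes.\<close>

lemma test_fun_partial: assumes "\<phi> \<in> test_fun n U" "i < n" shows "partial i \<phi> \<in> test_fun n U"
proof -
  obtain K where K: "compactin (top_Rn n) K" "closedin (top_Rn n) K" "K \<subseteq> U" "\<And>x. x \<in> Rn n \<Longrightarrow> x \<notin> K \<Longrightarrow> \<phi> x = 0"
    using test_fun_support[OF assms(1)] by metis
  show ?thesis
  proof (rule test_funI[OF smooth_partial[OF test_fun_smooth[OF assms(1)] assms(2)] K(1,3)])
    fix x assume x: "x \<in> Rn n" "x \<notin> K"
    have "openin (top_Rn n) (Rn n - K)" using K(2) by (simp add: closedin_def)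
    then obtain e where e: "e > 0" "ball_n n x e \<subseteq> Rn n - K"
      using open_contains_ball_n[of n "Rn n - K" x] x by auto
    have "\<phi> (x(i := t)) = 0" if "\<bar>t - x i\<bar> < e" for t
    proof -
      have "(\<Sum>j<n. ((x(i := t)) j - x j)\<^sup>2) = (\<Sum>j<n. if j = i then (t - x i)\<^sup>2 else 0)"
        by (intro sum.cong) auto
      then have "dist_n n (x(i := t)) x = \<bar>t - x i\<bar>"
        using assms(2) by (simp add: dist_n_sqrt)
      then have "x(i := t) \<in> ball_n n x e" using that x assms(2) by (simp add: ball_n_def Rn_fun_upd dist_n_commute[of n x])
      then show ?thesis using e(2) K(4) by auto
    qed
    then have ev: "\<forall>\<^sub>F t in nhds (x i). \<phi> (x(i := t)) = 0"
      unfolding eventually_nhds_metric dist_real_def using e(1) by blast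
    have "((\<lambda>t. \<phi> (x(i := t))) has_real_derivative 0) (at (x i))"
      by (subst DERIV_cong_ev[OF refl ev refl]) simp
    then show "partial i \<phi> x = 0" by (rule partial_eqI)
  qed
qed

lemma test_fun_mult: assumes "\<phi> \<in> test_fun n U" "smooth n f" shows "(\<lambda>x. \<phi> x * f x) \<in> test_fun n U"
  by (rule test_fun_support[OF assms(1)], rule test_funI[where U = U])
     (use assms test_fun_smooth[OF assms(1)] in \<open>auto intro!: smooth_mult\<close>)

lemma test_fun_cmult: assumes "\<phi> \<in> test_fun n U" shows "(\<lambda>x. c * \<phi> x) \<in> test_fun n U"
  using test_fun_mult[OF assms smooth_const[of n c]] by (simp add: mult.commute)

lemma test_fun_partials:
  "\<phi> \<in> test_fun n U \<Longrightarrow> set is \<subseteq> {..<n} \<Longrightarrow> partials is \<phi> \<in> test_fun n U"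
  by (induction "is") (auto simp: partials_def intro: test_fun_partial)

section \<open>Integration by parts and Lebesgue norms\<close>

text \<open>By Fubini coordinate i is integrated first, and on each line the fundamental theorem
  leaves only boundary values outside the support.\<close>

lemma integral_partial:
  assumes f: "f \<in> test_fun n (Rn n)" and i: "i < n"
  shows "(LINT x|bor n. partial i f x) = 0"
proof -
  let ?I = "{..<n} - {i}"
  have ins: "{..<n} = insert i ?I" using i by auto
  have sm: "smooth n f" by (rule test_fun_smooth[OF f])
  obtain R where R: "\<And>x. x \<in> Rn n \<Longrightarrow> dist_n n (origin n) x > R \<Longrightarrow> f x = 0"
    using test_fun_cc[OF f] by (auto simp: cc_def)
  obtain R' where R': "\<And>x. x \<in> Rn n \<Longrightarrow> dist_n n (origin n) x > R' \<Longrightarrow> partial i f x = 0"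
    using test_fun_cc[OF test_fun_partial[OF f i]] by (auto simp: cc_def)
  \<comment> \<open>S exceeds both radii: the boundary values of f vanish, and so does the integrand
    outside the interval from -S to S.\<close>
  define S where "S = max 0 (max R R') + 1"
  have S: "S > 0" "S > R" "S > R'" by (auto simp: S_def)
  have inner: "(LINT y|lborel. partial i f (x(i := y))) = 0" if "x \<in> space (\<Pi>\<^sub>M j\<in>?I. lborel)" for x
  proof -
    have x: "x(i := y) \<in> Rn n" for y
      using that i by (auto simp: space_PiM Rn_def PiE_iff extensional_def simp del: PiE_UNIV_Rn)
    have d: "\<bar>y\<bar> \<le> dist_n n (origin n) (x(i := y))" for y
      using coord_le_dist_n[OF i, of "origin n" "x(i := y)"] i by (simp add: origin_def)
    have D: "((\<lambda>t. f (x(i := t))) has_real_derivative partial i f (x(i := y))) (at y)" for y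
      using smooth_DERIV'[OF sm i x[of undefined], of y] by simp
    have "continuous_on UNIV (\<lambda>y. partial i f (x(i := y)))"
      using continuous_map_compose[OF continuous_fun_upd[OF i x[of undefined]] smooth_continuous[OF smooth_partial[OF sm i]]]
      by (simp add: o_def)
    then have c: "isCont (\<lambda>y. partial i f (x(i := y))) y" for y
      by (simp add: continuous_on_eq_continuous_at)
    have "(LINT y|lborel. partial i f (x(i := y))) = (LINT y|lborel. partial i f (x(i := y)) * indicator {-S..S} y)"
    proof (rule Bochner_Integration.integral_cong[OF refl])
      fix y show "partial i f (x(i := y)) = partial i f (x(i := y)) * indicator {-S..S} y"
      proof (cases "\<bar>y\<bar> \<le> S")
        case True then show ?thesis by (simp add: abs_le_iff)
      next
        case False
        then have "R' < dist_n n (origin n) (x(i := y))" using d[of y] S by linarith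
        then show ?thesis using R'[OF x, of y] by simp
      qed
    qed
    also have "\<dots> = f (x(i := S)) - f (x(i := - S))"
      by (rule integral_FTC_Icc_real[where F = "\<lambda>y. f (x(i := y))", OF _ D c]) (use S in simp)
    also have "\<dots> = 0" using R[OF x, of S] R[OF x, of "-S"] d[of S] d[of "-S"] S by auto
    finally show ?thesis .
  qed
  have "integrable (bor n) (partial i f)" by (intro cc_integrable test_fun_cc[OF test_fun_partial[OF f i]])
  then have "(LINT x|bor n. partial i f x) = (LINT x|(\<Pi>\<^sub>M j\<in>?I. lborel). (LINT y|lborel. partial i f (x(i := y))))"
    using lbs.product_integral_insert[of ?I i "partial i f"] ins by simp
  also have "\<dots> = 0" using Bochner_Integration.integral_cong[OF refl inner] by simp
  finally show ?thesis .
qed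

lemma integral_by_parts:
  assumes f: "f \<in> test_fun n (Rn n)" and g: "smooth n g" and i: "i < n"
  shows "(LINT x|bor n. partial i f x * g x) = - (LINT x|bor n. f x * partial i g x)"
proof -
  have c: "integrable (bor n) (\<lambda>x. partial i f x * g x)" "integrable (bor n) (\<lambda>x. f x * partial i g x)"
    by (intro cc_integrable cc_mult test_fun_cc[OF test_fun_partial[OF f i]] test_fun_cc[OF f] smooth_continuous g smooth_partial i)+
  have "0 = (LINT x|bor n. partial i (\<lambda>x. f x * g x) x)"
    using integral_partial[OF test_fun_mult[OF f g] i] by simp
  also have "\<dots> = (LINT x|bor n. partial i f x * g x + f x * partial i g x)"
    by (rule Bochner_Integration.integral_cong[OF refl]) (simp add: space_bor partial_mult[OF test_fun_smooth[OF f] g i])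
  also have "\<dots> = (LINT x|bor n. partial i f x * g x) + (LINT x|bor n. f x * partial i g x)"
    by (rule Bochner_Integration.integral_add[OF c])
  finally show ?thesis by linarith
qed

section \<open>Lebesgue norms over an arbitrary measure\<close>

definition Lq :: "'a measure \<Rightarrow> real \<Rightarrow> ('a \<Rightarrow> real) set" where
  "Lq M q = {f \<in> borel_measurable M. integrable M (\<lambda>x. \<bar>f x\<bar> powr q)}"

text \<open>\<open>Lp\<close> and \<open>Lp_norm\<close> refer to a subset and to the completed
  measure. Fubini, convolutions and limits are carried out with \<open>Lq\<close> and
  \<open>nrm\<close> for the Borel product measure on the whole space; \<open>brep\<close> connects
  the two.\<close>

definition nrm :: "'a measure \<Rightarrow> real \<Rightarrow> ('a \<Rightarrow> real) \<Rightarrow> real" where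
  "nrm M q f = (LINT x|M. \<bar>f x\<bar> powr q) powr (1 / q)"

lemma LqD: "f \<in> Lq M q \<Longrightarrow> f \<in> borel_measurable M" "f \<in> Lq M q \<Longrightarrow> integrable M (\<lambda>x. \<bar>f x\<bar> powr q)"
  by (auto simp: Lq_def)

lemma nrm_nonneg [simp]: "nrm M q f \<ge> 0"
  by (simp add: nrm_def)

lemma nrm_powr: "q > 0 \<Longrightarrow> nrm M q f powr q = (LINT x|M. \<bar>f x\<bar> powr q)"
  by (simp add: nrm_def powr_powr)

lemma nrm_le_iff:
  assumes "q > 0" "C \<ge> 0" shows "nrm M q f \<le> C \<longleftrightarrow> (LINT x|M. \<bar>f x\<bar> powr q) \<le> C powr q"
proof -
  have "nrm M q f \<le> C \<longleftrightarrow> nrm M q f powr q \<le> C powr q"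
    using assms by (metis nrm_nonneg powr_less_mono2 powr_mono2 not_le less_imp_le)
  then show ?thesis using assms by (simp add: nrm_powr)
qed

lemma Lq_bound:
  assumes "g \<in> Lq M q" "f \<in> borel_measurable M" "AE x in M. \<bar>f x\<bar> \<le> C * \<bar>g x\<bar>" "q > 0" "C \<ge> 0"
  shows "f \<in> Lq M q" "nrm M q f \<le> C * nrm M q g"
proof -
  have b: "AE x in M. \<bar>f x\<bar> powr q \<le> C powr q * \<bar>g x\<bar> powr q"
    using assms(3)
  proof eventually_elim
    case (elim x)
    then have "\<bar>f x\<bar> powr q \<le> (C * \<bar>g x\<bar>) powr q" using assms by (intro powr_mono2) auto
    then show ?case using assms by (simp add: powr_mult)
  qed
  have i: "integrable M (\<lambda>x. C powr q * \<bar>g x\<bar> powr q)" using LqD[OF assms(1)] by auto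
  have i2: "integrable M (\<lambda>x. \<bar>f x\<bar> powr q)"
    by (rule Bochner_Integration.integrable_bound[OF i]) (use b assms in auto)
  then show "f \<in> Lq M q" using assms by (simp add: Lq_def)
  have "(LINT x|M. \<bar>f x\<bar> powr q) \<le> (LINT x|M. C powr q * \<bar>g x\<bar> powr q)"
    by (rule integral_mono_AE[OF i2 i b])
  also have "\<dots> = (C * nrm M q g) powr q" using assms by (simp add: powr_mult nrm_powr)
  finally show "nrm M q f \<le> C * nrm M q g" using assms by (subst nrm_le_iff) auto
qed

lemma Lq_cmult: "f \<in> Lq M q \<Longrightarrow> (\<lambda>x. c * f x) \<in> Lq M q"
  by (auto simp: Lq_def abs_mult powr_mult)

lemma nrm_cmult: "q > 0 \<Longrightarrow> nrm M q (\<lambda>x. c * f x) = \<bar>c\<bar> * nrm M q f"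
  by (simp add: nrm_def abs_mult powr_mult powr_powr)

lemma Lq_zero [simp]: "(\<lambda>x. 0) \<in> Lq M q" and nrm_zero [simp]: "nrm M q (\<lambda>x. 0) = 0"
  by (auto simp: Lq_def nrm_def)

lemma nrm_cong_AE:
  assumes "f \<in> borel_measurable M" "g \<in> borel_measurable M" "AE x in M. f x = g x"
  shows "nrm M q f = nrm M q g"
proof -
  have "(LINT x|M. \<bar>f x\<bar> powr q) = (LINT x|M. \<bar>g x\<bar> powr q)"
    by (rule integral_cong_AE) (use assms in auto)
  then show ?thesis by (simp add: nrm_def)
qed

lemma nrm_cong: "(\<And>x. x \<in> space M \<Longrightarrow> \<bar>f x\<bar> = \<bar>g x\<bar>) \<Longrightarrow> nrm M q f = nrm M q g"
  unfolding nrm_def by (simp cong: Bochner_Integration.integral_cong)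

text \<open>Convexity is applied on the open half-line; if s or t is 0, the claim reduces to l^q <=
  l for 0 <= l <= 1.\<close>

lemma convex_powr:
  fixes s t l q :: real
  assumes "q \<ge> 1" "s \<ge> 0" "t \<ge> 0" "0 \<le> l" "l \<le> 1"
  shows "(l * s + (1 - l) * t) powr q \<le> l * s powr q + (1 - l) * t powr q"
proof -
  have le: "l powr q \<le> l" if "0 \<le> l" "l \<le> 1" for l :: real
    using powr_mono'[of 1 q l] that assms(1) by simp
  consider "s = 0" | "t = 0" | "s > 0" "t > 0" using assms by linarith
  then show ?thesis
  proof cases
    case 1
    then show ?thesis using mult_right_mono[OF le[of "1 - l"], of "t powr q"] assms by (simp add: powr_mult)
  next
    case 2
    then show ?thesis using mult_right_mono[OF le[of l], of "s powr q"] assms by (simp add: powr_mult)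
  next
    case 3
    then show ?thesis
      using convex_onD[OF powr_convex[OF assms(1)], of "1 - l" s t] assms by (simp add: algebra_simps)
  qed
qed

text \<open>With A and B the two norms, f + g is (A + B) times the convex combination of f / A and g
  / B with weights A / (A + B) and B / (A + B), and the q-th power is convex. Adding e to both norms
  keeps the denominators positive; e is arbitrary in the end.\<close>

lemma Minkowski:
  assumes q: "q \<ge> 1" and f: "f \<in> Lq M q" and g: "g \<in> Lq M q"
  shows "(\<lambda>x. f x + g x) \<in> Lq M q" "nrm M q (\<lambda>x. f x + g x) \<le> nrm M q f + nrm M q g"
proof -
  have q0: "q > 0" using q by simp
  have main: "integrable M (\<lambda>x. \<bar>f x + g x\<bar> powr q) \<and> nrm M q (\<lambda>x. f x + g x) \<le> (nrm M q f + e) + (nrm M q g + e)" if e: "e > 0" for e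
  proof -
    define A B where "A = nrm M q f + e" and "B = nrm M q g + e"
    have AB: "A > 0" "B > 0" using e by (auto simp: A_def B_def add_nonneg_pos)
    define h where "h x = (A + B) powr q * (A / (A + B) * A powr (-q) * \<bar>f x\<bar> powr q + B / (A + B) * B powr (-q) * \<bar>g x\<bar> powr q)" for x
    have b: "\<bar>f x + g x\<bar> powr q \<le> h x" for x
    proof -
      define l where "l = A / (A + B)"
      have l: "0 \<le> l" "l \<le> 1" "1 - l = B / (A + B)" using AB by (auto simp: l_def field_simps)
      have "(A + B) * (l * (\<bar>f x\<bar> / A)) = \<bar>f x\<bar>" "(A + B) * ((1 - l) * (\<bar>g x\<bar> / B)) = \<bar>g x\<bar>"
        using AB by (simp add: l_def, subst l(3), simp)
      then have "\<bar>f x + g x\<bar> \<le> (A + B) * (l * (\<bar>f x\<bar> / A) + (1 - l) * (\<bar>g x\<bar> / B))"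
        by (simp add: distrib_left)
      then have "\<bar>f x + g x\<bar> powr q \<le> ((A + B) * (l * (\<bar>f x\<bar> / A) + (1 - l) * (\<bar>g x\<bar> / B))) powr q"
        using q0 by (intro powr_mono2) auto
      also have "\<dots> = (A + B) powr q * (l * (\<bar>f x\<bar> / A) + (1 - l) * (\<bar>g x\<bar> / B)) powr q"
        using AB by (subst powr_mult) (auto simp: l)
      also have "\<dots> \<le> (A + B) powr q * (l * (\<bar>f x\<bar> / A) powr q + (1 - l) * (\<bar>g x\<bar> / B) powr q)"
        using AB l by (intro mult_left_mono convex_powr q) auto
      also have "\<dots> = h x" using AB l
        by (simp add: h_def powr_divide powr_minus_divide l_def[symmetric] l(3)[symmetric])
      finally show ?thesis .
    qed
    have i: "integrable M h" unfolding h_def[abs_def] using LqD[OF f] LqD[OF g] by auto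
    have i2: "integrable M (\<lambda>x. \<bar>f x + g x\<bar> powr q)"
      by (rule Bochner_Integration.integrable_bound[OF i]) (use b LqD[OF f] LqD[OF g] in \<open>auto intro!: AE_I2 order_trans[OF b]\<close>)
    have "(LINT x|M. \<bar>f x + g x\<bar> powr q) \<le> (LINT x|M. h x)" by (rule integral_mono[OF i2 i b])
    also have "\<dots> = (A + B) powr q * (A / (A + B) * (A powr (-q) * nrm M q f powr q) + B / (A + B) * (B powr (-q) * nrm M q g powr q))"
      unfolding h_def using LqD[OF f] LqD[OF g] q0 by (simp add: nrm_powr)
    also have "\<dots> \<le> (A + B) powr q * (A / (A + B) * 1 + B / (A + B) * 1)"
    proof -
      have "A powr (-q) * nrm M q f powr q \<le> A powr (-q) * A powr q"
        using e q0 by (intro mult_left_mono powr_mono2) (auto simp: A_def)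
      moreover have "B powr (-q) * nrm M q g powr q \<le> B powr (-q) * B powr q"
        using e q0 by (intro mult_left_mono powr_mono2) (auto simp: B_def)
      ultimately show ?thesis using AB
        by (intro mult_left_mono add_mono) (auto simp: powr_add[symmetric])
    qed
    also have "\<dots> = (A + B) powr q" using AB by (simp add: add_divide_distrib[symmetric])
    finally have "nrm M q (\<lambda>x. f x + g x) \<le> A + B" using AB q0 by (subst nrm_le_iff) auto
    then show ?thesis using i2 by (simp add: A_def B_def)
  qed
  show "(\<lambda>x. f x + g x) \<in> Lq M q" using main[of 1] LqD[OF f] LqD[OF g] by (auto simp: Lq_def)
  show "nrm M q (\<lambda>x. f x + g x) \<le> nrm M q f + nrm M q g"
  proof (rule field_le_epsilon)
    fix e :: real assume "e > 0"
    then show "nrm M q (\<lambda>x. f x + g x) \<le> nrm M q f + nrm M q g + e" using main[of "e/2"] by simp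
  qed
qed

lemma Lq_diff: "q \<ge> 1 \<Longrightarrow> f \<in> Lq M q \<Longrightarrow> g \<in> Lq M q \<Longrightarrow> (\<lambda>x. f x - g x) \<in> Lq M q"
  using Minkowski(1)[of q f M "\<lambda>x. (-1) * g x"] Lq_cmult[of g M q "-1"] by simp

lemma Minkowski_sum:
  assumes q: "q \<ge> 1" and f: "\<And>i. i \<in> I \<Longrightarrow> f i \<in> Lq M q"
  shows "(\<lambda>x. \<Sum>i\<in>I. f i x) \<in> Lq M q \<and> nrm M q (\<lambda>x. \<Sum>i\<in>I. f i x) \<le> (\<Sum>i\<in>I. nrm M q (f i))"
  using f
proof (induction I rule: infinite_finite_induct)
  case (insert i I)
  then show ?case using Minkowski[OF q, of "f i" M "\<lambda>x. \<Sum>i\<in>I. f i x"] by force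
qed auto

text \<open>Young's inequality for f / A and g / B is integrated. As in \<open>Minkowski\<close>,
  the norms are enlarged by e to be positive, and e tends to 0.\<close>

lemma Holder:
  assumes ab: "a > 0" "b > 0" "1 / a + 1 / b = 1" and f: "f \<in> Lq M a" and g: "g \<in> Lq M b"
  shows "integrable M (\<lambda>x. f x * g x)" "(LINT x|M. \<bar>f x * g x\<bar>) \<le> nrm M a f * nrm M b g"
proof -
  have a1: "a > 1" "b > 1" using ab by (smt (verit) divide_pos_pos less_divide_eq_1_pos mult_cancel_right1 le_divide_eq_1_pos)+
  have main: "integrable M (\<lambda>x. f x * g x) \<and> (LINT x|M. \<bar>f x * g x\<bar>) \<le> (nrm M a f + e) * (nrm M b g + e)" if e: "e > 0" for e
  proof -
    define A B where "A = nrm M a f + e" and "B = nrm M b g + e"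
    have AB: "A > 0" "B > 0" using e by (auto simp: A_def B_def add_nonneg_pos)
    define h where "h x = A * B * (A powr (-a) * \<bar>f x\<bar> powr a / a + B powr (-b) * \<bar>g x\<bar> powr b / b)" for x
    have bd: "\<bar>f x * g x\<bar> \<le> h x" for x
    proof -
      have "(\<bar>f x\<bar> / A) * (\<bar>g x\<bar> / B) \<le> (\<bar>f x\<bar> / A) powr a / a + (\<bar>g x\<bar> / B) powr b / b"
        using Youngs_inequality[of a b "\<bar>f x\<bar> / A" "\<bar>g x\<bar> / B"] a1 ab AB by simp
      then have "A * B * ((\<bar>f x\<bar> / A) * (\<bar>g x\<bar> / B)) \<le> A * B * ((\<bar>f x\<bar> / A) powr a / a + (\<bar>g x\<bar> / B) powr b / b)"
        using AB by (intro mult_left_mono) auto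
      then show ?thesis using AB by (simp add: h_def abs_mult powr_divide powr_minus_divide)
    qed
    have i: "integrable M h" unfolding h_def[abs_def] using LqD[OF f] LqD[OF g] by auto
    have i2: "integrable M (\<lambda>x. f x * g x)"
      by (rule Bochner_Integration.integrable_bound[OF i]) (use LqD[OF f] LqD[OF g] in \<open>auto intro!: AE_I2 order_trans[OF bd]\<close>)
    have "(LINT x|M. \<bar>f x * g x\<bar>) \<le> (LINT x|M. h x)" by (rule integral_mono[OF _ i bd]) (use i2 in auto)
    also have "\<dots> = A * B * ((A powr (-a) * nrm M a f powr a) / a + (B powr (-b) * nrm M b g powr b) / b)"
      unfolding h_def using LqD[OF f] LqD[OF g] ab by (simp add: nrm_powr)
    also have "\<dots> \<le> A * B * (1 / a + 1 / b)"
    proof -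
      have "A powr (-a) * nrm M a f powr a \<le> A powr (-a) * A powr a"
        using e ab by (intro mult_left_mono powr_mono2) (auto simp: A_def)
      moreover have "B powr (-b) * nrm M b g powr b \<le> B powr (-b) * B powr b"
        using e ab by (intro mult_left_mono powr_mono2) (auto simp: B_def)
      ultimately show ?thesis using AB ab
        by (intro mult_left_mono add_mono divide_right_mono) (auto simp: powr_add[symmetric])
    qed
    also have "\<dots> = A * B" using ab by simp
    finally show ?thesis using i2 by (simp add: A_def B_def)
  qed
  show "integrable M (\<lambda>x. f x * g x)" using main[of 1] by simp
  have "((\<lambda>e. (nrm M a f + e) * (nrm M b g + e)) \<longlongrightarrow> (nrm M a f + 0) * (nrm M b g + 0)) (at_right 0)"
    by (intro tendsto_intros)
  moreover have "\<forall>\<^sub>F e in at_right 0. (LINT x|M. \<bar>f x * g x\<bar>) \<le> (nrm M a f + e) * (nrm M b g + e)"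
    using main by (auto simp: eventually_at_right_less intro: eventually_at_rightI[of 0 1])
  ultimately show "(LINT x|M. \<bar>f x * g x\<bar>) \<le> nrm M a f * nrm M b g"
    by (intro tendsto_lowerbound[where F = "at_right 0"]) auto
qed

lemma Holder_abs:
  assumes ab: "a > 0" "b > 0" "1 / a + 1 / b = 1" and f: "f \<in> Lq M a" and g: "g \<in> Lq M b"
  shows "\<bar>LINT x|M. f x * g x\<bar> \<le> nrm M a f * nrm M b g"
  using Holder(2)[OF assms] integral_norm_bound[of M "\<lambda>x. f x * g x"] unfolding real_norm_def by linarith

text \<open>This is the case s = 1 for |f|^s and |g|^s with the exponents a / s and b / s.\<close>

lemma Holder_general:
  assumes s: "s > 0" and ab: "a > 0" "b > 0" "1 / a + 1 / b = 1 / s" and f: "f \<in> Lq M a" and g: "g \<in> Lq M b"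
  shows "(\<lambda>x. f x * g x) \<in> Lq M s" "nrm M s (\<lambda>x. f x * g x) \<le> nrm M a f * nrm M b g"
proof -
  define F G where "F x = \<bar>f x\<bar> powr s" and "G x = \<bar>g x\<bar> powr s" for x
  have F: "F \<in> Lq M (a / s)" "nrm M (a / s) F = nrm M a f powr s"
    using LqD[OF f] s ab by (auto simp: Lq_def F_def[abs_def] powr_powr nrm_def)
  have G: "G \<in> Lq M (b / s)" "nrm M (b / s) G = nrm M b g powr s"
    using LqD[OF g] s ab by (auto simp: Lq_def G_def[abs_def] powr_powr nrm_def)
  have e: "1 / (a / s) + 1 / (b / s) = 1"
  proof -
    have "1 / (a / s) + 1 / (b / s) = s * (1 / a + 1 / b)" by (simp add: distrib_left)
    then show ?thesis using ab s by simp
  qed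
  have FG: "\<bar>F x * G x\<bar> = \<bar>f x * g x\<bar> powr s" "F x * G x = \<bar>f x * g x\<bar> powr s" for x
    by (auto simp: F_def G_def abs_mult powr_mult)
  note H = Holder[OF _ _ e F(1) G(1), unfolded FG]
  show "(\<lambda>x. f x * g x) \<in> Lq M s" using H(1) LqD[OF f] LqD[OF g] s ab by (auto simp: Lq_def)
  have "(LINT x|M. \<bar>f x * g x\<bar> powr s) \<le> (nrm M a f * nrm M b g) powr s"
    using H(2) s ab by (simp add: F(2) G(2) powr_mult)
  then show "nrm M s (\<lambda>x. f x * g x) \<le> nrm M a f * nrm M b g" using s by (subst nrm_le_iff) auto
qed

lemma nrm_diff_triangle:
  assumes q: "q \<ge> 1" and f: "f \<in> Lq M q" and g: "g \<in> Lq M q"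
  shows "\<bar>nrm M q f - nrm M q g\<bar> \<le> nrm M q (\<lambda>x. f x - g x)"
proof -
  have d: "(\<lambda>x. f x - g x) \<in> Lq M q" "(\<lambda>x. g x - f x) \<in> Lq M q" using Lq_diff assms by blast+
  have "nrm M q (\<lambda>x. g x - f x) = nrm M q (\<lambda>x. f x - g x)" by (rule nrm_cong) simp
  then show ?thesis
    using Minkowski(2)[OF q d(1) g] Minkowski(2)[OF q d(2) f] by simp
qed

lemma nrm_tendsto:
  assumes q: "q \<ge> 1" and f: "\<And>k. f k \<in> Lq M q" "g \<in> Lq M q" and lim: "(\<lambda>k. nrm M q (\<lambda>x. f k x - g x)) \<longlonglongrightarrow> 0"
  shows "(\<lambda>k. nrm M q (f k)) \<longlonglongrightarrow> nrm M q g"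
proof -
  have "norm (nrm M q (f k) - nrm M q g) \<le> nrm M q (\<lambda>x. f k x - g x)" for k
    unfolding real_norm_def by (rule nrm_diff_triangle[OF q f(1) f(2)])
  then have "\<forall>\<^sub>F k in sequentially. norm (nrm M q (f k) - nrm M q g) \<le> nrm M q (\<lambda>x. f k x - g x)"
    by (rule eventuallyI)
  then show ?thesis by (rule LIM_zero_cancel[OF Lim_null_comparison[OF _ lim]])
qed

lemma nrm_tendsto_mult:
  assumes q: "q \<ge> 1" and f: "\<And>k. f k \<in> Lq M q" "g \<in> Lq M q" and lim: "(\<lambda>k. nrm M q (\<lambda>x. f k x - g x)) \<longlonglongrightarrow> 0"
    and h: "h \<in> borel_measurable M" "\<And>x. x \<in> space M \<Longrightarrow> \<bar>h x\<bar> \<le> C"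
  shows "(\<lambda>k. nrm M q (\<lambda>x. h x * f k x - h x * g x)) \<longlonglongrightarrow> 0"
    "(\<lambda>x. h x * g x) \<in> Lq M q" "\<And>k. (\<lambda>x. h x * f k x) \<in> Lq M q"
proof -
  \<comment> \<open>The absolute value covers an empty space, where C may be negative.\<close>
  have C: "\<And>x. x \<in> space M \<Longrightarrow> \<bar>h x\<bar> \<le> \<bar>C\<bar>" using h(2) by fastforce
  have m: "(\<lambda>x. h x * w x) \<in> Lq M q \<and> nrm M q (\<lambda>x. h x * w x) \<le> \<bar>C\<bar> * nrm M q w" if "w \<in> Lq M q" for w
  proof -
    have "AE x in M. \<bar>h x * w x\<bar> \<le> \<bar>C\<bar> * \<bar>w x\<bar>"
      by (rule AE_I2) (auto simp: abs_mult intro: mult_right_mono C)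
    moreover have "(\<lambda>x. h x * w x) \<in> borel_measurable M" using LqD(1)[OF that] h(1) by simp
    ultimately show ?thesis using Lq_bound[OF that, of "\<lambda>x. h x * w x" "\<bar>C\<bar>"] q by simp
  qed
  show "(\<lambda>x. h x * g x) \<in> Lq M q" "\<And>k. (\<lambda>x. h x * f k x) \<in> Lq M q" using m f by auto
  have "nrm M q (\<lambda>x. h x * f k x - h x * g x) \<le> \<bar>C\<bar> * nrm M q (\<lambda>x. f k x - g x)" for k
    using m[OF Lq_diff[OF q f(1) f(2)], of k] by (simp add: right_diff_distrib)
  then have "\<forall>\<^sub>F k in sequentially. norm (nrm M q (\<lambda>x. h x * f k x - h x * g x)) \<le> \<bar>C\<bar> * nrm M q (\<lambda>x. f k x - g x)"
    by (intro eventuallyI) simp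
  moreover have "(\<lambda>k. \<bar>C\<bar> * nrm M q (\<lambda>x. f k x - g x)) \<longlonglongrightarrow> 0"
    using tendsto_mult_left[OF lim, of "\<bar>C\<bar>"] by simp
  ultimately show "(\<lambda>k. nrm M q (\<lambda>x. h x * f k x - h x * g x)) \<longlonglongrightarrow> 0"
    by (rule Lim_null_comparison)
qed

text \<open>The split f_k g_k - f' g' = (f_k - f') g_k + f' (g_k - g') reduces the claim to Hoelder
  and to the convergence of the norms of g_k.\<close>

lemma integral_mult_tendsto:
  assumes ab: "a \<ge> 1" "b \<ge> 1" "1 / a + 1 / b = 1"
    and f: "\<And>k. f k \<in> Lq M a" "f' \<in> Lq M a" "(\<lambda>k. nrm M a (\<lambda>x. f k x - f' x)) \<longlonglongrightarrow> 0"
    and g: "\<And>k. g k \<in> Lq M b" "g' \<in> Lq M b" "(\<lambda>k. nrm M b (\<lambda>x. g k x - g' x)) \<longlonglongrightarrow> 0"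
  shows "(\<lambda>k. LINT x|M. f k x * g k x) \<longlonglongrightarrow> (LINT x|M. f' x * g' x)"
proof -
  have p: "a > 0" "b > 0" using ab by auto
  note H = Holder[OF p ab(3)]
  have "\<bar>(LINT x|M. f k x * g k x) - (LINT x|M. f' x * g' x)\<bar>
     \<le> nrm M a (\<lambda>x. f k x - f' x) * nrm M b (g k) + nrm M a f' * nrm M b (\<lambda>x. g k x - g' x)" for k
  proof -
    have d: "(\<lambda>x. f k x - f' x) \<in> Lq M a" "(\<lambda>x. g k x - g' x) \<in> Lq M b" using ab f g by (auto intro: Lq_diff)
    have "(LINT x|M. f k x * g k x) - (LINT x|M. f' x * g' x) = (LINT x|M. f k x * g k x - f' x * g' x)"
      by (rule Bochner_Integration.integral_diff[symmetric]) (rule H(1)[OF f(1) g(1)] H(1)[OF f(2) g(2)])+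
    also have "\<dots> = (LINT x|M. (f k x - f' x) * g k x + f' x * (g k x - g' x))"
      by (rule Bochner_Integration.integral_cong) (auto simp: algebra_simps)
    also have "\<dots> = (LINT x|M. (f k x - f' x) * g k x) + (LINT x|M. f' x * (g k x - g' x))"
      by (rule Bochner_Integration.integral_add) (rule H(1)[OF d(1) g(1)] H(1)[OF f(2) d(2)])+
    finally show ?thesis
      using Holder_abs[OF p ab(3) d(1) g(1)[of k]] Holder_abs[OF p ab(3) f(2) d(2)] by linarith
  qed
  then have ev: "\<forall>\<^sub>F k in sequentially. norm ((LINT x|M. f k x * g k x) - (LINT x|M. f' x * g' x))
     \<le> nrm M a (\<lambda>x. f k x - f' x) * nrm M b (g k) + nrm M a f' * nrm M b (\<lambda>x. g k x - g' x)"
    by (intro eventuallyI) (simp only: real_norm_def)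
  have "(\<lambda>k. nrm M a (\<lambda>x. f k x - f' x) * nrm M b (g k) + nrm M a f' * nrm M b (\<lambda>x. g k x - g' x))
     \<longlonglongrightarrow> 0 * nrm M b g' + nrm M a f' * 0"
    by (rule tendsto_add[OF tendsto_mult[OF f(3) nrm_tendsto[OF ab(2) g]] tendsto_mult[OF tendsto_const g(3)]])
  then have l: "(\<lambda>k. nrm M a (\<lambda>x. f k x - f' x) * nrm M b (g k) + nrm M a f' * nrm M b (\<lambda>x. g k x - g' x)) \<longlonglongrightarrow> 0"
    by simp
  show ?thesis by (rule LIM_zero_cancel[OF Lim_null_comparison[OF ev l]])
qed

text \<open>Convergence in L^q is convergence of |f_k - g|^q to 0 in L^1, for which an almost
  everywhere convergent subsequence exists.\<close>

lemma nrm_AE_subseq: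
  assumes q: "q \<ge> 1" and f: "\<And>k. f k \<in> Lq M q" "g \<in> Lq M q" and lim: "(\<lambda>k. nrm M q (\<lambda>x. f k x - g x)) \<longlonglongrightarrow> 0"
  obtains r :: "nat \<Rightarrow> nat" where "strict_mono r" "AE x in M. (\<lambda>k. f (r k) x) \<longlonglongrightarrow> g x"
proof -
  have "(\<lambda>k. nrm M q (\<lambda>x. f k x - g x) powr q) \<longlonglongrightarrow> 0 powr q"
    using q lim by (intro tendsto_powr' tendsto_const) auto
  then have 1: "(\<lambda>k. LINT x|M. norm (\<bar>f k x - g x\<bar> powr q)) \<longlonglongrightarrow> 0" using q by (simp add: nrm_powr)
  have 2: "integrable M (\<lambda>x. \<bar>f k x - g x\<bar> powr q)" for k using LqD(2)[OF Lq_diff[OF q f(1) f(2)]] .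
  obtain r where r: "strict_mono r" "AE x in M. (\<lambda>k. \<bar>f (r k) x - g x\<bar> powr q) \<longlonglongrightarrow> 0"
    using tendsto_L1_AE_subseq[of M "\<lambda>k x. \<bar>f k x - g x\<bar> powr q", OF 2 1] by blast
  have "AE x in M. (\<lambda>k. f (r k) x) \<longlonglongrightarrow> g x"
    using r(2)
  proof eventually_elim
    case (elim x)
    have "(\<lambda>k. (\<bar>f (r k) x - g x\<bar> powr q) powr (1 / q)) \<longlonglongrightarrow> 0 powr (1 / q)"
      using q elim by (intro tendsto_powr' tendsto_const) auto
    then have "(\<lambda>k. \<bar>f (r k) x - g x\<bar>) \<longlonglongrightarrow> 0" using q by (simp add: powr_powr)
    then show ?case using LIM_zero_cancel tendsto_rabs_zero_iff by blast
  qed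
  with r(1) show ?thesis using that by blast
qed

text \<open>Membership of the limit is part of the conclusion: this is how integrability is gained
  from uniform bounds on mollifications or on test functions.\<close>

lemma Lq_Fatou:
  assumes q: "q > 0" and f: "\<And>k. f k \<in> Lq M q" "\<And>k. nrm M q (f k) \<le> C" and g: "g \<in> borel_measurable M"
    and lim: "AE x in M. (\<lambda>k. f k x) \<longlonglongrightarrow> g x"
  shows "g \<in> Lq M q" "nrm M q g \<le> C"
proof -
  have C: "C \<ge> 0" using f(2)[of 0] nrm_nonneg order_trans by blast
  have "(\<integral>\<^sup>+x. ennreal (\<bar>g x\<bar> powr q) \<partial>M) = (\<integral>\<^sup>+x. liminf (\<lambda>k. ennreal (\<bar>f k x\<bar> powr q)) \<partial>M)"
  proof (rule nn_integral_cong_AE, use lim in eventually_elim)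
    case (elim x)
    have "(\<lambda>k. ennreal (\<bar>f k x\<bar> powr q)) \<longlonglongrightarrow> ennreal (\<bar>g x\<bar> powr q)"
      using q elim by (intro tendsto_ennrealI tendsto_powr' tendsto_rabs tendsto_const) auto
    then show ?case by (rule lim_imp_Liminf[OF sequentially_bot, symmetric])
  qed
  also have "\<dots> \<le> liminf (\<lambda>k. \<integral>\<^sup>+x. ennreal (\<bar>f k x\<bar> powr q) \<partial>M)"
    by (rule nn_integral_liminf) (use LqD[OF f(1)] in auto)
  also have "\<dots> \<le> ennreal (C powr q)"
  proof (rule Liminf_le)
    have "(\<integral>\<^sup>+x. ennreal (\<bar>f k x\<bar> powr q) \<partial>M) \<le> ennreal (C powr q)" for k
      using nn_integral_eq_integral[OF LqD(2)[OF f(1)], of k] f(2)[of k] q C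
      by (simp add: nrm_le_iff ennreal_leI)
    then show "\<forall>\<^sub>F k in sequentially. (\<integral>\<^sup>+x. ennreal (\<bar>f k x\<bar> powr q) \<partial>M) \<le> ennreal (C powr q)" by simp
  qed simp
  finally have *: "(\<integral>\<^sup>+x. ennreal (\<bar>g x\<bar> powr q) \<partial>M) \<le> ennreal (C powr q)" .
  have i: "integrable M (\<lambda>x. \<bar>g x\<bar> powr q)"
    by (rule integrableI_bounded) (use g * in \<open>auto simp: top_unique less_top[symmetric]\<close>)
  then show "g \<in> Lq M q" using g by (simp add: Lq_def)
  have "(LINT x|M. \<bar>g x\<bar> powr q) \<le> C powr q"
    using * nn_integral_eq_integral[OF i] by simp
  then show "nrm M q g \<le> C" using q C by (simp add: nrm_le_iff)
qed

lemma cc_Lq: "cc n f \<Longrightarrow> q > 0 \<Longrightarrow> f \<in> Lq (bor n) q"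
  using cc_integrable[OF cc_powr] ccD borel_measurable_continuous_Rn by (simp add: Lq_def)

lemma nrm_2: "(nrm M 2 f)\<^sup>2 = (LINT x|M. (f x)\<^sup>2)"
  using nrm_powr[of 2 M f] by (simp add: powr_numeral)

section \<open>The inequalities of Loomis--Whitney and Gagliardo--Nirenberg--Sobolev\<close>

text \<open>Concavity of the logarithm, after a vanishing factor has been set aside.\<close>

lemma weighted_AM_GM:
  fixes x w :: "'i \<Rightarrow> real"
  assumes J: "finite J" "J \<noteq> {}" and w: "\<And>j. j \<in> J \<Longrightarrow> w j > 0" "sum w J = 1" and x: "\<And>j. j \<in> J \<Longrightarrow> x j \<ge> 0"
  shows "(\<Prod>j\<in>J. x j powr w j) \<le> (\<Sum>j\<in>J. w j * x j)"
proof (cases "\<exists>j\<in>J. x j = 0")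
  case True
  then have "(\<Prod>j\<in>J. x j powr w j) = 0" using J by auto
  moreover have "(\<Sum>j\<in>J. w j * x j) \<ge> 0" using w x by (intro sum_nonneg mult_nonneg_nonneg) (auto intro: less_imp_le)
  ultimately show ?thesis by simp
next
  case False
  then have xp: "\<And>j. j \<in> J \<Longrightarrow> x j > 0" using x by (metis less_eq_real_def)
  have "ln (\<Sum>j\<in>J. w j *\<^sub>R x j) \<ge> (\<Sum>j\<in>J. w j * ln (x j))"
    by (rule concave_on_sum[OF J ln_concave w(2)]) (use w xp in \<open>auto intro: less_imp_le\<close>)
  moreover have "(\<Sum>j\<in>J. w j * x j) > 0" using J w xp by (intro sum_pos) auto
  moreover have "(\<Prod>j\<in>J. x j powr w j) = exp (\<Sum>j\<in>J. w j * ln (x j))"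
    unfolding exp_sum[OF J(1)]
  proof (rule prod.cong[OF refl])
    fix j assume "j \<in> J" then show "x j powr w j = exp (w j * ln (x j))"
      using xp[of j] by (simp add: powr_def)
  qed
  ultimately show ?thesis by (simp add: ln_ge_iff)
qed

text \<open>In contrast to the usual convention, \<open>epow top 0 = top\<close>.\<close>

definition epow :: "ennreal \<Rightarrow> real \<Rightarrow> ennreal" where
  "epow x a = (if x = top then top else ennreal (enn2real x powr a))"

lemma epow_ennreal: "r \<ge> 0 \<Longrightarrow> epow (ennreal r) a = ennreal (r powr a)"
  by (simp add: epow_def)

lemma epow_top [simp]: "epow top a = top"
  by (simp add: epow_def)

lemma epow_0 [simp]: "epow 0 a = 0"
  by (simp add: epow_def)

lemma epow_1 [simp]: "epow x 1 = x"
  by (cases x) (auto simp: epow_ennreal)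

lemma epow_one [simp]: "epow 1 a = 1"
  using epow_ennreal[of 1 a] by simp

lemma epow_eq_0: "epow x a = 0 \<longleftrightarrow> x = 0"
  by (cases x) (auto simp: epow_ennreal)

lemma epow_mult: "epow (x * y) a = epow x a * epow y a"
proof (cases "x = top \<or> y = top")
  case True
  then show ?thesis by (auto simp: ennreal_top_mult ennreal_mult_top epow_eq_0)
next
  case False
  then obtain r s where "x = ennreal r" "y = ennreal s" "r \<ge> 0" "s \<ge> 0" by (metis ennreal_cases)
  then show ?thesis by (simp add: epow_ennreal powr_mult flip: ennreal_mult')
qed

lemma epow_prod: "epow (\<Prod>i\<in>I. f i) a = (\<Prod>i\<in>I. epow (f i) a)"
  by (induction I rule: infinite_finite_induct) (auto simp: epow_mult)

lemma epow_epow: "epow (epow x a) b = epow x (a * b)"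
  by (cases x) (auto simp: epow_ennreal powr_powr)

lemma epow_add: "epow x (a + b) = epow x a * epow x b"
  by (cases x) (auto simp: epow_ennreal powr_add ennreal_mult)

lemma epow_mono: "x \<le> y \<Longrightarrow> a \<ge> 0 \<Longrightarrow> epow x a \<le> epow y a"
  by (cases x; cases y) (auto simp: epow_ennreal ennreal_leI powr_mono2 top_unique)

lemma epow_prod_const: "finite I \<Longrightarrow> I \<noteq> {} \<Longrightarrow> (\<Prod>i\<in>I. epow x a) = epow x (real (card I) * a)"
proof (induction I rule: finite_ne_induct)
  case (insert i I)
  then show ?case by (simp add: epow_add[symmetric] algebra_simps)
qed simp

lemma measurable_epow [measurable]:
  assumes f [measurable]: "f \<in> borel_measurable M"
  shows "(\<lambda>x. epow (f x) a) \<in> borel_measurable M"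
  unfolding epow_def by measurable

text \<open>After division by the integrals, the pointwise weighted AM-GM inequality integrates to
  the claim. The division is legitimate when all integrals are finite and nonzero: one zero integral
  makes the product vanish almost everywhere, and otherwise an infinite one makes the right-hand
  side \<open>top\<close>.\<close>

lemma nn_Holder:
  assumes J: "finite J" "J \<noteq> {}" and w: "\<And>j. j \<in> J \<Longrightarrow> w j > 0" "sum w J = 1"
    and F: "\<And>j. j \<in> J \<Longrightarrow> F j \<in> borel_measurable M"
  shows "(\<integral>\<^sup>+x. (\<Prod>j\<in>J. epow (F j x) (w j)) \<partial>M) \<le> (\<Prod>j\<in>J. epow (\<integral>\<^sup>+x. F j x \<partial>M) (w j))"
proof -
  define a where "a j = (\<integral>\<^sup>+x. F j x \<partial>M)" for j
  consider j where "j \<in> J" "a j = 0" | "\<And>j. j \<in> J \<Longrightarrow> a j \<noteq> 0" "\<exists>j\<in>J. a j = top"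
    | "\<And>j. j \<in> J \<Longrightarrow> a j \<noteq> 0" "\<And>j. j \<in> J \<Longrightarrow> a j \<noteq> top" by blast
  then show ?thesis
  proof cases
    case 1
    then have "AE x in M. F j x = 0" using nn_integral_0_iff_AE[OF F[OF 1(1)]] by (simp add: a_def)
    then have "AE x in M. (\<Prod>j\<in>J. epow (F j x) (w j)) = 0"
      by eventually_elim (use 1 J in \<open>auto simp: prod_zero_iff epow_eq_0\<close>)
    then have "(\<integral>\<^sup>+x. (\<Prod>j\<in>J. epow (F j x) (w j)) \<partial>M) = (\<integral>\<^sup>+x. 0 \<partial>M)" by (rule nn_integral_cong_AE)
    then show ?thesis by simp
  next
    case 2
    then have "(\<Prod>j\<in>J. epow (a j) (w j)) = top"
      using J by (auto simp: ennreal_prod_eq_top epow_eq_0) (metis epow_top)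
    then show ?thesis by (simp add: a_def)
  next
    case 3
    define \<alpha> where "\<alpha> j = enn2real (a j)" for j
    have \<alpha>: "a j = ennreal (\<alpha> j)" "\<alpha> j > 0" if "j \<in> J" for j
      using 3[OF that] by (auto simp: \<alpha>_def enn2real_positive_iff less_top[symmetric] zero_less_iff_neq_zero)
    have nn: "\<alpha> j \<ge> 0" "w j \<ge> 0" "w j / \<alpha> j \<ge> 0" if "j \<in> J" for j
      using \<alpha>(2)[OF that] w(1)[OF that] by simp_all
    define c where "c = (\<Prod>j\<in>J. \<alpha> j powr w j)"
    have c: "c > 0" unfolding c_def
    proof (rule prod_pos)
      fix j assume "j \<in> J" then show "0 < \<alpha> j powr w j" using \<alpha>(2)[of j] by simp
    qed
    have c': "(\<Prod>j\<in>J. epow (a j) (w j)) = ennreal c"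
      using \<alpha> by (simp add: c_def epow_ennreal less_imp_le prod_ennreal)
    have pt: "(\<Prod>j\<in>J. epow (F j x) (w j)) \<le> ennreal c * (\<Sum>j\<in>J. ennreal (w j / \<alpha> j) * F j x)" for x
    proof (cases "\<exists>j\<in>J. F j x = top")
      case True
      then obtain j where j: "j \<in> J" "F j x = top" by auto
      have "ennreal (w j / \<alpha> j) * F j x = top" using j \<alpha>[OF j(1)] w(1)[OF j(1)] by (simp add: ennreal_mult_top)
      then have "(\<Sum>j\<in>J. ennreal (w j / \<alpha> j) * F j x) = top" using J(1) j(1) member_le_sum[of j J "\<lambda>j. ennreal (w j / \<alpha> j) * F j x"] by (simp add: top_unique)
      then show ?thesis using c by (simp add: ennreal_mult_top)
    next
      case False
      define f where "f j = enn2real (F j x)" for j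
      have f: "F j x = ennreal (f j)" "f j \<ge> 0" if "j \<in> J" for j
        using False that by (auto simp: f_def less_top[symmetric])
      have "(\<Prod>j\<in>J. f j powr w j) = c * (\<Prod>j\<in>J. (f j / \<alpha> j) powr w j)"
        unfolding c_def prod.distrib[symmetric]
      proof (rule prod.cong[OF refl])
        fix j assume "j \<in> J"
        then show "f j powr w j = \<alpha> j powr w j * (f j / \<alpha> j) powr w j"
          using \<alpha>(2)[of j] f(2)[of j] by (simp add: powr_divide)
      qed
      also have "\<dots> \<le> c * (\<Sum>j\<in>J. w j * (f j / \<alpha> j))"
        using c nn f by (intro mult_left_mono weighted_AM_GM J w divide_nonneg_nonneg) auto
      finally have "ennreal (\<Prod>j\<in>J. f j powr w j) \<le> ennreal (c * (\<Sum>j\<in>J. w j / \<alpha> j * f j))"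
        by (intro ennreal_leI) simp
      moreover have "(\<Prod>j\<in>J. epow (F j x) (w j)) = ennreal (\<Prod>j\<in>J. f j powr w j)"
        using f by (simp add: epow_ennreal prod_ennreal)
      moreover have "(\<Sum>j\<in>J. ennreal (w j / \<alpha> j) * F j x) = ennreal (\<Sum>j\<in>J. w j / \<alpha> j * f j)"
      proof -
        have "(\<Sum>j\<in>J. ennreal (w j / \<alpha> j) * F j x) = (\<Sum>j\<in>J. ennreal (w j / \<alpha> j * f j))"
          using f nn by (intro sum.cong refl) (simp add: ennreal_mult del: times_divide_eq_left)
        also have "\<dots> = ennreal (\<Sum>j\<in>J. w j / \<alpha> j * f j)"
          using f nn by (intro sum_ennreal mult_nonneg_nonneg) auto
        finally show ?thesis .
      qed
      ultimately show ?thesis using c by (simp add: ennreal_mult')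
    qed
    have "(\<integral>\<^sup>+x. (\<Prod>j\<in>J. epow (F j x) (w j)) \<partial>M) \<le> (\<integral>\<^sup>+x. ennreal c * (\<Sum>j\<in>J. ennreal (w j / \<alpha> j) * F j x) \<partial>M)"
      by (rule nn_integral_mono) (rule pt)
    also have "\<dots> = ennreal c * (\<Sum>j\<in>J. ennreal (w j / \<alpha> j) * a j)"
      using F by (simp add: nn_integral_cmult nn_integral_sum a_def)
    also have "(\<Sum>j\<in>J. ennreal (w j / \<alpha> j) * a j) = (\<Sum>j\<in>J. ennreal (w j))"
    proof (rule sum.cong[OF refl])
      fix j assume "j \<in> J"
      then show "ennreal (w j / \<alpha> j) * a j = ennreal (w j)"
        using \<alpha>[of j] nn[of j] by (simp add: ennreal_mult[symmetric])
    qed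
    also have "\<dots> = 1" using w(2) nn by (subst sum_ennreal) auto
    finally show ?thesis using c' by (simp add: a_def)
  qed
qed

text \<open>Induction on the number of coordinates. For a frozen value t of coordinate k, Hoelder
  with weights 1/m and (m - 1)/m splits off \<open>g k\<close>, which does not see t, from the
  remaining product, to which the induction hypothesis applies on the slice. Hoelder with m equal
  weights then integrates over t.\<close>

lemma Loomis_Whitney:
  fixes I :: "nat set"
  assumes "finite I" "card I \<ge> 2"
    and "\<And>i. i \<in> I \<Longrightarrow> g i \<in> borel_measurable (\<Pi>\<^sub>M j\<in>I - {i}. lborel :: real measure)"
  shows "(\<integral>\<^sup>+x. (\<Prod>i\<in>I. epow (g i (restrict x (I - {i}))) (1 / (real (card I) - 1))) \<partial>(\<Pi>\<^sub>M j\<in>I. lborel))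
    \<le> (\<Prod>i\<in>I. epow (\<integral>\<^sup>+x. g i x \<partial>(\<Pi>\<^sub>M j\<in>I - {i}. lborel)) (1 / (real (card I) - 1)))"
  using assms
proof (induction I arbitrary: g rule: finite_induct)
  case empty
  then show ?case by simp
next
  case (insert k J)
  note [measurable] = insert.prems(2)
  define m where "m = card J"
  have cI: "real (card (insert k J)) - 1 = real m" using insert by (simp add: m_def)
  have m1: "m \<ge> 1" using insert by (simp add: m_def)
  have Jne: "J \<noteq> {}" using m1 by (auto simp: m_def)
  have gk: "g k \<in> borel_measurable (\<Pi>\<^sub>M j\<in>J. lborel)" using insert.prems(2)[of k] insert.hyps by simp
  have sets_eq: "insert k J - {i} = insert k (J - {i})" if "i \<in> J" for i using that insert.hyps by auto
  define h where "h t i y = g i (y(k := t))" for t i and y :: "nat \<Rightarrow> real"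
  have h_meas: "(\<lambda>(y, t). h t i y) \<in> borel_measurable ((\<Pi>\<^sub>M j\<in>J - {i}. lborel) \<Otimes>\<^sub>M lborel)" if "i \<in> J" for i
  proof -
    have "g i \<in> borel_measurable (\<Pi>\<^sub>M j\<in>insert k (J - {i}). lborel)"
      using insert.prems(2)[of i] sets_eq[OF that] that by simp
    from measurable_compose[OF measurable_add_dim[of k "J - {i}" "\<lambda>_. lborel"] this]
    show ?thesis by (simp add: h_def case_prod_unfold)
  qed
  have h_meas1: "h t i \<in> borel_measurable (\<Pi>\<^sub>M j\<in>J - {i}. lborel)" if "i \<in> J" for i t
    using measurable_compose[OF _ h_meas[OF that], of "\<lambda>y. (y, t)"] by simp
  define G where "G i t = (\<integral>\<^sup>+y. h t i y \<partial>(\<Pi>\<^sub>M j\<in>J - {i}. lborel))" for i t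
  have G_meas: "G i \<in> borel_measurable lborel" if "i \<in> J" for i
  proof -
    interpret s: sigma_finite_measure "\<Pi>\<^sub>M j\<in>J - {i}. lborel :: real measure" using insert by (intro sigma_finite_bor) auto
    have "(\<lambda>(t, y). h t i y) \<in> borel_measurable (lborel \<Otimes>\<^sub>M (\<Pi>\<^sub>M j\<in>J - {i}. lborel))"
      using h_meas[OF that] by (subst measurable_pair_swap_iff) (simp add: case_prod_unfold)
    then show ?thesis unfolding G_def[abs_def] by (rule s.borel_measurable_nn_integral)
  qed
  have G_int: "(\<integral>\<^sup>+t. G i t \<partial>lborel) = (\<integral>\<^sup>+x. g i x \<partial>(\<Pi>\<^sub>M j\<in>insert k J - {i}. lborel))" if "i \<in> J" for i
    unfolding sets_eq[OF that] G_def h_def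
    by (rule lbs.product_nn_integral_insert_rev[symmetric])
       (use insert that insert.prems(2)[of i] sets_eq[OF that] in auto)
  define A where "A = (\<integral>\<^sup>+x. g k x \<partial>(\<Pi>\<^sub>M j\<in>J. lborel))"
  have slice: "(\<integral>\<^sup>+x. (\<Prod>i\<in>insert k J. epow (g i (restrict (x(k := t)) (insert k J - {i}))) (1 / real m)) \<partial>(\<Pi>\<^sub>M j\<in>J. lborel))
      \<le> epow A (1 / real m) * (\<Prod>i\<in>J. epow (G i t) (1 / real m))" for t
  proof -
    have eq: "(\<Prod>i\<in>insert k J. epow (g i (restrict (x(k := t)) (insert k J - {i}))) (1 / real m))
       = epow (g k x) (1 / real m) * (\<Prod>i\<in>J. epow (h t i (restrict x (J - {i}))) (1 / real m))"
      if x: "x \<in> space (\<Pi>\<^sub>M j\<in>J. lborel)" for x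
    proof -
      have 1: "restrict (x(k := t)) (insert k J - {k}) = x"
        using x insert.hyps by (auto simp: space_PiM PiE_iff extensional_def fun_eq_iff restrict_def)
      have 2: "restrict (x(k := t)) (insert k J - {i}) = (restrict x (J - {i}))(k := t)" if "i \<in> J" for i
        using insert.hyps that by (auto simp: fun_eq_iff restrict_def)
      show ?thesis unfolding prod.insert[OF insert.hyps] 1 h_def
        by (rule arg_cong2[where f = "(*)", OF refl], rule prod.cong) (use 2 in auto)
    qed
    have le: "(\<integral>\<^sup>+x. (\<Prod>i\<in>insert k J. epow (g i (restrict (x(k := t)) (insert k J - {i}))) (1 / real m)) \<partial>(\<Pi>\<^sub>M j\<in>J. lborel))
      = (\<integral>\<^sup>+x. epow (g k x) (1 / real m) * (\<Prod>i\<in>J. epow (h t i (restrict x (J - {i}))) (1 / real m)) \<partial>(\<Pi>\<^sub>M j\<in>J. lborel))"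
      by (rule nn_integral_cong) (rule eq)
    show ?thesis
    \<comment> \<open>A slice with a single coordinate is below the reach of the induction
      hypothesis. There the other factor is constant on the slice and the bound is an
      equality.\<close>
    proof (cases "m = 1")
      case True
      then obtain i where J: "J = {i}" by (auto simp: m_def card_1_singleton_iff)
      have r: "restrict x {} = (\<lambda>_. undefined)" for x :: "nat \<Rightarrow> real" by (simp add: restrict_def)
      have "G i t = h t i (\<lambda>_. undefined)"
        unfolding G_def J by (simp add: lbs.nn_integral_empty)
      then show ?thesis unfolding le unfolding True using gk
        by (simp add: J r A_def nn_integral_multc)
    next
      case False
      with m1 have m2: "m \<ge> 2" by simp
      define H where "H x = (\<Prod>i\<in>J. epow (h t i (restrict x (J - {i}))) (1 / (real m - 1)))" for x
      have rm: "(\<lambda>x. h t i (restrict x (J - {i}))) \<in> borel_measurable (\<Pi>\<^sub>M j\<in>J. lborel)" if "i \<in> J" for i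
        by (rule measurable_compose[OF measurable_restrict_subset h_meas1[OF that]]) auto
      have H_meas: "H \<in> borel_measurable (\<Pi>\<^sub>M j\<in>J. lborel)"
        unfolding H_def[abs_def] using rm by (intro borel_measurable_prod_ennreal measurable_epow) auto
      have e: "1 / (real m - 1) * ((real m - 1) / real m) = 1 / real m" using m2 by simp
      define w where "w b = (if b then 1 / real m else (real m - 1) / real m)" for b
      have "(\<integral>\<^sup>+x. epow (g k x) (1 / real m) * (\<Prod>i\<in>J. epow (h t i (restrict x (J - {i}))) (1 / real m)) \<partial>(\<Pi>\<^sub>M j\<in>J. lborel))
         = (\<integral>\<^sup>+x. (\<Prod>b\<in>{True, False}. epow (if b then g k x else H x) (w b)) \<partial>(\<Pi>\<^sub>M j\<in>J. lborel))"
        using m2 by (simp add: w_def H_def epow_prod epow_epow)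
      also have "\<dots> \<le> (\<Prod>b\<in>{True, False}. epow (\<integral>\<^sup>+x. (if b then g k x else H x) \<partial>(\<Pi>\<^sub>M j\<in>J. lborel)) (w b))"
        by (rule nn_Holder) (use gk H_meas m2 in \<open>auto simp: w_def field_simps\<close>)
      also have "\<dots> = epow A (1 / real m) * epow (\<integral>\<^sup>+x. H x \<partial>(\<Pi>\<^sub>M j\<in>J. lborel)) ((real m - 1) / real m)"
        by (simp add: w_def A_def)
      also have "\<dots> \<le> epow A (1 / real m) * epow (\<Prod>i\<in>J. epow (G i t) (1 / (real m - 1))) ((real m - 1) / real m)"
      proof -
        have "(\<integral>\<^sup>+x. H x \<partial>(\<Pi>\<^sub>M j\<in>J. lborel)) \<le> (\<Prod>i\<in>J. epow (G i t) (1 / (real m - 1)))"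
          unfolding H_def m_def G_def by (rule insert.IH) (use m2 h_meas1 in \<open>auto simp: m_def\<close>)
        then show ?thesis using m2 by (intro mult_left_mono epow_mono) auto
      qed
      also have "\<dots> = epow A (1 / real m) * (\<Prod>i\<in>J. epow (G i t) (1 / real m))"
        using m2 by (simp add: epow_prod epow_epow)
      finally show ?thesis unfolding le .
    qed
  qed
  have int_meas: "(\<lambda>x. \<Prod>i\<in>insert k J. epow (g i (restrict x (insert k J - {i}))) (1 / real m)) \<in> borel_measurable (\<Pi>\<^sub>M j\<in>insert k J. lborel)"
  proof (intro borel_measurable_prod_ennreal measurable_epow)
    fix i assume i: "i \<in> insert k J"
    show "(\<lambda>x. g i (restrict x (insert k J - {i}))) \<in> borel_measurable (\<Pi>\<^sub>M j\<in>insert k J. lborel)"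
      by (rule measurable_compose[OF measurable_restrict_subset insert.prems(2)[OF i]]) auto
  qed
  have "(\<integral>\<^sup>+x. (\<Prod>i\<in>insert k J. epow (g i (restrict x (insert k J - {i}))) (1 / real m)) \<partial>(\<Pi>\<^sub>M j\<in>insert k J. lborel))
    = (\<integral>\<^sup>+t. (\<integral>\<^sup>+x. (\<Prod>i\<in>insert k J. epow (g i (restrict (x(k := t)) (insert k J - {i}))) (1 / real m)) \<partial>(\<Pi>\<^sub>M j\<in>J. lborel)) \<partial>lborel)"
    by (rule lbs.product_nn_integral_insert_rev[OF insert.hyps int_meas])
  also have "\<dots> \<le> (\<integral>\<^sup>+t. epow A (1 / real m) * (\<Prod>i\<in>J. epow (G i t) (1 / real m)) \<partial>lborel)"
    by (rule nn_integral_mono) (rule slice)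
  also have "\<dots> = epow A (1 / real m) * (\<integral>\<^sup>+t. (\<Prod>i\<in>J. epow (G i t) (1 / real m)) \<partial>lborel)"
    using G_meas by (intro nn_integral_cmult borel_measurable_prod_ennreal measurable_epow) auto
  also have "\<dots> \<le> epow A (1 / real m) * (\<Prod>i\<in>J. epow (\<integral>\<^sup>+t. G i t \<partial>lborel) (1 / real m))"
    using m1 insert.hyps Jne G_meas by (intro mult_left_mono nn_Holder) (auto simp: m_def)
  also have "\<dots> = (\<Prod>i\<in>insert k J. epow (\<integral>\<^sup>+x. g i x \<partial>(\<Pi>\<^sub>M j\<in>insert k J - {i}. lborel)) (1 / real m))"
    unfolding prod.insert[OF insert.hyps] using insert.hyps by (simp add: G_int A_def cong: prod.cong)
  finally show ?case unfolding cI .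
qed

text \<open>The form s |s|^(c-2) covers both signs at once and is visibly continuous for c > 2, as
  the fundamental theorem of calculus requires later. At 0 the difference quotient has size
  |h|^(c-1).\<close>

lemma abs_powr_deriv:
  fixes s c :: real
  assumes c: "c > 2"
  shows "((\<lambda>s. \<bar>s\<bar> powr c) has_real_derivative c * (s * \<bar>s\<bar> powr (c - 2))) (at s)"
proof -
  consider "s > 0" | "s < 0" | "s = 0" by linarith
  then show ?thesis
  proof cases
    case 1
    have "((\<lambda>s. s powr c) has_real_derivative c * s powr (c - 1)) (at s)"
      using has_real_derivative_powr[OF 1, of c] by simp
    moreover have "c * s powr (c - 1) = c * (s * \<bar>s\<bar> powr (c - 2))"
      using 1 powr_add[of s 1 "c - 2"] by simp
    moreover have "\<forall>\<^sub>F t in nhds s. \<bar>t\<bar> powr c = t powr c"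
      using eventually_nhds_in_open[of "{0<..}" s] 1 by (auto elim!: eventually_mono)
    ultimately show ?thesis using DERIV_cong_ev[of s s "\<lambda>s. \<bar>s\<bar> powr c" "\<lambda>s. s powr c"] by simp
  next
    case 2
    have "((\<lambda>s. (- s) powr c) has_real_derivative c * (- s) powr (c - 1) * (- 1)) (at s)"
      by (rule DERIV_chain2[OF has_real_derivative_powr]) (use 2 in \<open>auto intro!: derivative_eq_intros\<close>)
    moreover have "c * (- s) powr (c - 1) * (- 1) = c * (s * \<bar>s\<bar> powr (c - 2))"
      using 2 powr_add[of "- s" 1 "c - 2"] by simp
    moreover have "\<forall>\<^sub>F t in nhds s. \<bar>t\<bar> powr c = (- t) powr c"
      using eventually_nhds_in_open[of "{..<0}" s] 2 by (auto elim!: eventually_mono)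
    ultimately show ?thesis using DERIV_cong_ev[of s s "\<lambda>s. \<bar>s\<bar> powr c" "\<lambda>s. (- s) powr c"] by simp
  next
    case 3
    have "((\<lambda>h. \<bar>h\<bar> powr c / h) \<longlongrightarrow> 0) (at 0)"
    proof (rule Lim_null_comparison)
      show "\<forall>\<^sub>F h in at 0. norm (\<bar>h\<bar> powr c / h) \<le> \<bar>h\<bar> powr (c - 1)"
      proof (rule eventually_at_filter[THEN iffD2], rule always_eventually, intro allI impI)
        fix h :: real assume "h \<noteq> 0"
        then show "norm (\<bar>h\<bar> powr c / h) \<le> \<bar>h\<bar> powr (c - 1)"
          by (simp add: powr_diff abs_divide)
      qed
      show "((\<lambda>h. \<bar>h\<bar> powr (c - 1)) \<longlongrightarrow> 0) (at (0::real))"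
        using c tendsto_powr'[OF tendsto_rabs[OF tendsto_ident_at] tendsto_const, of 0 "c - 1" UNIV] by simp
    qed
    then show ?thesis by (simp add: 3 DERIV_def)
  qed
qed

definition gradn :: "nat \<Rightarrow> ((nat \<Rightarrow> real) \<Rightarrow> real) \<Rightarrow> (nat \<Rightarrow> real) \<Rightarrow> real" where
  "gradn n f x = sqrt (\<Sum>i<n. (partial i f x)\<^sup>2)"

lemma gradn_nonneg [simp]: "gradn n f x \<ge> 0"
  by (simp add: gradn_def sum_nonneg)

lemma gradn_sq: "(gradn n f x)\<^sup>2 = (\<Sum>i<n. (partial i f x)\<^sup>2)"
  by (simp add: gradn_def sum_nonneg)

lemma partial_le_gradn: "i < n \<Longrightarrow> \<bar>partial i f x\<bar> \<le> gradn n f x"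
  unfolding gradn_def by (rule real_le_rsqrt) (auto intro!: member_le_sum)

lemma continuous_gradn: "smooth n f \<Longrightarrow> continuous_map (top_Rn n) euclideanreal (gradn n f)"
  unfolding gradn_def[abs_def]
  by (intro continuous_comp_real[where h = sqrt] continuous_map_sum continuous_map_real_pow smooth_continuous smooth_partial)
     (auto intro: continuous_intros)

lemma cc_gradn: assumes "f \<in> test_fun n (Rn n)" shows "cc n (gradn n f)"
proof -
  have "cc n (\<lambda>x. \<Sum>i<n. (partial i f x)\<^sup>2)"
    by (intro cc_sum cc_power2 test_fun_cc[OF test_fun_partial[OF assms]]) auto
  from cc_comp[OF this, of sqrt] show ?thesis
    by (simp add: gradn_def[abs_def] continuous_on_real_sqrt)
qed

text \<open>On each of the n coordinate lines through x, |w|^c is at most the integral of the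
  absolute value of its derivative. Hence |w|^(n c / (n - 1)) is at most a product of powers of n
  functions, each independent of one coordinate, and \<open>Loomis_Whitney\<close> applies.
  Cauchy-Schwarz then separates the gradient, and a power of the integral of |w|^p' is
  cancelled.\<close>

lemma Gagliardo_Nirenberg_Sobolev:
  assumes n: "n \<ge> 3" and w: "w \<in> test_fun n (Rn n)"
  shows "nrm (bor n) (exp_p' n) w \<le> 2 * (real n - 1) / (real n - 2) * nrm (bor n) 2 (gradn n w)"
proof -
  \<comment> \<open>This c satisfies n c / (n - 1) = p' as well as 2 (c - 1) = p', so that the same
    integral of |w|^p' appears on both sides.\<close>
  define c where "c = 2 * (real n - 1) / (real n - 2)"
  have c: "c > 2" using n by (simp add: c_def field_simps)
  have sm: "smooth n w" by (rule test_fun_smooth[OF w])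
  define D where "D x = c * (\<bar>w x\<bar> powr (c - 1) * gradn n w x)" for x
  have Dcc: "cc n D" unfolding D_def[abs_def]
    using c by (intro cc_cmult cc_mult' cc_gradn[OF w] ccD cc_powr test_fun_cc[OF w]) auto
  have D0: "D x \<ge> 0" for x using c by (simp add: D_def)
  have Dm: "(\<lambda>x. ennreal (D x)) \<in> borel_measurable (bor n)"
    using borel_measurable_continuous_Rn[OF ccD[OF Dcc]] by simp
  obtain R where R: "\<And>x. x \<in> Rn n \<Longrightarrow> dist_n n (origin n) x > R \<Longrightarrow> w x = 0"
    using test_fun_cc[OF w] by (auto simp: cc_def)
  define g where "g i y = (\<integral>\<^sup>+t. ennreal (D (y(i := t))) \<partial>lborel)" for i and y :: "nat \<Rightarrow> real"
  have ins: "{..<n} = insert i ({..<n} - {i})" if "i < n" for i using that by auto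
  have pm: "(\<lambda>(y, t). ennreal (D (y(i := t)))) \<in> borel_measurable ((\<Pi>\<^sub>M j\<in>{..<n} - {i}. lborel) \<Otimes>\<^sub>M lborel)" if "i < n" for i
    using measurable_compose[OF measurable_add_dim[of i "{..<n} - {i}" "\<lambda>_. lborel"], of "\<lambda>x. ennreal (D x)" borel] Dm ins[OF that]
    by (simp add: case_prod_unfold)
  have gm: "g i \<in> borel_measurable (\<Pi>\<^sub>M j\<in>{..<n} - {i}. lborel)" if "i < n" for i
    unfolding g_def[abs_def] by (rule lborel.borel_measurable_nn_integral[OF pm[OF that]])
  have gi: "(\<integral>\<^sup>+y. g i y \<partial>(\<Pi>\<^sub>M j\<in>{..<n} - {i}. lborel)) = (\<integral>\<^sup>+x. ennreal (D x) \<partial>bor n)" if "i < n" for i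
    using lbs.product_nn_integral_insert[of "{..<n} - {i}" i "\<lambda>x. ennreal (D x)"] Dm ins[OF that] by (simp add: g_def)
  have bound: "ennreal (\<bar>w x\<bar> powr c) \<le> g i (restrict x ({..<n} - {i}))" if x: "x \<in> Rn n" and i: "i < n" for x i
  proof -
    have up: "(restrict x ({..<n} - {i}))(i := t) = x(i := t)" for t
      using x i by (auto simp: fun_eq_iff restrict_def Rn_def PiE_iff extensional_def simp del: PiE_UNIV_Rn)
    define \<phi> where "\<phi> t = w (x(i := t))" for t
    define \<phi>' where "\<phi>' t = partial i w (x(i := t))" for t
    have d\<phi>: "(\<phi> has_real_derivative \<phi>' t) (at t)" for t
      unfolding \<phi>_def[abs_def] \<phi>'_def by (rule smooth_DERIV'[OF sm i x])
    have c\<phi>': "continuous_on UNIV \<phi>'"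
      using continuous_map_compose[OF continuous_fun_upd[OF i x] smooth_continuous[OF smooth_partial[OF sm i]]]
      by (simp add: o_def \<phi>'_def[abs_def])
    have c\<phi>: "continuous_on UNIV \<phi>" by (rule DERIV_continuous_on) (use d\<phi> in simp)
    define \<psi> where "\<psi> t = c * (\<phi> t * \<bar>\<phi> t\<bar> powr (c - 2)) * \<phi>' t" for t
    have d\<psi>: "((\<lambda>t. \<bar>\<phi> t\<bar> powr c) has_real_derivative \<psi> t) (at t)" for t
      unfolding \<psi>_def by (rule DERIV_chain2[OF abs_powr_deriv[OF c] d\<phi>])
    have c\<psi>: "continuous_on UNIV \<psi>"
      unfolding \<psi>_def[abs_def] using c
      by (intro continuous_on_mult continuous_on_const c\<phi> c\<phi>' continuous_on_powr' continuous_on_rabs) auto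
    \<comment> \<open>Beyond R, so that the lower boundary value vanishes, and beyond |x i|, so that
      the interval from -S to \<open>x i\<close> is not empty.\<close>
    define S where "S = max \<bar>R\<bar> \<bar>x i\<bar> + 1"
    have "dist_n n (origin n) (x(i := - S)) \<ge> \<bar>- S\<bar>"
      using coord_le_dist_n[OF i, of "origin n" "x(i := - S)"] i by (simp add: origin_def)
    then have z: "\<phi> (- S) = 0" unfolding \<phi>_def by (intro R Rn_fun_upd i x) (auto simp: S_def)
    have le: "- S \<le> x i" by (auto simp: S_def)
    have "\<bar>w x\<bar> powr c = (LINT t|lborel. \<psi> t * indicator {-S..x i} t)"
      using integral_FTC_Icc_real[OF le, of "\<lambda>t. \<bar>\<phi> t\<bar> powr c" \<psi>] d\<psi> c\<psi> z
      by (simp add: \<phi>_def continuous_on_eq_continuous_at)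
    also have "\<dots> = (LINT t|lborel. indicator {-S..x i} t *\<^sub>R \<psi> t)" by (simp add: mult.commute)
    finally have eq: "\<bar>w x\<bar> powr c = (LINT t|lborel. indicator {-S..x i} t *\<^sub>R \<psi> t)" .
    have int: "integrable lborel (\<lambda>t. indicator {-S..x i} t *\<^sub>R \<psi> t)"
      using borel_integrable_compact[of "{-S..x i}" \<psi>] continuous_on_subset[OF c\<psi>] by (auto simp: set_integrable_def)
    have "ennreal (\<bar>w x\<bar> powr c) \<le> ennreal (LINT t|lborel. norm (indicator {-S..x i} t *\<^sub>R \<psi> t))"
      unfolding eq
      by (rule ennreal_leI, rule order_trans[OF abs_ge_self])
         (use integral_norm_bound[of lborel "\<lambda>t. indicator {-S..x i} t *\<^sub>R \<psi> t"] in \<open>simp only: real_norm_def\<close>)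
    also have "\<dots> = (\<integral>\<^sup>+t. ennreal (norm (indicator {-S..x i} t *\<^sub>R \<psi> t)) \<partial>lborel)"
      by (rule nn_integral_eq_integral[symmetric]) (use integrable_norm[OF int] in auto)
    also have "\<dots> \<le> (\<integral>\<^sup>+t. ennreal (D (x(i := t))) \<partial>lborel)"
    proof (intro nn_integral_mono ennreal_leI)
      fix t
      have "\<bar>\<phi> t\<bar> * \<bar>\<phi> t\<bar> powr (c - 2) = \<bar>\<phi> t\<bar> powr (c - 1)"
      proof (cases "\<phi> t = 0")
        case False
        then show ?thesis using powr_add[of "\<bar>\<phi> t\<bar>" 1 "c - 2"] by simp
      qed auto
      then have "\<bar>\<psi> t\<bar> = c * (\<bar>\<phi> t\<bar> powr (c - 1) * \<bar>\<phi>' t\<bar>)"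
        using c by (simp add: \<psi>_def abs_mult)
      also have "\<dots> \<le> D (x(i := t))"
        unfolding D_def \<phi>_def \<phi>'_def using c partial_le_gradn[OF i] by (intro mult_left_mono) auto
      finally show "norm (indicator {-S..x i} t *\<^sub>R \<psi> t) \<le> D (x(i := t))"
        using D0 by (auto simp: indicator_def)
    qed
    finally show ?thesis by (simp add: g_def up)
  qed
  define e where "e = 1 / (real n - 1)"
  have e: "e > 0" using n by (simp add: e_def)
  have "0 \<in> {..<n}" using n by simp
  then have ne: "{..<n} \<noteq> {}" by blast
  define A where "A = (LINT x|bor n. \<bar>w x\<bar> powr exp_p' n)"
  have p': "exp_p' n > 0" using n by (simp add: exp_p'_def)
  have intA: "integrable (bor n) (\<lambda>x. \<bar>w x\<bar> powr exp_p' n)" by (intro cc_integrable cc_powr test_fun_cc[OF w] p')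
  have ce: "c * (real n * e) = exp_p' n"
  proof -
    have *: "2 * b / d * (m * (1 / b)) = 2 * m / d" if "b \<noteq> 0" for b d m :: real using that by simp
    show ?thesis unfolding c_def e_def exp_p'_def by (rule *) (use n in simp)
  qed
  have "ennreal A = (\<integral>\<^sup>+x. ennreal (\<bar>w x\<bar> powr exp_p' n) \<partial>bor n)"
    unfolding A_def by (rule nn_integral_eq_integral[symmetric, OF intA]) simp
  also have "\<dots> = (\<integral>\<^sup>+x. (\<Prod>i<n. epow (ennreal (\<bar>w x\<bar> powr c)) e) \<partial>bor n)"
    by (subst epow_prod_const[OF finite_lessThan ne]) (simp add: epow_ennreal powr_powr ce)
  also have "\<dots> \<le> (\<integral>\<^sup>+x. (\<Prod>i<n. epow (g i (restrict x ({..<n} - {i}))) e) \<partial>bor n)"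
    using e by (intro nn_integral_mono prod_mono_ennreal epow_mono bound) (auto simp: space_bor)
  also have "\<dots> \<le> (\<Prod>i<n. epow (\<integral>\<^sup>+y. g i y \<partial>(\<Pi>\<^sub>M j\<in>{..<n} - {i}. lborel)) e)"
    using Loomis_Whitney[of "{..<n}" g] gm n by (simp add: e_def)
  also have "\<dots> = epow (\<integral>\<^sup>+x. ennreal (D x) \<partial>bor n) (real n * e)"
    using epow_prod_const[OF finite_lessThan ne, of "\<integral>\<^sup>+x. ennreal (D x) \<partial>bor n" e] by (simp add: gi)
  also have "(\<integral>\<^sup>+x. ennreal (D x) \<partial>bor n) = ennreal (LINT x|bor n. D x)"
    by (rule nn_integral_eq_integral[OF cc_integrable[OF Dcc]]) (simp add: D0)
  finally have A1: "A \<le> (LINT x|bor n. D x) powr (real n * e)"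
    using D0 by (simp add: epow_ennreal Bochner_Integration.integral_nonneg)
  define G where "G = nrm (bor n) 2 (gradn n w)"
  have A0: "A \<ge> 0" unfolding A_def by (rule Bochner_Integration.integral_nonneg) simp
  have "(LINT x|bor n. D x) \<le> c * (sqrt A * G)"
  proof -
    have L: "(\<lambda>x. \<bar>w x\<bar> powr (c - 1)) \<in> Lq (bor n) 2" "gradn n w \<in> Lq (bor n) 2"
      using c by (auto intro!: cc_Lq cc_gradn w cc_powr test_fun_cc[OF w])
    have "nrm (bor n) 2 (\<lambda>x. \<bar>w x\<bar> powr (c - 1)) = A powr (1 / 2)"
    proof -
      have "(c - 1) * 2 = exp_p' n" using n by (simp add: c_def exp_p'_def field_simps)
      then show ?thesis by (simp add: nrm_def A_def powr_powr)
    qed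
    then have "(LINT x|bor n. \<bar>\<bar>w x\<bar> powr (c - 1) * gradn n w x\<bar>) \<le> sqrt A * G"
      using Holder(2)[OF _ _ _ L] A0 by (simp add: G_def powr_half_sqrt)
    then show ?thesis using c by (simp add: D_def abs_mult)
  qed
  then have A2: "A \<le> (c * (sqrt A * G)) powr (real n * e)"
    using e by (intro order_trans[OF A1] powr_mono2) (auto intro!: Bochner_Integration.integral_nonneg D0)
  \<comment> \<open>Taking the (n - 1) / n power of \<open>A2\<close> and dividing by the square
    root of A leaves the exponent (n - 1) / n - 1/2 = 1 / p' on A.\<close>
  have "A powr (1 / exp_p' n) \<le> c * G"
  proof (cases "A = 0")
    case True
    then show ?thesis using c by (simp add: G_def)
  next
    case False
    then have Ap: "A > 0" using A0 by simp
    have "A powr (1 / (real n * e)) \<le> ((c * (sqrt A * G)) powr (real n * e)) powr (1 / (real n * e))"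
      using A2 Ap e by (intro powr_mono2) auto
    also have "\<dots> = c * (sqrt A * G)"
      using e n c Ap by (simp add: powr_powr G_def)
    finally have "A powr (1 / (real n * e)) * A powr (- (1 / 2)) \<le> c * (sqrt A * G) * A powr (- (1 / 2))"
      by (rule mult_right_mono) simp
    also have "c * (sqrt A * G) * A powr (- (1 / 2)) = c * G"
      using Ap by (simp add: powr_minus powr_half_sqrt)
    also have "A powr (1 / (real n * e)) * A powr (- (1 / 2)) = A powr (1 / exp_p' n)"
    proof -
      have "1 / (real n * e) + - (1 / 2) = 1 / exp_p' n" using n by (simp add: e_def exp_p'_def field_simps)
      then show ?thesis by (simp flip: powr_add)
    qed
    finally show ?thesis .
  qed
  then show ?thesis by (simp add: nrm_def A_def G_def c_def)
qed

section \<open>Mollification\<close>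

text \<open>One factor \<open>Suc k\<close> normalises the mass, and each of the j derivatives of
  the rescaled bump contributes another; the support lies in [-1/(k+1), 1/(k+1)].\<close>

definition mol :: "nat \<Rightarrow> nat \<Rightarrow> real \<Rightarrow> real" where
  "mol k j t = real (Suc k) ^ Suc j * bump j (real (Suc k) * t)"

lemma mol_deriv: "(mol k j has_real_derivative mol k (Suc j) t) (at t)"
proof -
  have "((\<lambda>t. real (Suc k) ^ Suc j * bump j (real (Suc k) * t)) has_real_derivative
     real (Suc k) ^ Suc j * (bump (Suc j) (real (Suc k) * t) * real (Suc k))) (at t)"
    by (intro DERIV_cmult DERIV_chain2[OF bump_deriv]) (auto intro!: derivative_eq_intros)
  then show ?thesis by (simp add: mol_def[abs_def] mult_ac)
qed

lemma mol_outside: "\<bar>t\<bar> \<ge> 1 / real (Suc k) \<Longrightarrow> mol k j t = 0"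
proof -
  assume "\<bar>t\<bar> \<ge> 1 / real (Suc k)"
  then have "\<bar>real (Suc k) * t\<bar> \<ge> 1" by (simp add: abs_mult field_simps)
  then show ?thesis by (simp add: mol_def bump_outside)
qed

lemma mol_nonneg: "mol k 0 t \<ge> 0"
  by (simp add: mol_def bump_nonneg)

lemma mol_bounded: "\<exists>C. \<forall>t. \<bar>mol k j t\<bar> \<le> C"
proof -
  obtain C where "\<And>t. \<bar>bump j t\<bar> \<le> C" using bump_bounded by blast
  then have "\<bar>mol k j t\<bar> \<le> real (Suc k) ^ Suc j * C" for t
    unfolding mol_def abs_mult by (intro mult_mono) auto
  then show ?thesis by blast
qed

lemma mol_measurable [measurable]: "mol k j \<in> borel_measurable borel"
proof (rule borel_measurable_continuous_onI)
  show "continuous_on UNIV (mol k j)"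
    by (rule DERIV_continuous_on[where D = "mol k (Suc j)"]) (use mol_deriv in simp)
qed

lemma nn_integral_bump: "(\<integral>\<^sup>+t. ennreal (bump 0 t) \<partial>lborel) = 1"
proof -
  have "(bump 0 has_integral 1) UNIV"
    by (rule has_integral_on_superset[OF bump_integral]) (auto intro!: bump_outside)
  from nn_integral_has_integral_lborel[OF _ bump_nonneg this] show ?thesis
    using borel_measurable_continuous_onI[OF bump_continuous] by simp
qed

lemma nn_integral_mol: "(\<integral>\<^sup>+t. ennreal (mol k 0 (t - s)) \<partial>lborel) = 1"
proof -
  let ?c = "real (Suc k)"
  have "(\<integral>\<^sup>+t. ennreal (bump 0 t) \<partial>lborel) = ?c * (\<integral>\<^sup>+t. ennreal (bump 0 (- ?c * s + ?c * t)) \<partial>lborel)"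
    using nn_integral_real_affine[of "\<lambda>t. ennreal (bump 0 t)" ?c "- ?c * s"] borel_measurable_continuous_onI[OF bump_continuous] by simp
  also have "\<dots> = (\<integral>\<^sup>+t. ennreal ?c * ennreal (bump 0 (- ?c * s + ?c * t)) \<partial>lborel)"
    using borel_measurable_continuous_onI[OF bump_continuous]
    by (intro nn_integral_cmult[symmetric]) simp
  also have "\<dots> = (\<integral>\<^sup>+t. ennreal (mol k 0 (t - s)) \<partial>lborel)"
  proof (rule nn_integral_cong)
    fix t
    have "mol k 0 (t - s) = ?c * bump 0 (- ?c * s + ?c * t)"
      by (simp add: mol_def right_diff_distrib del: of_nat_Suc)
    then show "ennreal ?c * ennreal (bump 0 (- ?c * s + ?c * t)) = ennreal (mol k 0 (t - s))"
      by (simp add: ennreal_mult' del: of_nat_Suc)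
  qed
  finally show ?thesis by (simp add: nn_integral_bump)
qed

text \<open>The kernel is differentiated in its first argument according to the multi-index \<open>a\<close>.\<close>

definition rho :: "nat \<Rightarrow> nat \<Rightarrow> (nat \<Rightarrow> nat) \<Rightarrow> (nat \<Rightarrow> real) \<Rightarrow> (nat \<Rightarrow> real) \<Rightarrow> real" where
  "rho n k a x y = (\<Prod>i<n. mol k (a i) (x i - y i))"

definition conv :: "nat \<Rightarrow> nat \<Rightarrow> (nat \<Rightarrow> nat) \<Rightarrow> ((nat \<Rightarrow> real) \<Rightarrow> real) \<Rightarrow> (nat \<Rightarrow> real) \<Rightarrow> real" where
  "conv n k a f x = (LINT y|bor n. rho n k a x y * f y)"

lemma rho_nonneg: "rho n k (\<lambda>_. 0) x y \<ge> 0"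
  by (simp add: rho_def prod_nonneg mol_nonneg)

lemma rho_outside:
  assumes "i < n" "\<bar>x i - y i\<bar> \<ge> 1 / real (Suc k)" shows "rho n k a x y = 0"
  unfolding rho_def using assms mol_outside by (intro prod_zero) auto

lemma measurable_rho_pair: "(\<lambda>(x, y). rho n k a x y) \<in> borel_measurable (bor n \<Otimes>\<^sub>M bor n)"
  unfolding rho_def by measurable

lemma measurable_rho1: "x \<in> Rn n \<Longrightarrow> (\<lambda>y. rho n k a x y) \<in> borel_measurable (bor n)"
  unfolding rho_def by measurable

lemma measurable_rho2: "y \<in> Rn n \<Longrightarrow> (\<lambda>x. rho n k a x y) \<in> borel_measurable (bor n)"
  unfolding rho_def by measurable

text \<open>One constant for all coordinates; being at least 1, it may be divided by and raised to
  powers freely.\<close>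

lemma mol_bounded_all:
  fixes n :: nat
  obtains C where "C \<ge> 1" "\<And>i t. i < n \<Longrightarrow> \<bar>mol k (a i) t\<bar> \<le> C"
proof -
  obtain B where B: "\<And>j t. \<bar>mol k j t\<bar> \<le> B j" using mol_bounded by metis
  have B0: "B j \<ge> 0" for j using B[of j 0] by linarith
  have "\<bar>mol k (a i) t\<bar> \<le> 1 + (\<Sum>i<n. B (a i))" if "i < n" for i t
  proof -
    have "B (a i) \<le> (\<Sum>i<n. B (a i))" using that B0 by (intro member_le_sum) auto
    then show ?thesis using B[of "a i" t] by linarith
  qed
  moreover have "1 + (\<Sum>i<n. B (a i)) \<ge> 1" using B0 by (simp add: sum_nonneg)
  ultimately show ?thesis using that by blast
qed

lemma rho_bounded: obtains C where "C \<ge> 0" "\<And>x y. \<bar>rho n k a x y\<bar> \<le> C"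
proof -
  obtain C where C: "C \<ge> 1" "\<And>i t. i < n \<Longrightarrow> \<bar>mol k (a i) t\<bar> \<le> C" using mol_bounded_all by blast
  have "\<bar>rho n k a x y\<bar> \<le> C ^ n" for x y
  proof -
    have "\<bar>rho n k a x y\<bar> = (\<Prod>i<n. \<bar>mol k (a i) (x i - y i)\<bar>)" by (simp add: rho_def abs_prod)
    also have "\<dots> \<le> (\<Prod>i<n. C)" by (intro prod_mono) (use C in auto)
    finally show ?thesis by simp
  qed
  moreover have "C ^ n \<ge> 0" using C by simp
  ultimately show ?thesis using that by blast
qed

lemma mol_Lipschitz: "\<exists>C\<ge>0. \<forall>s t. \<bar>mol k j s - mol k j t\<bar> \<le> C * \<bar>s - t\<bar>"
proof -
  obtain C where C: "\<And>t. \<bar>mol k (Suc j) t\<bar> \<le> C" using mol_bounded by blast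
  have "norm (mol k j s - mol k j t) \<le> C * norm (s - t)" for s t
    by (rule field_differentiable_bound[of UNIV]) (use C mol_deriv in auto)
  moreover have "C \<ge> 0" using C[of 0] by linarith
  ultimately show ?thesis by auto
qed

lemma rho_Lipschitz: obtains L where "L \<ge> 0" "\<And>x x' y. \<bar>rho n k a x y - rho n k a x' y\<bar> \<le> L * dist_n n x x'"
proof -
  obtain C where C: "C \<ge> 1" "\<And>i t. i < n \<Longrightarrow> \<bar>mol k (a i) t\<bar> \<le> C" using mol_bounded_all by blast
  obtain B where B: "\<And>j. B j \<ge> 0" "\<And>j s t. \<bar>mol k j s - mol k j t\<bar> \<le> B j * \<bar>s - t\<bar>"
    using mol_Lipschitz by metis
  define L where "L = C ^ n * (\<Sum>i<n. B (a i))"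
  have "\<bar>rho n k a x y - rho n k a x' y\<bar> \<le> L * dist_n n x x'" for x x' y
  proof -
    \<comment> \<open>Dividing by C brings all factors into the unit interval of absolute values,
      where the difference of two products is at most the sum of the differences of their
      factors.\<close>
    have e: "rho n k a x y = C ^ n * (\<Prod>i<n. mol k (a i) (x i - y i) / C)" for x
      using C(1) by (simp add: rho_def prod_dividef)
    have "\<bar>rho n k a x y - rho n k a x' y\<bar> = C ^ n * \<bar>(\<Prod>i<n. mol k (a i) (x i - y i) / C) - (\<Prod>i<n. mol k (a i) (x' i - y i) / C)\<bar>"
      unfolding e using C(1) by (simp add: abs_mult flip: right_diff_distrib)
    also have "\<dots> \<le> C ^ n * (\<Sum>i<n. \<bar>mol k (a i) (x i - y i) / C - mol k (a i) (x' i - y i) / C\<bar>)"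
    proof -
      have n: "norm (mol k (a i) t / C) \<le> 1" if "i \<in> {..<n}" for i t
        using C(2)[of i t] C(1) that by simp
      show ?thesis using C(1) norm_prod_diff[of "{..<n}" "\<lambda>i. mol k (a i) (x i - y i) / C" "\<lambda>i. mol k (a i) (x' i - y i) / C", OF n n]
        by (intro mult_left_mono) auto
    qed
    also have "\<dots> \<le> C ^ n * (\<Sum>i<n. B (a i) * dist_n n x x')"
    proof (intro mult_left_mono sum_mono)
      fix i assume i: "i \<in> {..<n}"
      have "\<bar>mol k (a i) (x i - y i) / C - mol k (a i) (x' i - y i) / C\<bar> \<le> \<bar>mol k (a i) (x i - y i) - mol k (a i) (x' i - y i)\<bar>"
        using C(1) by (simp add: divide_le_eq mult_left_le_one_le mult_le_cancel_left1 flip: diff_divide_distrib)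
      also have "\<dots> \<le> B (a i) * \<bar>(x i - y i) - (x' i - y i)\<bar>" by (rule B)
      also have "\<dots> \<le> B (a i) * dist_n n x x'"
        using coord_le_dist_n[of i n x x'] i B(1) by (intro mult_left_mono) auto
      finally show "\<bar>mol k (a i) (x i - y i) / C - mol k (a i) (x' i - y i) / C\<bar> \<le> B (a i) * dist_n n x x'" .
    qed (use C in auto)
    finally show ?thesis unfolding L_def by (simp add: sum_distrib_right[symmetric] mult.assoc)
  qed
  moreover have "L \<ge> 0" unfolding L_def using C B by (intro mult_nonneg_nonneg sum_nonneg) auto
  ultimately show ?thesis using that by blast
qed

lemma conv_integrable:
  assumes f: "integrable (bor n) f" and x: "x \<in> Rn n"
  shows "integrable (bor n) (\<lambda>y. rho n k a x y * f y)"
proof -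
  obtain C where C: "C \<ge> 0" "\<And>x y. \<bar>rho n k a x y\<bar> \<le> C" using rho_bounded by blast
  show ?thesis
  proof (rule Bochner_Integration.integrable_bound)
    show "integrable (bor n) (\<lambda>y. C * f y)" using f by simp
    show "(\<lambda>y. rho n k a x y * f y) \<in> borel_measurable (bor n)"
      using f measurable_rho1[OF x] by (intro borel_measurable_times) auto
    show "AE y in bor n. norm (rho n k a x y * f y) \<le> norm (C * f y)"
      using C by (intro AE_I2) (auto simp: abs_mult intro!: mult_right_mono)
  qed
qed

lemma conv_Lipschitz:
  assumes f: "integrable (bor n) f"
  obtains L where "L \<ge> 0" "\<And>x x'. x \<in> Rn n \<Longrightarrow> x' \<in> Rn n \<Longrightarrow> \<bar>conv n k a f x - conv n k a f x'\<bar> \<le> L * dist_n n x x'"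
proof -
  obtain L where L: "L \<ge> 0" "\<And>x x' y. \<bar>rho n k a x y - rho n k a x' y\<bar> \<le> L * dist_n n x x'"
    using rho_Lipschitz by blast
  have "\<bar>conv n k a f x - conv n k a f x'\<bar> \<le> (L * (LINT y|bor n. \<bar>f y\<bar>)) * dist_n n x x'" if "x \<in> Rn n" "x' \<in> Rn n" for x x'
  proof -
    have i: "integrable (bor n) (\<lambda>y. (rho n k a x y - rho n k a x' y) * f y)"
      using conv_integrable[OF f that(1)] conv_integrable[OF f that(2)] by (simp add: left_diff_distrib)
    have "\<bar>conv n k a f x - conv n k a f x'\<bar> = \<bar>LINT y|bor n. (rho n k a x y - rho n k a x' y) * f y\<bar>"
      using conv_integrable[OF f that(1)] conv_integrable[OF f that(2)] by (simp add: conv_def left_diff_distrib)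
    also have "\<dots> \<le> (LINT y|bor n. \<bar>(rho n k a x y - rho n k a x' y) * f y\<bar>)"
      using integral_norm_bound[of "bor n" "\<lambda>y. (rho n k a x y - rho n k a x' y) * f y"] by simp
    also have "\<dots> \<le> (LINT y|bor n. (L * dist_n n x x') * \<bar>f y\<bar>)"
      by (rule integral_mono[OF integrable_abs[OF i]]) (use f L in \<open>auto simp: abs_mult intro!: mult_right_mono\<close>)
    finally show ?thesis by (simp add: mult_ac)
  qed
  moreover have "L * (LINT y|bor n. \<bar>f y\<bar>) \<ge> 0" using L by (intro mult_nonneg_nonneg Bochner_Integration.integral_nonneg) auto
  ultimately show ?thesis using that by blast
qed

lemma conv_continuous: "integrable (bor n) f \<Longrightarrow> continuous_map (top_Rn n) euclideanreal (conv n k a f)"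
  by (metis conv_Lipschitz continuous_Lipschitz)

lemma conv_measurable: "integrable (bor n) f \<Longrightarrow> conv n k a f \<in> borel_measurable (bor n)"
  by (intro borel_measurable_continuous_Rn conv_continuous)

text \<open>A uniform quadratic remainder survives integration against an integrable function, so
  the kernel's remainder justifies differentiating \<open>conv\<close> under the integral
  sign.\<close>

lemma DERIV_quadratic:
  assumes "\<And>t. \<bar>F t - F s - (t - s) * D\<bar> \<le> K * (t - s)\<^sup>2"
  shows "(F has_real_derivative D) (at s)"
proof -
  have "((\<lambda>h. (F (s + h) - F s) / h - D) \<longlongrightarrow> 0) (at 0)"
  proof (rule Lim_null_comparison)
    show "\<forall>\<^sub>F h in at 0. norm ((F (s + h) - F s) / h - D) \<le> K * \<bar>h\<bar>"
    proof (rule eventually_at_filter[THEN iffD2], rule always_eventually, intro allI impI)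
      fix h :: real assume h: "h \<noteq> 0"
      have "(F (s + h) - F s) / h - D = (F (s + h) - F s - h * D) / h" using h by (simp add: diff_divide_distrib)
      then have "norm ((F (s + h) - F s) / h - D) = \<bar>F (s + h) - F s - h * D\<bar> / \<bar>h\<bar>" by (simp add: abs_divide)
      also have "\<dots> \<le> K * h\<^sup>2 / \<bar>h\<bar>" using assms[of "s + h"] by (intro divide_right_mono) auto
      also have "\<dots> = K * \<bar>h\<bar>" using h by (simp add: power2_eq_square abs_if)
      finally show "norm ((F (s + h) - F s) / h - D) \<le> K * \<bar>h\<bar>" .
    qed
    show "((\<lambda>h. K * \<bar>h\<bar>) \<longlongrightarrow> 0) (at 0)" by (auto intro!: tendsto_eq_intros)
  qed
  then show ?thesis unfolding DERIV_def by (rule LIM_zero_cancel)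
qed

text \<open>The mean value theorem gives a derivative at an intermediate point, and the derivative
  is itself Lipschitz.\<close>

lemma mol_quadratic: "\<exists>C\<ge>0. \<forall>s t. \<bar>mol k j t - mol k j s - (t - s) * mol k (Suc j) s\<bar> \<le> C * (t - s)\<^sup>2"
proof -
  obtain C where C: "C \<ge> 0" "\<And>s t. \<bar>mol k (Suc j) s - mol k (Suc j) t\<bar> \<le> C * \<bar>s - t\<bar>"
    using mol_Lipschitz by blast
  have "\<bar>mol k j t - mol k j s - (t - s) * mol k (Suc j) s\<bar> \<le> C * (t - s)\<^sup>2" for s t
  proof -
    have "\<exists>z. mol k j t - mol k j s = (t - s) * mol k (Suc j) z \<and> \<bar>z - s\<bar> \<le> \<bar>t - s\<bar>"
    proof (cases s t rule: linorder_cases)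
      case less
      then obtain z where "s < z" "z < t" "mol k j t - mol k j s = (t - s) * mol k (Suc j) z"
        using MVT2[OF less, of "mol k j" "mol k (Suc j)"] mol_deriv by auto
      then show ?thesis by (intro exI[of _ z]) auto
    next
      case greater
      then obtain z where "t < z" "z < s" "mol k j s - mol k j t = (s - t) * mol k (Suc j) z"
        using MVT2[OF greater, of "mol k j" "mol k (Suc j)"] mol_deriv by auto
      then show ?thesis by (intro exI[of _ z]) (auto simp: algebra_simps)
    qed auto
    then obtain z where z: "mol k j t - mol k j s = (t - s) * mol k (Suc j) z" "\<bar>z - s\<bar> \<le> \<bar>t - s\<bar>" by blast
    have "\<bar>mol k j t - mol k j s - (t - s) * mol k (Suc j) s\<bar> = \<bar>t - s\<bar> * \<bar>mol k (Suc j) z - mol k (Suc j) s\<bar>"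
      unfolding z(1) by (simp add: abs_mult flip: right_diff_distrib)
    also have "\<dots> \<le> \<bar>t - s\<bar> * (C * \<bar>z - s\<bar>)" by (intro mult_left_mono C) auto
    also have "\<dots> \<le> \<bar>t - s\<bar> * (C * \<bar>t - s\<bar>)" using z(2) C(1) by (intro mult_left_mono) auto
    finally show ?thesis by (simp add: power2_eq_square mult_ac)
  qed
  then show ?thesis using C(1) by blast
qed

lemma rho_split: "i < n \<Longrightarrow> rho n k a x y = mol k (a i) (x i - y i) * (\<Prod>j\<in>{..<n} - {i}. mol k (a j) (x j - y j))"
  unfolding rho_def by (subst prod.remove[of "{..<n}" i]) auto

lemma conv_DERIV:
  assumes f: "integrable (bor n) f" and i: "i < n" and x: "x \<in> Rn n"
  shows "((\<lambda>t. conv n k a f (x(i := t))) has_real_derivative conv n k (a(i := Suc (a i))) f x) (at (x i))"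
proof -
  obtain B where B: "B \<ge> 0" "\<And>s t. \<bar>mol k (a i) t - mol k (a i) s - (t - s) * mol k (Suc (a i)) s\<bar> \<le> B * (t - s)\<^sup>2"
    using mol_quadratic by blast
  obtain C where C: "C \<ge> 1" "\<And>i t. i < n \<Longrightarrow> \<bar>mol k (a i) t\<bar> \<le> C" using mol_bounded_all by blast
  let ?m = "card ({..<n} - {i})"
  let ?a' = "a(i := Suc (a i))"
  have pt: "\<bar>rho n k a (x(i := t)) y - rho n k a x y - (t - x i) * rho n k ?a' x y\<bar> \<le> B * (t - x i)\<^sup>2 * C ^ ?m" for t y
  proof -
    define P where "P = (\<Prod>j\<in>{..<n} - {i}. mol k (a j) (x j - y j))"
    have P: "\<bar>P\<bar> \<le> C ^ ?m"
    proof -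
      have "\<bar>P\<bar> = (\<Prod>j\<in>{..<n} - {i}. \<bar>mol k (a j) (x j - y j)\<bar>)" by (simp add: P_def abs_prod)
      also have "\<dots> \<le> (\<Prod>j\<in>{..<n} - {i}. C)" by (intro prod_mono) (use C in auto)
      finally show ?thesis by simp
    qed
    have r1: "rho n k a (x(i := t)) y = mol k (a i) (t - y i) * P"
      unfolding rho_split[OF i] P_def by (auto intro!: prod.cong)
    have r2: "rho n k a x y = mol k (a i) (x i - y i) * P" unfolding rho_split[OF i] P_def ..
    have r3: "rho n k ?a' x y = mol k (Suc (a i)) (x i - y i) * P"
      unfolding rho_split[OF i] P_def by (auto intro!: prod.cong)
    have "rho n k a (x(i := t)) y - rho n k a x y - (t - x i) * rho n k ?a' x y
      = (mol k (a i) (t - y i) - mol k (a i) (x i - y i) - ((t - y i) - (x i - y i)) * mol k (Suc (a i)) (x i - y i)) * P"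
      unfolding r1 r2 r3 by (simp add: algebra_simps)
    then have "\<bar>rho n k a (x(i := t)) y - rho n k a x y - (t - x i) * rho n k ?a' x y\<bar>
      = \<bar>mol k (a i) (t - y i) - mol k (a i) (x i - y i) - ((t - y i) - (x i - y i)) * mol k (Suc (a i)) (x i - y i)\<bar> * \<bar>P\<bar>"
      by (simp only: abs_mult)
    also have "\<dots> \<le> (B * ((t - y i) - (x i - y i))\<^sup>2) * C ^ ?m"
      by (intro mult_mono B P) (use B in auto)
    finally show ?thesis by simp
  qed
  show ?thesis
  proof (rule DERIV_quadratic)
    fix t
    have x': "x(i := t) \<in> Rn n" by (rule Rn_fun_upd[OF i x])
    note I = conv_integrable[OF f x', of k a] conv_integrable[OF f x, of k a] conv_integrable[OF f x, of k ?a']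
    have eq: "conv n k a f (x(i := t)) - conv n k a f (x(i := x i)) - (t - x i) * conv n k ?a' f x
      = (LINT y|bor n. (rho n k a (x(i := t)) y - rho n k a x y - (t - x i) * rho n k ?a' x y) * f y)"
    proof -
      have "(LINT y|bor n. (rho n k a (x(i := t)) y - rho n k a x y - (t - x i) * rho n k ?a' x y) * f y)
        = (LINT y|bor n. rho n k a (x(i := t)) y * f y - rho n k a x y * f y - (t - x i) * (rho n k ?a' x y * f y))"
        by (rule Bochner_Integration.integral_cong) (auto simp: algebra_simps)
      also have "\<dots> = conv n k a f (x(i := t)) - conv n k a f (x(i := x i)) - (t - x i) * conv n k ?a' f x"
        using I by (simp add: conv_def)
      finally show ?thesis by simp
    qed
    have "\<bar>LINT y|bor n. (rho n k a (x(i := t)) y - rho n k a x y - (t - x i) * rho n k ?a' x y) * f y\<bar>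
      \<le> (LINT y|bor n. \<bar>(rho n k a (x(i := t)) y - rho n k a x y - (t - x i) * rho n k ?a' x y) * f y\<bar>)"
      using integral_norm_bound[of "bor n" "\<lambda>y. (rho n k a (x(i := t)) y - rho n k a x y - (t - x i) * rho n k ?a' x y) * f y"] by simp
    also have "\<dots> \<le> (LINT y|bor n. (B * (t - x i)\<^sup>2 * C ^ ?m) * \<bar>f y\<bar>)"
    proof (rule integral_mono)
      have "integrable (bor n) (\<lambda>y. rho n k a (x(i := t)) y * f y - rho n k a x y * f y - (t - x i) * (rho n k ?a' x y * f y))"
        by (intro Bochner_Integration.integrable_diff I integrable_mult_right)
      then show "integrable (bor n) (\<lambda>y. \<bar>(rho n k a (x(i := t)) y - rho n k a x y - (t - x i) * rho n k ?a' x y) * f y\<bar>)"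
        by (intro integrable_abs) (simp add: algebra_simps)
    qed (use f pt in \<open>auto simp: abs_mult intro!: mult_right_mono\<close>)
    finally show "\<bar>conv n k a f (x(i := t)) - conv n k a f (x(i := x i)) - (t - x i) * conv n k ?a' f x\<bar>
      \<le> (B * C ^ ?m * (LINT y|bor n. \<bar>f y\<bar>)) * (t - x i)\<^sup>2"
      unfolding eq by (simp add: mult_ac)
  qed
qed

text \<open>The convolutions with all multi-indices a form a class closed under partial
  differentiation.\<close>

lemma conv_smooth: assumes f: "integrable (bor n) f" shows "smooth n (conv n k a f)"
proof (rule smooth_coinduct[where P = "\<lambda>g. \<exists>a. g = conv n k a f"])
  fix g i assume "\<exists>a. g = conv n k a f" "i < n"
  then obtain a where g: "g = conv n k a f" by blast
  show "\<exists>g'. (\<exists>a. g' = conv n k a f) \<and> (\<forall>x\<in>Rn n. ((\<lambda>t. g (x(i := t))) has_real_derivative g' x) (at (x i)))"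
    unfolding g using conv_DERIV[OF f \<open>i < n\<close>] by blast
qed (use conv_continuous[OF f] in auto)

lemma partial_conv:
  "integrable (bor n) f \<Longrightarrow> i < n \<Longrightarrow> x \<in> Rn n \<Longrightarrow> partial i (conv n k a f) x = conv n k (a(i := Suc (a i))) f x"
  by (rule partial_eqI) (rule conv_DERIV)

lemma nn_integral_rho:
  "(\<integral>\<^sup>+x. ennreal (rho n k (\<lambda>_. 0) x y) \<partial>bor n) = 1"
proof -
  have "(\<integral>\<^sup>+x. ennreal (rho n k (\<lambda>_. 0) x y) \<partial>bor n) = (\<integral>\<^sup>+x. (\<Prod>i<n. ennreal (mol k 0 (x i - y i))) \<partial>bor n)"
    unfolding rho_def by (simp add: prod_ennreal mol_nonneg)
  also have "\<dots> = (\<Prod>i<n. \<integral>\<^sup>+t. ennreal (mol k 0 (t - y i)) \<partial>lborel)"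
    by (rule lbs.product_nn_integral_prod) auto
  finally show ?thesis by (simp add: nn_integral_mol)
qed

text \<open>The reflection of y at x exchanges the two arguments of the kernel and reduces the
  integral in the second argument to the one in the first.\<close>

lemma nn_integral_rho':
  assumes x: "x \<in> Rn n"
  shows "(\<integral>\<^sup>+y. ennreal (rho n k (\<lambda>_. 0) x y) \<partial>bor n) = 1"
proof -
  have "(\<integral>\<^sup>+y. ennreal (rho n k (\<lambda>_. 0) x y) \<partial>bor n) = (\<integral>\<^sup>+y. ennreal (rho n k (\<lambda>_. 0) x (refl n (\<lambda>i. 2 * x i) y)) \<partial>bor n)"
    using measurable_rho1[OF x] by (intro nn_integral_refl[symmetric]) simp
  also have "\<dots> = (\<integral>\<^sup>+y. ennreal (rho n k (\<lambda>_. 0) y x) \<partial>bor n)"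
    by (intro nn_integral_cong arg_cong[where f = ennreal]) (simp add: rho_def refl_def)
  finally show ?thesis by (simp add: nn_integral_rho)
qed

lemma rho_integral:
  assumes x: "x \<in> Rn n"
  shows "integrable (bor n) (rho n k (\<lambda>_. 0) x)" "(LINT y|bor n. rho n k (\<lambda>_. 0) x y) = 1"
proof -
  have "has_bochner_integral (bor n) (rho n k (\<lambda>_. 0) x) 1"
    by (rule has_bochner_integral_nn_integral)
       (use nn_integral_rho'[OF x] measurable_rho1[OF x] in \<open>auto simp: rho_nonneg\<close>)
  then show "integrable (bor n) (rho n k (\<lambda>_. 0) x)" "(LINT y|bor n. rho n k (\<lambda>_. 0) x y) = 1"
    by (auto simp: has_bochner_integral_iff)
qed

lemma powr_tangent:
  fixes s t q :: real
  assumes "q \<ge> 1" "s \<ge> 0" "t \<ge> 0"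
  shows "t powr q \<ge> s powr q + q * s powr (q - 1) * (t - s)"
proof (cases "s = 0 \<or> t = 0")
  case True
  then show ?thesis
  proof (elim disjE)
    assume "t = 0"
    show ?thesis
    proof (cases "s = 0")
      case False
      then have "s powr (q - 1) * s = s powr q" using powr_add[of s "q - 1" 1] assms by simp
      then have "s powr q + q * s powr (q - 1) * (t - s) = s powr q - q * s powr q"
        using \<open>t = 0\<close> by simp
      also have "\<dots> \<le> 0" using assms mult_right_mono[of 1 q "s powr q"] by simp
      finally show ?thesis using \<open>t = 0\<close> by simp
    qed (use \<open>t = 0\<close> in simp)
  qed (use assms in \<open>cases "q = 1"; simp\<close>)
next
  case False
  then have st: "s > 0" "t > 0" using assms by auto
  have "q * s powr (q - 1) * (t - s) \<le> t powr q - s powr q"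
    by (rule convex_on_imp_above_tangent[OF powr_convex[OF assms(1)]])
       (use st in \<open>auto intro!: has_field_derivative_at_within has_real_derivative_powr connected_Ioi simp: interior_open\<close>)
  then show ?thesis by linarith
qed

text \<open>The tangent of t^q at the mean s of |f| lies below the power; it is integrated against
  the kernel, a probability density in y. The right-hand side is an extended integral, so that an
  infinite value settles the claim.\<close>

lemma conv_Jensen:
  assumes q: "q \<ge> 1" and f: "integrable (bor n) f" and x: "x \<in> Rn n"
  shows "ennreal (\<bar>conv n k (\<lambda>_. 0) f x\<bar> powr q) \<le> (\<integral>\<^sup>+y. ennreal (rho n k (\<lambda>_. 0) x y * \<bar>f y\<bar> powr q) \<partial>bor n)"
proof (cases "(\<integral>\<^sup>+y. ennreal (rho n k (\<lambda>_. 0) x y * \<bar>f y\<bar> powr q) \<partial>bor n) = \<infinity>")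
  case False
  let ?\<rho> = "rho n k (\<lambda>_. 0) x"
  have m: "(\<lambda>y. ?\<rho> y * \<bar>f y\<bar> powr q) \<in> borel_measurable (bor n)"
    using measurable_rho1[OF x] borel_measurable_integrable[OF f] by measurable
  have i: "integrable (bor n) (\<lambda>y. ?\<rho> y * \<bar>f y\<bar> powr q)"
    by (rule integrableI_nonneg) (use m False in \<open>auto simp: rho_nonneg less_top\<close>)
  define s where "s = (LINT y|bor n. ?\<rho> y * \<bar>f y\<bar>)"
  have s0: "s \<ge> 0" unfolding s_def by (intro Bochner_Integration.integral_nonneg) (simp add: rho_nonneg)
  have i1: "integrable (bor n) (\<lambda>y. ?\<rho> y * \<bar>f y\<bar>)" using conv_integrable[OF integrable_abs[OF f] x] .
  have "\<bar>conv n k (\<lambda>_. 0) f x\<bar> \<le> (LINT y|bor n. \<bar>?\<rho> y * f y\<bar>)"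
    using integral_norm_bound[of "bor n" "\<lambda>y. ?\<rho> y * f y"] by (simp add: conv_def)
  also have "\<dots> = s" by (simp add: s_def abs_mult rho_nonneg)
  finally have "\<bar>conv n k (\<lambda>_. 0) f x\<bar> powr q \<le> s powr q" using q by (intro powr_mono2) auto
  also have "s powr q = (LINT y|bor n. s powr q * ?\<rho> y + q * s powr (q - 1) * (?\<rho> y * \<bar>f y\<bar> - s * ?\<rho> y))"
    using i1 rho_integral[OF x] by (simp add: s_def[symmetric])
  also have "\<dots> \<le> (LINT y|bor n. ?\<rho> y * \<bar>f y\<bar> powr q)"
  proof (rule integral_mono[OF _ i])
    show "integrable (bor n) (\<lambda>y. s powr q * ?\<rho> y + q * s powr (q - 1) * (?\<rho> y * \<bar>f y\<bar> - s * ?\<rho> y))"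
      using i1 rho_integral[OF x] by auto
    fix y
    have "?\<rho> y * (s powr q + q * s powr (q - 1) * (\<bar>f y\<bar> - s)) \<le> ?\<rho> y * \<bar>f y\<bar> powr q"
      by (intro mult_left_mono powr_tangent q s0 rho_nonneg) auto
    then show "s powr q * ?\<rho> y + q * s powr (q - 1) * (?\<rho> y * \<bar>f y\<bar> - s * ?\<rho> y) \<le> ?\<rho> y * \<bar>f y\<bar> powr q"
      by (simp add: algebra_simps)
  qed
  finally show ?thesis
    using nn_integral_eq_integral[OF i] by (simp add: rho_nonneg ennreal_leI)
qed simp

text \<open>Jensen's inequality and then Tonelli, where the kernel integrates to 1 in x as
  well.\<close>

lemma conv_Young:
  assumes q: "q \<ge> 1" and f: "integrable (bor n) f" "f \<in> Lq (bor n) q"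
  shows "conv n k (\<lambda>_. 0) f \<in> Lq (bor n) q" "nrm (bor n) q (conv n k (\<lambda>_. 0) f) \<le> nrm (bor n) q f"
proof -
  let ?c = "conv n k (\<lambda>_. 0) f"
  interpret pair_sigma_finite "bor n" "bor n" by (rule pair_sigma_finite_bor)
  have fm [measurable]: "f \<in> borel_measurable (bor n)" using f by auto
  have "(\<integral>\<^sup>+x. ennreal (\<bar>?c x\<bar> powr q) \<partial>bor n) \<le> (\<integral>\<^sup>+x. (\<integral>\<^sup>+y. ennreal (rho n k (\<lambda>_. 0) x y * \<bar>f y\<bar> powr q) \<partial>bor n) \<partial>bor n)"
    by (intro nn_integral_mono conv_Jensen q f) (simp add: space_bor)
  also have "\<dots> = (\<integral>\<^sup>+y. (\<integral>\<^sup>+x. ennreal (rho n k (\<lambda>_. 0) x y * \<bar>f y\<bar> powr q) \<partial>bor n) \<partial>bor n)"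
  proof (rule Fubini'[symmetric])
    have [measurable]: "(\<lambda>z. rho n k (\<lambda>_. 0) (fst z) (snd z)) \<in> borel_measurable (bor n \<Otimes>\<^sub>M bor n)"
      using measurable_rho_pair[of n k] by (simp add: case_prod_unfold)
    show "(\<lambda>(x, y). ennreal (rho n k (\<lambda>_. 0) x y * \<bar>f y\<bar> powr q)) \<in> borel_measurable (bor n \<Otimes>\<^sub>M bor n)"
      unfolding case_prod_unfold by measurable
  qed
  also have "\<dots> = (\<integral>\<^sup>+y. ennreal (\<bar>f y\<bar> powr q) \<partial>bor n)"
  proof (rule nn_integral_cong)
    fix y assume "y \<in> space (bor n)"
    then have y: "y \<in> Rn n" by (simp add: space_bor)
    have "(\<integral>\<^sup>+x. ennreal (rho n k (\<lambda>_. 0) x y * \<bar>f y\<bar> powr q) \<partial>bor n) = (\<integral>\<^sup>+x. ennreal (rho n k (\<lambda>_. 0) x y) * ennreal (\<bar>f y\<bar> powr q) \<partial>bor n)"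
      by (intro nn_integral_cong) (simp add: ennreal_mult rho_nonneg)
    also have "\<dots> = ennreal (\<bar>f y\<bar> powr q)"
      using measurable_rho2[OF y] by (subst nn_integral_multc) (auto simp: nn_integral_rho)
    finally show "(\<integral>\<^sup>+x. ennreal (rho n k (\<lambda>_. 0) x y * \<bar>f y\<bar> powr q) \<partial>bor n) = ennreal (\<bar>f y\<bar> powr q)" .
  qed
  also have "\<dots> = ennreal (LINT y|bor n. \<bar>f y\<bar> powr q)"
    by (rule nn_integral_eq_integral[OF LqD(2)[OF f(2)]]) simp
  finally have *: "(\<integral>\<^sup>+x. ennreal (\<bar>?c x\<bar> powr q) \<partial>bor n) \<le> ennreal (LINT y|bor n. \<bar>f y\<bar> powr q)" .
  have i: "integrable (bor n) (\<lambda>x. \<bar>?c x\<bar> powr q)"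
    by (rule integrableI_nonneg) (use * conv_measurable[OF f(1)] in \<open>auto simp: top_unique less_top[symmetric]\<close>)
  then show L: "?c \<in> Lq (bor n) q" using conv_measurable[OF f(1)] by (simp add: Lq_def)
  have "(LINT x|bor n. \<bar>?c x\<bar> powr q) \<le> (LINT y|bor n. \<bar>f y\<bar> powr q)"
    using * nn_integral_eq_integral[OF i] by (simp add: Bochner_Integration.integral_nonneg)
  then show "nrm (bor n) q ?c \<le> nrm (bor n) q f"
    unfolding nrm_def using q by (intro powr_mono2) (auto intro!: Bochner_Integration.integral_nonneg)
qed

lemma conv_diff:
  assumes "integrable (bor n) f" "integrable (bor n) g" "x \<in> Rn n"
  shows "conv n k a (\<lambda>y. f y - g y) x = conv n k a f x - conv n k a g x"
  using conv_integrable[OF assms(1,3)] conv_integrable[OF assms(2,3)] by (simp add: conv_def right_diff_distrib)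

lemma conv_add:
  assumes "integrable (bor n) f" "integrable (bor n) g" "x \<in> Rn n"
  shows "conv n k a (\<lambda>y. f y + g y) x = conv n k a f x + conv n k a g x"
  using conv_integrable[OF assms(1,3)] conv_integrable[OF assms(2,3)] by (simp add: conv_def distrib_left)

lemma conv_cmult: "conv n k a (\<lambda>y. c * f y) x = c * conv n k a f x"
  by (simp add: conv_def mult.left_commute)

abbreviation conv0 :: "nat \<Rightarrow> nat \<Rightarrow> ((nat \<Rightarrow> real) \<Rightarrow> real) \<Rightarrow> (nat \<Rightarrow> real) \<Rightarrow> real" where
  "conv0 n k f \<equiv> conv n k (\<lambda>_. 0) f"

section \<open>The mollifier as an approximate identity\<close>

lemma Lq_1: "f \<in> Lq M 1 \<longleftrightarrow> integrable M f"
  by (auto simp: Lq_def intro: integrable_abs_cancel)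

lemma nrm_1: "nrm M 1 f = (LINT x|M. \<bar>f x\<bar>)"
  by (simp add: nrm_def Bochner_Integration.integral_nonneg)

text \<open>A predicate for induction: closed under linear combinations and dominated limits, it
  propagates from Lipschitz functions to boxes, from there to Borel sets of finite measure and
  finally to all integrable functions.\<close>

definition appr :: "nat \<Rightarrow> ((nat \<Rightarrow> real) \<Rightarrow> real) \<Rightarrow> bool" where
  "appr n f \<longleftrightarrow> integrable (bor n) f \<and> (\<lambda>k. nrm (bor n) 1 (\<lambda>x. conv0 n k f x - f x)) \<longlonglongrightarrow> 0"

lemma conv0_Lq: "q \<ge> 1 \<Longrightarrow> integrable (bor n) f \<Longrightarrow> f \<in> Lq (bor n) q \<Longrightarrow> (\<lambda>x. conv0 n k f x - f x) \<in> Lq (bor n) q"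
  by (intro Lq_diff conv_Young) auto

lemma conv_cong: "(\<And>x. x \<in> Rn n \<Longrightarrow> f x = g x) \<Longrightarrow> conv n k a f x = conv n k a g x"
  unfolding conv_def by (rule Bochner_Integration.integral_cong) (auto simp: space_bor)

lemma appr_cong: assumes "appr n f" "\<And>x. x \<in> Rn n \<Longrightarrow> f x = g x" shows "appr n g"
proof -
  have "integrable (bor n) f \<longleftrightarrow> integrable (bor n) g"
    by (rule Bochner_Integration.integrable_cong) (use assms(2) in \<open>auto simp: space_bor\<close>)
  then have "integrable (bor n) g" using assms(1) by (simp add: appr_def)
  moreover have "nrm (bor n) 1 (\<lambda>x. conv0 n k f x - f x) = nrm (bor n) 1 (\<lambda>x. conv0 n k g x - g x)" for k
    by (rule nrm_cong) (use assms conv_cong[OF assms(2)] in \<open>simp add: space_bor\<close>)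
  ultimately show ?thesis using assms(1) by (simp add: appr_def)
qed

lemma appr_add: assumes f: "appr n f" and g: "appr n g" shows "appr n (\<lambda>x. f x + g x)"
proof -
  have i: "integrable (bor n) f" "integrable (bor n) g" using assms by (auto simp: appr_def)
  have "nrm (bor n) 1 (\<lambda>x. conv0 n k (\<lambda>x. f x + g x) x - (f x + g x))
     \<le> nrm (bor n) 1 (\<lambda>x. conv0 n k f x - f x) + nrm (bor n) 1 (\<lambda>x. conv0 n k g x - g x)" for k
  proof -
    have "nrm (bor n) 1 (\<lambda>x. conv0 n k (\<lambda>x. f x + g x) x - (f x + g x)) = nrm (bor n) 1 (\<lambda>x. (conv0 n k f x - f x) + (conv0 n k g x - g x))"
      by (rule nrm_cong) (simp add: conv_add[OF i] space_bor)
    also have "\<dots> \<le> nrm (bor n) 1 (\<lambda>x. conv0 n k f x - f x) + nrm (bor n) 1 (\<lambda>x. conv0 n k g x - g x)"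
      by (rule Minkowski(2)[OF order_refl conv0_Lq[OF order_refl i(1)] conv0_Lq[OF order_refl i(2)]])
         (use i in \<open>simp_all add: Lq_1\<close>)
    finally show ?thesis .
  qed
  then have "\<forall>\<^sub>F k in sequentially. norm (nrm (bor n) 1 (\<lambda>x. conv0 n k (\<lambda>x. f x + g x) x - (f x + g x)))
     \<le> nrm (bor n) 1 (\<lambda>x. conv0 n k f x - f x) + nrm (bor n) 1 (\<lambda>x. conv0 n k g x - g x)"
    by (intro eventuallyI) simp
  moreover have "(\<lambda>k. nrm (bor n) 1 (\<lambda>x. conv0 n k f x - f x) + nrm (bor n) 1 (\<lambda>x. conv0 n k g x - g x)) \<longlonglongrightarrow> 0"
    using tendsto_add[of "\<lambda>k. nrm (bor n) 1 (\<lambda>x. conv0 n k f x - f x)" 0 sequentially "\<lambda>k. nrm (bor n) 1 (\<lambda>x. conv0 n k g x - g x)" 0]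
      f g by (simp add: appr_def)
  ultimately show ?thesis using i unfolding appr_def by (auto intro: Lim_null_comparison)
qed

lemma appr_cmult: assumes f: "appr n f" shows "appr n (\<lambda>x. c * f x)"
proof -
  have "nrm (bor n) 1 (\<lambda>x. conv0 n k (\<lambda>x. c * f x) x - c * f x) = \<bar>c\<bar> * nrm (bor n) 1 (\<lambda>x. conv0 n k f x - f x)" for k
    using nrm_cmult[of 1 "bor n" c "\<lambda>x. conv0 n k f x - f x"] by (simp add: conv_cmult right_diff_distrib)
  moreover have "(\<lambda>k. \<bar>c\<bar> * nrm (bor n) 1 (\<lambda>x. conv0 n k f x - f x)) \<longlonglongrightarrow> 0"
    using f tendsto_mult_right_zero by (auto simp: appr_def)
  ultimately show ?thesis using f by (simp add: appr_def)
qed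

text \<open>Mollification is a contraction on L^q, so replacing f by g costs the distance of f and g
  twice.\<close>

lemma conv_approx_triangle:
  assumes q: "q \<ge> 1" and i: "integrable (bor n) f" "integrable (bor n) g" and L: "f \<in> Lq (bor n) q" "g \<in> Lq (bor n) q"
  shows "nrm (bor n) q (\<lambda>x. conv0 n k f x - f x) \<le> 2 * nrm (bor n) q (\<lambda>x. f x - g x) + nrm (bor n) q (\<lambda>x. conv0 n k g x - g x)"
proof -
  have d: "(\<lambda>x. f x - g x) \<in> Lq (bor n) q" "integrable (bor n) (\<lambda>x. f x - g x)" using Lq_diff[OF q L] i by auto
  have d': "(\<lambda>x. g x - f x) \<in> Lq (bor n) q" using Lq_diff[OF q L(2,1)] .
  have c: "conv0 n k (\<lambda>x. f x - g x) \<in> Lq (bor n) q" by (rule conv_Young[OF q d(2,1)])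
  have s: "(\<lambda>x. (conv0 n k g x - g x) + (g x - f x)) \<in> Lq (bor n) q" by (rule Minkowski(1)[OF q conv0_Lq[OF q i(2) L(2)] d'])
  have "nrm (bor n) q (\<lambda>x. conv0 n k f x - f x) = nrm (bor n) q (\<lambda>x. conv0 n k (\<lambda>x. f x - g x) x + ((conv0 n k g x - g x) + (g x - f x)))"
    by (rule nrm_cong) (simp add: conv_diff[OF i] space_bor)
  also have "\<dots> \<le> nrm (bor n) q (conv0 n k (\<lambda>x. f x - g x)) + nrm (bor n) q (\<lambda>x. (conv0 n k g x - g x) + (g x - f x))"
    by (rule Minkowski(2)[OF q c s])
  also have "\<dots> \<le> nrm (bor n) q (\<lambda>x. f x - g x) + (nrm (bor n) q (\<lambda>x. conv0 n k g x - g x) + nrm (bor n) q (\<lambda>x. g x - f x))"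
    by (intro add_mono conv_Young[OF q d(2,1)] Minkowski(2)[OF q conv0_Lq[OF q i(2) L(2)] d'])
  also have "nrm (bor n) q (\<lambda>x. g x - f x) = nrm (bor n) q (\<lambda>x. f x - g x)" by (rule nrm_cong) simp
  finally show ?thesis by simp
qed

lemma conv_limit_closed:
  assumes q: "q \<ge> 1" and i: "integrable (bor n) f" "\<And>m. integrable (bor n) (g m)" and L: "f \<in> Lq (bor n) q" "\<And>m. g m \<in> Lq (bor n) q"
    and g: "\<And>m. (\<lambda>k. nrm (bor n) q (\<lambda>x. conv0 n k (g m) x - g m x)) \<longlonglongrightarrow> 0"
    and lim: "(\<lambda>m. nrm (bor n) q (\<lambda>x. f x - g m x)) \<longlonglongrightarrow> 0"
  shows "(\<lambda>k. nrm (bor n) q (\<lambda>x. conv0 n k f x - f x)) \<longlonglongrightarrow> 0"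
proof (rule LIMSEQ_I)
  fix e :: real assume e: "e > 0"
  from LIMSEQ_D[OF lim, of "e / 3"] e obtain m where m: "nrm (bor n) q (\<lambda>x. f x - g m x) < e / 3" by fastforce
  from LIMSEQ_D[OF g[of m], of "e / 3"] e obtain K where K: "\<And>k. k \<ge> K \<Longrightarrow> nrm (bor n) q (\<lambda>x. conv0 n k (g m) x - g m x) < e / 3" by fastforce
  have "nrm (bor n) q (\<lambda>x. conv0 n k f x - f x) < e" if "k \<ge> K" for k
    using conv_approx_triangle[OF q i(1) i(2)[of m] L(1) L(2)[of m], of k] m K[OF that] by linarith
  then show "\<exists>K. \<forall>k\<ge>K. norm (nrm (bor n) q (\<lambda>x. conv0 n k f x - f x) - 0) < e" by auto
qed

text \<open>The limit inherits the bound h, so 2 h dominates the differences and they tend to 0 in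
  L^1; then \<open>conv_limit_closed\<close> applies with q = 1.\<close>

lemma appr_dominated:
  assumes g: "\<And>m. appr n (g m)" and h: "integrable (bor n) h" and f: "f \<in> borel_measurable (bor n)"
    and b: "\<And>m x. x \<in> Rn n \<Longrightarrow> \<bar>g m x\<bar> \<le> h x" and lim: "\<And>x. x \<in> Rn n \<Longrightarrow> (\<lambda>m. g m x) \<longlonglongrightarrow> f x"
  shows "appr n f"
proof -
  have ig: "integrable (bor n) (g m)" for m using g by (simp add: appr_def)
  have fi: "integrable (bor n) f"
    by (rule integrable_dominated_convergence[where s = g and w = h])
       (use f borel_measurable_integrable[OF ig] h lim b in \<open>auto simp: space_bor\<close>)
  have fb: "\<bar>f x\<bar> \<le> h x" if "x \<in> Rn n" for x
    by (rule tendsto_upperbound[OF tendsto_rabs[OF lim[OF that]]]) (use b[OF that] in auto)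
  have "(\<lambda>m. LINT x|bor n. \<bar>f x - g m x\<bar>) \<longlonglongrightarrow> (LINT x|bor n. 0)"
  proof (rule integral_dominated_convergence)
    show "integrable (bor n) (\<lambda>x. 2 * h x)" using h by simp
    show "AE x in bor n. (\<lambda>m. \<bar>f x - g m x\<bar>) \<longlonglongrightarrow> 0"
    proof (rule AE_I2)
      fix x assume "x \<in> space (bor n)"
      then have "(\<lambda>m. f x - g m x) \<longlonglongrightarrow> f x - f x" using lim[of x] by (intro tendsto_intros) (auto simp: space_bor)
      then show "(\<lambda>m. \<bar>f x - g m x\<bar>) \<longlonglongrightarrow> 0" by (simp add: tendsto_rabs_zero)
    qed
    fix m show "AE x in bor n. norm \<bar>f x - g m x\<bar> \<le> 2 * h x"
    proof (rule AE_I2)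
      fix x assume "x \<in> space (bor n)"
      then show "norm \<bar>f x - g m x\<bar> \<le> 2 * h x" using b[of x m] fb[of x] by (simp add: space_bor)
    qed
  qed (use f borel_measurable_integrable[OF ig] in auto)
  then have "(\<lambda>m. nrm (bor n) 1 (\<lambda>x. f x - g m x)) \<longlonglongrightarrow> 0" by (simp add: nrm_1)
  then show ?thesis
    unfolding appr_def using fi ig g by (intro conjI conv_limit_closed[of 1 n f g]) (auto simp: Lq_1 appr_def)
qed

text \<open>The kernel lives on a cube of half-side 1 / (k + 1). Passing to the Euclidean norm
  through the sum of the coordinates costs the factor n, harmless as k grows.\<close>

lemma rho_support:
  assumes "rho n k a x y \<noteq> 0" shows "dist_n n x y \<le> real n / real (Suc k)"
proof -
  have "\<bar>x i - y i\<bar> \<le> 1 / real (Suc k)" if "i < n" for i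
    using rho_outside[OF that, of k x y a] assms by (metis less_imp_le not_le)
  from dist_n_le_cube[OF this] show ?thesis by simp
qed

text \<open>The kernel averages g over distances of at most n / (k + 1), so the error is at most L n
  / (k + 1) everywhere, and it vanishes outside the ball of radius R + n + 1.\<close>

lemma appr_Lipschitz:
  assumes L: "\<And>x y. x \<in> Rn n \<Longrightarrow> y \<in> Rn n \<Longrightarrow> \<bar>g x - g y\<bar> \<le> L * dist_n n x y" "L \<ge> 0"
    and R: "\<And>x. x \<in> Rn n \<Longrightarrow> dist_n n (origin n) x > R \<Longrightarrow> g x = 0"
  shows "appr n g"
proof -
  have cont: "continuous_map (top_Rn n) euclideanreal g" by (rule continuous_Lipschitz[OF L(1)])
  have cc: "cc n g" unfolding cc_def using cont R by blast
  have i: "integrable (bor n) g" by (rule cc_integrable[OF cc])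
  let ?B = "ball_n n (origin n) (R + real n + 1)"
  define V where "V = measure (bor n) ?B"
  have pt: "\<bar>conv0 n k g x - g x\<bar> \<le> L * real n / real (Suc k) * indicator ?B x" if x: "x \<in> Rn n" for x k
  proof -
    have "conv0 n k g x - g x = (LINT y|bor n. rho n k (\<lambda>_. 0) x y * g y) - (LINT y|bor n. rho n k (\<lambda>_. 0) x y * g x)"
      using rho_integral[OF x] by (simp add: conv_def)
    also have "\<dots> = (LINT y|bor n. rho n k (\<lambda>_. 0) x y * (g y - g x))"
      using rho_integral[OF x] conv_integrable[OF i x, of k "\<lambda>_. 0"] by (simp add: right_diff_distrib)
    finally have e: "conv0 n k g x - g x = (LINT y|bor n. rho n k (\<lambda>_. 0) x y * (g y - g x))" .
    have i2: "integrable (bor n) (\<lambda>y. rho n k (\<lambda>_. 0) x y * (g y - g x))"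
      using rho_integral[OF x] conv_integrable[OF i x, of k "\<lambda>_. 0"] by (simp add: right_diff_distrib)
    show ?thesis
    proof (cases "x \<in> ?B")
      case True
      have "\<bar>conv0 n k g x - g x\<bar> \<le> (LINT y|bor n. \<bar>rho n k (\<lambda>_. 0) x y * (g y - g x)\<bar>)"
        unfolding e using integral_norm_bound[of "bor n" "\<lambda>y. rho n k (\<lambda>_. 0) x y * (g y - g x)"] by simp
      also have "\<dots> \<le> (LINT y|bor n. rho n k (\<lambda>_. 0) x y * (L * real n / real (Suc k)))"
      proof (rule integral_mono[OF integrable_abs[OF i2]])
        show "integrable (bor n) (\<lambda>y. rho n k (\<lambda>_. 0) x y * (L * real n / real (Suc k)))"
          using rho_integral[OF x] by simp
        fix y assume "y \<in> space (bor n)"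
        then have y: "y \<in> Rn n" by (simp add: space_bor)
        show "\<bar>rho n k (\<lambda>_. 0) x y * (g y - g x)\<bar> \<le> rho n k (\<lambda>_. 0) x y * (L * real n / real (Suc k))"
        proof (cases "rho n k (\<lambda>_. 0) x y = 0")
          case False
          have "\<bar>g y - g x\<bar> \<le> L * dist_n n x y" using L(1)[OF x y] by (simp add: abs_minus_commute)
          also have "\<dots> \<le> L * (real n / real (Suc k))" by (intro mult_left_mono rho_support[OF False] L)
          finally have "\<bar>g y - g x\<bar> \<le> L * real n / real (Suc k)" by simp
          from mult_left_mono[OF this rho_nonneg[of n k x y]] show ?thesis by (simp add: abs_mult rho_nonneg)
        qed simp
      qed
      also have "\<dots> = L * real n / real (Suc k)" using rho_integral[OF x] by simp
      finally show ?thesis using True by simp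
    next
      case False
      then have d: "dist_n n (origin n) x \<ge> R + real n + 1" using x by (auto simp: ball_n_def)
      have z: "rho n k (\<lambda>_. 0) x y * (g y - g x) = 0" if "y \<in> Rn n" for y
      proof (cases "rho n k (\<lambda>_. 0) x y = 0")
        case False
        have "real n / real (Suc k) \<le> real n" by (simp add: divide_le_eq mult_le_cancel_left1)
        then have "dist_n n x y \<le> real n" using rho_support[OF False] by linarith
        then have "dist_n n (origin n) y > R" using dist_n_triangle[of n "origin n" x y] d by (simp add: dist_n_commute[of n y x])
        then show ?thesis using R[OF that] R[OF x] d by simp
      qed simp
      have "(LINT y|bor n. rho n k (\<lambda>_. 0) x y * (g y - g x)) = (LINT y|bor n. 0)"
        by (rule Bochner_Integration.integral_cong) (use z in \<open>auto simp: space_bor\<close>)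
      then show ?thesis using False e by simp
    qed
  qed
  have "nrm (bor n) 1 (\<lambda>x. conv0 n k g x - g x) \<le> L * real n * V / real (Suc k)" for k
  proof -
    have "nrm (bor n) 1 (\<lambda>x. conv0 n k g x - g x) \<le> (LINT x|bor n. L * real n / real (Suc k) * indicator ?B x)"
      unfolding nrm_1
    proof (rule integral_mono)
      show "integrable (bor n) (\<lambda>x. \<bar>conv0 n k g x - g x\<bar>)"
        using conv0_Lq[of 1 n g k] i by (simp add: Lq_1)
      show "integrable (bor n) (\<lambda>x. L * real n / real (Suc k) * indicator ?B x)"
        using ball_finite[of n "origin n" "R + real n + 1"] by (intro integrable_mult_right integrable_real_indicator) auto
    qed (use pt in \<open>simp add: space_bor\<close>)
    then show ?thesis by (simp add: V_def)
  qed
  then have "\<forall>\<^sub>F k in sequentially. norm (nrm (bor n) 1 (\<lambda>x. conv0 n k g x - g x)) \<le> L * real n * V / real (Suc k)"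
    by (intro eventuallyI) simp
  moreover have "(\<lambda>k. L * real n * V / real (Suc k)) \<longlonglongrightarrow> 0"
    by (rule LIMSEQ_Suc[OF lim_const_over_n])
  ultimately show ?thesis unfolding appr_def using i by (auto intro: Lim_null_comparison)
qed

definition box_n :: "nat \<Rightarrow> (nat \<Rightarrow> real) \<Rightarrow> (nat \<Rightarrow> real) \<Rightarrow> (nat \<Rightarrow> real) set" where
  "box_n n c d = (\<Pi>\<^sub>E i\<in>{..<n}. {c i<..<d i})"

lemma mem_box_n: "x \<in> box_n n c d \<longleftrightarrow> x \<in> Rn n \<and> (\<forall>i\<in>{..<n}. x i \<in> {c i<..<d i})"
  unfolding box_n_def Rn_def PiE_iff by blast

lemma box_sets: "box_n n c d \<in> sets (bor n)"
  unfolding box_n_def by (rule sets_PiM_I_finite) auto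

lemma box_finite: "emeasure (bor n) (box_n n c d) < \<infinity>"
proof -
  have "emeasure (bor n) (box_n n c d) = (\<Prod>i<n. emeasure lborel {c i<..<d i})"
    unfolding box_n_def by (rule lbs.emeasure_PiM) auto
  also have "\<dots> < \<infinity>"
  proof -
    have "emeasure lborel {c i<..<d i} \<noteq> top" for i
      using emeasure_lborel_box_finite[of "c i" "d i"] by (simp add: less_top)
    then show ?thesis by (simp add: less_top[symmetric] ennreal_prod_eq_top)
  qed
  finally show ?thesis .
qed

text \<open>Products of trapezoids of slope m, clipped to [0, 1], are Lipschitz, stay below the
  indicator of the open box and tend to it pointwise.\<close>

lemma appr_box: "appr n (indicator (box_n n c d))"
proof -
  define h where "h m i t = max 0 (min 1 (real m * min (t - c i) (d i - t)))" for m i t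
  have h01: "0 \<le> h m i t" "h m i t \<le> 1" for m i t by (auto simp: h_def)
  have hz: "h m i t = 0" if "t \<notin> {c i<..<d i}" for m i t
  proof -
    have "min (t - c i) (d i - t) \<le> 0" using that by (auto simp: min_le_iff_disj)
    then have "real m * min (t - c i) (d i - t) \<le> 0" by (simp add: mult_nonneg_nonpos)
    then show ?thesis by (simp add: h_def)
  qed
  have hL: "\<bar>h m i s - h m i t\<bar> \<le> real m * \<bar>s - t\<bar>" for m i s t
  proof -
    have "\<bar>h m i s - h m i t\<bar> \<le> \<bar>real m * min (s - c i) (d i - s) - real m * min (t - c i) (d i - t)\<bar>"
      unfolding h_def by (simp add: max_def min_def)
    also have "\<dots> = real m * \<bar>min (s - c i) (d i - s) - min (t - c i) (d i - t)\<bar>"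
      by (simp add: abs_mult flip: right_diff_distrib)
    also have "\<dots> \<le> real m * \<bar>s - t\<bar>" by (intro mult_left_mono) (auto simp: min_def)
    finally show ?thesis .
  qed
  have hlim: "(\<lambda>m. h m i t) \<longlonglongrightarrow> indicator {c i<..<d i} t" for i t
  proof (cases "t \<in> {c i<..<d i}")
    case True
    then have p: "min (t - c i) (d i - t) > 0" by auto
    then obtain M where M: "real M * min (t - c i) (d i - t) > 1" using reals_Archimedean3 by blast
    have "h m i t = 1" if "m \<ge> M" for m
    proof -
      have "real m * min (t - c i) (d i - t) \<ge> real M * min (t - c i) (d i - t)" using that p by (intro mult_right_mono) auto
      then have "real m * min (t - c i) (d i - t) \<ge> 1" using M by linarith
      then show ?thesis by (simp add: h_def)
    qed
    then show ?thesis using True by (intro tendsto_eventually) (auto simp: eventually_sequentially)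
  next
    case False
    then show ?thesis using hz by simp
  qed
  show ?thesis
  proof (rule appr_dominated[where g = "\<lambda>m x. \<Prod>i<n. h m i (x i)" and h = "indicator (box_n n c d)"])
    show "integrable (bor n) (indicator (box_n n c d) :: _ \<Rightarrow> real)" using box_sets box_finite by (intro integrable_real_indicator) auto
    show "indicator (box_n n c d) \<in> borel_measurable (bor n)" using box_sets by simp
    have ind: "indicator (box_n n c d) x = (\<Prod>i<n. indicator {c i<..<d i} (x i) :: real)" if xR: "x \<in> Rn n" for x
    proof (cases "x \<in> box_n n c d")
      case True
      then show ?thesis by (simp add: mem_box_n)
    next
      case False
      then obtain i where "i < n" "x i \<notin> {c i<..<d i}" using xR by (auto simp: mem_box_n)
      then show ?thesis using False by (subst prod_zero) (auto intro!: bexI[of _ i])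
    qed
    fix x assume x: "x \<in> Rn n"
    show "(\<lambda>m. \<Prod>i<n. h m i (x i)) \<longlonglongrightarrow> indicator (box_n n c d) x"
      unfolding ind[OF x] by (intro tendsto_prod hlim)
    show "\<bar>\<Prod>i<n. h m i (x i)\<bar> \<le> indicator (box_n n c d) x" for m
      unfolding ind[OF x] abs_prod
    proof (intro prod_mono conjI)
      fix i show "\<bar>h m i (x i)\<bar> \<le> indicator {c i<..<d i} (x i)"
        using h01[of m i "x i"] hz[of "x i" i m] by (auto simp: indicator_def)
    qed auto
  next
    fix m
    show "appr n (\<lambda>x. \<Prod>i<n. h m i (x i))"
    proof (rule appr_Lipschitz[where L = "real m * real n" and R = "\<Sum>i<n. \<bar>c i\<bar> + \<bar>d i\<bar>"])
      fix x y
      have "\<bar>(\<Prod>i<n. h m i (x i)) - (\<Prod>i<n. h m i (y i))\<bar> \<le> (\<Sum>i<n. \<bar>h m i (x i) - h m i (y i)\<bar>)"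
        using norm_prod_diff[of "{..<n}" "\<lambda>i. h m i (x i)" "\<lambda>i. h m i (y i)"] h01 by simp
      also have "\<dots> \<le> (\<Sum>i<n. real m * dist_n n x y)"
        using coord_le_dist_n[of _ n x y] by (intro sum_mono order_trans[OF hL] mult_left_mono) auto
      finally show "\<bar>(\<Prod>i<n. h m i (x i)) - (\<Prod>i<n. h m i (y i))\<bar> \<le> real m * real n * dist_n n x y" by (simp add: mult_ac)
    next
      fix x assume x: "x \<in> Rn n" "dist_n n (origin n) x > (\<Sum>i<n. \<bar>c i\<bar> + \<bar>d i\<bar>)"
      have "\<exists>i<n. x i \<notin> {c i<..<d i}"
      proof (rule ccontr)
        assume "\<not> ?thesis"
        then have "\<bar>origin n i - x i\<bar> \<le> \<bar>c i\<bar> + \<bar>d i\<bar>" if "i < n" for i using that by (force simp: origin_def)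
        then have "dist_n n (origin n) x \<le> (\<Sum>i<n. \<bar>c i\<bar> + \<bar>d i\<bar>)"
          by (intro order_trans[OF dist_n_le_sum sum_mono]) auto
        then show False using x by simp
      qed
      then show "(\<Prod>i<n. h m i (x i)) = 0" using hz by (intro prod_zero) auto
    qed simp
  qed
qed

text \<open>Boxes with open intervals as sides generate the product sigma-algebra because the real
  line is a countable union of such intervals. They form the generator for a Dynkin
  argument.\<close>

lemma sets_bor_boxes: "sets (bor n) = sigma_sets (Rn n) (range (\<lambda>(c, d). box_n n c d))"
proof -
  let ?E = "range (\<lambda>(a, b). {a<..<b :: real})"
  have 1: "sets (bor n) = sets (\<Pi>\<^sub>M i\<in>{..<n}. Sigma_Algebra.sigma UNIV ?E)"
    by (rule sets_PiM_cong[OF refl]) (use borel_eq_box[where 'a = real] in \<open>simp only: box_real sets_lborel\<close>)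
  have cover: "\<exists>S\<subseteq>?E. countable S \<and> UNIV = \<Union>S"
  proof (intro exI[of _ "range (\<lambda>m::nat. {- real m<..<real m})"] conjI)
    show "UNIV = \<Union>(range (\<lambda>m::nat. {- real m<..<real m}))"
    proof (intro equalityI subsetI)
      fix x :: real
      obtain m :: nat where "\<bar>x\<bar> < real m" using reals_Archimedean2 by blast
      then show "x \<in> \<Union>(range (\<lambda>m::nat. {- real m<..<real m}))" by (auto simp: abs_less_iff intro!: exI[of _ m])
    qed simp
  qed auto
  define P where "P = {{f \<in> (\<Pi>\<^sub>E i\<in>{..<n}. UNIV). \<forall>i\<in>j. f i \<in> A i} | A j. j \<in> {{..<n}} \<and> A \<in> Pi j (\<lambda>_. ?E)}"
  have 2: "sets (\<Pi>\<^sub>M i\<in>{..<n}. Sigma_Algebra.sigma UNIV ?E) = sets (Sigma_Algebra.sigma (\<Pi>\<^sub>E i\<in>{..<n}. UNIV) P)"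
    unfolding P_def by (rule sets_PiM_sigma) (use cover in auto)
  have 3: "P = range (\<lambda>(c, d). box_n n c d)"
  proof (intro equalityI subsetI)
    fix B assume "B \<in> P"
    then obtain A where A: "B = {f \<in> (\<Pi>\<^sub>E i\<in>{..<n}. UNIV). \<forall>i\<in>{..<n}. f i \<in> A i}" "A \<in> Pi {..<n} (\<lambda>_. ?E)" by (auto simp: P_def)
    have "\<forall>i\<in>{..<n}. \<exists>c d. A i = {c<..<d}"
    proof
      fix i assume "i \<in> {..<n}"
      then have "A i \<in> ?E" using A(2) by (rule Pi_mem[rotated])
      then show "\<exists>c d. A i = {c<..<d}" by auto
    qed
    from bchoice[OF this] obtain c where "\<forall>i\<in>{..<n}. \<exists>d. A i = {c i<..<d}" by (elim exE)
    from bchoice[OF this] obtain d where cd: "\<forall>i\<in>{..<n}. A i = {c i<..<d i}" by (elim exE)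
    have "(\<forall>i\<in>{..<n}. f i \<in> A i) = (\<forall>i\<in>{..<n}. f i \<in> {c i<..<d i})" for f
      by (rule ball_cong[OF refl]) (simp only: bspec[OF cd])
    then have "B = {f \<in> (\<Pi>\<^sub>E i\<in>{..<n}. UNIV). \<forall>i\<in>{..<n}. f i \<in> {c i<..<d i}}" unfolding A(1) by (simp only:)
    also have "\<dots> = box_n n c d" unfolding PiE_UNIV_Rn by (rule set_eqI) (simp only: mem_box_n mem_Collect_eq)
    finally have "B = box_n n c d" .
    then show "B \<in> range (\<lambda>(c, d). box_n n c d)" by auto
  next
    fix B assume "B \<in> range (\<lambda>(c, d). box_n n c d)"
    then obtain c d where B: "B = box_n n c d" by auto
    have "B = {f \<in> (\<Pi>\<^sub>E i\<in>{..<n}. UNIV). \<forall>i\<in>{..<n}. f i \<in> (\<lambda>i. {c i<..<d i}) i}"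
      unfolding B PiE_UNIV_Rn by (rule set_eqI) (simp only: mem_box_n mem_Collect_eq)
    moreover have "(\<lambda>i. {c i<..<d i}) \<in> Pi {..<n} (\<lambda>_. ?E)" by auto
    ultimately show "B \<in> P" unfolding P_def mem_Collect_eq
      by (intro exI[of _ "\<lambda>i. {c i<..<d i}"] exI[of _ "{..<n}"] conjI singletonI)
  qed
  have "P \<subseteq> Pow (Rn n)" unfolding 3 by (auto simp: mem_box_n)
  then have "sets (Sigma_Algebra.sigma (\<Pi>\<^sub>E i\<in>{..<n}. UNIV) P) = sigma_sets (Rn n) P" by simp
  then show ?thesis using 1 2 3 by simp
qed

text \<open>A Dynkin argument on the intersection-stable generator of boxes. Everything is
  intersected with one fixed box, so that complements remain integrable.\<close>

lemma appr_sets_box: 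
  assumes "A \<in> sets (bor n)" shows "appr n (indicator (A \<inter> box_n n c d))"
proof -
  let ?Q = "box_n n c d" and ?G = "range (\<lambda>(c, d). box_n n c d)"
  have inter: "box_n n c d \<inter> box_n n c' d' = box_n n (\<lambda>i. max (c i) (c' i)) (\<lambda>i. min (d i) (d' i))" for c d c' d'
    by (rule set_eqI) (auto simp: mem_box_n)
  have sub: "?G \<subseteq> Pow (Rn n)" by (auto simp: mem_box_n)
  have st: "Int_stable ?G" unfolding Int_stable_def using inter by auto
  have ms: "B \<in> sets (bor n)" if "B \<in> sigma_sets (Rn n) ?G" for B using that sets_bor_boxes by simp
  have "A \<in> sigma_sets (Rn n) ?G" using assms sets_bor_boxes by simp
  from st sub this show ?thesis
  proof (induction rule: sigma_sets_induct_disjoint)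
    case (basic A)
    then show ?case using inter by (auto simp: appr_box)
  next
    case empty
    have "appr n (\<lambda>x. 0 * indicator ?Q x)" by (rule appr_cmult[OF appr_box])
    then show ?case by (rule appr_cong) simp
  next
    case (compl A)
    have "appr n (\<lambda>x. indicator ?Q x + (-1) * indicator (A \<inter> ?Q) x)"
      by (intro appr_add appr_cmult appr_box compl)
    then show ?case by (rule appr_cong) (auto simp: indicator_def)
  next
    case (union A)
    show ?case
    proof (rule appr_dominated[where g = "\<lambda>m. indicator ((\<Union>i<m. A i) \<inter> ?Q)" and h = "indicator ?Q"])
      show "integrable (bor n) (indicator ?Q :: _ \<Rightarrow> real)" using box_sets box_finite by (intro integrable_real_indicator) auto
      have "range A \<subseteq> sets (bor n)" using union(2) sets_bor_boxes by simp
      then show "indicator (\<Union> (range A) \<inter> ?Q) \<in> borel_measurable (bor n)"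
        using box_sets by (intro borel_measurable_indicator sets.Int sets.countable_UN) auto
      show "appr n (indicator ((\<Union>i<m. A i) \<inter> ?Q))" for m
      proof (induction m)
        case 0
        have "appr n (\<lambda>x. 0 * indicator ?Q x)" by (rule appr_cmult[OF appr_box])
        then show ?case by (rule appr_cong) simp
      next
        case (Suc m)
        have "appr n (\<lambda>x. indicator ((\<Union>i<m. A i) \<inter> ?Q) x + indicator (A m \<inter> ?Q) x)"
          by (intro appr_add Suc union)
        moreover have "A m \<inter> A i = {}" if "i < m" for i
          using union(1) that unfolding disjoint_family_on_def by (metis UNIV_I less_irrefl)
        then have "A m \<inter> (\<Union>i<m. A i) = {}" by auto
        ultimately show ?case by (elim appr_cong) (auto simp: indicator_def lessThan_Suc)
      qed
      fix x assume "x \<in> Rn n"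
      show "(\<lambda>m. indicator ((\<Union>i<m. A i) \<inter> ?Q) x) \<longlonglongrightarrow> (indicator (\<Union> (range A) \<inter> ?Q) x :: real)"
        using tendsto_mult[OF LIMSEQ_indicator_UN[of A x] tendsto_const[of "indicator ?Q x"]]
        by (simp add: indicator_inter_arith)
      show "\<bar>indicator ((\<Union>i<m. A i) \<inter> ?Q) x\<bar> \<le> (indicator ?Q x :: real)" for m by (auto simp: indicator_def)
    qed
  qed
qed

lemma appr_finite_measure:
  assumes A: "A \<in> sets (bor n)" "emeasure (bor n) A < \<infinity>" shows "appr n (indicator A)"
proof (rule appr_dominated[where g = "\<lambda>m. indicator (A \<inter> box_n n (\<lambda>_. - real m) (\<lambda>_. real m))" and h = "indicator A"])
  show "appr n (indicator (A \<inter> box_n n (\<lambda>_. - real m) (\<lambda>_. real m)))" for m by (rule appr_sets_box[OF A(1)])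
  show "integrable (bor n) (indicator A :: _ \<Rightarrow> real)" using A by (intro integrable_real_indicator) auto
  fix x assume x: "x \<in> Rn n"
  obtain M :: nat where M: "(\<Sum>i<n. \<bar>x i\<bar>) < real M" using reals_Archimedean2 by blast
  have "x \<in> box_n n (\<lambda>_. - real m) (\<lambda>_. real m)" if "m \<ge> M" for m
  proof -
    have "x i \<in> {- real m<..<real m}" if "i < n" for i
    proof -
      have "\<bar>x i\<bar> \<le> (\<Sum>i<n. \<bar>x i\<bar>)" using that by (intro member_le_sum) auto
      then have "\<bar>x i\<bar> < real m" using M \<open>m \<ge> M\<close> by linarith
      then show ?thesis by (auto simp: abs_less_iff)
    qed
    then show ?thesis using x by (simp add: mem_box_n)
  qed
  then show "(\<lambda>m. indicator (A \<inter> box_n n (\<lambda>_. - real m) (\<lambda>_. real m)) x) \<longlonglongrightarrow> (indicator A x :: real)"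
    by (intro tendsto_eventually) (auto simp: eventually_sequentially indicator_def intro!: exI[of _ M])
qed (use A in \<open>auto simp: indicator_def\<close>)

lemma appr_integrable: "integrable (bor n) f \<Longrightarrow> appr n f"
proof (induction rule: integrable_induct)
  case (base A c)
  have "appr n (\<lambda>x. c * indicator A x)" by (intro appr_cmult appr_finite_measure base)
  then show ?case by (rule appr_cong) simp
next
  case (add f g)
  then show ?case by (intro appr_add)
next
  case (lim f s)
  show ?case
    by (rule appr_dominated[where g = s and h = "\<lambda>x. 2 * norm (f x)"]) (use lim in \<open>auto simp: space_bor\<close>)
qed

text \<open>For a function bounded by m the error D satisfies |D|^q <= (2 m)^(q-1) |D|, which turns
  convergence in L^1 into convergence in L^q. Truncation at height m reaches the general case
  through \<open>conv_limit_closed\<close>.\<close>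

lemma conv_Lq_tendsto:
  assumes q: "q \<ge> 1" and f: "integrable (bor n) f" "f \<in> Lq (bor n) q"
  shows "(\<lambda>k. nrm (bor n) q (\<lambda>x. conv0 n k f x - f x)) \<longlonglongrightarrow> 0"
proof -
  define g where "g m x = max (- real m) (min (real m) (f x))" for m :: nat and x
  have fm: "f \<in> borel_measurable (bor n)" using f by auto
  have gm: "g m \<in> borel_measurable (bor n)" for m unfolding g_def[abs_def] using fm by measurable
  have gb: "\<bar>g m x\<bar> \<le> \<bar>f x\<bar>" "\<bar>g m x\<bar> \<le> real m" "\<bar>f x - g m x\<bar> \<le> \<bar>f x\<bar>" for m x by (auto simp: g_def)
  have gi: "integrable (bor n) (g m)" for m
    by (rule Bochner_Integration.integrable_bound[OF f(1) gm]) (use gb in auto)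
  have gL: "g m \<in> Lq (bor n) q" for m
    by (rule Lq_bound(1)[OF f(2) gm, where C = 1]) (use gb q in auto)
  show ?thesis
  proof (rule conv_limit_closed[OF q f(1) gi f(2) gL])
    fix m
    let ?D = "\<lambda>k x. conv0 n k (g m) x - g m x"
    have b: "\<bar>?D k x\<bar> \<le> 2 * real m" if x: "x \<in> Rn n" for k x
    proof -
      have "\<bar>conv0 n k (g m) x\<bar> \<le> (LINT y|bor n. \<bar>rho n k (\<lambda>_. 0) x y * g m y\<bar>)"
        using integral_norm_bound[of "bor n" "\<lambda>y. rho n k (\<lambda>_. 0) x y * g m y"] by (simp add: conv_def)
      also have "\<dots> \<le> (LINT y|bor n. rho n k (\<lambda>_. 0) x y * real m)"
        by (rule integral_mono[OF integrable_abs[OF conv_integrable[OF gi x]]])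
           (use rho_integral[OF x] gb in \<open>auto simp: abs_mult rho_nonneg intro!: mult_left_mono\<close>)
      also have "\<dots> = real m" using rho_integral[OF x] by simp
      finally show ?thesis using gb(2)[of m x] by linarith
    qed
    have L1: "(\<lambda>k. nrm (bor n) 1 (?D k)) \<longlonglongrightarrow> 0" using appr_integrable[OF gi, of m] by (simp add: appr_def)
    have "nrm (bor n) q (?D k) \<le> ((2 * real m) powr (q - 1) * nrm (bor n) 1 (?D k)) powr (1 / q)" for k
    proof -
      have i1: "integrable (bor n) (?D k)" using conv0_Lq[of 1 n "g m" k] gi by (simp add: Lq_1)
      have "(LINT x|bor n. \<bar>?D k x\<bar> powr q) \<le> (LINT x|bor n. (2 * real m) powr (q - 1) * \<bar>?D k x\<bar>)"
      proof (rule integral_mono)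
        show "integrable (bor n) (\<lambda>x. \<bar>?D k x\<bar> powr q)" using LqD(2)[OF conv0_Lq[OF q gi gL]] .
        fix x assume "x \<in> space (bor n)"
        then have x: "x \<in> Rn n" by (simp add: space_bor)
        have "\<bar>?D k x\<bar> powr q = \<bar>?D k x\<bar> powr (q - 1) * \<bar>?D k x\<bar>"
          using powr_add[of "\<bar>?D k x\<bar>" "q - 1" 1] by simp
        also have "\<dots> \<le> (2 * real m) powr (q - 1) * \<bar>?D k x\<bar>"
          using b[OF x] q by (intro mult_right_mono powr_mono2) auto
        finally show "\<bar>?D k x\<bar> powr q \<le> (2 * real m) powr (q - 1) * \<bar>?D k x\<bar>" .
      qed (use i1 in auto)
      also have "\<dots> = (2 * real m) powr (q - 1) * nrm (bor n) 1 (?D k)" by (simp add: nrm_1)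
      finally show ?thesis unfolding nrm_def[of _ q] using q
        by (intro powr_mono2) (auto intro!: Bochner_Integration.integral_nonneg)
    qed
    then have ev: "\<forall>\<^sub>F k in sequentially. norm (nrm (bor n) q (?D k)) \<le> ((2 * real m) powr (q - 1) * nrm (bor n) 1 (?D k)) powr (1 / q)"
      by (intro eventuallyI) simp
    have "(\<lambda>k. (2 * real m) powr (q - 1) * nrm (bor n) 1 (?D k)) \<longlonglongrightarrow> 0"
      using tendsto_mult_right_zero[OF L1] by simp
    then have "(\<lambda>k. ((2 * real m) powr (q - 1) * nrm (bor n) 1 (?D k)) powr (1 / q)) \<longlonglongrightarrow> 0 powr (1 / q)"
      using q by (intro tendsto_powr' tendsto_const) auto
    then show "(\<lambda>k. nrm (bor n) q (?D k)) \<longlonglongrightarrow> 0" using Lim_null_comparison[OF ev] by simp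
  next
    have "(\<lambda>m. LINT x|bor n. \<bar>f x - g m x\<bar> powr q) \<longlonglongrightarrow> (LINT x|bor n. 0)"
    proof (rule integral_dominated_convergence[where w = "\<lambda>x. \<bar>f x\<bar> powr q"])
      show "AE x in bor n. (\<lambda>m. \<bar>f x - g m x\<bar> powr q) \<longlonglongrightarrow> 0"
      proof (rule AE_I2)
        fix x
        obtain M :: nat where M: "\<bar>f x\<bar> < real M" using reals_Archimedean2 by blast
        have "g m x = f x" if "m \<ge> M" for m using M that by (auto simp: g_def)
        then show "(\<lambda>m. \<bar>f x - g m x\<bar> powr q) \<longlonglongrightarrow> 0"
          by (intro tendsto_eventually) (auto simp: eventually_sequentially intro!: exI[of _ M])
      qed
      fix m show "AE x in bor n. norm (\<bar>f x - g m x\<bar> powr q) \<le> \<bar>f x\<bar> powr q"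
        using gb(3)[of _ m] q by (intro AE_I2) (auto intro: powr_mono2)
    qed (use fm gm LqD(2)[OF f(2)] in auto)
    then have "(\<lambda>m. (LINT x|bor n. \<bar>f x - g m x\<bar> powr q) powr (1 / q)) \<longlonglongrightarrow> 0 powr (1 / q)"
      using q by (intro tendsto_powr' tendsto_const) (auto intro!: always_eventually Bochner_Integration.integral_nonneg)
    then show "(\<lambda>m. nrm (bor n) q (\<lambda>x. f x - g m x)) \<longlonglongrightarrow> 0" by (simp add: nrm_def)
  qed
qed

section \<open>Weak derivatives\<close>

lemma leb_completion: "leb n = completion (bor n)"
  by (simp add: leb_def)

lemma AE_leb_iff: "(AE x in leb n. P x) \<longleftrightarrow> (AE x in bor n. P x)"
  unfolding leb_completion by (rule AE_completion_iff)

lemma measurable_leb: "f \<in> borel_measurable (bor n) \<Longrightarrow> f \<in> borel_measurable (leb n)"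
  by (simp add: leb_completion measurable_completion)

lemma leb_integral_eq:
  fixes f g :: "(nat \<Rightarrow> real) \<Rightarrow> real"
  assumes "f \<in> borel_measurable (leb n)" "g \<in> borel_measurable (bor n)" "AE x in bor n. f x = g x"
  shows "integral\<^sup>L (leb n) f = integral\<^sup>L (bor n) g" "integrable (leb n) f \<longleftrightarrow> integrable (bor n) g"
proof -
  have ae: "AE x in leb n. f x = g x" using assms(3) by (simp add: AE_leb_iff)
  have "integral\<^sup>L (leb n) f = integral\<^sup>L (leb n) g"
    by (rule integral_cong_AE[OF assms(1) measurable_leb[OF assms(2)] ae])
  then show "integral\<^sup>L (leb n) f = integral\<^sup>L (bor n) g"
    using assms(2) by (simp add: leb_completion integral_completion)
  have "integrable (leb n) f \<longleftrightarrow> integrable (leb n) g"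
    by (rule integrable_cong_AE[OF assms(1) measurable_leb[OF assms(2)] ae])
  then show "integrable (leb n) f \<longleftrightarrow> integrable (bor n) g"
    using assms(2) by (simp add: leb_completion integrable_completion)
qed

text \<open>The functions in the Sobolev spaces are measurable for the completion on U and arbitrary
  outside. A representative is Borel on the whole space and zero off U, which is the form that
  product integrals and convolutions require.\<close>

definition brep :: "nat \<Rightarrow> (nat \<Rightarrow> real) set \<Rightarrow> ((nat \<Rightarrow> real) \<Rightarrow> real) \<Rightarrow> ((nat \<Rightarrow> real) \<Rightarrow> real) \<Rightarrow> bool" where
  "brep n U f g \<longleftrightarrow> set_borel_measurable (leb n) U f \<and> g \<in> borel_measurable (bor n) \<and>
     (\<forall>x. x \<notin> U \<longrightarrow> g x = 0) \<and> (AE x in bor n. x \<in> U \<longrightarrow> f x = g x)"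

lemma brepD:
  assumes "brep n U f g"
  shows "set_borel_measurable (leb n) U f" "g \<in> borel_measurable (bor n)" "\<And>x. x \<notin> U \<Longrightarrow> g x = 0" "AE x in bor n. x \<in> U \<longrightarrow> f x = g x"
  using assms by (auto simp: brep_def)

lemma brep_exists:
  assumes "set_borel_measurable (leb n) U f" "U \<in> sets (bor n)"
  obtains g where "brep n U f g"
proof -
  have "(\<lambda>x. indicator U x *\<^sub>R f x) \<in> borel_measurable (completion (bor n))"
    using assms(1) unfolding set_borel_measurable_def leb_completion .
  from completion_ex_borel_measurable_real[OF this]
  obtain g' where g': "g' \<in> borel_measurable (bor n)" "AE x in bor n. indicator U x *\<^sub>R f x = g' x" by blast
  have "brep n U f (\<lambda>x. indicator U x * g' x)"
    unfolding brep_def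
  proof (intro conjI)
    show "(\<lambda>x. indicator U x * g' x) \<in> borel_measurable (bor n)" using g'(1) assms(2) by simp
    show "AE x in bor n. x \<in> U \<longrightarrow> f x = indicator U x * g' x"
      using g'(2) by eventually_elim auto
  qed (use assms in auto)
  then show ?thesis using that by blast
qed

lemma brep_integral_mult:
  assumes g: "brep n U f g" and h: "h \<in> borel_measurable (bor n)"
  shows "(LINT x:U|leb n. f x * h x) = (LINT x|bor n. g x * h x)"
  unfolding set_lebesgue_integral_def
proof (rule leb_integral_eq(1))
  have "(\<lambda>x. (indicator U x *\<^sub>R f x) * h x) \<in> borel_measurable (leb n)"
    using brepD(1)[OF g] measurable_leb[OF h] by (simp add: set_borel_measurable_def)
  then show "(\<lambda>x. indicator U x *\<^sub>R (f x * h x)) \<in> borel_measurable (leb n)" by (simp add: mult.assoc)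
  show "AE x in bor n. indicator U x *\<^sub>R (f x * h x) = g x * h x"
    using brepD(4)[OF g] by eventually_elim (use brepD(3)[OF g] in \<open>auto simp: indicator_def\<close>)
qed (use brepD(2)[OF g] h in auto)

lemma brep_sub:
  assumes g: "brep n U f g" and W: "W \<in> sets (bor n)" "W \<subseteq> U"
  shows "brep n W f (\<lambda>x. indicator W x * g x)"
proof -
  have "(\<lambda>x. indicator W x * (indicator U x *\<^sub>R f x)) \<in> borel_measurable (leb n)"
    using brepD(1)[OF g] measurable_leb[of "indicator W" n] W by (intro borel_measurable_times) (auto simp: set_borel_measurable_def)
  moreover have "(\<lambda>x. indicator W x * (indicator U x *\<^sub>R f x)) = (\<lambda>x. indicator W x *\<^sub>R f x)"
    using W(2) by (auto simp: indicator_def fun_eq_iff)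
  moreover have "AE x in bor n. x \<in> W \<longrightarrow> f x = indicator W x * g x"
    using brepD(4)[OF g] by eventually_elim (use W in auto)
  ultimately show ?thesis using brepD(2)[OF g] W by (simp add: brep_def set_borel_measurable_def)
qed

lemma brep_integral_comp:
  assumes g: "brep n U f g" and h: "h \<in> borel_measurable borel" "h 0 = (0::real)"
  shows "(LINT x:U|leb n. h (f x)) = (LINT x|bor n. h (g x))"
    "set_integrable (leb n) U (\<lambda>x. h (f x)) \<longleftrightarrow> integrable (bor n) (\<lambda>x. h (g x))"
proof -
  have e: "indicator U x *\<^sub>R h (f x) = h (indicator U x *\<^sub>R f x)" for x using h(2) by (auto simp: indicator_def)
  have 1: "(\<lambda>x. indicator U x *\<^sub>R h (f x)) \<in> borel_measurable (leb n)"
    unfolding e using measurable_compose[OF brepD(1)[OF g, unfolded set_borel_measurable_def] h(1)] .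
  have 2: "(\<lambda>x. h (g x)) \<in> borel_measurable (bor n)" using measurable_compose[OF brepD(2)[OF g] h(1)] .
  have 3: "AE x in bor n. indicator U x *\<^sub>R h (f x) = h (g x)"
    using brepD(4)[OF g] by eventually_elim (use brepD(3)[OF g] h(2) in \<open>auto simp: indicator_def\<close>)
  show "(LINT x:U|leb n. h (f x)) = (LINT x|bor n. h (g x))"
    unfolding set_lebesgue_integral_def by (rule leb_integral_eq(1)[OF 1 2 3])
  show "set_integrable (leb n) U (\<lambda>x. h (f x)) \<longleftrightarrow> integrable (bor n) (\<lambda>x. h (g x))"
    unfolding set_integrable_def by (rule leb_integral_eq(2)[OF 1 2 3])
qed

lemma brep_nrm: "q > 0 \<Longrightarrow> brep n U f g \<Longrightarrow> Lp_norm n q U f = nrm (bor n) q g"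
  unfolding Lp_norm_def nrm_def using brep_integral_comp(1)[of n U f g "\<lambda>t. \<bar>t\<bar> powr q"] by simp

lemma brep_Lp: "q > 0 \<Longrightarrow> brep n U f g \<Longrightarrow> f \<in> Lp n q U \<longleftrightarrow> g \<in> Lq (bor n) q"
  using brep_integral_comp(2)[of n U f g "\<lambda>t. \<bar>t\<bar> powr q"] by (auto simp: Lp_def Lq_def brep_def)

lemma brep_integrable: "brep n U f g \<Longrightarrow> set_integrable (leb n) U f \<longleftrightarrow> integrable (bor n) g"
  using brep_integral_comp(2)[of n U f g "\<lambda>t. t"] by auto

lemma brep_diff:
  assumes "brep n U f g" "brep n U f' g'" shows "brep n U (\<lambda>x. f x - f' x) (\<lambda>x. g x - g' x)"
proof -
  have "(\<lambda>x. indicator U x *\<^sub>R f x - indicator U x *\<^sub>R f' x) \<in> borel_measurable (leb n)"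
    using brepD(1)[OF assms(1)] brepD(1)[OF assms(2)] by (auto simp: set_borel_measurable_def)
  then have "set_borel_measurable (leb n) U (\<lambda>x. f x - f' x)" by (simp add: set_borel_measurable_def right_diff_distrib)
  moreover have "AE x in bor n. x \<in> U \<longrightarrow> f x - f' x = g x - g' x"
    using brepD(4)[OF assms(1)] brepD(4)[OF assms(2)] by eventually_elim auto
  ultimately show ?thesis using assms by (auto simp: brep_def)
qed

lemma brep_self:
  assumes "g \<in> borel_measurable (bor n)" "U \<in> sets (bor n)"
  shows "brep n U g (\<lambda>x. indicator U x * g x)"
  using assms measurable_leb[of "\<lambda>x. indicator U x * g x" n] by (auto simp: brep_def set_borel_measurable_def)

lemma brep_cong_AE:
  assumes g: "brep n U f g" and ae: "AE x in bor n. x \<in> U \<longrightarrow> f x = f' x" and f': "set_borel_measurable (leb n) U f'"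
  shows "brep n U f' g"
proof -
  have "AE x in bor n. x \<in> U \<longrightarrow> f' x = g x" using brepD(4)[OF g] ae by eventually_elim auto
  then show ?thesis using g f' by (simp add: brep_def)
qed

lemma brep_test:
  assumes "\<phi> \<in> test_fun n U" "U \<in> sets (bor n)" shows "brep n U \<phi> (\<lambda>x. indicator U x * \<phi> x)"
  by (intro brep_self borel_measurable_continuous_Rn smooth_continuous test_fun_smooth[OF assms(1)] assms(2))

section \<open>Compact exhaustion and uniqueness of weak derivatives\<close>

definition exh :: "nat \<Rightarrow> (nat \<Rightarrow> real) set \<Rightarrow> nat \<Rightarrow> (nat \<Rightarrow> real) set" where
  "exh n U m = {x \<in> Rn n. dist_n n (origin n) x \<le> real m \<and> (\<forall>y\<in>Rn n - U. 1 / real (Suc m) \<le> dist_n n y x)}"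

lemma exh_closed: "closedin (top_Rn n) (exh n U m)"
proof -
  have cl: "closedin (top_Rn n) {x \<in> Rn n. 1 / real (Suc m) \<le> dist_n n y x}" for y
    using closedin_continuous_map_preimage[OF continuous_dist_n[of n y], of "{1 / real (Suc m)..}"] by simp
  show ?thesis
  proof (cases "Rn n - U = {}")
    \<comment> \<open>With no complement points, the intersection used in the other case would run
      over the empty family.\<close>
    case True
    then have "exh n U m = {x \<in> Rn n. dist_n n (origin n) x \<le> real m}" unfolding exh_def by blast
    then show ?thesis by (simp only: closedin_dist_le)
  next
    case False
    have "exh n U m = {x \<in> Rn n. dist_n n (origin n) x \<le> real m} \<inter> \<Inter>((\<lambda>y. {x \<in> Rn n. 1 / real (Suc m) \<le> dist_n n y x}) ` (Rn n - U))"
      unfolding exh_def using False by blast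
    moreover have "closedin (top_Rn n) (\<Inter>((\<lambda>y. {x \<in> Rn n. 1 / real (Suc m) \<le> dist_n n y x}) ` (Rn n - U)))"
      by (rule closedin_Inter) (use False cl in blast)+
    ultimately show ?thesis using closedin_Int[OF closedin_dist_le] by (simp only:)
  qed
qed

lemma exh_compact: "compactin (top_Rn n) (exh n U m)"
  by (rule compactin_closed_bounded[OF exh_closed, where x = "origin n" and r = "real m"]) (simp add: exh_def)

lemma exh_subset: "exh n U m \<subseteq> U"
proof
  fix x assume x: "x \<in> exh n U m"
  show "x \<in> U"
  proof (rule ccontr)
    assume "x \<notin> U"
    then have "1 / real (Suc m) \<le> dist_n n x x" using x unfolding exh_def by blast
    then show False by simp
  qed
qed

lemma exh_sets: "exh n U m \<in> sets (bor n)"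
  by (rule closedin_measurable[OF exh_closed])

lemma exh_covers:
  assumes U: "openin (top_Rn n) U" and x: "x \<in> U" shows "\<exists>M. \<forall>m\<ge>M. x \<in> exh n U m"
proof -
  have xR: "x \<in> Rn n" using openin_subset[OF U] x by auto
  obtain e where e: "e > 0" "ball_n n x e \<subseteq> U" using open_contains_ball_n[OF U x] .
  obtain M1 :: nat where M1: "dist_n n (origin n) x \<le> real M1" using real_arch_simple by blast
  obtain M2 :: nat where M2: "inverse (real (Suc M2)) < e" using reals_Archimedean[OF e(1)] by blast
  have "x \<in> exh n U m" if m: "m \<ge> max M1 M2" for m
  proof -
    have "1 / real (Suc m) \<le> dist_n n y x" if y: "y \<in> Rn n - U" for y
    proof -
      have "1 / real (Suc m) \<le> inverse (real (Suc M2))" using m by (simp add: inverse_eq_divide frac_le)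
      moreover have "e \<le> dist_n n x y" using y e(2) by (force simp: ball_n_def)
      ultimately show ?thesis using M2 by (simp add: dist_n_commute[of n x])
    qed
    then show ?thesis using xR M1 m by (auto simp: exh_def)
  qed
  then show ?thesis by blast
qed

text \<open>Moving by half of the guaranteed distance to the complement keeps the other half. The
  new index fits because 1 / (2 m + 3) <= 1 / (2 m + 2) and m + 1 <= 2 m + 2.\<close>

lemma exh_nbhd:
  assumes x: "x \<in> exh n U m" and y: "y \<in> Rn n" "dist_n n x y \<le> 1 / (2 * real (Suc m))"
  shows "y \<in> exh n U (2 * m + 2)"
proof -
  have "dist_n n x y \<le> 1" using y(2) by (rule order_trans) (simp add: divide_le_eq)
  then have 1: "dist_n n (origin n) y \<le> real (2 * m + 2)"
    using dist_n_triangle[of n "origin n" y x] x by (simp add: exh_def)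
  have "1 / real (Suc (2 * m + 2)) \<le> dist_n n z y" if z: "z \<in> Rn n - U" for z
  proof -
    have "1 / real (Suc m) \<le> dist_n n z x" using x z by (auto simp: exh_def)
    also have "\<dots> \<le> dist_n n z y + dist_n n x y" using dist_n_triangle[of n z x y] by (simp add: dist_n_commute[of n y x])
    finally have "1 / real (Suc m) - 1 / (2 * real (Suc m)) \<le> dist_n n z y" using y(2) by linarith
    moreover have "1 / real (Suc m) - 1 / (2 * real (Suc m)) = 1 / (2 * real (Suc m))" by (simp add: field_simps)
    ultimately have "1 / (2 * real (Suc m)) \<le> dist_n n z y" by (simp only:)
    moreover have "1 / real (Suc (2 * m + 2)) \<le> 1 / (2 * real (Suc m))" by (intro frac_le) auto
    ultimately show ?thesis by (rule order_trans[rotated])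
  qed
  then show ?thesis using 1 y by (simp add: exh_def)
qed

lemma rho_DERIV2:
  assumes i: "i < n" and y: "y \<in> Rn n"
  shows "((\<lambda>t. rho n k a x (y(i := t))) has_real_derivative - rho n k (a(i := Suc (a i))) x y) (at (y i))"
proof -
  define P where "P = (\<Prod>j\<in>{..<n} - {i}. mol k (a j) (x j - y j))"
  have r1: "rho n k a x (y(i := t)) = mol k (a i) (x i - t) * P" for t
    unfolding rho_split[OF i] P_def by (auto intro!: prod.cong)
  have r2: "rho n k (a(i := Suc (a i))) x y = mol k (Suc (a i)) (x i - y i) * P"
    unfolding rho_split[OF i] P_def by (auto intro!: prod.cong)
  have "((\<lambda>t. mol k (a i) (x i - t)) has_real_derivative mol k (Suc (a i)) (x i - y i) * (- 1)) (at (y i))"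
    by (rule DERIV_chain2[OF mol_deriv]) (auto intro!: derivative_eq_intros)
  from DERIV_cmult_right[OF this, of P] show ?thesis unfolding r1 r2 by simp
qed

text \<open>The scalar c in the class records the sign that appears whenever the kernel is
  differentiated in its second argument.\<close>

lemma rho_smooth2: "x \<in> Rn n \<Longrightarrow> smooth n (rho n k a x)"
proof (rule smooth_coinduct[where P = "\<lambda>f. \<exists>c a. f = (\<lambda>y. c * rho n k a x y)"])
  fix f assume "\<exists>c a. f = (\<lambda>y. c * rho n k a x y)"
  then obtain c a where f: "f = (\<lambda>y. c * rho n k a x y)" by blast
  have "mol k j \<in> borel_measurable borel" for j by simp
  have cm: "continuous_on UNIV (mol k j)" for j
    by (rule DERIV_continuous_on[where D = "mol k (Suc j)"]) (use mol_deriv in simp)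
  have "continuous_map (top_Rn n) euclideanreal (\<lambda>y. mol k (a i) (x i - y i))" if "i < n" for i
  proof (rule continuous_comp_real[OF _ cm])
    show "continuous_map (top_Rn n) euclideanreal (\<lambda>y. x i - y i)"
      by (rule continuous_map_diff[OF _ continuous_coord[OF that]]) simp
  qed
  then show "continuous_map (top_Rn n) euclideanreal f"
    unfolding f rho_def by (intro continuous_map_real_mult continuous_map_prod) simp_all
next
  fix f i assume "\<exists>c a. f = (\<lambda>y. c * rho n k a x y)" "i < n"
  then obtain c a where f: "f = (\<lambda>y. c * rho n k a x y)" by blast
  have "((\<lambda>t. f (y(i := t))) has_real_derivative (- c) * rho n k (a(i := Suc (a i))) x y) (at (y i))" if "y \<in> Rn n" for y
    using DERIV_cmult[OF rho_DERIV2[OF \<open>i < n\<close> that, of k a x], of c] unfolding f by simp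
  then show "\<exists>g. (\<exists>c a. g = (\<lambda>y. c * rho n k a x y)) \<and> (\<forall>y\<in>Rn n. ((\<lambda>t. f (y(i := t))) has_real_derivative g y) (at (y i)))"
    by (intro exI[of _ "\<lambda>y. (- c) * rho n k (a(i := Suc (a i))) x y"] conjI) blast+
next
  show "\<exists>c a'. rho n k a x = (\<lambda>y. c * rho n k a' x y)" by (intro exI[of _ 1] exI[of _ a]) simp
qed

lemma rho_test_fun:
  assumes "x \<in> Rn n" "{y \<in> Rn n. dist_n n x y \<le> real n / real (Suc k)} \<subseteq> U"
  shows "rho n k a x \<in> test_fun n U"
proof (rule test_funI_ball[OF rho_smooth2[OF assms(1)] assms(2)])
  fix y assume "y \<in> Rn n" "real n / real (Suc k) < dist_n n x y"
  then show "rho n k a x y = 0" using rho_support[of n k a x y] by (meson not_le)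
qed

lemma conv_local:
  assumes "\<And>y. y \<in> Rn n \<Longrightarrow> dist_n n x y \<le> real n / real (Suc k) \<Longrightarrow> f y = g y"
  shows "conv n k a f x = conv n k a g x"
  unfolding conv_def
proof (rule Bochner_Integration.integral_cong[OF refl])
  fix y assume "y \<in> space (bor n)"
  then show "rho n k a x y * f y = rho n k a x y * g y"
    using assms[of y] rho_support[of n k a x y] by (cases "rho n k a x y = 0") (auto simp: space_bor)
qed

text \<open>The kernels themselves are admissible test functions, so the mollification of h vanishes
  on a compact set once its radius is small; convergence in L^1 then gives h = 0 almost everywhere
  there.\<close>

lemma fundamental_lemma:
  assumes U: "openin (top_Rn n) U"
    and h: "h \<in> borel_measurable (bor n)" "\<And>m. integrable (bor n) (\<lambda>x. indicator (exh n U m) x * h x)"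
    and z: "\<And>\<phi>. \<phi> \<in> test_fun n U \<Longrightarrow> (LINT x|bor n. h x * \<phi> x) = 0"
  shows "AE x in bor n. x \<in> U \<longrightarrow> h x = 0"
proof -
  have "AE x in bor n. x \<in> exh n U m \<longrightarrow> h x = 0" for m
  proof -
    let ?K = "exh n U m" and ?J = "exh n U (2 * m + 2)"
    define f where "f x = indicator ?J x * h x" for x
    have fi: "integrable (bor n) f" using h(2) by (simp add: f_def[abs_def])
    \<comment> \<open>From k0 on the kernel radius n / (k + 1) is at most 1 / (2 (m + 1)), the
      margin provided by \<open>exh_nbhd\<close>.\<close>
    obtain k0 :: nat where k0: "real k0 \<ge> real n * (2 * real (Suc m))" using real_arch_simple by blast
    have c0: "conv0 n k f x = 0" if x: "x \<in> ?K" and k: "k \<ge> k0" for x k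
    proof -
      have xR: "x \<in> Rn n" using x by (simp add: exh_def)
      have "real n / real (Suc k) \<le> 1 / (2 * real (Suc m))"
        using k0 k by (simp add: field_simps)
      then have nb: "y \<in> ?J" if "y \<in> Rn n" "dist_n n x y \<le> real n / real (Suc k)" for y
        using exh_nbhd[OF x that(1)] that(2) by linarith
      have "conv0 n k f x = conv0 n k h x" by (rule conv_local) (use nb in \<open>simp add: f_def\<close>)
      also have "\<dots> = (LINT y|bor n. h y * rho n k (\<lambda>_. 0) x y)" by (simp add: conv_def mult.commute)
      also have "\<dots> = 0" by (rule z, rule rho_test_fun[OF xR]) (use nb exh_subset[of n U "2 * m + 2"] in blast)
      finally show ?thesis .
    qed
    have K: "?K \<in> sets (bor n)" by (rule exh_sets)
    have KJ: "?K \<subseteq> ?J" using exh_nbhd[of _ n U m] by (auto simp: exh_def)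
    have gm: "(\<lambda>x. indicator ?K x * f x) \<in> borel_measurable (bor n)" using K fi by simp
    have le: "nrm (bor n) 1 (\<lambda>x. indicator ?K x * f x) \<le> nrm (bor n) 1 (\<lambda>x. conv0 n k f x - f x)" if k: "k \<ge> k0" for k
    proof -
      have D: "(\<lambda>x. conv0 n k f x - f x) \<in> Lq (bor n) 1" using conv0_Lq[of 1 n f k] fi by (simp add: Lq_1)
      have "nrm (bor n) 1 (\<lambda>x. indicator ?K x * f x) \<le> 1 * nrm (bor n) 1 (\<lambda>x. conv0 n k f x - f x)"
        by (rule Lq_bound(2)[OF D gm]) (use c0[OF _ k] in \<open>auto simp: indicator_def\<close>)
      then show ?thesis by simp
    qed
    have "(\<lambda>k. nrm (bor n) 1 (\<lambda>x. conv0 n k f x - f x)) \<longlonglongrightarrow> 0" using appr_integrable[OF fi] by (simp add: appr_def)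
    then have "nrm (bor n) 1 (\<lambda>x. indicator ?K x * f x) \<le> 0"
      by (rule tendsto_lowerbound) (use le in \<open>auto simp: eventually_sequentially\<close>)
    then have "(LINT x|bor n. \<bar>indicator ?K x * f x\<bar>) = 0" using Bochner_Integration.integral_nonneg[of "bor n" "\<lambda>x. \<bar>indicator ?K x * f x\<bar>"] unfolding nrm_1 by (intro antisym) auto
    moreover have "integrable (bor n) (\<lambda>x. \<bar>indicator ?K x * f x\<bar>)"
      by (rule integrable_abs, rule Bochner_Integration.integrable_bound[OF fi gm]) (auto simp: indicator_def)
    ultimately have "AE x in bor n. \<bar>indicator ?K x * f x\<bar> = 0"
      using integral_nonneg_eq_0_iff_AE[of "bor n" "\<lambda>x. \<bar>indicator ?K x * f x\<bar>"] by simp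
    then show ?thesis by eventually_elim (use KJ in \<open>auto simp: f_def\<close>)
  qed
  then have "AE x in bor n. \<forall>m. x \<in> exh n U m \<longrightarrow> h x = 0" by (subst AE_all_countable) blast
  then show ?thesis by eventually_elim (use exh_covers[OF U] in blast)
qed

text \<open>Local integrability gives measurability on each compact set of the exhaustion, and the
  indicators of these sets converge to the indicator of U.\<close>

lemma locally_integrable_measurable:
  assumes U: "openin (top_Rn n) U" and g: "locally_integrable n U g"
  shows "set_borel_measurable (leb n) U g"
proof -
  have m: "(\<lambda>x. indicator (exh n U m) x *\<^sub>R g x) \<in> borel_measurable (leb n)" for m
    using g exh_compact[of n U m] exh_subset[of n U m] by (auto simp: locally_integrable_def set_integrable_def)
  have "(\<lambda>x. indicator U x *\<^sub>R g x) \<in> borel_measurable (leb n)"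
  proof (rule borel_measurable_LIMSEQ_real[OF _ m])
    fix x
    show "(\<lambda>m. indicator (exh n U m) x *\<^sub>R g x) \<longlonglongrightarrow> indicator U x *\<^sub>R g x"
    proof (cases "x \<in> U")
      case True
      obtain M where "\<forall>m\<ge>M. x \<in> exh n U m" using exh_covers[OF U True] by blast
      then show ?thesis using True by (intro tendsto_eventually) (auto simp: eventually_sequentially intro!: exI[of _ M])
    next
      case False
      then have "x \<notin> exh n U m" for m using exh_subset by blast
      then show ?thesis using False by simp
    qed
  qed
  then show ?thesis by (simp add: set_borel_measurable_def)
qed

lemma weak_deriv_brep:
  assumes U: "openin (top_Rn n) U" and w: "has_weak_deriv n U is u g"
    and ru: "brep n U u u'" and rg: "brep n U g g'" and \<phi>: "\<phi> \<in> test_fun n U" and "is": "set is \<subseteq> {..<n}"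
  shows "(LINT x|bor n. u' x * partials is \<phi> x) = (-1) ^ length is * (LINT x|bor n. g' x * \<phi> x)"
proof -
  have m: "\<phi> \<in> borel_measurable (bor n)" "partials is \<phi> \<in> borel_measurable (bor n)"
    using \<phi> test_fun_partials[OF \<phi> "is"] by (auto intro!: borel_measurable_continuous_Rn smooth_continuous test_fun_smooth)
  show ?thesis
    using w \<phi> brep_integral_mult[OF ru m(2)] brep_integral_mult[OF rg m(1)] by (simp add: has_weak_deriv_def)
qed

lemma brep_locally_integrable:
  assumes U: "openin (top_Rn n) U" and g: "brep n U f g" "locally_integrable n U f"
  shows "integrable (bor n) (\<lambda>x. indicator (exh n U m) x * g x)"
proof -
  have "set_integrable (leb n) (exh n U m) f"
    using g exh_compact[of n U m] exh_subset[of n U m] by (auto simp: locally_integrable_def)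
  then show ?thesis using brep_integrable[OF brep_sub[OF g(1) exh_sets exh_subset]] by simp
qed

lemma brep_mult_integrable:
  assumes that: "brep n U g h" "locally_integrable n U g" and \<phi>: "\<phi> \<in> test_fun n U"
  shows "integrable (bor n) (\<lambda>x. h x * \<phi> x)"
proof -
    obtain K where K: "compactin (top_Rn n) K" "closedin (top_Rn n) K" "K \<subseteq> U" "\<And>x. x \<in> Rn n \<Longrightarrow> x \<notin> K \<Longrightarrow> \<phi> x = 0"
      using test_fun_support[OF \<phi>] by metis
    obtain C where C: "C \<ge> 0" "\<And>x. x \<in> Rn n \<Longrightarrow> \<bar>\<phi> x\<bar> \<le> C" using cc_bounded[OF test_fun_cc[OF \<phi>]] by metis
    have \<phi>m: "\<phi> \<in> borel_measurable (bor n)" by (intro borel_measurable_continuous_Rn smooth_continuous test_fun_smooth[OF \<phi>])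
      have "set_integrable (leb n) K g" using that K by (auto simp: locally_integrable_def)
      then have iK: "integrable (bor n) (\<lambda>x. C * (indicator K x * h x))"
        using brep_integrable[OF brep_sub[OF that(1) closedin_measurable[OF K(2)] K(3)]] by simp
      show ?thesis
      proof (rule Bochner_Integration.integrable_bound[OF iK])
        show "(\<lambda>x. h x * \<phi> x) \<in> borel_measurable (bor n)" using brepD(2)[OF that(1)] \<phi>m by simp
        show "AE x in bor n. norm (h x * \<phi> x) \<le> norm (C * (indicator K x * h x))"
        proof (rule AE_I2)
          fix x assume "x \<in> space (bor n)"
          then have x: "x \<in> Rn n" by (simp add: space_bor)
          show "norm (h x * \<phi> x) \<le> norm (C * (indicator K x * h x))"
            using C K(4)[OF x] mult_left_mono[OF C(2)[OF x], of "\<bar>h x\<bar>"]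
            by (cases "x \<in> K") (auto simp: abs_mult mult.commute)
        qed
      qed
    qed

lemma weak_deriv_unique:
  assumes U: "openin (top_Rn n) U" and w: "has_weak_deriv n U is u g1" "has_weak_deriv n U is u g2"
  shows "AE x in bor n. x \<in> U \<longrightarrow> g1 x = g2 x"
proof -
  have Us: "U \<in> sets (bor n)" by (rule openin_measurable[OF U])
  have l: "locally_integrable n U g1" "locally_integrable n U g2" using w by (auto simp: has_weak_deriv_def)
  obtain h1 h2 where h: "brep n U g1 h1" "brep n U g2 h2"
    using brep_exists[OF locally_integrable_measurable[OF U l(1)] Us] brep_exists[OF locally_integrable_measurable[OF U l(2)] Us] by metis
  have "AE x in bor n. x \<in> U \<longrightarrow> h1 x - h2 x = 0"
  proof (rule fundamental_lemma[OF U])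
    show "(\<lambda>x. h1 x - h2 x) \<in> borel_measurable (bor n)" using h by (auto simp: brep_def)
    show "integrable (bor n) (\<lambda>x. indicator (exh n U m) x * (h1 x - h2 x))" for m
      using brep_locally_integrable[OF U h(1) l(1), of m] brep_locally_integrable[OF U h(2) l(2), of m]
      by (simp add: right_diff_distrib)
    fix \<phi> assume \<phi>: "\<phi> \<in> test_fun n U"
    have \<phi>m: "\<phi> \<in> borel_measurable (bor n)" by (intro borel_measurable_continuous_Rn smooth_continuous test_fun_smooth[OF \<phi>])
    note i = brep_mult_integrable[OF _ _ \<phi>]
    have eq: "(LINT x:U|leb n. g1 x * \<phi> x) = (LINT x:U|leb n. g2 x * \<phi> x)"
    proof -
      have "(LINT x:U|leb n. u x * partials is \<phi> x) = (-1) ^ length is * (LINT x:U|leb n. g1 x * \<phi> x)"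
        "(LINT x:U|leb n. u x * partials is \<phi> x) = (-1) ^ length is * (LINT x:U|leb n. g2 x * \<phi> x)"
        using w \<phi> by (simp_all add: has_weak_deriv_def)
      then have "(-1::real) ^ length is * (LINT x:U|leb n. g1 x * \<phi> x) = (-1) ^ length is * (LINT x:U|leb n. g2 x * \<phi> x)"
        by (simp only:)
      then show ?thesis by simp
    qed
    show "(LINT x|bor n. (h1 x - h2 x) * \<phi> x) = 0"
      using brep_integral_mult[OF h(1) \<phi>m] brep_integral_mult[OF h(2) \<phi>m] eq i[OF h(1) l(1)] i[OF h(2) l(2)]
      by (simp add: left_diff_distrib)
  qed
  then show ?thesis using brepD(4)[OF h(1)] brepD(4)[OF h(2)] by eventually_elim auto
qed

lemma weak_deriv_AE:
  assumes U: "openin (top_Rn n) U" and w: "has_weak_deriv n U is u g"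
  shows "AE x in bor n. x \<in> U \<longrightarrow> weak_deriv n U is u x = g x" "locally_integrable n U (weak_deriv n U is u)"
proof -
  have s: "has_weak_deriv n U is u (weak_deriv n U is u)"
    unfolding weak_deriv_def by (rule someI[of _ g]) (rule w)
  then show "locally_integrable n U (weak_deriv n U is u)" by (simp add: has_weak_deriv_def)
  show "AE x in bor n. x \<in> U \<longrightarrow> weak_deriv n U is u x = g x" by (rule weak_deriv_unique[OF U s w])
qed

text \<open>\<open>weak_deriv\<close> is a choice among functions that agree almost everywhere on U;
  uniqueness lets the representative of any known weak derivative stand for it.\<close>

lemma brep_weak_deriv:
  assumes U: "openin (top_Rn n) U" and w: "has_weak_deriv n U is u g" and g: "brep n U g g'"
  shows "brep n U (weak_deriv n U is u) g'"
proof (rule brep_cong_AE[OF g _ locally_integrable_measurable[OF U weak_deriv_AE(2)[OF U w]]])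
  show "AE x in bor n. x \<in> U \<longrightarrow> g x = weak_deriv n U is u x"
    using weak_deriv_AE(1)[OF U w] by eventually_elim simp
qed

lemma integrable_test_mult:
  assumes "integrable (bor n) f" "cc n g" shows "integrable (bor n) (\<lambda>x. f x * g x)"
proof -
  obtain C where C: "C \<ge> 0" "\<And>x. x \<in> Rn n \<Longrightarrow> \<bar>g x\<bar> \<le> C" using cc_bounded[OF assms(2)] by blast
  have gm: "g \<in> borel_measurable (bor n)" by (intro borel_measurable_continuous_Rn ccD assms)
  show ?thesis
  proof (rule Bochner_Integration.integrable_bound)
    show "integrable (bor n) (\<lambda>x. C * f x)" using assms by simp
    show "AE x in bor n. norm (f x * g x) \<le> norm (C * f x)"
    proof (rule AE_I2)
      fix x assume "x \<in> space (bor n)"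
      then have "\<bar>g x\<bar> * \<bar>f x\<bar> \<le> C * \<bar>f x\<bar>" using C by (intro mult_right_mono) (auto simp: space_bor)
      then show "norm (f x * g x) \<le> norm (C * f x)" using C(1) by (simp add: abs_mult mult.commute[of "\<bar>f x\<bar>"])
    qed
  qed (use assms gm in auto)
qed

text \<open>Integration by parts moves the head of the list first, so the derivatives arrive at
  \<phi> in reversed order, hence \<open>rev is\<close>.\<close>

lemma test_weak_deriv:
  assumes \<phi>: "\<phi> \<in> test_fun n U" and U: "openin (top_Rn n) U" and "is": "set is \<subseteq> {..<n}"
  shows "has_weak_deriv n U is \<phi> (partials (rev is) \<phi>)"
proof -
  have Us: "U \<in> sets (bor n)" by (rule openin_measurable[OF U])
  have loc: "locally_integrable n U \<psi>" if \<psi>: "\<psi> \<in> test_fun n U" for \<psi>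
    unfolding locally_integrable_def
  proof (intro allI impI)
    fix K assume K: "compactin (top_Rn n) K \<and> K \<subseteq> U"
    have Ks: "K \<in> sets (bor n)" using compactin_imp_closedin[OF Hausdorff_Rn] K by (intro closedin_measurable) auto
    have m: "\<psi> \<in> borel_measurable (bor n)" by (intro borel_measurable_continuous_Rn smooth_continuous test_fun_smooth[OF \<psi>])
    have "integrable (bor n) (\<lambda>x. indicator K x * \<psi> x)"
      by (rule Bochner_Integration.integrable_bound[OF cc_integrable[OF test_fun_cc[OF \<psi>]]]) (use Ks m in \<open>auto simp: indicator_def\<close>)
    then show "set_integrable (leb n) K \<psi>" using brep_integrable[OF brep_self[OF m Ks]] by simp
  qed
  have int: "(LINT x:U|leb n. f x * g x) = (LINT x|bor n. f x * g x)" if "f \<in> test_fun n U" "g \<in> test_fun n U" for f g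
  proof -
    have "(LINT x:U|leb n. f x * g x) = (LINT x|bor n. (indicator U x * f x) * g x)"
      by (rule brep_integral_mult[OF brep_test[OF that(1) Us]]) (intro borel_measurable_continuous_Rn smooth_continuous test_fun_smooth[OF that(2)])
    also have "\<dots> = (LINT x|bor n. f x * g x)"
      by (rule Bochner_Integration.integral_cong) (use test_fun_outside[OF that(1)] in \<open>auto simp: indicator_def space_bor\<close>)
    finally show ?thesis .
  qed
  have UR: "U \<subseteq> Rn n" using openin_subset[OF U] by simp
  have parts: "(LINT x|bor n. \<psi> x * partials is \<eta> x) = (-1) ^ length is * (LINT x|bor n. partials (rev is) \<psi> x * \<eta> x)"
    if "\<psi> \<in> test_fun n U" "\<eta> \<in> test_fun n U" for \<psi> \<eta>
    using "is" that
  proof (induction "is" arbitrary: \<psi>)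
    case (Cons i "is")
    have i: "i < n" and "is": "set is \<subseteq> {..<n}" using Cons.prems by auto
    have p\<psi>: "partial i \<psi> \<in> test_fun n U" by (rule test_fun_partial[OF Cons.prems(2) i])
    have "(LINT x|bor n. \<psi> x * partials (i # is) \<eta> x) = (LINT x|bor n. \<psi> x * partial i (partials is \<eta>) x)"
      by (simp add: partials_def)
    also have "\<dots> = - (LINT x|bor n. partial i \<psi> x * partials is \<eta> x)"
      using integral_by_parts[OF test_fun_mono[OF UR Cons.prems(2)] test_fun_smooth[OF test_fun_partials[OF Cons.prems(3) "is"]] i] by simp
    also have "\<dots> = - ((-1) ^ length is * (LINT x|bor n. partials (rev is) (partial i \<psi>) x * \<eta> x))"
      using Cons.IH[OF "is" p\<psi> Cons.prems(3)] by simp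
    also have "partials (rev is) (partial i \<psi>) = partials (rev (i # is)) \<psi>" by (simp add: partials_def)
    finally show ?case by simp
  qed (simp add: partials_def)
  show ?thesis
    unfolding has_weak_deriv_def
    using loc[OF \<phi>] loc[OF test_fun_partials[OF \<phi>, of "rev is"]] "is" int[OF \<phi>] int[OF test_fun_partials[OF \<phi>, of "rev is"]]
      parts[OF \<phi>] test_fun_partials[OF _ "is"] by simp
qed

lemma test_Lp: "\<phi> \<in> test_fun n U \<Longrightarrow> openin (top_Rn n) U \<Longrightarrow> q > 0 \<Longrightarrow> \<phi> \<in> Lp n q U"
proof -
  assume \<phi>: "\<phi> \<in> test_fun n U" and U: "openin (top_Rn n) U" and q: "q > 0"
  have Us: "U \<in> sets (bor n)" by (rule openin_measurable[OF U])
  have "(\<lambda>x. indicator U x * \<phi> x) \<in> Lq (bor n) q"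
    by (rule Lq_bound(1)[OF cc_Lq[OF test_fun_cc[OF \<phi>] q] brepD(2)[OF brep_test[OF \<phi> Us]], where C = 1])
       (use q in \<open>auto simp: indicator_def\<close>)
  then show ?thesis using brep_Lp[OF q brep_test[OF \<phi> Us]] by simp
qed

lemma test_sobolev: "\<phi> \<in> test_fun n U \<Longrightarrow> openin (top_Rn n) U \<Longrightarrow> q > 0 \<Longrightarrow> \<phi> \<in> sobolev n k q U"
  unfolding sobolev_def
proof (intro CollectI conjI allI impI)
  fix "is" :: "nat list"
  assume a: "\<phi> \<in> test_fun n U" "openin (top_Rn n) U" "q > 0" "set is \<subseteq> {..<n} \<and> length is \<le> k"
  then have "partials (rev is) \<phi> \<in> Lp n q U" by (intro test_Lp test_fun_partials) auto
  then show "\<exists>g\<in>Lp n q U. has_weak_deriv n U is \<phi> g"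
    using test_weak_deriv[OF a(1,2), of "is"] a(4) by blast
qed (rule test_Lp)

lemma test_Lp_norm:
  assumes \<phi>: "\<phi> \<in> test_fun n U" and U: "openin (top_Rn n) U" and q: "q > 0"
  shows "Lp_norm n q U \<phi> = nrm (bor n) q \<phi>"
proof -
  have "Lp_norm n q U \<phi> = nrm (bor n) q (\<lambda>x. indicator U x * \<phi> x)"
    by (rule brep_nrm[OF q brep_test[OF \<phi> openin_measurable[OF U]]])
  also have "\<dots> = nrm (bor n) q \<phi>"
    by (rule nrm_cong) (use test_fun_outside[OF \<phi>] in \<open>auto simp: space_bor indicator_def\<close>)
  finally show ?thesis .
qed

section \<open>The Sobolev constant\<close>

lemma sqrt_sum_measurable:
  fixes f :: "nat \<Rightarrow> 'a \<Rightarrow> real"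
  assumes "\<And>i. i < n \<Longrightarrow> f i \<in> borel_measurable M"
  shows "(\<lambda>x. sqrt (\<Sum>i<n. (f i x)\<^sup>2)) \<in> borel_measurable M"
  by (rule measurable_compose[OF _ borel_measurable_sqrt])
     (intro borel_measurable_sum borel_measurable_power assms, simp)

lemma grad_norm_brep:
  assumes g: "\<And>i. i < n \<Longrightarrow> brep n U (weak_deriv n U [i] u) (g i)"
  shows "grad_L2_norm n U u = nrm (bor n) 2 (\<lambda>x. sqrt (\<Sum>i<n. (g i x)\<^sup>2))"
proof -
  have "brep n U (\<lambda>x. norm_n n (\<lambda>i. weak_deriv n U [i] u x)) (\<lambda>x. sqrt (\<Sum>i<n. (g i x)\<^sup>2))"
    unfolding brep_def
  proof (intro conjI allI impI)
    have e: "indicator U x *\<^sub>R norm_n n (\<lambda>i. weak_deriv n U [i] u x) = sqrt (\<Sum>i<n. (indicator U x *\<^sub>R weak_deriv n U [i] u x)\<^sup>2)" for x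
      by (auto simp: indicator_def norm_n_def L2_set_def)
    have "(\<lambda>x. indicator U x *\<^sub>R weak_deriv n U [i] u x) \<in> borel_measurable (leb n)" if "i < n" for i
      using brepD(1)[OF g[OF that]] by (simp add: set_borel_measurable_def)
    then have "(\<lambda>x. sqrt (\<Sum>i<n. (indicator U x *\<^sub>R weak_deriv n U [i] u x)\<^sup>2)) \<in> borel_measurable (leb n)"
      by (rule sqrt_sum_measurable)
    then show "set_borel_measurable (leb n) U (\<lambda>x. norm_n n (\<lambda>i. weak_deriv n U [i] u x))"
      unfolding set_borel_measurable_def e .
    show "(\<lambda>x. sqrt (\<Sum>i<n. (g i x)\<^sup>2)) \<in> borel_measurable (bor n)"
      by (rule sqrt_sum_measurable[OF brepD(2)[OF g]])
    fix x assume "x \<notin> U"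
    then show "sqrt (\<Sum>i<n. (g i x)\<^sup>2) = 0" using brepD(3)[OF g] by simp
  next
    have "AE x in bor n. \<forall>i\<in>{..<n}. x \<in> U \<longrightarrow> weak_deriv n U [i] u x = g i x"
      using brepD(4)[OF g] by (intro AE_finite_allI) auto
    then show "AE x in bor n. x \<in> U \<longrightarrow> norm_n n (\<lambda>i. weak_deriv n U [i] u x) = sqrt (\<Sum>i<n. (g i x)\<^sup>2)"
      by eventually_elim (auto simp: norm_n_def L2_set_def)
  qed
  from brep_nrm[OF _ this, of 2] show ?thesis by (simp add: grad_L2_norm_def)
qed

lemma test_weak_deriv_brep:
  assumes \<phi>: "\<phi> \<in> test_fun n U" and U: "openin (top_Rn n) U" and "is": "set is \<subseteq> {..<n}"
  shows "brep n U (weak_deriv n U is \<phi>) (\<lambda>x. indicator U x * partials (rev is) \<phi> x)"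
  by (rule brep_weak_deriv[OF U test_weak_deriv[OF \<phi> U "is"] brep_test[OF test_fun_partials[OF \<phi>] openin_measurable[OF U]]])
     (use "is" in auto)

lemma test_grad_norm:
  assumes \<phi>: "\<phi> \<in> test_fun n U" and U: "openin (top_Rn n) U"
  shows "grad_L2_norm n U \<phi> = nrm (bor n) 2 (gradn n \<phi>)"
proof -
  have "brep n U (weak_deriv n U [i] \<phi>) (\<lambda>x. indicator U x * partial i \<phi> x)" if "i < n" for i
    using test_weak_deriv_brep[OF \<phi> U, of "[i]"] that by (simp add: partials_def)
  from grad_norm_brep[OF this] have "grad_L2_norm n U \<phi> = nrm (bor n) 2 (\<lambda>x. sqrt (\<Sum>i<n. (indicator U x * partial i \<phi> x)\<^sup>2))" .
  also have "\<dots> = nrm (bor n) 2 (gradn n \<phi>)"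
  proof (rule nrm_cong)
    fix x assume "x \<in> space (bor n)"
    then have x: "x \<in> Rn n" by (simp add: space_bor)
    have "indicator U x * partial i \<phi> x = partial i \<phi> x" if "i < n" for i
      using test_fun_outside[OF test_fun_partial[OF \<phi> that] x] by (cases "x \<in> U") auto
    then have "(\<Sum>i<n. (indicator U x * partial i \<phi> x)\<^sup>2) = (\<Sum>i<n. (partial i \<phi> x)\<^sup>2)"
      by (intro sum.cong refl) (simp only: lessThan_iff)
    then show "\<bar>sqrt (\<Sum>i<n. (indicator U x * partial i \<phi> x)\<^sup>2)\<bar> = \<bar>gradn n \<phi> x\<bar>" by (simp only: gradn_def)
  qed
  finally show ?thesis .
qed

lemma zero_test_fun: "(\<lambda>x. 0) \<in> test_fun n U"
  by (rule test_funI[of _ _ "{}"]) (auto intro: smooth_const)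

lemma test_fun_H10: assumes \<phi>: "\<phi> \<in> test_fun n U" and U: "openin (top_Rn n) U" shows "\<phi> \<in> H10 n U"
proof -
  have "gradn n (\<lambda>x. 0) = (\<lambda>x. 0)" by (simp add: gradn_def[abs_def])
  then have "H1_norm n U (\<lambda>x. 0) = 0"
    using test_Lp_norm[OF zero_test_fun U, of 2] test_grad_norm[OF zero_test_fun U] by (simp add: H1_norm_def)
  then have "(\<lambda>k. H1_norm n U (\<lambda>x. \<phi> x - \<phi> x)) \<longlonglongrightarrow> 0" by simp
  then show ?thesis using \<phi> test_sobolev[OF \<phi> U, of 2 1] unfolding H10_def
    by (intro CollectI conjI exI[of _ "\<lambda>k. \<phi>"]) auto
qed

text \<open>Integrals against a test function may be split because each product is integrable: local
  integrability covers the compact support.\<close>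

lemma has_weak_deriv_diff:
  assumes U: "openin (top_Rn n) U" and "is": "set is \<subseteq> {..<n}" and u: "has_weak_deriv n U is u g" and v: "has_weak_deriv n U is v h"
  shows "has_weak_deriv n U is (\<lambda>x. u x - v x) (\<lambda>x. g x - h x)"
proof -
  have Us: "U \<in> sets (bor n)" by (rule openin_measurable[OF U])
  have l: "locally_integrable n U u" "locally_integrable n U g" "locally_integrable n U v" "locally_integrable n U h"
    using u v by (auto simp: has_weak_deriv_def)
  have ld: "locally_integrable n U (\<lambda>x. f x - f' x)" if "locally_integrable n U f" "locally_integrable n U f'" for f f'
    using that unfolding locally_integrable_def by (auto intro: set_integral_diff)
  have dif: "(LINT x:U|leb n. (f x - f' x) * \<phi> x) = (LINT x:U|leb n. f x * \<phi> x) - (LINT x:U|leb n. f' x * \<phi> x)"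
    if f: "locally_integrable n U f" "locally_integrable n U f'" and \<phi>: "\<phi> \<in> test_fun n U" for f f' \<phi>
  proof -
    obtain F F' where F: "brep n U f F" "brep n U f' F'"
      using brep_exists[OF locally_integrable_measurable[OF U f(1)] Us] brep_exists[OF locally_integrable_measurable[OF U f(2)] Us] by metis
    have m: "\<phi> \<in> borel_measurable (bor n)" by (intro borel_measurable_continuous_Rn smooth_continuous test_fun_smooth[OF \<phi>])
    show ?thesis
      using brep_integral_mult[OF brep_diff[OF F] m] brep_integral_mult[OF F(1) m] brep_integral_mult[OF F(2) m]
        brep_mult_integrable[OF F(1) f(1) \<phi>] brep_mult_integrable[OF F(2) f(2) \<phi>] by (simp add: left_diff_distrib)
  qed
  show ?thesis
    unfolding has_weak_deriv_def
  proof (intro conjI ballI ld l)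
    fix \<phi> assume \<phi>: "\<phi> \<in> test_fun n U"
    have "(LINT x:U|leb n. u x * partials is \<phi> x) = (-1) ^ length is * (LINT x:U|leb n. g x * \<phi> x)"
      "(LINT x:U|leb n. v x * partials is \<phi> x) = (-1) ^ length is * (LINT x:U|leb n. h x * \<phi> x)"
      using u v \<phi> by (simp_all add: has_weak_deriv_def)
    then show "(LINT x:U|leb n. (u x - v x) * partials is \<phi> x) = (-1) ^ length is * (LINT x:U|leb n. (g x - h x) * \<phi> x)"
      using dif[OF l(1,3) test_fun_partials[OF \<phi> "is"]] dif[OF l(2,4) \<phi>] by (simp add: right_diff_distrib)
  qed
qed

text \<open>If w has unit gradient norm, the approximating test functions eventually have gradient
  norm at most 2, so \<open>Gagliardo_Nirenberg_Sobolev\<close> bounds their L^p' norms by 2 c.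
  Along a subsequence they converge to w almost everywhere, and Fatou hands the bound on to
  w.\<close>

lemma sigma_bdd_above:
  assumes n: "n \<ge> 3" and U: "openin (top_Rn n) U"
  shows "bdd_above {Lp_norm n (exp_p' n) U w | w. w \<in> H10 n U \<and> grad_L2_norm n U w = 1}"
proof -
  define c where "c = 2 * (real n - 1) / (real n - 2)"
  have c0: "c \<ge> 0" using n by (simp add: c_def)
  have p': "exp_p' n > 0" using n by (simp add: exp_p'_def)
  have Us: "U \<in> sets (bor n)" by (rule openin_measurable[OF U])
  have UR: "U \<subseteq> Rn n" using openin_subset[OF U] by simp
  have "Lp_norm n (exp_p' n) U w \<le> c * 2" if w: "w \<in> H10 n U" "grad_L2_norm n U w = 1" for w
  proof -
    from w(1) obtain \<phi> where \<phi>: "\<And>k. \<phi> k \<in> test_fun n U" "(\<lambda>k. H1_norm n U (\<lambda>x. w x - \<phi> k x)) \<longlonglongrightarrow> 0"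
      and ws: "w \<in> sobolev n 1 2 U" unfolding H10_def by blast
    have wL: "w \<in> Lp n 2 U" using ws by (simp add: sobolev_def)
    obtain w' where w': "brep n U w w'" using brep_exists[OF _ Us] wL by (auto simp: Lp_def)
    have w'L: "w' \<in> Lq (bor n) 2" using brep_Lp[OF _ w', of 2] wL by simp
    have "\<exists>g. g \<in> Lp n 2 U \<and> has_weak_deriv n U [i] w g" if "i < n" for i
      using ws that unfolding sobolev_def by (auto dest!: spec[of _ "[i]"])
    then obtain g where g: "\<And>i. i < n \<Longrightarrow> g i \<in> Lp n 2 U" "\<And>i. i < n \<Longrightarrow> has_weak_deriv n U [i] w (g i)" by metis
    have "\<exists>h. brep n U (g i) h" if "i < n" for i using brep_exists[OF _ Us] g(1)[OF that] by (auto simp: Lp_def)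
    then obtain h where h: "\<And>i. i < n \<Longrightarrow> brep n U (g i) (h i)" by metis
    have hL: "h i \<in> Lq (bor n) 2" if "i < n" for i using brep_Lp[OF _ h[OF that], of 2] g(1)[OF that] by simp
    have gw: "nrm (bor n) 2 (\<lambda>x. sqrt (\<Sum>i<n. (h i x)\<^sup>2)) = 1"
      using grad_norm_brep[of n U w h] brep_weak_deriv[OF U g(2) h] w(2) by simp
    define D where "D k x = sqrt (\<Sum>i<n. (h i x - indicator U x * partial i (\<phi> k) x)\<^sup>2)" for k x
    have DL: "grad_L2_norm n U (\<lambda>x. w x - \<phi> k x) = nrm (bor n) 2 (D k)" for k
      unfolding D_def
    proof (rule grad_norm_brep)
      fix i assume i: "i < n"
      have t: "has_weak_deriv n U [i] (\<phi> k) (partial i (\<phi> k))"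
        using test_weak_deriv[OF \<phi>(1) U, of "[i]" k] i by (simp add: partials_def)
      have b: "brep n U (partial i (\<phi> k)) (\<lambda>x. indicator U x * partial i (\<phi> k) x)"
        by (rule brep_test[OF test_fun_partial[OF \<phi>(1) i] Us])
      show "brep n U (weak_deriv n U [i] (\<lambda>x. w x - \<phi> k x)) (\<lambda>x. h i x - indicator U x * partial i (\<phi> k) x)"
        by (rule brep_weak_deriv[OF U has_weak_deriv_diff[OF U _ g(2)[OF i] t] brep_diff[OF h[OF i] b]]) (use i in simp)
    qed
    have AL: "Lp_norm n 2 U (\<lambda>x. w x - \<phi> k x) = nrm (bor n) 2 (\<lambda>x. w' x - indicator U x * \<phi> k x)" for k
      by (rule brep_nrm[OF _ brep_diff[OF w' brep_test[OF \<phi>(1) Us]]]) simp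
    have lim: "(\<lambda>k. f k) \<longlonglongrightarrow> 0" if "\<And>k. 0 \<le> f k" "\<And>k. f k \<le> H1_norm n U (\<lambda>x. w x - \<phi> k x)" for f :: "nat \<Rightarrow> real"
      by (rule Lim_null_comparison[OF _ \<phi>(2)]) (use that in \<open>auto intro!: always_eventually\<close>)
    have Dlim: "(\<lambda>k. nrm (bor n) 2 (D k)) \<longlonglongrightarrow> 0"
      by (rule lim) (auto simp: H1_norm_def DL intro!: real_le_rsqrt)
    have Alim: "(\<lambda>k. nrm (bor n) 2 (\<lambda>x. w' x - indicator U x * \<phi> k x)) \<longlonglongrightarrow> 0"
      by (rule lim) (auto simp: H1_norm_def AL intro!: real_le_rsqrt)
    define H where "H x = sqrt (\<Sum>i<n. (h i x)\<^sup>2)" for x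
    have sq: "sqrt (\<Sum>i<n. (f i x)\<^sup>2) \<le> (\<Sum>i<n. \<bar>f i x\<bar>)" for f :: "nat \<Rightarrow> (nat \<Rightarrow> real) \<Rightarrow> real" and x
      using L2_set_le_sum_abs[of "\<lambda>i. f i x" "{..<n}"] by (simp add: L2_set_def)
    have sqL: "(\<lambda>x. sqrt (\<Sum>i<n. (f i x)\<^sup>2)) \<in> Lq (bor n) 2" if f: "\<And>i. i < n \<Longrightarrow> f i \<in> Lq (bor n) 2" for f :: "nat \<Rightarrow> (nat \<Rightarrow> real) \<Rightarrow> real"
    proof -
      have a: "(\<lambda>x. \<bar>f i x\<bar>) \<in> Lq (bor n) 2" if "i < n" for i
        using f[OF that] by (auto simp: Lq_def)
      have s: "(\<lambda>x. \<Sum>i<n. \<bar>f i x\<bar>) \<in> Lq (bor n) 2" using Minkowski_sum[of 2 "{..<n}" "\<lambda>i x. \<bar>f i x\<bar>" "bor n"] a by auto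
      show ?thesis
      proof (rule Lq_bound(1)[OF s, where C = 1])
        show "(\<lambda>x. sqrt (\<Sum>i<n. (f i x)\<^sup>2)) \<in> borel_measurable (bor n)"
          by (rule sqrt_sum_measurable[OF LqD(1)[OF f]])
        show "AE x in bor n. \<bar>sqrt (\<Sum>i<n. (f i x)\<^sup>2)\<bar> \<le> 1 * \<bar>\<Sum>i<n. \<bar>f i x\<bar>\<bar>"
          using sq[of f] by (intro AE_I2) (simp add: sum_nonneg)
      qed auto
    qed
    have indL: "(\<lambda>x. indicator U x * \<psi> x) \<in> Lq (bor n) 2" if "\<psi> \<in> test_fun n U" for \<psi>
      using test_Lp[OF that U, of 2] brep_Lp[OF _ brep_test[OF that Us], of 2] by simp
    have HL: "H \<in> Lq (bor n) 2" unfolding H_def[abs_def] by (rule sqL[OF hL])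
    have DL2: "D k \<in> Lq (bor n) 2" for k unfolding D_def[abs_def]
      by (rule sqL) (intro Lq_diff hL indL test_fun_partial[OF \<phi>(1)], auto)
    \<comment> \<open>The triangle inequality is used twice: for the vectors of partial derivatives
      at each point, and then in L^2.\<close>
    have grad: "nrm (bor n) 2 (gradn n (\<phi> k)) \<le> 1 + nrm (bor n) 2 (D k)" for k
    proof -
      have M: "(\<lambda>x. H x + D k x) \<in> Lq (bor n) 2" "nrm (bor n) 2 (\<lambda>x. H x + D k x) \<le> nrm (bor n) 2 H + nrm (bor n) 2 (D k)"
        using Minkowski[OF _ HL DL2, of k] by auto
      have "nrm (bor n) 2 (gradn n (\<phi> k)) \<le> 1 * nrm (bor n) 2 (\<lambda>x. H x + D k x)"
      proof (rule Lq_bound(2)[OF M(1)])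
        show "gradn n (\<phi> k) \<in> borel_measurable (bor n)"
          by (intro borel_measurable_continuous_Rn continuous_gradn test_fun_smooth[OF \<phi>(1)])
        show "AE x in bor n. \<bar>gradn n (\<phi> k) x\<bar> \<le> 1 * \<bar>H x + D k x\<bar>"
        proof (rule AE_I2)
          fix x assume "x \<in> space (bor n)"
          then have x: "x \<in> Rn n" by (simp add: space_bor)
          have e: "partial i (\<phi> k) x = h i x + - (h i x - indicator U x * partial i (\<phi> k) x)" if "i < n" for i
            using test_fun_outside[OF test_fun_partial[OF \<phi>(1) that] x] by (cases "x \<in> U") auto
          have "gradn n (\<phi> k) x = L2_set (\<lambda>i. h i x + - (h i x - indicator U x * partial i (\<phi> k) x)) {..<n}"
          proof -
            have "(\<Sum>i<n. (partial i (\<phi> k) x)\<^sup>2) = (\<Sum>i<n. (h i x + - (h i x - indicator U x * partial i (\<phi> k) x))\<^sup>2)"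
            proof (rule sum.cong[OF refl])
              fix i assume "i \<in> {..<n}"
              then show "(partial i (\<phi> k) x)\<^sup>2 = (h i x + - (h i x - indicator U x * partial i (\<phi> k) x))\<^sup>2"
                by (intro arg_cong[where f = "\<lambda>t. t\<^sup>2"] e) simp
            qed
            then show ?thesis unfolding gradn_def L2_set_def by (simp only:)
          qed
          also have "\<dots> \<le> L2_set (\<lambda>i. h i x) {..<n} + L2_set (\<lambda>i. - (h i x - indicator U x * partial i (\<phi> k) x)) {..<n}"
            by (rule L2_set_triangle_ineq)
          also have "\<dots> = H x + D k x" unfolding H_def D_def L2_set_def by (simp only: power2_minus)
          finally show "\<bar>gradn n (\<phi> k) x\<bar> \<le> 1 * \<bar>H x + D k x\<bar>" by simp
        qed
      qed auto
      then show ?thesis using M(2) gw by (simp add: H_def[abs_def])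
    qed
    obtain K where K: "\<And>k. k \<ge> K \<Longrightarrow> nrm (bor n) 2 (D k) < 1"
      using LIMSEQ_D[OF Dlim, of 1] by auto
    have bound: "nrm (bor n) (exp_p' n) (\<phi> k) \<le> c * 2" if "k \<ge> K" for k
    proof -
      have "nrm (bor n) (exp_p' n) (\<phi> k) \<le> c * nrm (bor n) 2 (gradn n (\<phi> k))"
        using Gagliardo_Nirenberg_Sobolev[OF n test_fun_mono[OF UR \<phi>(1)]] by (simp add: c_def)
      also have "\<dots> \<le> c * 2" using grad[of k] K[OF that] c0 by (intro mult_left_mono) auto
      finally show ?thesis .
    qed
    have Alim': "(\<lambda>k. nrm (bor n) 2 (\<lambda>x. indicator U x * \<phi> k x - w' x)) \<longlonglongrightarrow> 0"
    proof -
      have "nrm (bor n) 2 (\<lambda>x. indicator U x * \<phi> k x - w' x) = nrm (bor n) 2 (\<lambda>x. w' x - indicator U x * \<phi> k x)" for k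
        by (rule nrm_cong) (simp add: abs_minus_commute)
      then show ?thesis using Alim by simp
    qed
    obtain r where r: "strict_mono r" "AE x in bor n. (\<lambda>k. indicator U x * \<phi> (r k) x) \<longlonglongrightarrow> w' x"
      using nrm_AE_subseq[OF _ indL[OF \<phi>(1)] w'L Alim'] by auto
    have ae: "AE x in bor n. (\<lambda>k. \<phi> (r (k + K)) x) \<longlonglongrightarrow> w' x"
    proof -
      have "AE x in bor n. x \<in> Rn n" by (rule AE_I2) (simp add: space_bor)
      with r(2) show ?thesis
      proof eventually_elim
        case (elim x)
        have "indicator U x * \<phi> k x = \<phi> k x" for k
          using test_fun_outside[OF \<phi>(1) elim(2)] by (cases "x \<in> U") auto
        then show ?case using LIMSEQ_ignore_initial_segment[OF elim(1), of K] by (simp only:)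
      qed
    qed
    have "nrm (bor n) (exp_p' n) w' \<le> c * 2"
    proof (rule Lq_Fatou(2)[OF p' _ _ brepD(2)[OF w'] ae])
      show "\<phi> (r (k + K)) \<in> Lq (bor n) (exp_p' n)" for k by (intro cc_Lq test_fun_cc[OF \<phi>(1)] p')
      show "nrm (bor n) (exp_p' n) (\<phi> (r (k + K))) \<le> c * 2" for k
        using bound[of "r (k + K)"] seq_suble[OF r(1), of "k + K"] by simp
    qed
    then show ?thesis using brep_nrm[OF p' w'] by simp
  qed
  then show ?thesis by (intro bdd_aboveI[of _ "c * 2"]) auto
qed

lemma nrm_gradn_cmult:
  assumes "smooth n \<phi>" shows "nrm (bor n) 2 (gradn n (\<lambda>x. c * \<phi> x)) = \<bar>c\<bar> * nrm (bor n) 2 (gradn n \<phi>)"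
proof -
  have "nrm (bor n) 2 (gradn n (\<lambda>x. c * \<phi> x)) = nrm (bor n) 2 (\<lambda>x. c * gradn n \<phi> x)"
  proof (rule nrm_cong)
    fix x assume "x \<in> space (bor n)"
    then have x: "x \<in> Rn n" by (simp add: space_bor)
    have "(\<Sum>i<n. (partial i (\<lambda>x. c * \<phi> x) x)\<^sup>2) = c\<^sup>2 * (\<Sum>i<n. (partial i \<phi> x)\<^sup>2)"
      using partial_cmult[OF assms _ x] by (simp add: power_mult_distrib sum_distrib_left)
    then show "\<bar>gradn n (\<lambda>x. c * \<phi> x) x\<bar> = \<bar>c * gradn n \<phi> x\<bar>"
      by (simp add: gradn_def real_sqrt_mult abs_mult)
  qed
  then show ?thesis by (simp add: nrm_cmult)
qed

lemma sobolev_normalized: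
  assumes n: "n \<ge> 3" and U: "openin (top_Rn n) U" and \<phi>: "\<phi> \<in> test_fun n U" and pos: "nrm (bor n) 2 (gradn n \<phi>) > 0"
  shows "nrm (bor n) (exp_p' n) \<phi> / nrm (bor n) 2 (gradn n \<phi>) \<le> sigma n U"
proof -
  let ?t = "nrm (bor n) 2 (gradn n \<phi>)"
  have p': "exp_p' n > 0" using n by (simp add: exp_p'_def)
  define w where "w x = inverse ?t * \<phi> x" for x
  have wt: "w \<in> test_fun n U" unfolding w_def[abs_def] by (rule test_fun_cmult[OF \<phi>])
  have "grad_L2_norm n U w = 1"
    using test_grad_norm[OF wt U] nrm_gradn_cmult[OF test_fun_smooth[OF \<phi>], of "inverse ?t"] pos by (simp add: w_def[abs_def])
  then have "Lp_norm n (exp_p' n) U w \<le> sigma n U"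
    unfolding sigma_def using test_fun_H10[OF wt U] by (intro cSup_upper sigma_bdd_above[OF n U]) auto
  then show ?thesis
    using test_Lp_norm[OF wt U p'] nrm_cmult[OF p', of "bor n" "inverse ?t" \<phi>] pos by (simp add: w_def[abs_def] divide_inverse mult.commute)
qed

lemma sobolev_inequality:
  assumes n: "n \<ge> 3" and U: "openin (top_Rn n) U" and \<phi>: "\<phi> \<in> test_fun n U"
  shows "nrm (bor n) (exp_p' n) \<phi> \<le> sigma n U * nrm (bor n) 2 (gradn n \<phi>)"
\<comment> \<open>A vanishing gradient norm cannot be normalised; in that case the explicit constant
  forces the left-hand side to vanish.\<close>
proof (cases "nrm (bor n) 2 (gradn n \<phi>) = 0")
  case True
  have "U \<subseteq> Rn n" using openin_subset[OF U] by simp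
  then show ?thesis using Gagliardo_Nirenberg_Sobolev[OF n test_fun_mono[OF _ \<phi>]] True by simp
next
  case False
  then have "nrm (bor n) 2 (gradn n \<phi>) > 0" using nrm_nonneg[of "bor n" 2 "gradn n \<phi>"] by linarith
  from sobolev_normalized[OF n U \<phi> this] this show ?thesis by (simp add: divide_le_eq)
qed

text \<open>A supremum is bounded below only through an element of its set; here a kernel supported
  in U is normalised. Its gradient cannot vanish, since \<open>Gagliardo_Nirenberg_Sobolev\<close>
  would make the kernel zero almost everywhere although its integral is 1.\<close>

lemma sigma_nonneg:
  assumes n: "n \<ge> 3" and U: "openin (top_Rn n) U" "U \<noteq> {}"
  shows "sigma n U \<ge> 0"
proof -
  obtain x where x: "x \<in> U" using U(2) by blast
  have UR: "U \<subseteq> Rn n" using openin_subset[OF U(1)] by simp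
  obtain e where e: "e > 0" "ball_n n x e \<subseteq> U" using open_contains_ball_n[OF U(1) x] .
  obtain k :: nat where k: "real n / e < real k" using reals_Archimedean2 by blast
  have xR: "x \<in> Rn n" using x UR by auto
  have "real n / real (Suc k) < e" using k e(1) by (simp add: field_simps)
  then have r: "rho n k (\<lambda>_. 0) x \<in> test_fun n U"
    by (intro rho_test_fun[OF xR]) (use e(2) in \<open>auto simp: ball_n_def\<close>)
  have "nrm (bor n) 2 (gradn n (rho n k (\<lambda>_. 0) x)) > 0"
  proof (rule ccontr)
    assume "\<not> ?thesis"
    then have "nrm (bor n) 2 (gradn n (rho n k (\<lambda>_. 0) x)) = 0" using nrm_nonneg[of "bor n" 2 "gradn n (rho n k (\<lambda>_. 0) x)"] by linarith
    then have "nrm (bor n) (exp_p' n) (rho n k (\<lambda>_. 0) x) = 0"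
      using Gagliardo_Nirenberg_Sobolev[OF n test_fun_mono[OF UR r]] nrm_nonneg[of "bor n" "exp_p' n" "rho n k (\<lambda>_. 0) x"] by simp
    moreover have "exp_p' n > 0" using n by (simp add: exp_p'_def)
    ultimately have z: "(LINT y|bor n. \<bar>rho n k (\<lambda>_. 0) x y\<bar> powr exp_p' n) = 0" by (simp add: nrm_def)
    have "AE y in bor n. \<bar>rho n k (\<lambda>_. 0) x y\<bar> powr exp_p' n = 0"
      using z integral_nonneg_eq_0_iff_AE[OF cc_integrable[OF cc_powr[OF test_fun_cc[OF r]]]] \<open>exp_p' n > 0\<close> by simp
    then have "AE y in bor n. rho n k (\<lambda>_. 0) x y = 0" by eventually_elim simp
    then have "(LINT y|bor n. rho n k (\<lambda>_. 0) x y) = 0" by (rule integral_eq_zero_AE)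
    then show False using rho_integral(2)[OF xR] by simp
  qed
  from sobolev_normalized[OF n U(1) r this] show ?thesis by (rule order_trans[rotated]) simp
qed

section \<open>Energy identity and radial cutoff functions\<close>

definition lap :: "nat \<Rightarrow> ((nat \<Rightarrow> real) \<Rightarrow> real) \<Rightarrow> (nat \<Rightarrow> real) \<Rightarrow> real" where
  "lap n f x = (\<Sum>i<n. partial i (partial i f) x)"

lemma smooth_lap: "smooth n f \<Longrightarrow> smooth n (lap n f)"
  unfolding lap_def[abs_def] by (intro smooth_sum smooth_partial) auto

lemma partial_mult_fun:
  assumes "smooth n f" "smooth n g" "i < n" "x \<in> Rn n"
  shows "partial i (partial i (\<lambda>x. f x * g x)) x = partial i (partial i f) x * g x + 2 * (partial i f x * partial i g x) + f x * partial i (partial i g) x"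
proof -
  have "partial i (partial i (\<lambda>x. f x * g x)) x = partial i (\<lambda>x. partial i f x * g x + f x * partial i g x) x"
    by (rule partial_cong[OF partial_mult[OF assms(1,2,3)] assms(3,4)])
  also have "\<dots> = partial i (\<lambda>x. partial i f x * g x) x + partial i (\<lambda>x. f x * partial i g x) x"
    by (intro partial_add[of n] smooth_mult smooth_partial assms)
  also have "partial i (\<lambda>x. partial i f x * g x) x = partial i (partial i f) x * g x + partial i f x * partial i g x"
    by (intro partial_mult[of n] smooth_partial assms)
  also have "partial i (\<lambda>x. f x * partial i g x) x = partial i f x * partial i g x + f x * partial i (partial i g) x"
    by (intro partial_mult[of n] smooth_partial assms)
  finally show ?thesis by simp
qed

lemma lap_mult:
  assumes "smooth n f" "smooth n g" "x \<in> Rn n"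
  shows "lap n (\<lambda>x. f x * g x) x = lap n f x * g x + 2 * (\<Sum>i<n. partial i f x * partial i g x) + f x * lap n g x"
proof -
  have "lap n (\<lambda>x. f x * g x) x = (\<Sum>i<n. partial i (partial i f) x * g x + 2 * (partial i f x * partial i g x) + f x * partial i (partial i g) x)"
    unfolding lap_def by (rule sum.cong[OF refl], rule partial_mult_fun[of n]) (use assms in auto)
  then show ?thesis by (simp add: sum.distrib lap_def sum_distrib_left sum_distrib_right)
qed

lemma nrm2_gradn:
  assumes "f \<in> test_fun n (Rn n)"
  shows "(nrm (bor n) 2 (gradn n f))\<^sup>2 = (\<Sum>i<n. LINT x|bor n. (partial i f x)\<^sup>2)"
proof -
  have "(nrm (bor n) 2 (gradn n f))\<^sup>2 = (LINT x|bor n. (\<Sum>i<n. (partial i f x)\<^sup>2))"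
    by (simp add: nrm_2 gradn_sq)
  also have "\<dots> = (\<Sum>i<n. LINT x|bor n. (partial i f x)\<^sup>2)"
    by (rule Bochner_Integration.integral_sum) (intro cc_integrable cc_power2 test_fun_cc[OF test_fun_partial[OF assms]], simp)
  finally show ?thesis .
qed

text \<open>Pointwise, the square of grad (\<eta> v) is |grad \<eta>|^2 v^2 plus the inner product
  of grad (\<eta>^2 v) and grad v, and the latter is integrated by parts. The right-hand side then
  contains v and its Laplacian, but no first derivative of v.\<close>

lemma energy_identity:
  assumes \<eta>: "\<eta> \<in> test_fun n (Rn n)" and v: "smooth n v"
  shows "(nrm (bor n) 2 (gradn n (\<lambda>x. \<eta> x * v x)))\<^sup>2
    = (LINT x|bor n. (gradn n \<eta> x)\<^sup>2 * (v x)\<^sup>2) - (LINT x|bor n. (\<eta> x * v x) * (\<eta> x * lap n v x))"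
proof -
  have sm: "smooth n \<eta>" by (rule test_fun_smooth[OF \<eta>])
  define w where "w x = \<eta> x * v x" for x
  have w: "w \<in> test_fun n (Rn n)" unfolding w_def[abs_def] by (rule test_fun_mult[OF \<eta> v])
  define h where "h x = \<eta> x * w x" for x
  have h: "h \<in> test_fun n (Rn n)" unfolding h_def[abs_def] by (rule test_fun_mult[OF \<eta> test_fun_smooth[OF w]])
  have cont: "continuous_map (top_Rn n) euclideanreal f" if "smooth n f" for f by (rule smooth_continuous[OF that])
  have each: "(LINT x|bor n. (partial i w x)\<^sup>2) = (LINT x|bor n. (partial i \<eta> x)\<^sup>2 * (v x)\<^sup>2) - (LINT x|bor n. h x * partial i (partial i v) x)"
    if i: "i < n" for i
  proof -
    have cc1: "cc n (partial i \<eta>)" by (rule test_fun_cc[OF test_fun_partial[OF \<eta> i]])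
    have I1: "integrable (bor n) (\<lambda>x. (partial i \<eta> x)\<^sup>2 * (v x)\<^sup>2)"
      by (intro cc_integrable cc_mult cc_power2 cc1 cont smooth_power v)
    have I2: "integrable (bor n) (\<lambda>x. partial i h x * partial i v x)"
      by (intro cc_integrable cc_mult test_fun_cc[OF test_fun_partial[OF h i]] cont smooth_partial v i)
    have "(LINT x|bor n. (partial i w x)\<^sup>2) = (LINT x|bor n. (partial i \<eta> x)\<^sup>2 * (v x)\<^sup>2 + partial i h x * partial i v x)"
    proof (rule Bochner_Integration.integral_cong[OF refl])
      fix x assume "x \<in> space (bor n)"
      then have x: "x \<in> Rn n" by (simp add: space_bor)
      have pw: "partial i w x = partial i \<eta> x * v x + \<eta> x * partial i v x"
        unfolding w_def[abs_def] by (rule partial_mult[OF sm v i x])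
      have ph: "partial i h x = partial i \<eta> x * w x + \<eta> x * partial i w x"
        unfolding h_def[abs_def] by (rule partial_mult[OF sm test_fun_smooth[OF w] i x])
      show "(partial i w x)\<^sup>2 = (partial i \<eta> x)\<^sup>2 * (v x)\<^sup>2 + partial i h x * partial i v x"
        unfolding ph pw w_def by (simp add: power2_eq_square algebra_simps)
    qed
    also have "\<dots> = (LINT x|bor n. (partial i \<eta> x)\<^sup>2 * (v x)\<^sup>2) + (LINT x|bor n. partial i h x * partial i v x)"
      by (rule Bochner_Integration.integral_add[OF I1 I2])
    also have "(LINT x|bor n. partial i h x * partial i v x) = - (LINT x|bor n. h x * partial i (partial i v) x)"
      by (rule integral_by_parts[OF h smooth_partial[OF v i] i])
    finally show ?thesis by simp
  qed
  have "(nrm (bor n) 2 (gradn n w))\<^sup>2 = (\<Sum>i<n. (LINT x|bor n. (partial i \<eta> x)\<^sup>2 * (v x)\<^sup>2) - (LINT x|bor n. h x * partial i (partial i v) x))"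
    unfolding nrm2_gradn[OF w] using each by simp
  also have "\<dots> = (\<Sum>i<n. LINT x|bor n. (partial i \<eta> x)\<^sup>2 * (v x)\<^sup>2) - (\<Sum>i<n. LINT x|bor n. h x * partial i (partial i v) x)"
    by (rule sum_subtractf)
  also have "(\<Sum>i<n. LINT x|bor n. (partial i \<eta> x)\<^sup>2 * (v x)\<^sup>2) = (LINT x|bor n. (gradn n \<eta> x)\<^sup>2 * (v x)\<^sup>2)"
    unfolding gradn_sq sum_distrib_right
    by (rule Bochner_Integration.integral_sum[symmetric])
       (intro cc_integrable cc_mult cc_power2 test_fun_cc[OF test_fun_partial[OF \<eta>]] cont smooth_power v, simp)
  also have "(\<Sum>i<n. LINT x|bor n. h x * partial i (partial i v) x) = (LINT x|bor n. h x * lap n v x)"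
    unfolding lap_def sum_distrib_left
    by (rule Bochner_Integration.integral_sum[symmetric])
       (intro cc_integrable cc_mult test_fun_cc[OF h] cont smooth_partial v, simp_all)
  finally show ?thesis by (simp add: w_def[abs_def] h_def mult_ac)
qed

lemma test_energy:
  assumes w: "w \<in> test_fun n (Rn n)"
  shows "(nrm (bor n) 2 (gradn n w))\<^sup>2 = - (LINT x|bor n. w x * lap n w x)"
proof -
  have sm: "smooth n w" by (rule test_fun_smooth[OF w])
  have "(nrm (bor n) 2 (gradn n w))\<^sup>2 = (\<Sum>i<n. - (LINT x|bor n. w x * partial i (partial i w) x))"
    unfolding nrm2_gradn[OF w]
    by (rule sum.cong[OF refl]) (use integral_by_parts[OF w smooth_partial[OF sm]] in \<open>simp add: power2_eq_square\<close>)
  also have "\<dots> = - (LINT x|bor n. (\<Sum>i<n. w x * partial i (partial i w) x))"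
    unfolding sum_negf
    by (subst Bochner_Integration.integral_sum)
       (intro cc_integrable cc_mult test_fun_cc[OF w] smooth_continuous smooth_partial sm, simp_all)
  finally show ?thesis by (simp add: lap_def sum_distrib_left)
qed

text \<open>The field x - x0 has divergence n and length at most R on the support: n times the
  integral of w^2 is minus the integral of 2 w times the inner product of grad w and x - x0. The
  resulting constant 2 R / n improves with the dimension, which \<open>growth\<close>
  exploits.\<close>

lemma Poincare:
  assumes w: "w \<in> test_fun n (Rn n)" and R: "R \<ge> 0" "\<And>x. x \<in> Rn n \<Longrightarrow> dist_n n x0 x > R \<Longrightarrow> w x = 0"
  shows "real n * nrm (bor n) 2 w \<le> 2 * R * nrm (bor n) 2 (gradn n w)"
proof -
  have sm: "smooth n w" by (rule test_fun_smooth[OF w])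
  define N where "N = nrm (bor n) 2 w"
  have sd: "smooth n (\<lambda>x. x i - x0 i)" if "i < n" for i by (intro smooth_diff smooth_coord smooth_const that)
  have ww: "(\<lambda>x. w x * w x) \<in> test_fun n (Rn n)" by (rule test_fun_mult[OF w sm])
  have I: "integrable (bor n) (\<lambda>x. 2 * (w x * partial i w x) * (x i - x0 i))" if "i < n" for i
    by (intro cc_integrable cc_mult cc_cmult test_fun_cc[OF w] smooth_continuous smooth_partial sm sd that)
  have each: "N\<^sup>2 = - (LINT x|bor n. 2 * (w x * partial i w x) * (x i - x0 i))" if i: "i < n" for i
  proof -
    have "(LINT x|bor n. partial i (\<lambda>x. w x * w x) x * (x i - x0 i)) = - (LINT x|bor n. (w x * w x) * partial i (\<lambda>x. x i - x0 i) x)"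
      by (rule integral_by_parts[OF ww sd[OF i] i])
    also have "(LINT x|bor n. (w x * w x) * partial i (\<lambda>x. x i - x0 i) x) = N\<^sup>2"
    proof -
      have "partial i (\<lambda>x. x i - x0 i) x = 1" for x by (rule partial_eqI) (auto intro!: derivative_eq_intros)
      then show ?thesis using nrm_2[of "bor n" w] by (simp add: N_def power2_eq_square)
    qed
    also have "(LINT x|bor n. partial i (\<lambda>x. w x * w x) x * (x i - x0 i)) = (LINT x|bor n. 2 * (w x * partial i w x) * (x i - x0 i))"
      by (rule Bochner_Integration.integral_cong[OF refl]) (simp add: space_bor partial_mult[OF sm sm i])
    finally show ?thesis by simp
  qed
  have "real n * N\<^sup>2 = (\<Sum>i<n. - (LINT x|bor n. 2 * (w x * partial i w x) * (x i - x0 i)))"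
  proof -
    have "real n * N\<^sup>2 = (\<Sum>i<n. N\<^sup>2)" by simp
    also have "\<dots> = (\<Sum>i<n. - (LINT x|bor n. 2 * (w x * partial i w x) * (x i - x0 i)))"
      by (intro sum.cong refl each) simp
    finally show ?thesis .
  qed
  also have "\<dots> = - (LINT x|bor n. (\<Sum>i<n. 2 * (w x * partial i w x) * (x i - x0 i)))"
    unfolding sum_negf using I by (subst Bochner_Integration.integral_sum) auto
  also have "\<dots> \<le> (LINT x|bor n. \<bar>(2 * R * w x) * gradn n w x\<bar>)"
  proof -
    have "- (LINT x|bor n. (\<Sum>i<n. 2 * (w x * partial i w x) * (x i - x0 i))) = (LINT x|bor n. - (\<Sum>i<n. 2 * (w x * partial i w x) * (x i - x0 i)))"
      by simp
    also have "\<dots> \<le> (LINT x|bor n. \<bar>(2 * R * w x) * gradn n w x\<bar>)"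
    proof (rule integral_mono)
      show "integrable (bor n) (\<lambda>x. - (\<Sum>i<n. 2 * (w x * partial i w x) * (x i - x0 i)))"
        using I by (intro Bochner_Integration.integrable_minus Bochner_Integration.integrable_sum) auto
      show "integrable (bor n) (\<lambda>x. \<bar>(2 * R * w x) * gradn n w x\<bar>)"
        by (intro integrable_abs cc_integrable cc_mult cc_cmult test_fun_cc[OF w] continuous_gradn sm)
      fix x assume "x \<in> space (bor n)"
      then have x: "x \<in> Rn n" by (simp add: space_bor)
      show "- (\<Sum>i<n. 2 * (w x * partial i w x) * (x i - x0 i)) \<le> \<bar>(2 * R * w x) * gradn n w x\<bar>"
      proof (cases "w x = 0")
        case False
        then have d: "dist_n n x0 x \<le> R" using R(2)[OF x] by force
        have "\<bar>\<Sum>i<n. partial i w x * (x i - x0 i)\<bar> \<le> (\<Sum>i<n. \<bar>partial i w x\<bar> * \<bar>x i - x0 i\<bar>)"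
          by (rule order_trans[OF sum_abs]) (simp add: abs_mult)
        also have "\<dots> \<le> L2_set (\<lambda>i. partial i w x) {..<n} * L2_set (\<lambda>i. x i - x0 i) {..<n}"
          by (rule L2_set_mult_ineq)
        also have "\<dots> = gradn n w x * dist_n n x0 x"
          by (simp add: gradn_def L2_set_def dist_n_sqrt power2_commute)
        also have "\<dots> \<le> gradn n w x * R" using d by (intro mult_left_mono) auto
        finally have *: "\<bar>\<Sum>i<n. partial i w x * (x i - x0 i)\<bar> \<le> gradn n w x * R" .
        have "- (\<Sum>i<n. 2 * (w x * partial i w x) * (x i - x0 i)) = - (2 * w x * (\<Sum>i<n. partial i w x * (x i - x0 i)))"
        proof -
          have "(\<Sum>i<n. 2 * (w x * partial i w x) * (x i - x0 i)) = 2 * w x * (\<Sum>i<n. partial i w x * (x i - x0 i))"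
            unfolding sum_distrib_left by (rule sum.cong) (simp_all only: mult_ac)
          then show ?thesis by (simp only:)
        qed
        also have "\<dots> \<le> \<bar>2 * w x\<bar> * \<bar>\<Sum>i<n. partial i w x * (x i - x0 i)\<bar>"
          by (rule order_trans[OF abs_ge_minus_self]) (simp add: abs_mult)
        also have "\<dots> \<le> \<bar>2 * w x\<bar> * (gradn n w x * R)" by (rule mult_left_mono[OF *]) simp
        also have "\<dots> = \<bar>(2 * R * w x) * gradn n w x\<bar>" using R(1) by (simp add: abs_mult)
        finally show ?thesis .
      qed simp
    qed
    finally show ?thesis .
  qed
  also have "\<dots> \<le> nrm (bor n) 2 (\<lambda>x. 2 * R * w x) * nrm (bor n) 2 (gradn n w)"
    by (rule Holder(2)) (use cc_Lq cc_cmult test_fun_cc[OF w] cc_gradn[OF w] in auto)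
  also have "nrm (bor n) 2 (\<lambda>x. 2 * R * w x) = 2 * R * N" using R(1) by (simp add: nrm_cmult N_def)
  finally have *: "real n * N * N \<le> (2 * R * nrm (bor n) 2 (gradn n w)) * N" by (simp add: power2_eq_square mult_ac)
  show ?thesis
  proof (cases "N = 0")
    case True then show ?thesis using R(1) by (simp add: N_def[symmetric])
  next
    case False
    then have "N > 0" using nrm_nonneg[of "bor n" 2 w] unfolding N_def by linarith
    then show ?thesis using * by (simp add: N_def[symmetric])
  qed
qed

section \<open>Radial cutoff functions\<close>

definition sqd :: "nat \<Rightarrow> (nat \<Rightarrow> real) \<Rightarrow> real \<Rightarrow> (nat \<Rightarrow> real) \<Rightarrow> real" where
  "sqd n x0 r x = (\<Sum>i<n. ((x i - x0 i) / r)\<^sup>2)"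

lemma sqd_dist: "sqd n x0 r x = (dist_n n x0 x / r)\<^sup>2"
  by (simp add: sqd_def dist_n_sqrt power_divide sum_divide_distrib[symmetric] sum_nonneg power2_commute)

lemma sqd_nonneg: "sqd n x0 r x \<ge> 0"
  by (simp add: sqd_dist)

lemma sqd_le: "r > 0 \<Longrightarrow> c \<ge> 0 \<Longrightarrow> sqd n x0 r x \<le> c\<^sup>2 \<longleftrightarrow> dist_n n x0 x \<le> c * r"
  by (simp add: sqd_dist abs_le_square_iff[symmetric] divide_le_eq)

lemma sqd_ge: "r > 0 \<Longrightarrow> c \<ge> 0 \<Longrightarrow> c\<^sup>2 \<le> sqd n x0 r x \<longleftrightarrow> c * r \<le> dist_n n x0 x"
  by (simp add: sqd_dist abs_le_square_iff[symmetric] le_divide_eq)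

lemma sqd_less: "r > 0 \<Longrightarrow> c \<ge> 0 \<Longrightarrow> sqd n x0 r x < c\<^sup>2 \<longleftrightarrow> dist_n n x0 x < c * r"
  using sqd_ge[of r c n x0 x] by (simp add: not_le[symmetric])

text \<open>The squared distance is a polynomial, hence smooth at the centre as well. This is why
  all cutoffs are functions of it and their thresholds are squared radii in units of r.\<close>

lemma smooth_sqd: "smooth n (sqd n x0 r)"
  unfolding sqd_def[abs_def] divide_inverse
  by (intro smooth_sum smooth_power smooth_mult smooth_diff smooth_coord smooth_const) simp

lemma partial_sqd: "i < n \<Longrightarrow> x \<in> Rn n \<Longrightarrow> partial i (sqd n x0 r) x = 2 * (x i - x0 i) / r\<^sup>2"
proof (rule partial_eqI)
  assume i: "i < n" and x: "x \<in> Rn n"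
  have "sqd n x0 r (x(i := t)) = ((t - x0 i) / r)\<^sup>2 + (\<Sum>j\<in>{..<n} - {i}. ((x j - x0 j) / r)\<^sup>2)" for t
    unfolding sqd_def using i by (subst sum.remove[of _ i]) (auto intro!: sum.cong)
  moreover have "((\<lambda>t. ((t - x0 i) * inverse r)\<^sup>2 + C) has_real_derivative 2 * (x i - x0 i) / r\<^sup>2) (at (x i))" for C
    by (auto intro!: derivative_eq_intros simp: power2_eq_square divide_inverse)
  ultimately show "((\<lambda>t. sqd n x0 r (x(i := t))) has_real_derivative 2 * (x i - x0 i) / r\<^sup>2) (at (x i))"
    by (simp only: divide_inverse)
qed

lemma sum_partial_sqd: "x \<in> Rn n \<Longrightarrow> r \<noteq> 0 \<Longrightarrow> (\<Sum>i<n. (partial i (sqd n x0 r) x)\<^sup>2) = 4 * sqd n x0 r x / r\<^sup>2"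
proof -
  assume x: "x \<in> Rn n"
  have "(2 * z / r\<^sup>2)\<^sup>2 = 4 / r\<^sup>2 * (z / r)\<^sup>2" for z by (simp add: power2_eq_square)
  then have "(\<Sum>i<n. (partial i (sqd n x0 r) x)\<^sup>2) = (\<Sum>i<n. 4 / r\<^sup>2 * ((x i - x0 i) / r)\<^sup>2)"
    using x by (intro sum.cong refl) (simp only: partial_sqd lessThan_iff)
  also have "\<dots> = 4 / r\<^sup>2 * sqd n x0 r x" unfolding sqd_def by (rule sum_distrib_left[symmetric])
  finally show ?thesis by simp
qed

definition cutoff :: "nat \<Rightarrow> (nat \<Rightarrow> real) \<Rightarrow> real \<Rightarrow> real \<Rightarrow> real \<Rightarrow> (nat \<Rightarrow> real) \<Rightarrow> real" where
  "cutoff n x0 r a b x = step 0 ((sqd n x0 r x - a) / (b - a))"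

lemma smooth_step_sqd: "smooth n (\<lambda>x. step k ((sqd n x0 r x - a) / (b - a)))"
  unfolding divide_inverse
  by (rule smooth_comp[where h = step, OF _ step_deriv]) (intro smooth_mult smooth_diff smooth_sqd smooth_const)

lemma smooth_cut: "smooth n (cutoff n x0 r a b)"
  unfolding cutoff_def[abs_def] by (rule smooth_step_sqd)

lemma partial_step_sqd:
  assumes "i < n" "x \<in> Rn n"
  shows "partial i (\<lambda>x. step k ((sqd n x0 r x - a) / (b - a))) x = step (Suc k) ((sqd n x0 r x - a) / (b - a)) / (b - a) * (2 * (x i - x0 i) / r\<^sup>2)"
proof -
  have d: "((\<lambda>s. step k ((s - a) / (b - a))) has_real_derivative step (Suc k) ((sqd n x0 r x - a) / (b - a)) * (1 / (b - a))) (at (sqd n x0 r x))"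
    by (rule DERIV_chain2[OF step_deriv], rule DERIV_cdivide) (auto intro!: derivative_eq_intros)
  show ?thesis using partial_comp[OF smooth_sqd assms d] partial_sqd[OF assms, of x0 r] by simp
qed

lemma partial_cut: "i < n \<Longrightarrow> x \<in> Rn n \<Longrightarrow>
   partial i (cutoff n x0 r a b) x = step 1 ((sqd n x0 r x - a) / (b - a)) / (b - a) * (2 * (x i - x0 i) / r\<^sup>2)"
  unfolding cutoff_def[abs_def] using partial_step_sqd[of i n x 0 x0 r a b] by simp

lemma cut_01: "0 \<le> cutoff n x0 r a b x" "cutoff n x0 r a b x \<le> 1"
  by (auto simp: cutoff_def step_nonneg step_le_1)

lemma cut_one: "a < b \<Longrightarrow> sqd n x0 r x \<le> a \<Longrightarrow> cutoff n x0 r a b x = 1"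
  unfolding cutoff_def by (rule step_left) (simp add: divide_nonpos_pos)

lemma cut_zero: "a < b \<Longrightarrow> sqd n x0 r x \<ge> b \<Longrightarrow> cutoff n x0 r a b x = 0"
  unfolding cutoff_def by (rule step_right) simp

lemma step_zero_sqd: "a < b \<Longrightarrow> sqd n x0 r x \<le> a \<or> b \<le> sqd n x0 r x \<Longrightarrow> step (Suc k) ((sqd n x0 r x - a) / (b - a)) = 0"
  by (rule step_Suc_outside) (auto simp: divide_nonpos_pos)

lemma partial_cut_zero:
  "a < b \<Longrightarrow> i < n \<Longrightarrow> x \<in> Rn n \<Longrightarrow> sqd n x0 r x \<le> a \<or> b \<le> sqd n x0 r x \<Longrightarrow> partial i (cutoff n x0 r a b) x = 0"
  using step_zero_sqd[of a b n x0 r x 0] by (simp add: partial_cut)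

lemma gradn_cut_sq:
  assumes "x \<in> Rn n" "r \<noteq> 0"
  shows "(gradn n (cutoff n x0 r a b) x)\<^sup>2 = (step 1 ((sqd n x0 r x - a) / (b - a)) / (b - a))\<^sup>2 * (4 * sqd n x0 r x / r\<^sup>2)"
proof -
  have "(gradn n (cutoff n x0 r a b) x)\<^sup>2 = (\<Sum>i<n. (step 1 ((sqd n x0 r x - a) / (b - a)) / (b - a))\<^sup>2 * (partial i (sqd n x0 r) x)\<^sup>2)"
    unfolding gradn_sq
  proof (rule sum.cong[OF refl])
    fix i assume "i \<in> {..<n}"
    then have i: "i < n" by simp
    show "(partial i (cutoff n x0 r a b) x)\<^sup>2 = (step 1 ((sqd n x0 r x - a) / (b - a)) / (b - a))\<^sup>2 * (partial i (sqd n x0 r) x)\<^sup>2"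
      unfolding partial_cut[OF i assms(1)] partial_sqd[OF i assms(1)] by (simp only: power_mult_distrib)
  qed
  then show ?thesis by (simp add: sum_distrib_left[symmetric] sum_partial_sqd[OF assms])
qed

text \<open>The chain rule, with |grad sqd|^2 = 4 sqd / r^2 and Laplacian of sqd equal to 2 n / r^2.
  The second summand is the origin of the factor n in \<open>carleman_estimate\<close>.\<close>

lemma lap_cut:
  assumes x: "x \<in> Rn n" and r: "r \<noteq> 0"
  shows "lap n (cutoff n x0 r a b) x = step 2 ((sqd n x0 r x - a) / (b - a)) / (b - a)\<^sup>2 * (4 * sqd n x0 r x / r\<^sup>2)
     + step 1 ((sqd n x0 r x - a) / (b - a)) / (b - a) * (2 * real n / r\<^sup>2)"
proof -
  let ?q = "(sqd n x0 r x - a) / (b - a)"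
  have each: "partial i (partial i (cutoff n x0 r a b)) x = step 2 ?q / (b - a)\<^sup>2 * (partial i (sqd n x0 r) x)\<^sup>2 + step 1 ?q / (b - a) * (2 / r\<^sup>2)"
    if i: "i < n" for i
  proof -
    define c where "c = 2 / (b - a) / r\<^sup>2"
    define p where "p y = c * (y i - x0 i)" for y :: "nat \<Rightarrow> real"
    have p: "smooth n p" unfolding p_def[abs_def] by (intro smooth_cmult smooth_diff smooth_coord smooth_const i)
    have pp: "partial i p x = c"
      unfolding p_def[abs_def] by (rule partial_eqI) (auto intro!: derivative_eq_intros)
    have "partial i (partial i (cutoff n x0 r a b)) x = partial i (\<lambda>y. step (Suc 0) ((sqd n x0 r y - a) / (b - a)) * p y) x"
      by (rule partial_cong[OF _ i x]) (simp add: partial_cut[OF i] p_def c_def)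
    also have "\<dots> = partial i (\<lambda>y. step (Suc 0) ((sqd n x0 r y - a) / (b - a))) x * p x + step (Suc 0) ?q * partial i p x"
      by (rule partial_mult[OF smooth_step_sqd p i x])
    finally show ?thesis
      unfolding pp partial_step_sqd[OF i x] partial_sqd[OF i x] p_def c_def
      by (simp add: power2_eq_square numeral_2_eq_2 mult_ac)
  qed
  have "lap n (cutoff n x0 r a b) x = (\<Sum>i<n. step 2 ?q / (b - a)\<^sup>2 * (partial i (sqd n x0 r) x)\<^sup>2 + step 1 ?q / (b - a) * (2 / r\<^sup>2))"
    unfolding lap_def using each by simp
  also have "\<dots> = step 2 ?q / (b - a)\<^sup>2 * (\<Sum>i<n. (partial i (sqd n x0 r) x)\<^sup>2) + real n * (step 1 ?q / (b - a) * (2 / r\<^sup>2))"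
    by (simp only: sum.distrib sum_distrib_left[symmetric]) simp
  finally show ?thesis by (simp add: sum_partial_sqd[OF x r])
qed

lemma cut_test_fun:
  assumes "a < b" "r > 0" "c \<ge> 0" "b \<le> c\<^sup>2" "{y \<in> Rn n. dist_n n x0 y \<le> c * r} \<subseteq> U"
  shows "cutoff n x0 r a b \<in> test_fun n U"
proof (rule test_funI_ball[OF smooth_cut assms(5)])
  fix x assume "x \<in> Rn n" "c * r < dist_n n x0 x"
  then have "\<not> sqd n x0 r x \<le> c\<^sup>2" using sqd_le[OF assms(2,3)] by simp
  then show "cutoff n x0 r a b x = 0" using assms by (intro cut_zero) auto
qed

section \<open>Energy and growth estimates for solutions\<close>

lemma exponents:
  assumes "n \<ge> 3"
  shows "exp_p n \<ge> 1" "exp_p' n > 2" "exp_p n < 2" "1 / exp_p n + 1 / exp_p' n = 1" "1 / (real n / 2) + 1 / exp_p' n = 1 / exp_p n"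
    "1 / 2 - 1 / exp_p' n = 1 / real n" "1 / exp_p n - 1 / 2 = 1 / real n"
proof -
  have n: "real n \<ge> 3" using assms by simp
  show "exp_p n \<ge> 1" "exp_p' n > 2" "exp_p n < 2" using n by (auto simp: exp_p_def exp_p'_def field_simps)
  show "1 / exp_p n + 1 / exp_p' n = 1" "1 / (real n / 2) + 1 / exp_p' n = 1 / exp_p n"
    "1 / 2 - 1 / exp_p' n = 1 / real n" "1 / exp_p n - 1 / 2 = 1 / real n"
    using n by (auto simp: exp_p_def exp_p'_def divide_simps)
qed

lemma Lq_indicator:
  assumes "A \<in> sets M" "emeasure M A < \<infinity>" "q > 0"
  shows "indicator A \<in> Lq M q" "nrm M q (indicator A) = measure M A powr (1 / q)"
proof -
  have e: "\<bar>indicator A x\<bar> powr q = indicator A x" "indicat_real A x powr q = indicator A x" for x :: 'a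
    using assms by (simp_all add: indicator_def)
  show "indicator A \<in> Lq M q" using assms by (simp add: Lq_def e integrable_real_indicator)
  show "nrm M q (indicator A) = measure M A powr (1 / q)" using assms by (simp add: nrm_def e)
qed

text \<open>Hoelder with the indicator of the ball. For the pairs p < 2 and 2 < p' the exponent 1/s
  - 1/a equals 1/n, so that the factor is just 2 R.\<close>

lemma Lq_support_mono:
  assumes f: "f \<in> Lq (bor n) a" and z: "\<And>x. x \<in> Rn n \<Longrightarrow> x \<notin> ball_n n x0 R \<Longrightarrow> f x = 0" and s: "0 < s" "s < a" and R: "R \<ge> 0"
  shows "f \<in> Lq (bor n) s" "nrm (bor n) s f \<le> ((2 * R) ^ n) powr (1 / s - 1 / a) * nrm (bor n) a f"
proof -
  define b where "b = 1 / (1 / s - 1 / a)"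
  have d: "1 / s - 1 / a > 0" using s by (simp add: field_simps)
  have b: "b > 0" "1 / a + 1 / b = 1 / s" "1 / b = 1 / s - 1 / a" using d by (simp_all add: b_def)
  note i = Lq_indicator[OF ball_measurable ball_finite b(1), of n x0 R]
  have e: "f x * indicator (ball_n n x0 R) x = f x" if "x \<in> space (bor n)" for x
    using z that by (cases "x \<in> ball_n n x0 R") (auto simp: space_bor)
  note H = Holder_general[OF s(1) _ b(1,2) f i(1)]
  have m: "f \<in> borel_measurable (bor n)" by (rule LqD(1)[OF f])
  show "f \<in> Lq (bor n) s"
    by (rule Lq_bound(1)[where C = 1, OF H(1)]) (use s m in \<open>auto intro!: AE_I2 simp del: abs_mult simp: e\<close>)
  have "measure (bor n) (ball_n n x0 R) \<le> (2 * R) ^ n"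
    using emeasure_ball_le[OF R, of n x0] R unfolding measure_def by (intro enn2real_leI) auto
  then have "measure (bor n) (ball_n n x0 R) powr (1 / b) \<le> ((2 * R) ^ n) powr (1 / b)"
    using d R by (intro powr_mono2) (auto simp: b(3) simp del: power_mult_distrib)
  then have l: "nrm (bor n) b (indicator (ball_n n x0 R)) \<le> ((2 * R) ^ n) powr (1 / s - 1 / a)"
    using i(2) b(3) by simp
  have "nrm (bor n) s f = nrm (bor n) s (\<lambda>x. f x * indicator (ball_n n x0 R) x)"
    by (rule nrm_cong) (simp add: e)
  also have "\<dots> \<le> nrm (bor n) a f * nrm (bor n) b (indicator (ball_n n x0 R))"
    using s by (intro H(2)) auto
  also have "\<dots> \<le> nrm (bor n) a f * ((2 * R) ^ n) powr (1 / s - 1 / a)"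
    by (rule mult_left_mono[OF l]) simp
  finally show "nrm (bor n) s f \<le> ((2 * R) ^ n) powr (1 / s - 1 / a) * nrm (bor n) a f" by (simp only: mult.commute)
qed

lemma power_root: "(R::real) \<ge> 0 \<Longrightarrow> n > 0 \<Longrightarrow> (R ^ n) powr (1 / real n) = R"
proof (cases "R = 0")
  case False
  assume "R \<ge> 0" "n > 0"
  then show ?thesis using False by (simp only: powr_realpow[of R n, symmetric] powr_powr) simp
qed simp

text \<open>A derivative of the kernel in x is minus the one in y, so the weak identity applies with
  the kernel as test function. Its support stays in the ball because of the margin n / (k +
  1).\<close>

lemma partial_conv_weak:
  assumes u: "integrable (bor n) u"
    and weak: "\<And>\<phi>. \<phi> \<in> test_fun n (ball_n n x0 R) \<Longrightarrow> (LINT y|bor n. u y * partial i \<phi> y) = - (LINT y|bor n. g y * \<phi> y)"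
    and i: "i < n" and x: "x \<in> Rn n" "dist_n n x0 x + real n / real (Suc k) < R"
  shows "partial i (conv0 n k u) x = conv0 n k g x"
proof -
  let ?a = "(\<lambda>_. 0) :: nat \<Rightarrow> nat"
  have t: "rho n k ?a x \<in> test_fun n (ball_n n x0 R)"
  proof (rule rho_test_fun[OF x(1)], safe)
    fix y assume "y \<in> Rn n" "dist_n n x y \<le> real n / real (Suc k)"
    then show "y \<in> ball_n n x0 R" using dist_n_triangle[of n x0 y x] x(2) by (simp add: ball_n_def)
  qed
  have p: "partial i (rho n k ?a x) y = - rho n k (?a(i := Suc 0)) x y" if "y \<in> Rn n" for y
    using rho_DERIV2[OF i that] by (rule partial_eqI)
  have "partial i (conv0 n k u) x = conv n k (?a(i := Suc 0)) u x" using partial_conv[OF u i x(1)] .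
  also have "\<dots> = - (LINT y|bor n. u y * partial i (rho n k ?a x) y)"
    unfolding conv_def integral_minus[symmetric] by (rule Bochner_Integration.integral_cong) (auto simp: p space_bor)
  also have "\<dots> = (LINT y|bor n. g y * rho n k ?a x y)" using weak[OF t] by simp
  finally show ?thesis unfolding conv_def by (simp add: mult.commute)
qed

lemma lap_conv_weak:
  assumes u: "integrable (bor n) u"
    and weak: "\<And>\<phi>. \<phi> \<in> test_fun n (ball_n n x0 R) \<Longrightarrow> (LINT y|bor n. u y * lap n \<phi> y) = (LINT y|bor n. F y * \<phi> y)"
    and x: "x \<in> Rn n" "dist_n n x0 x + real n / real (Suc k) < R"
  shows "lap n (conv0 n k u) x = conv0 n k F x"
proof -
  let ?a = "(\<lambda>_. 0) :: nat \<Rightarrow> nat"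
  have t: "rho n k ?a x \<in> test_fun n (ball_n n x0 R)"
  proof (rule rho_test_fun[OF x(1)], safe)
    fix y assume "y \<in> Rn n" "dist_n n x y \<le> real n / real (Suc k)"
    then show "y \<in> ball_n n x0 R" using dist_n_triangle[of n x0 y x] x(2) by (simp add: ball_n_def)
  qed
  have up: "(?a(i := Suc 0))(i := Suc ((?a(i := Suc 0)) i)) = ?a(i := 2)" for i by auto
  have p: "partial i (partial i (rho n k ?a x)) y = rho n k (?a(i := 2)) x y" if y: "y \<in> Rn n" and i: "i < n" for y i
  proof -
    have "partial i (partial i (rho n k ?a x)) y = partial i (\<lambda>y. - 1 * rho n k (?a(i := Suc 0)) x y) y"
    proof (rule partial_cong[OF _ i y])
      fix z assume z: "z \<in> Rn n"
      show "partial i (rho n k ?a x) z = - 1 * rho n k (?a(i := Suc 0)) x z"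
        using partial_eqI[OF rho_DERIV2[OF i z, of k ?a x]] by simp
    qed
    also have "\<dots> = - 1 * partial i (rho n k (?a(i := Suc 0)) x) y"
      by (rule partial_cmult[OF rho_smooth2[OF x(1)] i y])
    also have "partial i (rho n k (?a(i := Suc 0)) x) y = - rho n k (?a(i := 2)) x y"
      using partial_eqI[OF rho_DERIV2[OF i y, of k "?a(i := Suc 0)" x]] unfolding up .
    finally show ?thesis by simp
  qed
  have q: "partial i (partial i (conv0 n k u)) x = conv n k (?a(i := 2)) u x" if i: "i < n" for i
  proof -
    have "partial i (partial i (conv0 n k u)) x = partial i (conv n k (?a(i := Suc 0)) u) x"
      by (rule partial_cong[OF _ i x(1)]) (rule partial_conv[OF u i])
    also have "\<dots> = conv n k (?a(i := 2)) u x"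
      using partial_conv[OF u i x(1), of k "?a(i := Suc 0)"] unfolding up .
    finally show ?thesis .
  qed
  have "lap n (conv0 n k u) x = (\<Sum>i<n. (LINT y|bor n. rho n k (?a(i := 2)) x y * u y))"
    unfolding lap_def using q by (simp add: conv_def)
  also have "\<dots> = (LINT y|bor n. (\<Sum>i<n. rho n k (?a(i := 2)) x y * u y))"
    by (rule Bochner_Integration.integral_sum[symmetric]) (rule conv_integrable[OF u x(1)])
  also have "\<dots> = (LINT y|bor n. u y * lap n (rho n k ?a x) y)"
    by (rule Bochner_Integration.integral_cong) (simp_all add: lap_def p space_bor sum_distrib_left mult.commute)
  also have "\<dots> = (LINT y|bor n. F y * rho n k ?a x y)" by (rule weak[OF t])
  finally show ?thesis unfolding conv_def by (simp add: mult.commute)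
qed

text \<open>The energy is minus the integral of w times its Laplacian, which Hoelder bounds by the
  dual norms; one factor cancels against the squared Sobolev inequality. This estimate drives the
  gain of integrability in \<open>interior_Lq\<close>.\<close>

lemma sobolev_lap:
  assumes n: "n \<ge> 3" and U: "openin (top_Rn n) U" and w: "w \<in> test_fun n U"
  shows "nrm (bor n) (exp_p' n) w \<le> (sigma n U)\<^sup>2 * nrm (bor n) (exp_p n) (lap n w)"
proof -
  note e = exponents[OF n]
  let ?A = "nrm (bor n) (exp_p' n) w" and ?B = "nrm (bor n) (exp_p n) (lap n w)"
  have wr: "w \<in> test_fun n (Rn n)" using w openin_subset[OF U] by (auto intro: test_fun_mono simp: topspace_Rn)
  have cl: "cc n (lap n w)"
    unfolding lap_def[abs_def] using wr by (intro cc_sum test_fun_cc[of _ n "Rn n"] test_fun_partial) auto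
  have "?A\<^sup>2 \<le> (sigma n U * nrm (bor n) 2 (gradn n w))\<^sup>2"
    by (rule power_mono[OF sobolev_inequality[OF n U w]]) simp
  also have "\<dots> = (sigma n U)\<^sup>2 * - (LINT x|bor n. w x * lap n w x)"
    by (simp only: power_mult_distrib test_energy[OF wr])
  also have "\<dots> \<le> (sigma n U)\<^sup>2 * (?A * ?B)"
  proof (rule mult_left_mono)
    have "\<bar>LINT x|bor n. w x * lap n w x\<bar> \<le> ?A * ?B"
      by (rule Holder_abs) (use e in \<open>auto intro!: cc_Lq cl test_fun_cc[OF wr]\<close>)
    then show "- (LINT x|bor n. w x * lap n w x) \<le> ?A * ?B" by linarith
  qed simp
  finally have *: "?A * ?A \<le> ((sigma n U)\<^sup>2 * ?B) * ?A" by (simp add: power2_eq_square mult_ac)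
  show ?thesis
  proof (cases "?A = 0")
    case True then show ?thesis by simp
  next
    case False
    then have "?A > 0" using nrm_nonneg[of "bor n" "exp_p' n" w] by linarith
    then show ?thesis using * by simp
  qed
qed

text \<open>The data on the ball of radius 3 r are Borel functions extended by zero, and F stands
  for the Laplacian of u. The constant \<sigma> is that of the whole domain U: functions supported
  in the ball are admissible for it.\<close>

locale ball_solution =
  fixes n :: nat and x0 :: "nat \<Rightarrow> real" and r :: real and U :: "(nat \<Rightarrow> real) set" and u F V :: "(nat \<Rightarrow> real) \<Rightarrow> real" and kap :: real
  assumes n: "n \<ge> 3" and r: "r > 0" and U: "openin (top_Rn n) U" "ball_n n x0 (3 * r) \<subseteq> U" and x0: "x0 \<in> Rn n"
    and u: "u \<in> Lq (bor n) (exp_p' n)" "\<And>x. x \<notin> ball_n n x0 (3 * r) \<Longrightarrow> u x = 0"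
    and F: "F \<in> Lq (bor n) (exp_p n)" "\<And>x. x \<notin> ball_n n x0 (3 * r) \<Longrightarrow> F x = 0"
    and V: "V \<in> Lq (bor n) (real n / 2)" "nrm (bor n) (real n / 2) V \<le> kap" "2 * (sigma n U)\<^sup>2 * kap \<le> 1"
    and FV: "AE x in bor n. F x = V x * u x"
    and weak: "\<And>\<phi>. \<phi> \<in> test_fun n (ball_n n x0 (3 * r)) \<Longrightarrow> (LINT y|bor n. u y * lap n \<phi> y) = (LINT y|bor n. F y * \<phi> y)"
begin

abbreviation "L \<equiv> nrm (bor n)"
abbreviation "v k \<equiv> conv0 n k u"

lemma u2: "u \<in> Lq (bor n) 2"
  using exponents[OF n] r by (intro Lq_support_mono(1)[OF u(1), of x0 "3 * r"] u(2)) auto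

lemma u_int: "integrable (bor n) u"
  unfolding Lq_1[symmetric] using r by (intro Lq_support_mono(1)[OF u2, of x0 "3 * r"] u(2)) auto

lemma F_int: "integrable (bor n) F"
proof (cases "exp_p n = 1")
  case True then show ?thesis using F(1) Lq_1[of F "bor n"] by simp
next
  case False then show ?thesis unfolding Lq_1[symmetric] using r exponents[OF n]
    by (intro Lq_support_mono(1)[OF F(1), of x0 "3 * r"] F(2)) auto
qed

lemma v_smooth: "smooth n (v k)" by (rule conv_smooth[OF u_int])

lemma v_Lq: "q \<ge> 1 \<Longrightarrow> u \<in> Lq (bor n) q \<Longrightarrow> v k \<in> Lq (bor n) q" by (rule conv_Young(1)[OF _ u_int])

lemma mult_v_tendsto:
  assumes q: "q \<ge> 1" "u \<in> Lq (bor n) q" and h: "cc n h"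
  shows "(\<lambda>k. L q (\<lambda>x. h x * v k x - h x * u x)) \<longlonglongrightarrow> 0" "(\<lambda>x. h x * u x) \<in> Lq (bor n) q" "\<And>k. (\<lambda>x. h x * v k x) \<in> Lq (bor n) q"
proof -
  obtain C where C: "\<And>x. x \<in> Rn n \<Longrightarrow> \<bar>h x\<bar> \<le> C" using cc_bounded[OF h] by metis
  have m: "h \<in> borel_measurable (bor n)" by (rule borel_measurable_continuous_Rn[OF ccD[OF h]])
  note N = nrm_tendsto_mult[OF q(1) v_Lq[OF q] q(2) conv_Lq_tendsto[OF q(1) u_int q(2)] m, of C]
  show "(\<lambda>k. L q (\<lambda>x. h x * v k x - h x * u x)) \<longlonglongrightarrow> 0" "(\<lambda>x. h x * u x) \<in> Lq (bor n) q" "\<And>k. (\<lambda>x. h x * v k x) \<in> Lq (bor n) q"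
    using N C by (auto simp: space_bor)
qed

lemma mult_F_tendsto:
  assumes h: "cc n h"
  shows "(\<lambda>k. L (exp_p n) (\<lambda>x. h x * conv0 n k F x - h x * F x)) \<longlonglongrightarrow> 0" "(\<lambda>x. h x * F x) \<in> Lq (bor n) (exp_p n)"
    "\<And>k. (\<lambda>x. h x * conv0 n k F x) \<in> Lq (bor n) (exp_p n)"
proof -
  obtain C where C: "\<And>x. x \<in> Rn n \<Longrightarrow> \<bar>h x\<bar> \<le> C" using cc_bounded[OF h] by metis
  have m: "h \<in> borel_measurable (bor n)" by (rule borel_measurable_continuous_Rn[OF ccD[OF h]])
  note q = exponents(1)[OF n]
  note N = nrm_tendsto_mult[OF q conv_Young(1)[OF q F_int F(1)] F(1) conv_Lq_tendsto[OF q F_int F(1)] m, of C]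
  show "(\<lambda>k. L (exp_p n) (\<lambda>x. h x * conv0 n k F x - h x * F x)) \<longlonglongrightarrow> 0" "(\<lambda>x. h x * F x) \<in> Lq (bor n) (exp_p n)"
    "\<And>k. (\<lambda>x. h x * conv0 n k F x) \<in> Lq (bor n) (exp_p n)"
    using N C by (auto simp: space_bor)
qed

lemma nrm_mult_v_tendsto:
  assumes "q \<ge> 1" "u \<in> Lq (bor n) q" "cc n h"
  shows "(\<lambda>k. L q (\<lambda>x. h x * v k x)) \<longlonglongrightarrow> L q (\<lambda>x. h x * u x)"
  using mult_v_tendsto[OF assms] by (intro nrm_tendsto[OF assms(1)])

text \<open>The kernel radius n / (k + 1) eventually fits between \<rho> and 3 r.\<close>

lemma lap_v_eventually:
  assumes "\<rho> < 3 * r"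
  shows "\<forall>\<^sub>F k in sequentially. \<forall>x\<in>Rn n. dist_n n x0 x \<le> \<rho> \<longrightarrow> lap n (v k) x = conv0 n k F x"
proof -
  have "(\<lambda>k. \<rho> + real n / real (Suc k)) \<longlonglongrightarrow> \<rho> + real n * 0"
    unfolding divide_inverse by (intro tendsto_add tendsto_const tendsto_mult LIMSEQ_inverse_real_of_nat)
  then have "\<forall>\<^sub>F k in sequentially. \<rho> + real n / real (Suc k) < 3 * r"
    using assms by (intro order_tendstoD(2)[of _ "\<rho> + real n * 0"]) auto
  then show ?thesis
  proof eventually_elim
    case (elim k)
    show ?case
    proof (intro ballI impI)
      fix x assume "x \<in> Rn n" "dist_n n x0 x \<le> \<rho>"
      then show "lap n (v k) x = conv0 n k F x" using elim by (intro lap_conv_weak[OF u_int weak, of x0 "3 * r"]) auto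
    qed
  qed
qed

text \<open>F is V u almost everywhere, and 2 / n + 1 / p' = 1 / p makes Hoelder return the same
  L^p' norm that stands on the left of the Sobolev and Carleman inequalities. This is what permits
  absorption.\<close>

lemma nrm_mult_F:
  assumes h: "h \<in> borel_measurable (bor n)" and hu: "(\<lambda>x. h x * u x) \<in> Lq (bor n) (exp_p' n)"
  shows "L (exp_p n) (\<lambda>x. h x * F x) \<le> kap * L (exp_p' n) (\<lambda>x. h x * u x)"
proof -
  note e = exponents[OF n]
  have [measurable]: "V \<in> borel_measurable (bor n)" "u \<in> borel_measurable (bor n)" "F \<in> borel_measurable (bor n)" "h \<in> borel_measurable (bor n)"
    using V(1) u(1) F(1) h by (auto dest: LqD(1))
  have "L (exp_p n) (\<lambda>x. h x * F x) = L (exp_p n) (\<lambda>x. V x * (h x * u x))"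
    by (rule nrm_cong_AE) (use FV in auto)
  also have "\<dots> \<le> L (real n / 2) V * L (exp_p' n) (\<lambda>x. h x * u x)"
    using e n by (intro Holder_general(2)[OF _ _ _ _ V(1) hu]) auto
  also have "\<dots> \<le> kap * L (exp_p' n) (\<lambda>x. h x * u x)" by (rule mult_right_mono[OF V(2)]) simp
  finally show ?thesis .
qed

lemma kap_nonneg: "kap \<ge> 0" using V(2) nrm_nonneg[of "bor n" "real n / 2" V] by linarith

text \<open>Half of the energy absorbs the potential term because \<open>2 \<sigma>\<^sup>2 \<kappa> \<le> 1\<close>.\<close>

lemma energy_limit:
  assumes \<eta>: "smooth n \<eta>" and z: "\<And>x. x \<in> Rn n \<Longrightarrow> dist_n n x0 x > \<rho> \<Longrightarrow> \<eta> x = 0" and \<rho>: "\<rho> < 3 * r"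
  obtains E where "(\<lambda>k. (L 2 (gradn n (\<lambda>x. \<eta> x * v k x)))\<^sup>2) \<longlonglongrightarrow> E" "E \<le> 2 * (L 2 (\<lambda>x. gradn n \<eta> x * u x))\<^sup>2"
proof -
  note e = exponents[OF n]
  have tB: "\<eta> \<in> test_fun n (ball_n n x0 (3 * r))"
    by (rule test_funI_ball[OF \<eta> _ z]) (use \<rho> in \<open>auto simp: ball_n_def\<close>)
  have tU: "\<eta> \<in> test_fun n U" by (rule test_fun_mono[OF U(2) tB])
  have tR: "\<eta> \<in> test_fun n (Rn n)" using openin_subset[OF U(1)] by (intro test_fun_mono[OF _ tU]) (auto simp: topspace_Rn)
  have c: "cc n \<eta>" "cc n (gradn n \<eta>)" using test_fun_cc[OF tR] cc_gradn[OF tR] by auto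
  \<comment> \<open>Where \<eta> is nonzero, the Laplacian of the mollification is the mollification
    of F for large k; elsewhere both products vanish.\<close>
  have ev: "\<forall>\<^sub>F k in sequentially. (L 2 (gradn n (\<lambda>x. \<eta> x * v k x)))\<^sup>2 =
     (LINT x|bor n. (gradn n \<eta> x * v k x) * (gradn n \<eta> x * v k x)) - (LINT x|bor n. (\<eta> x * v k x) * (\<eta> x * conv0 n k F x))"
    using lap_v_eventually[OF \<rho>]
  proof eventually_elim
    case (elim k)
    have "(LINT x|bor n. (\<eta> x * v k x) * (\<eta> x * lap n (v k) x)) = (LINT x|bor n. (\<eta> x * v k x) * (\<eta> x * conv0 n k F x))"
    proof (rule Bochner_Integration.integral_cong[OF refl])
      fix x assume "x \<in> space (bor n)"
      then have "x \<in> Rn n" by (simp add: space_bor)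
      then show "(\<eta> x * v k x) * (\<eta> x * lap n (v k) x) = (\<eta> x * v k x) * (\<eta> x * conv0 n k F x)"
        using elim z by (cases "dist_n n x0 x \<le> \<rho>") auto
    qed
    moreover have "(LINT x|bor n. (gradn n \<eta> x)\<^sup>2 * (v k x)\<^sup>2) = (LINT x|bor n. (gradn n \<eta> x * v k x) * (gradn n \<eta> x * v k x))"
      by (simp only: power2_eq_square mult_ac)
    ultimately show ?case using energy_identity[OF tR v_smooth, of k] by (simp only:)
  qed
  define E where "E = (LINT x|bor n. (gradn n \<eta> x * u x) * (gradn n \<eta> x * u x)) - (LINT x|bor n. (\<eta> x * u x) * (\<eta> x * F x))"
  note g2 = mult_v_tendsto[OF _ u2 c(2)] and p' = mult_v_tendsto[OF _ u(1) c(1)] and pF = mult_F_tendsto[OF c(1)]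
  have lim: "(\<lambda>k. (L 2 (gradn n (\<lambda>x. \<eta> x * v k x)))\<^sup>2) \<longlonglongrightarrow> E"
  proof (rule Lim_transform_eventually)
    show "\<forall>\<^sub>F k in sequentially. (LINT x|bor n. (gradn n \<eta> x * v k x) * (gradn n \<eta> x * v k x)) - (LINT x|bor n. (\<eta> x * v k x) * (\<eta> x * conv0 n k F x))
       = (L 2 (gradn n (\<lambda>x. \<eta> x * v k x)))\<^sup>2"
      using ev by eventually_elim simp
    show "(\<lambda>k. (LINT x|bor n. (gradn n \<eta> x * v k x) * (gradn n \<eta> x * v k x)) - (LINT x|bor n. (\<eta> x * v k x) * (\<eta> x * conv0 n k F x))) \<longlonglongrightarrow> E"
      unfolding E_def
    proof (rule tendsto_diff)
      show "(\<lambda>k. LINT x|bor n. (gradn n \<eta> x * v k x) * (gradn n \<eta> x * v k x)) \<longlonglongrightarrow> (LINT x|bor n. (gradn n \<eta> x * u x) * (gradn n \<eta> x * u x))"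
        by (rule integral_mult_tendsto[of 2 2]) (use g2 in auto)
      show "(\<lambda>k. LINT x|bor n. (\<eta> x * v k x) * (\<eta> x * conv0 n k F x)) \<longlonglongrightarrow> (LINT x|bor n. (\<eta> x * u x) * (\<eta> x * F x))"
        by (rule integral_mult_tendsto[of "exp_p' n" "exp_p n"]) (use p' pF e in auto)
    qed
  qed
  have E0: "E \<ge> 0" by (rule LIMSEQ_le_const[OF lim]) auto
  \<comment> \<open>The Sobolev inequality is used for \<eta> times the mollification and passed to
    the limit: E takes the place of the energy of \<eta> u.\<close>
  define N where "N = L (exp_p' n) (\<lambda>x. \<eta> x * u x)"
  have NE: "N\<^sup>2 \<le> (sigma n U)\<^sup>2 * E"
  proof (rule LIMSEQ_le)
    show "(\<lambda>k. (L (exp_p' n) (\<lambda>x. \<eta> x * v k x))\<^sup>2) \<longlonglongrightarrow> N\<^sup>2"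
      unfolding N_def by (intro tendsto_power nrm_mult_v_tendsto u(1) c) (use e in auto)
    show "(\<lambda>k. (sigma n U)\<^sup>2 * (L 2 (gradn n (\<lambda>x. \<eta> x * v k x)))\<^sup>2) \<longlonglongrightarrow> (sigma n U)\<^sup>2 * E"
      by (intro tendsto_mult tendsto_const lim)
    show "\<exists>N. \<forall>k\<ge>N. (L (exp_p' n) (\<lambda>x. \<eta> x * v k x))\<^sup>2 \<le> (sigma n U)\<^sup>2 * (L 2 (gradn n (\<lambda>x. \<eta> x * v k x)))\<^sup>2"
    proof (intro exI allI impI)
      fix k :: nat
      have "L (exp_p' n) (\<lambda>x. \<eta> x * v k x) \<le> sigma n U * L 2 (gradn n (\<lambda>x. \<eta> x * v k x))"
        by (rule sobolev_inequality[OF n U(1) test_fun_mult[OF tU v_smooth]])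
      then show "(L (exp_p' n) (\<lambda>x. \<eta> x * v k x))\<^sup>2 \<le> (sigma n U)\<^sup>2 * (L 2 (gradn n (\<lambda>x. \<eta> x * v k x)))\<^sup>2"
        unfolding power_mult_distrib[symmetric] by (rule power_mono) simp
    qed
  qed
  have "\<bar>LINT x|bor n. (\<eta> x * u x) * (\<eta> x * F x)\<bar> \<le> N * L (exp_p n) (\<lambda>x. \<eta> x * F x)"
    unfolding N_def by (rule Holder_abs) (use p' pF e in auto)
  also have "\<dots> \<le> N * (kap * N)"
    unfolding N_def by (intro mult_left_mono nrm_mult_F nrm_nonneg) (use p' e borel_measurable_continuous_Rn[OF ccD[OF c(1)]] in auto)
  also have "\<dots> = kap * N\<^sup>2" by (simp add: power2_eq_square)
  also have "\<dots> \<le> kap * ((sigma n U)\<^sup>2 * E)" by (rule mult_left_mono[OF NE kap_nonneg])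
  also have "\<dots> = (2 * (sigma n U)\<^sup>2 * kap) * (E / 2)" by (simp add: mult_ac)
  also have "\<dots> \<le> 1 * (E / 2)" using E0 by (intro mult_right_mono[OF V(3)]) simp
  finally have I: "\<bar>LINT x|bor n. (\<eta> x * u x) * (\<eta> x * F x)\<bar> \<le> E / 2" by simp
  have "(LINT x|bor n. (gradn n \<eta> x * u x) * (gradn n \<eta> x * u x)) = (L 2 (\<lambda>x. gradn n \<eta> x * u x))\<^sup>2"
    unfolding nrm_2 by (simp only: power2_eq_square)
  moreover have "e \<le> 2 * g" if "e = g' - j" "\<bar>j\<bar> \<le> e / 2" "g' = g" for e g g' j :: real using that by linarith
  ultimately have "E \<le> 2 * (L 2 (\<lambda>x. gradn n \<eta> x * u x))\<^sup>2" using E_def I by blast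
  then show thesis using that lim by blast
qed

text \<open>On radius 3 r the squared Poincare constant contributes 36 r^2, and
  \<open>energy_limit\<close> another factor 2.\<close>

lemma Poincare_limit:
  assumes \<eta>: "smooth n \<eta>" and z: "\<And>x. x \<in> Rn n \<Longrightarrow> dist_n n x0 x > \<rho> \<Longrightarrow> \<eta> x = 0" and \<rho>: "\<rho> < 3 * r"
  shows "(real n)\<^sup>2 * (L 2 (\<lambda>x. \<eta> x * u x))\<^sup>2 \<le> 72 * r\<^sup>2 * (L 2 (\<lambda>x. gradn n \<eta> x * u x))\<^sup>2"
proof -
  obtain E where E: "(\<lambda>k. (L 2 (gradn n (\<lambda>x. \<eta> x * v k x)))\<^sup>2) \<longlonglongrightarrow> E" "E \<le> 2 * (L 2 (\<lambda>x. gradn n \<eta> x * u x))\<^sup>2"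
    using energy_limit[OF assms] by blast
  have tR: "\<eta> \<in> test_fun n (Rn n)" by (rule test_funI_ball[OF \<eta> _ z]) auto
  have "(real n)\<^sup>2 * (L 2 (\<lambda>x. \<eta> x * u x))\<^sup>2 \<le> 36 * r\<^sup>2 * E"
  proof (rule LIMSEQ_le)
    show "(\<lambda>k. (real n)\<^sup>2 * (L 2 (\<lambda>x. \<eta> x * v k x))\<^sup>2) \<longlonglongrightarrow> (real n)\<^sup>2 * (L 2 (\<lambda>x. \<eta> x * u x))\<^sup>2"
      by (intro tendsto_intros nrm_mult_v_tendsto u2 test_fun_cc[OF tR]) auto
    show "(\<lambda>k. 36 * r\<^sup>2 * (L 2 (gradn n (\<lambda>x. \<eta> x * v k x)))\<^sup>2) \<longlonglongrightarrow> 36 * r\<^sup>2 * E"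
      by (intro tendsto_mult tendsto_const E)
    show "\<exists>N. \<forall>k\<ge>N. (real n)\<^sup>2 * (L 2 (\<lambda>x. \<eta> x * v k x))\<^sup>2 \<le> 36 * r\<^sup>2 * (L 2 (gradn n (\<lambda>x. \<eta> x * v k x)))\<^sup>2"
    proof (intro exI allI impI)
      fix k :: nat
      have "real n * L 2 (\<lambda>x. \<eta> x * v k x) \<le> 2 * (3 * r) * L 2 (gradn n (\<lambda>x. \<eta> x * v k x))"
        using r z \<rho> by (intro Poincare[OF test_fun_mult[OF tR v_smooth], where ?x0.0 = x0]) auto
      then have "(real n * L 2 (\<lambda>x. \<eta> x * v k x))\<^sup>2 \<le> (6 * r * L 2 (gradn n (\<lambda>x. \<eta> x * v k x)))\<^sup>2"
        by (intro power_mono) (auto simp: mult_ac)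
      then show "(real n)\<^sup>2 * (L 2 (\<lambda>x. \<eta> x * v k x))\<^sup>2 \<le> 36 * r\<^sup>2 * (L 2 (gradn n (\<lambda>x. \<eta> x * v k x)))\<^sup>2"
        by (simp add: power_mult_distrib)
    qed
  qed
  also have "\<dots> \<le> 36 * r\<^sup>2 * (2 * (L 2 (\<lambda>x. gradn n \<eta> x * u x))\<^sup>2)" by (rule mult_left_mono[OF E(2)]) simp
  finally show ?thesis by simp
qed

end

context ball_solution
begin

text \<open>The Poincare inequality for \<open>u\<close> times a Gaussian weight of width of order \<open>r / sqrt n\<close>.\<close>

lemma growth:
  assumes C: "\<And>s. \<bar>step 1 s\<bar> \<le> C"
  shows "L 2 (\<lambda>x. indicator (ball_n n x0 (2 * r)) x * u x) \<le> 16 * C * exp (- (real n / 51)) * L 2 u"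
proof -
  \<comment> \<open>Chosen so that 72 times 64 \<tau>^2, that is 4608 \<tau>^2, is at most n^2 / 2:
    half of the left-hand side of Poincare then absorbs the gradient of the weight. The final
    exponent is 2 \<tau> = n / 51.\<close>
  define \<tau> where "\<tau> = real n / 102"
  \<comment> \<open>The transition between squared radii 6 and 8 stays inside 9. There the squared
    weight is at most exp (-12 \<tau>), whereas on the ball of radius 2 r it is at least exp (-8
    \<tau>); the ratio is the gain.\<close>
  define \<chi>' where "\<chi>' = cutoff n x0 r 6 8"
  define \<eta> where "\<eta> x = exp (- \<tau> * sqd n x0 r x) * \<chi>' x" for x
  define s where "s = sqd n x0 r"
  have tau: "\<tau> \<ge> 0" by (simp add: \<tau>_def)
  have C0: "C \<ge> 0" using C[of 0] by linarith
  have se: "smooth n (\<lambda>x. exp (- \<tau> * sqd n x0 r x))"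
  proof -
    have "smooth n (\<lambda>x. (\<lambda>k t. (- \<tau>) ^ k * exp (- \<tau> * t)) 0 (sqd n x0 r x))"
      by (rule smooth_comp[OF smooth_sqd]) (auto intro!: derivative_eq_intros)
    then show ?thesis by simp
  qed
  have \<eta>: "smooth n \<eta>" unfolding \<eta>_def[abs_def] \<chi>'_def by (intro smooth_mult se smooth_cut)
  have sq8: "sqrt 8 < 3" by (rule real_less_lsqrt) auto
  have out: "\<chi>' x = 0" if "8 \<le> s x" for x
    using that unfolding \<chi>'_def s_def by (intro cut_zero) auto
  have z: "\<eta> x = 0" if "x \<in> Rn n" "dist_n n x0 x > sqrt 8 * r" for x
  proof -
    have "\<not> sqd n x0 r x \<le> (sqrt 8)\<^sup>2" using that sqd_le[OF r, of "sqrt 8" n x0 x] by simp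
    then show ?thesis using out[of x] by (simp add: \<eta>_def s_def)
  qed
  have \<rho>: "sqrt 8 * r < 3 * r" using sq8 r by simp
  have tR: "\<eta> \<in> test_fun n (Rn n)" by (rule test_funI_ball[OF \<eta> _ z]) auto
  define q where "q x = (s x - 6) / (8 - 6)" for x
  have grad: "(gradn n \<eta> x)\<^sup>2 = (exp (- \<tau> * s x) * (- \<tau> * \<chi>' x + step 1 (q x) / 2))\<^sup>2 * (4 * s x / r\<^sup>2)" if x: "x \<in> Rn n" for x
  proof -
    define c where "c = exp (- \<tau> * s x) * (- \<tau> * \<chi>' x + step 1 (q x) / 2)"
    have "partial i \<eta> x = c * partial i (sqd n x0 r) x" if i: "i < n" for i
    proof -
      have d: "((\<lambda>t. exp (- \<tau> * t)) has_real_derivative - \<tau> * exp (- \<tau> * sqd n x0 r x)) (at (sqd n x0 r x))"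
        by (auto intro!: derivative_eq_intros)
      have p1: "partial i (\<lambda>x. exp (- \<tau> * sqd n x0 r x)) x = - \<tau> * exp (- \<tau> * s x) * partial i (sqd n x0 r) x"
        unfolding s_def by (rule partial_comp[OF smooth_sqd i x d])
      have p2: "partial i \<chi>' x = step 1 (q x) / 2 * partial i (sqd n x0 r) x"
        unfolding \<chi>'_def partial_cut[OF i x] partial_sqd[OF i x] q_def s_def by simp
      have "partial i \<eta> x = partial i (\<lambda>x. exp (- \<tau> * sqd n x0 r x)) x * \<chi>' x + exp (- \<tau> * sqd n x0 r x) * partial i \<chi>' x"
        unfolding \<eta>_def[abs_def] by (rule partial_mult[OF se _ i x]) (simp add: \<chi>'_def smooth_cut)
      then show ?thesis unfolding p1 p2 unfolding c_def s_def by (simp add: algebra_simps)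
    qed
    then have "(gradn n \<eta> x)\<^sup>2 = (\<Sum>i<n. c\<^sup>2 * (partial i (sqd n x0 r) x)\<^sup>2)"
      unfolding gradn_sq by (intro sum.cong refl) (simp add: power_mult_distrib)
    also have "\<dots> = c\<^sup>2 * (4 * s x / r\<^sup>2)"
      unfolding sum_distrib_left[symmetric] using sum_partial_sqd[OF x, of r x0] r by (simp add: s_def)
    finally show ?thesis unfolding c_def .
  qed
  \<comment> \<open>An upper bound for the square of the weight times half the slope of
    \<open>step 0\<close>: this slope is nonzero only where s > 6.\<close>
  define K where "K = C\<^sup>2 / 4 * exp (- 12 * \<tau>)"
  have pt: "(gradn n \<eta> x * u x)\<^sup>2 \<le> 64 / r\<^sup>2 * (\<tau>\<^sup>2 * (\<eta> x * u x)\<^sup>2 + K * (u x)\<^sup>2)" if x: "x \<in> Rn n" for x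
  proof -
    have s0: "s x \<ge> 0" unfolding s_def by (rule sqd_nonneg)
    have K0: "K \<ge> 0" by (simp add: K_def)
    have ee: "(exp (- \<tau> * s x))\<^sup>2 = exp (- 2 * \<tau> * s x)" by (simp add: power2_eq_square exp_add[symmetric])
    have b: "(exp (- \<tau> * s x))\<^sup>2 * (step 1 (q x) / 2)\<^sup>2 \<le> K"
    proof (cases "s x \<le> 6")
      case True
      then have "step 1 (q x) = 0" using step_Suc_outside[of "q x" 0] by (simp add: q_def)
      then show ?thesis using K0 by simp
    next
      case False
      have "(step 1 (q x))\<^sup>2 \<le> C\<^sup>2" using C[of "q x"] by (rule power2_le_iff_abs_le[THEN iffD2, OF C0])
      then have "(step 1 (q x) / 2)\<^sup>2 \<le> C\<^sup>2 / 4" by (simp add: power_divide)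
      moreover have "(exp (- \<tau> * s x))\<^sup>2 \<le> exp (- 12 * \<tau>)"
        unfolding ee using False mult_left_mono[of 6 "s x" \<tau>] tau by simp
      ultimately have "(exp (- \<tau> * s x))\<^sup>2 * (step 1 (q x) / 2)\<^sup>2 \<le> exp (- 12 * \<tau>) * (C\<^sup>2 / 4)"
        by (intro mult_mono) auto
      then show ?thesis by (simp add: K_def mult.commute)
    qed
    \<comment> \<open>The constant 64 is 2 from the square of a sum times 32 from 4 s <= 32.\<close>
    have "(gradn n \<eta> x)\<^sup>2 \<le> 64 / r\<^sup>2 * (\<tau>\<^sup>2 * (\<eta> x)\<^sup>2 + K)"
    proof (cases "s x \<le> 8")
      case True
      have sq: "(a + b)\<^sup>2 \<le> 2 * a\<^sup>2 + 2 * b\<^sup>2" for a b :: real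
        using zero_le_power2[of "a - b"] by (simp add: power2_eq_square algebra_simps)
      have "(exp (- \<tau> * s x) * (- \<tau> * \<chi>' x + step 1 (q x) / 2))\<^sup>2 \<le> (exp (- \<tau> * s x))\<^sup>2 * (2 * (- \<tau> * \<chi>' x)\<^sup>2 + 2 * (step 1 (q x) / 2)\<^sup>2)"
        unfolding power_mult_distrib[of "exp (- \<tau> * s x)"] by (rule mult_left_mono[OF sq]) simp
      also have "\<dots> = 2 * (\<tau>\<^sup>2 * (\<eta> x)\<^sup>2) + 2 * ((exp (- \<tau> * s x))\<^sup>2 * (step 1 (q x) / 2)\<^sup>2)"
        unfolding \<eta>_def s_def[symmetric] by (simp add: power_mult_distrib algebra_simps)
      also have "\<dots> \<le> 2 * (\<tau>\<^sup>2 * (\<eta> x)\<^sup>2 + K)" using b by simp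
      finally have 1: "(exp (- \<tau> * s x) * (- \<tau> * \<chi>' x + step 1 (q x) / 2))\<^sup>2 \<le> 2 * (\<tau>\<^sup>2 * (\<eta> x)\<^sup>2 + K)" .
      have "4 * s x / r\<^sup>2 \<le> 32 / r\<^sup>2" using True by (intro divide_right_mono) auto
      then have "(gradn n \<eta> x)\<^sup>2 \<le> (2 * (\<tau>\<^sup>2 * (\<eta> x)\<^sup>2 + K)) * (32 / r\<^sup>2)"
        unfolding grad[OF x] using 1 s0 K0 by (intro mult_mono) auto
      then show ?thesis by simp
    next
      case False
      then have "step 1 (q x) = 0" using step_Suc_outside[of "q x" 0] by (simp add: q_def)
      then show ?thesis using out[of x] False K0 by (simp add: grad[OF x])
    qed
    then have "(gradn n \<eta> x)\<^sup>2 * (u x)\<^sup>2 \<le> (64 / r\<^sup>2 * (\<tau>\<^sup>2 * (\<eta> x)\<^sup>2 + K)) * (u x)\<^sup>2" by (rule mult_right_mono) simp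
    also have "\<dots> = 64 / r\<^sup>2 * (\<tau>\<^sup>2 * (\<eta> x * u x)\<^sup>2 + K * (u x)\<^sup>2)" by (simp only: power_mult_distrib distrib_left distrib_right mult_ac)
    finally show ?thesis by (simp add: power_mult_distrib)
  qed
  have sqi: "integrable (bor n) (\<lambda>x. (f x)\<^sup>2)" if "f \<in> Lq (bor n) 2" for f
    using LqD(2)[OF that] by (simp add: powr_numeral)
  note lim = mult_v_tendsto(2)[OF _ u2]
  have i1: "integrable (bor n) (\<lambda>x. (\<eta> x * u x)\<^sup>2)" by (rule sqi[OF lim]) (auto simp: test_fun_cc[OF tR])
  have i2: "integrable (bor n) (\<lambda>x. (gradn n \<eta> x * u x)\<^sup>2)" by (rule sqi[OF lim]) (auto simp: cc_gradn[OF tR])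
  have i3: "integrable (bor n) (\<lambda>x. (u x)\<^sup>2)" by (rule sqi[OF u2])
  define N where "N = (L 2 (\<lambda>x. \<eta> x * u x))\<^sup>2"
  define B where "B = (L 2 u)\<^sup>2"
  define M where "M = L 2 (\<lambda>x. indicator (ball_n n x0 (2 * r)) x * u x)"
  have "(L 2 (\<lambda>x. gradn n \<eta> x * u x))\<^sup>2 \<le> (LINT x|bor n. 64 / r\<^sup>2 * (\<tau>\<^sup>2 * (\<eta> x * u x)\<^sup>2 + K * (u x)\<^sup>2))"
    unfolding nrm_2 using pt by (intro integral_mono i2 integrable_mult_right Bochner_Integration.integrable_add i1 i3) (auto simp: space_bor)
  also have "\<dots> = 64 / r\<^sup>2 * (\<tau>\<^sup>2 * N + K * B)"
    unfolding N_def B_def nrm_2 using i1 i3 by simp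
  finally have G: "(L 2 (\<lambda>x. gradn n \<eta> x * u x))\<^sup>2 \<le> 64 / r\<^sup>2 * (\<tau>\<^sup>2 * N + K * B)" .
  have "(real n)\<^sup>2 * N \<le> 72 * r\<^sup>2 * (L 2 (\<lambda>x. gradn n \<eta> x * u x))\<^sup>2"
    unfolding N_def by (rule Poincare_limit[OF \<eta> z \<rho>])
  also have "\<dots> \<le> 72 * r\<^sup>2 * (64 / r\<^sup>2 * (\<tau>\<^sup>2 * N + K * B))" by (rule mult_left_mono[OF G]) simp
  also have "\<dots> = 4608 * \<tau>\<^sup>2 * N + 4608 * K * B" using r by (simp add: field_simps)
  finally have 1: "(real n)\<^sup>2 * N \<le> 4608 * \<tau>\<^sup>2 * N + 4608 * K * B" .
  have t2: "4608 * \<tau>\<^sup>2 \<le> (real n)\<^sup>2 / 2" by (simp add: \<tau>_def power_divide)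
  have N0: "N \<ge> 0" "B \<ge> 0" by (simp_all add: N_def B_def)
  have "(real n)\<^sup>2 * N \<le> (real n)\<^sup>2 / 2 * N + 4608 * K * B" using 1 mult_right_mono[OF t2 N0(1)] by linarith
  then have 2: "(real n)\<^sup>2 * N \<le> 9216 * K * B" by simp
  have "(3::real)\<^sup>2 \<le> (real n)\<^sup>2" using n by (intro power_mono) auto
  then have "9 * N \<le> (real n)\<^sup>2 * N" using N0 by (intro mult_right_mono) auto
  \<comment> \<open>Division by n^2 >= 9 lowers 9216 to 1024; with the factor C^2 / 4 in K this
    becomes 256 C^2, the square of 16 C.\<close>
  with 2 have 3: "N \<le> 1024 * K * B" by simp
  have ind: "(\<lambda>x. indicator (ball_n n x0 (2 * r)) x * u x) \<in> Lq (bor n) 2"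
    by (rule Lq_bound(1)[OF u2, where C = 1]) (use LqD(1)[OF u2] in \<open>auto simp: indicator_def\<close>)
  have "exp (- 8 * \<tau>) * M\<^sup>2 = (LINT x|bor n. exp (- 8 * \<tau>) * (indicator (ball_n n x0 (2 * r)) x * u x)\<^sup>2)"
    unfolding M_def nrm_2 by simp
  also have "\<dots> \<le> N"
    unfolding N_def nrm_2
  proof (rule integral_mono)
    show "integrable (bor n) (\<lambda>x. exp (- 8 * \<tau>) * (indicator (ball_n n x0 (2 * r)) x * u x)\<^sup>2)"
      by (rule integrable_mult_right[OF sqi[OF ind]])
    fix x assume "x \<in> space (bor n)"
    then have x: "x \<in> Rn n" by (simp add: space_bor)
    show "exp (- 8 * \<tau>) * (indicator (ball_n n x0 (2 * r)) x * u x)\<^sup>2 \<le> (\<eta> x * u x)\<^sup>2"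
    proof (cases "x \<in> ball_n n x0 (2 * r)")
      case True
      then have "s x < 2\<^sup>2" unfolding s_def using sqd_less[OF r, of 2] by (simp add: ball_n_def)
      then have s4: "s x \<le> 4" by simp
      have "\<chi>' x = 1" unfolding \<chi>'_def using s4 by (intro cut_one) (auto simp: s_def)
      then have e: "\<eta> x = exp (- \<tau> * s x)" by (simp add: \<eta>_def s_def)
      have "exp (- 4 * \<tau>) \<le> \<eta> x" unfolding e using mult_left_mono[OF s4 tau] by simp
      then have "(exp (- 4 * \<tau>))\<^sup>2 \<le> (\<eta> x)\<^sup>2" by (rule power_mono) simp
      then have "exp (- 8 * \<tau>) \<le> (\<eta> x)\<^sup>2" by (simp add: power2_eq_square exp_add[symmetric])
      then show ?thesis using True by (simp add: power_mult_distrib mult_right_mono)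
    qed simp
  qed (rule i1)
  finally have 4: "exp (- 8 * \<tau>) * M\<^sup>2 \<le> 1024 * K * B" using 3 by linarith
  have "M\<^sup>2 = exp (8 * \<tau>) * (exp (- 8 * \<tau>) * M\<^sup>2)" by (simp add: mult.assoc[symmetric] exp_add[symmetric])
  also have "\<dots> \<le> exp (8 * \<tau>) * (1024 * K * B)" by (rule mult_left_mono[OF 4]) simp
  also have "\<dots> = (exp (8 * \<tau>) * exp (- 12 * \<tau>)) * (256 * C\<^sup>2 * B)" by (simp add: K_def)
  also have "exp (8 * \<tau>) * exp (- 12 * \<tau>) = (exp (- (real n / 51)))\<^sup>2"
    by (simp add: \<tau>_def power2_eq_square exp_add[symmetric])
  also have "(exp (- (real n / 51)))\<^sup>2 * (256 * C\<^sup>2 * B) = (16 * C * exp (- (real n / 51)) * L 2 u)\<^sup>2"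
    by (simp add: B_def power_mult_distrib)
  finally show ?thesis unfolding M_def by (rule power2_le_imp_le) (simp add: C0)
qed

end

text \<open>The bound is the same for all k, as the use of Fatou in \<open>interior_Lq\<close>
  requires.\<close>

lemma mult_conv_bound:
  assumes h: "cc n h" and q: "q \<ge> 1" and f: "f \<in> Lq (bor n) q" "integrable (bor n) f"
  shows "\<exists>C\<ge>0. \<forall>k. (\<lambda>x. h x * conv0 n k f x) \<in> Lq (bor n) q \<and> nrm (bor n) q (\<lambda>x. h x * conv0 n k f x) \<le> C"
proof -
  obtain D where D: "D \<ge> 0" "\<And>x. x \<in> Rn n \<Longrightarrow> \<bar>h x\<bar> \<le> D" using cc_bounded[OF h] by metis
  have m: "(\<lambda>x. h x * conv0 n k f x) \<in> borel_measurable (bor n)" for k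
    using borel_measurable_continuous_Rn[OF ccD[OF h]] conv_measurable[OF f(2)] by simp
  have ae: "AE x in bor n. \<bar>h x * conv0 n k f x\<bar> \<le> D * \<bar>conv0 n k f x\<bar>" for k
    by (rule AE_I2) (auto simp: abs_mult space_bor intro!: mult_right_mono D(2))
  have "(\<lambda>x. h x * conv0 n k f x) \<in> Lq (bor n) q \<and> nrm (bor n) q (\<lambda>x. h x * conv0 n k f x) \<le> D * nrm (bor n) q f" for k
  proof
    show "(\<lambda>x. h x * conv0 n k f x) \<in> Lq (bor n) q"
      by (rule Lq_bound(1)[OF conv_Young(1)[OF q f(2,1)] m ae]) (use q D in auto)
    have "nrm (bor n) q (\<lambda>x. h x * conv0 n k f x) \<le> D * nrm (bor n) q (conv0 n k f)"
      by (rule Lq_bound(2)[OF conv_Young(1)[OF q f(2,1)] m ae]) (use q D in auto)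
    also have "\<dots> \<le> D * nrm (bor n) q f" by (rule mult_left_mono[OF conv_Young(2)[OF q f(2,1)] D(1)])
    finally show "nrm (bor n) q (\<lambda>x. h x * conv0 n k f x) \<le> D * nrm (bor n) q f" .
  qed
  moreover have "0 \<le> D * nrm (bor n) q f" using D by simp
  ultimately show ?thesis by blast
qed

text \<open>The Laplacian of a cutoff times a mollification of u involves mollifications of u, of
  its gradient and of its Laplacian, all in L^p, and so is bounded in L^p uniformly in k.
  \<open>sobolev_lap\<close> turns this into a uniform L^p' bound, which Fatou passes to u.
  Finiteness is what counts, not the size of the bound.\<close>

lemma interior_Lq:
  assumes n: "n \<ge> 3" and r: "r > 0" and x0: "x0 \<in> Rn n"
    and Lu: "u \<in> Lq (bor n) (exp_p n)" "integrable (bor n) u"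
    and Lg: "\<And>i. i < n \<Longrightarrow> g i \<in> Lq (bor n) (exp_p n)" "\<And>i. i < n \<Longrightarrow> integrable (bor n) (g i)"
    and LF: "F \<in> Lq (bor n) (exp_p n)" "integrable (bor n) F"
    and w1: "\<And>i \<phi>. i < n \<Longrightarrow> \<phi> \<in> test_fun n (ball_n n x0 (4 * r)) \<Longrightarrow> (LINT y|bor n. u y * partial i \<phi> y) = - (LINT y|bor n. g i y * \<phi> y)"
    and w2: "\<And>\<phi>. \<phi> \<in> test_fun n (ball_n n x0 (4 * r)) \<Longrightarrow> (LINT y|bor n. u y * lap n \<phi> y) = (LINT y|bor n. F y * \<phi> y)"
  shows "(\<lambda>x. indicator (ball_n n x0 (3 * r)) x * u x) \<in> Lq (bor n) (exp_p' n)"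
proof -
  note e = exponents[OF n]
  let ?p = "exp_p n"
  \<comment> \<open>Equal to 1 on the ball of radius 3 r and zero beyond squared radius 12 < 16,
    which leaves room for the kernels inside the ball of radius 4 r.\<close>
  define \<zeta> where "\<zeta> = cutoff n x0 r 9 12"
  have \<zeta>: "smooth n \<zeta>" unfolding \<zeta>_def by (rule smooth_cut)
  have U: "openin (top_Rn n) (Rn n)" by (metis openin_topspace topspace_Rn)
  have sq12: "sqrt 12 < 4" by (rule real_less_lsqrt) auto
  have tR: "\<zeta> \<in> test_fun n (Rn n)"
    unfolding \<zeta>_def using r by (intro cut_test_fun[where c = "sqrt 12"]) auto
  have z: "\<zeta> x = 0" "partial i \<zeta> x = 0" "lap n \<zeta> x = 0" if "x \<in> Rn n" "dist_n n x0 x > sqrt 12 * r" "i < n" for x i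
  proof -
    have "\<not> sqd n x0 r x \<le> (sqrt 12)\<^sup>2" using that sqd_le[OF r, of "sqrt 12" n x0 x] by simp
    then have s: "12 \<le> sqd n x0 r x" by simp
    show "\<zeta> x = 0" unfolding \<zeta>_def by (rule cut_zero) (use s in auto)
    show "partial i \<zeta> x = 0" unfolding \<zeta>_def by (rule partial_cut_zero) (use s that in auto)
    have "step (Suc 0) ((sqd n x0 r x - 9) / (12 - 9)) = 0" "step (Suc (Suc 0)) ((sqd n x0 r x - 9) / (12 - 9)) = 0"
      using s step_zero_sqd[of 9 12 n x0 r x 0] step_zero_sqd[of 9 12 n x0 r x "Suc 0"] by simp_all
    then show "lap n \<zeta> x = 0" unfolding \<zeta>_def using lap_cut[of x n r x0 9 12] that r by (simp add: numeral_2_eq_2)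
  qed
  have cc: "cc n \<zeta>" "cc n (lap n \<zeta>)" "\<And>i. i < n \<Longrightarrow> cc n (\<lambda>x. 2 * partial i \<zeta> x)"
  proof -
    show "cc n \<zeta>" by (rule test_fun_cc[OF tR])
    show "cc n (lap n \<zeta>)" unfolding lap_def[abs_def]
      by (intro cc_sum test_fun_cc[OF test_fun_partial[OF test_fun_partial[OF tR]]]) auto
    show "cc n (\<lambda>x. 2 * partial i \<zeta> x)" if "i < n" for i
      by (rule cc_cmult[OF test_fun_cc[OF test_fun_partial[OF tR that]]])
  qed
  obtain Cu where Cu: "\<And>k. (\<lambda>x. lap n \<zeta> x * conv0 n k u x) \<in> Lq (bor n) ?p \<and> nrm (bor n) ?p (\<lambda>x. lap n \<zeta> x * conv0 n k u x) \<le> Cu"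
    using mult_conv_bound[OF cc(2) e(1) Lu] by blast
  obtain CF where CF: "\<And>k. (\<lambda>x. \<zeta> x * conv0 n k F x) \<in> Lq (bor n) ?p \<and> nrm (bor n) ?p (\<lambda>x. \<zeta> x * conv0 n k F x) \<le> CF"
    using mult_conv_bound[OF cc(1) e(1) LF] by blast
  have "\<exists>C. \<forall>i\<in>{..<n}. \<forall>k. (\<lambda>x. 2 * partial i \<zeta> x * conv0 n k (g i) x) \<in> Lq (bor n) ?p \<and> nrm (bor n) ?p (\<lambda>x. 2 * partial i \<zeta> x * conv0 n k (g i) x) \<le> C i"
    by (rule bchoice) (use mult_conv_bound[OF cc(3) e(1) Lg] in blast)
  then obtain C where C: "\<And>i k. i < n \<Longrightarrow> (\<lambda>x. 2 * partial i \<zeta> x * conv0 n k (g i) x) \<in> Lq (bor n) ?p"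
     "\<And>i k. i < n \<Longrightarrow> nrm (bor n) ?p (\<lambda>x. 2 * partial i \<zeta> x * conv0 n k (g i) x) \<le> C i" by blast
  define K where "K = Cu + (\<Sum>i<n. C i) + CF"
  have "(\<lambda>k. sqrt 12 * r + real n / real (Suc k)) \<longlonglongrightarrow> sqrt 12 * r + real n * 0"
    unfolding divide_inverse by (intro tendsto_add tendsto_const tendsto_mult LIMSEQ_inverse_real_of_nat)
  then have "\<forall>\<^sub>F k in sequentially. sqrt 12 * r + real n / real (Suc k) < 4 * r"
    using sq12 r by (intro order_tendstoD(2)[of _ "sqrt 12 * r + real n * 0"]) auto
  then obtain k0 where k0: "\<And>k. k \<ge> k0 \<Longrightarrow> sqrt 12 * r + real n / real (Suc k) < 4 * r"
    unfolding eventually_sequentially by blast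
  have bound: "nrm (bor n) (exp_p' n) (\<lambda>x. \<zeta> x * conv0 n k u x) \<le> (sigma n (Rn n))\<^sup>2 * K" if k: "k \<ge> k0" for k
  proof -
    let ?h = "\<lambda>x. (lap n \<zeta> x * conv0 n k u x + (\<Sum>i<n. 2 * partial i \<zeta> x * conv0 n k (g i) x)) + \<zeta> x * conv0 n k F x"
    have eq: "lap n (\<lambda>x. \<zeta> x * conv0 n k u x) x = ?h x" if x: "x \<in> Rn n" for x
    proof -
      have "lap n (\<lambda>x. \<zeta> x * conv0 n k u x) x = lap n \<zeta> x * conv0 n k u x + 2 * (\<Sum>i<n. partial i \<zeta> x * partial i (conv0 n k u) x) + \<zeta> x * lap n (conv0 n k u) x"
        by (rule lap_mult[OF \<zeta> conv_smooth[OF Lu(2)] x])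
      also have "\<dots> = ?h x"
      proof (cases "dist_n n x0 x \<le> sqrt 12 * r")
        case True
        then have d: "dist_n n x0 x + real n / real (Suc k) < 4 * r" using k0[OF k] by linarith
        have "lap n (conv0 n k u) x = conv0 n k F x" by (rule lap_conv_weak[OF Lu(2) w2 x d])
        moreover have "partial i (conv0 n k u) x = conv0 n k (g i) x" if "i < n" for i
          by (rule partial_conv_weak[OF Lu(2) w1 _ x d]) (use that in auto)
        ultimately show ?thesis by (simp add: sum_distrib_left mult_ac)
      next
        case False
        then have "\<zeta> x = 0" "\<And>i. i < n \<Longrightarrow> partial i \<zeta> x = 0" "lap n \<zeta> x = 0" using z[OF x] n by force+
        then show ?thesis by simp
      qed
      finally show ?thesis .
    qed
    have S: "(\<lambda>x. \<Sum>i<n. 2 * partial i \<zeta> x * conv0 n k (g i) x) \<in> Lq (bor n) ?p \<and>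
       nrm (bor n) ?p (\<lambda>x. \<Sum>i<n. 2 * partial i \<zeta> x * conv0 n k (g i) x) \<le> (\<Sum>i<n. nrm (bor n) ?p (\<lambda>x. 2 * partial i \<zeta> x * conv0 n k (g i) x))"
      by (rule Minkowski_sum[OF e(1)]) (use C in auto)
    have S': "(\<Sum>i<n. nrm (bor n) ?p (\<lambda>x. 2 * partial i \<zeta> x * conv0 n k (g i) x)) \<le> (\<Sum>i<n. C i)"
      by (rule sum_mono) (use C in auto)
    note M1 = Minkowski[OF e(1) conjunct1[OF Cu[of k]] conjunct1[OF S]]
    note M2 = Minkowski(2)[OF e(1) M1(1) conjunct1[OF CF[of k]]]
    have "nrm (bor n) ?p (lap n (\<lambda>x. \<zeta> x * conv0 n k u x)) = nrm (bor n) ?p ?h"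
      by (rule nrm_cong) (simp add: eq space_bor)
    also have "\<dots> \<le> K" unfolding K_def using M1(2) M2 conjunct2[OF S] S' Cu[of k] CF[of k] by linarith
    finally have "nrm (bor n) ?p (lap n (\<lambda>x. \<zeta> x * conv0 n k u x)) \<le> K" .
    then have "(sigma n (Rn n))\<^sup>2 * nrm (bor n) ?p (lap n (\<lambda>x. \<zeta> x * conv0 n k u x)) \<le> (sigma n (Rn n))\<^sup>2 * K"
      by (rule mult_left_mono) simp
    with sobolev_lap[OF n U test_fun_mult[OF tR conv_smooth[OF Lu(2)]], of k "\<lambda>_. 0"] show ?thesis by linarith
  qed
  obtain q :: "nat \<Rightarrow> nat" where q: "strict_mono q" "AE x in bor n. (\<lambda>k. conv0 n (q k) u x) \<longlonglongrightarrow> u x"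
    using nrm_AE_subseq[OF e(1) conv_Young(1)[OF e(1) Lu(2,1)] Lu(1) conv_Lq_tendsto[OF e(1) Lu(2,1)]] by blast
  have m: "\<zeta> \<in> borel_measurable (bor n)" "u \<in> borel_measurable (bor n)"
    using borel_measurable_continuous_Rn[OF ccD[OF cc(1)]] LqD(1)[OF Lu(1)] by auto
  have qk: "q (k + k0) \<ge> k0" for k using seq_suble[OF q(1), of "k + k0"] by simp
  have "(\<lambda>x. \<zeta> x * u x) \<in> Lq (bor n) (exp_p' n)"
  proof (rule Lq_Fatou(1)[where f = "\<lambda>k x. \<zeta> x * conv0 n (q (k + k0)) u x"])
    show "(\<lambda>x. \<zeta> x * conv0 n (q (k + k0)) u x) \<in> Lq (bor n) (exp_p' n)" for k
      by (rule cc_Lq[OF cc_mult[OF cc(1) smooth_continuous[OF conv_smooth[OF Lu(2)]]]]) (use e in auto)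
    show "nrm (bor n) (exp_p' n) (\<lambda>x. \<zeta> x * conv0 n (q (k + k0)) u x) \<le> (sigma n (Rn n))\<^sup>2 * K" for k
      by (rule bound[OF qk])
    show "AE x in bor n. (\<lambda>k. \<zeta> x * conv0 n (q (k + k0)) u x) \<longlonglongrightarrow> \<zeta> x * u x"
      using q(2)
    proof eventually_elim
      case (elim x)
      show ?case by (intro tendsto_mult tendsto_const LIMSEQ_ignore_initial_segment[OF elim])
    qed
  qed (use m e in auto)
  then show ?thesis
  proof (rule Lq_bound(1)[where C = 1])
    show "AE x in bor n. \<bar>indicator (ball_n n x0 (3 * r)) x * u x\<bar> \<le> 1 * \<bar>\<zeta> x * u x\<bar>"
    proof (rule AE_I2)
      fix x
      show "\<bar>indicator (ball_n n x0 (3 * r)) x * u x\<bar> \<le> 1 * \<bar>\<zeta> x * u x\<bar>"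
      proof (cases "x \<in> ball_n n x0 (3 * r)")
        case True
        then have "sqd n x0 r x \<le> 3\<^sup>2" using sqd_le[OF r, of 3] by (simp add: ball_n_def)
        then have "\<zeta> x = 1" unfolding \<zeta>_def by (intro cut_one) auto
        then show ?thesis using True by simp
      qed simp
    qed
  qed (use m e in auto)
qed

section \<open>The Carleman estimate\<close>

lemma partial_partial_tr:
  assumes "smooth n f" "i < n"
  shows "partial i (partial i (\<lambda>x. f (tr n a x))) x = partial i (partial i f) (tr n a x)"
proof -
  have "partial i (\<lambda>x. f (tr n a x)) = (\<lambda>x. partial i f (tr n a x))"
    using partial_tr[OF assms] by blast
  then show ?thesis using partial_tr[OF smooth_partial[OF assms] assms(2)] by simp
qed

lemma dist_tr: "dist_n n x0 (tr n x0 y) = norm_n n y"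
  unfolding dist_n_def norm_n_def L2_set_def by (rule arg_cong[where f = sqrt], rule sum.cong[OF refl]) (simp add: tr_def)

lemma dist_origin: "dist_n n (origin n) y = norm_n n y"
  unfolding dist_n_def norm_n_def L2_set_def by (rule arg_cong[where f = sqrt], rule sum.cong[OF refl]) (simp add: origin_def)

lemma nrm_tr:
  assumes "f \<in> borel_measurable (bor n)" shows "nrm (bor n) q (\<lambda>y. f (tr n a y)) = nrm (bor n) q f"
  unfolding nrm_def using integral_tr[of "\<lambda>y. \<bar>f y\<bar> powr q" n a] assms by simp

lemma measurable_weight: "(\<lambda>x. dist_n n x0 x powr c) \<in> borel_measurable (bor n)"
proof -
  have [measurable]: "dist_n n x0 \<in> borel_measurable (bor n)" using borel_measurable_continuous_Rn[OF continuous_dist_n] by simp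
  show ?thesis by measurable
qed

text \<open>The hypothesis concerns balls about the origin, weak Laplacians and supports of
  almost-everywhere classes. Translation by x0 moves the centre, the weak derivatives of a test
  function agree almost everywhere with the classical ones, and vanishing on a small ball keeps the
  centre out of the support.\<close>

lemma carleman_test:
  assumes car: "carleman n \<theta>" and \<theta>: "\<theta> \<ge> 0" and mu: "\<mu> \<in> Lambda n" and n: "n \<ge> 3" and w: "smooth n w"
    and out: "\<And>x. x \<in> Rn n \<Longrightarrow> dist_n n x0 x > \<rho> \<Longrightarrow> w x = 0" and \<rho>: "0 \<le> \<rho>" "\<rho> < R"
    and inn: "\<And>x. x \<in> Rn n \<Longrightarrow> dist_n n x0 x < e \<Longrightarrow> w x = 0" and e: "e > 0"
  shows "nrm (bor n) (exp_p' n) (\<lambda>x. dist_n n x0 x powr (- \<mu>) * w x) \<le> \<theta> * nrm (bor n) (exp_p n) (\<lambda>x. dist_n n x0 x powr (- \<mu>) * lap n w x)"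
proof -
  note ex = exponents[OF n]
  let ?B = "ball_n n (origin n) R"
  define W where "W y = w (tr n x0 y)" for y
  have W: "smooth n W" unfolding W_def[abs_def] by (rule smooth_tr[OF w])
  have Wout: "W y = 0" if "dist_n n (origin n) y > \<rho>" for y
    unfolding W_def using out[OF tr_Rn] that by (simp add: dist_tr dist_origin)
  have Win: "W y = 0" if "dist_n n (origin n) y < e" for y
    unfolding W_def using inn[OF tr_Rn] that by (simp add: dist_tr dist_origin)
  have B: "openin (top_Rn n) ?B" by (rule openin_ball)
  have t: "W \<in> test_fun n ?B"
    by (rule test_funI_ball[OF W _ Wout]) (use \<rho> in \<open>auto simp: ball_n_def\<close>)
  have o: "openin (top_Rn n) {y \<in> Rn n. dist_n n (origin n) y > \<rho>}"
  proof -
    have "{y \<in> Rn n. dist_n n (origin n) y > \<rho>} = topspace (top_Rn n) - {y \<in> Rn n. dist_n n (origin n) y \<le> \<rho>}"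
      by (auto simp: topspace_Rn)
    then show ?thesis by (simp only: openin_diff[OF openin_topspace closedin_dist_le])
  qed
  \<comment> \<open>Two open sets on which W vanishes witness the inclusion: the complement of the
    closed ball of radius \<rho> and the ball of radius e about the origin.\<close>
  have S: "supp n ?B W \<subseteq> ?B - {origin n}"
  proof
    fix x assume x: "x \<in> supp n ?B W"
    then have xR: "x \<in> Rn n" by (simp add: supp_def)
    have no: False if "openin (top_Rn n) O'" "x \<in> O'" "\<And>y. y \<in> O' \<Longrightarrow> W y = 0" for O'
    proof -
      have "AE y in leb n. y \<in> O' \<inter> ?B \<longrightarrow> W y = 0" using that by (intro AE_I2) auto
      then show False using x that(1,2) by (auto simp: supp_def)
    qed
    have "dist_n n (origin n) x \<le> \<rho>"
    proof (rule ccontr)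
      assume "\<not> dist_n n (origin n) x \<le> \<rho>"
      then show False using no[OF o] xR Wout by auto
    qed
    moreover have "x \<noteq> origin n"
    proof
      assume "x = origin n"
      then show False using no[OF openin_ball, of "origin n" e] xR e Win by (auto simp: ball_n_def)
    qed
    ultimately show "x \<in> ?B - {origin n}" using \<rho> xR by (simp add: ball_n_def)
  qed
  have BB: "?B \<in> sets (bor n)" by (rule ball_measurable)
  define N where "N y = norm_n n y powr (- \<mu>)" for y
  have N [measurable]: "N \<in> borel_measurable (bor n)"
    using measurable_weight[of n "origin n" "- \<mu>"] by (simp add: N_def[abs_def] dist_origin)
  have Wm [measurable]: "W \<in> borel_measurable (bor n)" by (rule borel_measurable_continuous_Rn[OF smooth_continuous[OF W]])
  have lm: "lap n f \<in> borel_measurable (bor n)" if "smooth n f" for f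
    by (rule borel_measurable_continuous_Rn[OF smooth_continuous[OF smooth_lap[OF that]]])
  have b0: "brep n ?B (\<lambda>y. N y * W y) (\<lambda>y. indicator ?B y * (N y * W y))"
    by (rule brep_self[OF _ BB]) measurable
  have lhs: "Lp_norm n (exp_p' n) ?B (\<lambda>y. N y * W y) = nrm (bor n) (exp_p' n) (\<lambda>y. N y * W y)"
  proof -
    have "Lp_norm n (exp_p' n) ?B (\<lambda>y. N y * W y) = nrm (bor n) (exp_p' n) (\<lambda>y. indicator ?B y * (N y * W y))"
      by (rule brep_nrm[OF _ b0]) (use ex in simp)
    also have "\<dots> = nrm (bor n) (exp_p' n) (\<lambda>y. N y * W y)"
      by (rule nrm_cong) (use test_fun_outside[OF t] in \<open>auto simp: space_bor indicator_def\<close>)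
    finally show ?thesis .
  qed
  have D: "brep n ?B (weak_deriv n ?B [i, i] W) (\<lambda>x. indicator ?B x * partial i (partial i W) x)" if "i < n" for i
    using test_weak_deriv_brep[OF t B, of "[i, i]"] that by (simp add: partials_def)
  have bL: "brep n ?B (\<lambda>y. N y * laplacian n ?B W y) (\<lambda>y. indicator ?B y * (N y * lap n W y))"
    unfolding brep_def
  proof (intro conjI)
    have d: "(\<lambda>y. indicator ?B y *\<^sub>R weak_deriv n ?B [i, i] W y) \<in> borel_measurable (leb n)" if "i \<in> {..<n}" for i
      using brepD(1)[OF D[of i]] that by (simp only: set_borel_measurable_def lessThan_iff)
    have "(\<lambda>y. N y * (\<Sum>i<n. indicator ?B y *\<^sub>R weak_deriv n ?B [i, i] W y)) \<in> borel_measurable (leb n)"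
      by (intro borel_measurable_times borel_measurable_sum measurable_leb[OF N] d) simp
    moreover have "indicator ?B y *\<^sub>R (N y * laplacian n ?B W y) = N y * (\<Sum>i<n. indicator ?B y *\<^sub>R weak_deriv n ?B [i, i] W y)" for y
      by (cases "y \<in> ?B") (simp_all add: laplacian_def sum_distrib_left mult_ac)
    ultimately show "set_borel_measurable (leb n) ?B (\<lambda>y. N y * laplacian n ?B W y)"
      unfolding set_borel_measurable_def by (simp only:)
    show "(\<lambda>y. indicator ?B y * (N y * lap n W y)) \<in> borel_measurable (bor n)"
      using lm[OF W] by measurable
    show "\<forall>y. y \<notin> ?B \<longrightarrow> indicator ?B y * (N y * lap n W y) = 0" by simp
    have "AE y in bor n. \<forall>i\<in>{..<n}. y \<in> ?B \<longrightarrow> weak_deriv n ?B [i, i] W y = indicator ?B y * partial i (partial i W) y"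
      by (rule AE_finite_allI[OF finite_lessThan], rule brepD(4)[OF D]) simp
    then show "AE y in bor n. y \<in> ?B \<longrightarrow> N y * laplacian n ?B W y = indicator ?B y * (N y * lap n W y)"
      by eventually_elim (auto simp: laplacian_def lap_def)
  qed
  have rhs: "Lp_norm n (exp_p n) ?B (\<lambda>y. N y * laplacian n ?B W y) \<le> nrm (bor n) (exp_p n) (\<lambda>y. N y * lap n W y)"
  proof -
    have tl: "lap n W y = 0" if "y \<in> Rn n" "y \<notin> ?B" for y
      unfolding lap_def using test_fun_outside[OF test_fun_partial[OF test_fun_partial[OF t]] that] by simp
    have "Lp_norm n (exp_p n) ?B (\<lambda>y. N y * laplacian n ?B W y) = nrm (bor n) (exp_p n) (\<lambda>y. indicator ?B y * (N y * lap n W y))"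
      by (rule brep_nrm[OF _ bL]) (use ex in simp)
    also have "\<dots> = nrm (bor n) (exp_p n) (\<lambda>y. N y * lap n W y)"
      by (rule nrm_cong) (use tl in \<open>auto simp: space_bor indicator_def\<close>)
    finally show ?thesis by simp
  qed
  have So: "W \<in> sobolev n 2 (exp_p n) ?B" by (rule test_sobolev[OF t B]) (use ex in simp)
  have R: "R > 0" using \<rho> by simp
  have main: "Lp_norm n (exp_p' n) ?B (\<lambda>y. N y * W y) \<le> \<theta> * Lp_norm n (exp_p n) ?B (\<lambda>y. N y * laplacian n ?B W y)"
    using car R mu So S unfolding carleman_def N_def by blast
  have wm [measurable]: "w \<in> borel_measurable (bor n)" by (rule borel_measurable_continuous_Rn[OF smooth_continuous[OF w]])
  note [measurable] = measurable_weight lm[OF w]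
  have l: "nrm (bor n) (exp_p' n) (\<lambda>y. N y * W y) = nrm (bor n) (exp_p' n) (\<lambda>x. dist_n n x0 x powr (- \<mu>) * w x)"
    using nrm_tr[of "\<lambda>x. dist_n n x0 x powr (- \<mu>) * w x" n "exp_p' n" x0] by (simp add: dist_tr N_def W_def)
  have "lap n W y = lap n w (tr n x0 y)" for y
    unfolding lap_def W_def[abs_def] using partial_partial_tr[OF w] by simp
  then have rr: "nrm (bor n) (exp_p n) (\<lambda>y. N y * lap n W y) = nrm (bor n) (exp_p n) (\<lambda>x. dist_n n x0 x powr (- \<mu>) * lap n w x)"
    using nrm_tr[of "\<lambda>x. dist_n n x0 x powr (- \<mu>) * lap n w x" n "exp_p n" x0] by (simp add: dist_tr N_def)
  show ?thesis using main mult_left_mono[OF rhs \<theta>] unfolding lhs l rr by linarith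
qed

lemma cc_support: "smooth n f \<Longrightarrow> (\<And>x. x \<in> Rn n \<Longrightarrow> dist_n n x0 x > \<rho> \<Longrightarrow> f x = 0) \<Longrightarrow> cc n f"
  by (rule test_fun_cc[OF test_funI_ball[where U = "Rn n"]]) auto

lemma gradn_Cauchy_Schwarz: "\<bar>\<Sum>i<n. partial i f x * partial i g x\<bar> \<le> gradn n f x * gradn n g x"
proof -
  have "\<bar>\<Sum>i<n. partial i f x * partial i g x\<bar> \<le> (\<Sum>i<n. \<bar>partial i f x\<bar> * \<bar>partial i g x\<bar>)"
    by (rule order_trans[OF sum_abs]) (simp add: abs_mult)
  also have "\<dots> \<le> L2_set (\<lambda>i. partial i f x) {..<n} * L2_set (\<lambda>i. partial i g x) {..<n}" by (rule L2_set_mult_ineq)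
  finally show ?thesis by (simp add: gradn_def L2_set_def)
qed

context ball_solution
begin

text \<open>By \<open>lap_mult\<close> this is the Laplacian of c v minus c times the Laplacian of
  v, the error made by cutting off.\<close>

definition commutator :: "((nat \<Rightarrow> real) \<Rightarrow> real) \<Rightarrow> nat \<Rightarrow> (nat \<Rightarrow> real) \<Rightarrow> real" where
  "commutator c k x = lap n c x * v k x + 2 * (\<Sum>i<n. partial i c x * partial i (v k) x)"

text \<open>The commutator lives where a <= sqd <= b, so the weight is at most its value at the
  inner radius. The gradient of the mollification is controlled through a wider cutoff \<zeta>,
  equal to 1 on that shell, and \<open>energy_limit\<close>; this control is obtained in the limit,
  hence the convergent majorant t. The numerical assumptions bound 4 b / (b - a)^2 by 32, 1 / (b -
  a) by 4 and 4 d / (d - c)^2 by 144; the shell near the centre attains the first two, and the outer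
  one has 136 in the last. The function u' dominates u below squared radius d: it will be u itself
  or its restriction to the ball of radius r.\<close>

lemma commutator_bound:
  assumes ab: "0 < a" "a < b" "b \<le> c" "c < d" "d < 9"
    and num: "4 * b \<le> 32 * (b - a)\<^sup>2" "1 \<le> 4 * (b - a)" "4 * d \<le> 144 * (d - c)\<^sup>2"
    and C: "C \<ge> 1" "\<And>s. \<bar>step 1 s\<bar> \<le> C" "\<And>s. \<bar>step 2 s\<bar> \<le> C" and mu: "\<mu> \<ge> 0"
    and X: "\<And>x. x \<in> Rn n \<Longrightarrow> sqd n x0 r x < d \<Longrightarrow> \<bar>u x\<bar> \<le> \<bar>u' x\<bar>" "u' \<in> Lq (bor n) 2"
  obtains t T where "t \<longlonglongrightarrow> T" "T \<le> (sqrt a * r) powr (- \<mu>) * (1400 * C\<^sup>2 * real n / r * L 2 u')"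
    "\<And>k. L (exp_p n) (\<lambda>x. dist_n n x0 x powr (- \<mu>) * commutator (cutoff n x0 r a b) k x) \<le> t k"
    "\<And>k. (\<lambda>x. dist_n n x0 x powr (- \<mu>) * commutator (cutoff n x0 r a b) k x) \<in> Lq (bor n) (exp_p n)"
proof -
  note e = exponents[OF n]
  define ch where "ch = cutoff n x0 r a b"
  define \<zeta> where "\<zeta> = cutoff n x0 r c d"
  define \<rho> where "\<rho> = sqrt d * r"
  have "sqrt d < 3" using ab by (intro real_less_lsqrt) auto
  then have \<rho>: "\<rho> < 3 * r" using r by (simp add: \<rho>_def)
  have sch: "smooth n ch" and sz: "smooth n \<zeta>" unfolding ch_def \<zeta>_def by (rule smooth_cut)+
  have sd: "d \<le> sqd n x0 r x" if "dist_n n x0 x > \<rho>" for x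
  proof -
    have "\<not> sqd n x0 r x \<le> (sqrt d)\<^sup>2" using that sqd_le[OF r, of "sqrt d" n x0 x] ab by (simp add: \<rho>_def)
    then show ?thesis using ab by simp
  qed
  have z0: "\<zeta> x = 0" if "d \<le> sqd n x0 r x" for x
    unfolding \<zeta>_def by (rule cut_zero) (use that ab in auto)
  have zp0: "partial i \<zeta> x = 0" if "sqd n x0 r x \<le> c \<or> d \<le> sqd n x0 r x" "i < n" "x \<in> Rn n" for x i
    unfolding \<zeta>_def by (rule partial_cut_zero) (use that ab in auto)
  have zz: "\<zeta> x = 0" if "x \<in> Rn n" "dist_n n x0 x > \<rho>" for x using z0 sd that by blast
  define z where "z k x = \<zeta> x * v k x" for k x
  have smz: "smooth n (z k)" for k unfolding z_def[abs_def] by (intro smooth_mult sz v_smooth)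
  have tz: "z k \<in> test_fun n (Rn n)" for k
    by (rule test_funI_ball[OF smz]) (use zz in \<open>auto simp: z_def\<close>)
  have pz: "partial i (z k) x = partial i \<zeta> x * v k x + \<zeta> x * partial i (v k) x" if "i < n" "x \<in> Rn n" for i k x
    unfolding z_def[abs_def] by (rule partial_mult[OF sz v_smooth that])
  have C0: "C \<ge> 0" using C by simp
  have s1: "(step 1 s)\<^sup>2 \<le> C\<^sup>2" for s using C(2)[of s] by (rule power2_le_iff_abs_le[THEN iffD2, OF C0])
  have nn: "real n \<ge> 3" using n by simp
  have gch: "gradn n ch x \<le> 6 * C / r" if x: "x \<in> Rn n" "sqd n x0 r x \<le> b" for x
  proof -
    have "(gradn n ch x)\<^sup>2 = (step 1 ((sqd n x0 r x - a) / (b - a)))\<^sup>2 * ((4 * sqd n x0 r x) / (b - a)\<^sup>2) / r\<^sup>2"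
      unfolding ch_def gradn_cut_sq[OF x(1) less_imp_neq[OF r, symmetric]] by (simp add: power_divide)
    also have "\<dots> \<le> C\<^sup>2 * 32 / r\<^sup>2"
    proof (intro divide_right_mono mult_mono s1)
      have "4 * sqd n x0 r x \<le> 32 * (b - a)\<^sup>2" using x(2) num(1) by linarith
      then show "4 * sqd n x0 r x / (b - a)\<^sup>2 \<le> 32" using ab by (simp add: divide_le_eq)
    qed (auto simp: sqd_nonneg)
    also have "\<dots> \<le> (6 * C / r)\<^sup>2" by (simp add: power_divide power_mult_distrib divide_right_mono)
    finally show ?thesis by (rule power2_le_imp_le) (use C0 r in simp)
  qed
  have gz: "gradn n \<zeta> x \<le> 12 * C / r" if x: "x \<in> Rn n" for x
  proof (cases "sqd n x0 r x \<le> d")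
    case True
    have "(gradn n \<zeta> x)\<^sup>2 = (step 1 ((sqd n x0 r x - c) / (d - c)))\<^sup>2 * ((4 * sqd n x0 r x) / (d - c)\<^sup>2) / r\<^sup>2"
      unfolding \<zeta>_def gradn_cut_sq[OF x less_imp_neq[OF r, symmetric]] by (simp add: power_divide)
    also have "\<dots> \<le> C\<^sup>2 * 144 / r\<^sup>2"
    proof (intro divide_right_mono mult_mono s1)
      have "4 * sqd n x0 r x \<le> 144 * (d - c)\<^sup>2" using True num(3) by linarith
      then show "4 * sqd n x0 r x / (d - c)\<^sup>2 \<le> 144" using ab by (simp add: divide_le_eq)
    qed (auto simp: sqd_nonneg)
    also have "\<dots> = (12 * C / r)\<^sup>2" by (simp add: power_divide power_mult_distrib)
    finally show ?thesis by (rule power2_le_imp_le) (use C0 r in simp)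
  next
    case False
    then have "gradn n \<zeta> x = 0" using zp0[OF _ _ x] by (simp add: gradn_def)
    then show ?thesis using C0 r by simp
  qed
  \<comment> \<open>The second derivative of \<open>step 0\<close> contributes 32 C and the first 8
    n C; since 32 <= 11 n for n >= 3, the sum is at most 19 n C.\<close>
  have lch: "\<bar>lap n ch x\<bar> \<le> 19 * real n * C / r\<^sup>2" if x: "x \<in> Rn n" "sqd n x0 r x \<le> b" for x
  proof -
    let ?q = "(sqd n x0 r x - a) / (b - a)"
    have 1: "\<bar>step 2 ?q / (b - a)\<^sup>2 * (4 * sqd n x0 r x / r\<^sup>2)\<bar> \<le> 32 * C / r\<^sup>2"
    proof -
      have "\<bar>step 2 ?q / (b - a)\<^sup>2 * (4 * sqd n x0 r x / r\<^sup>2)\<bar> = \<bar>step 2 ?q\<bar> * (4 * sqd n x0 r x / (b - a)\<^sup>2) / r\<^sup>2"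
        by (simp add: abs_mult sqd_nonneg)
      also have "\<dots> \<le> C * 32 / r\<^sup>2"
      proof (intro divide_right_mono mult_mono C)
        have "4 * sqd n x0 r x \<le> 32 * (b - a)\<^sup>2" using x(2) num(1) by linarith
        then show "4 * sqd n x0 r x / (b - a)\<^sup>2 \<le> 32" using ab by (simp add: divide_le_eq)
      qed (auto simp: sqd_nonneg C0)
      finally show ?thesis by (simp add: mult.commute)
    qed
    have 2: "\<bar>step 1 ?q / (b - a) * (2 * real n / r\<^sup>2)\<bar> \<le> 8 * real n * C / r\<^sup>2"
    proof -
      have "\<bar>step 1 ?q / (b - a) * (2 * real n / r\<^sup>2)\<bar> = \<bar>step 1 ?q\<bar> * (1 / (b - a)) * (2 * real n) / r\<^sup>2"
        using ab by (simp add: abs_mult)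
      also have "\<dots> \<le> C * 4 * (2 * real n) / r\<^sup>2"
      proof (intro divide_right_mono mult_mono C)
        show "1 / (b - a) \<le> 4" using ab num(2) by (simp add: divide_le_eq)
      qed (use ab C0 in auto)
      finally show ?thesis by (simp add: mult_ac)
    qed
    have "\<bar>lap n ch x\<bar> \<le> 32 * C / r\<^sup>2 + 8 * real n * C / r\<^sup>2"
      unfolding ch_def lap_cut[OF x(1) less_imp_neq[OF r, symmetric]] using 1 2 by linarith
    also have "\<dots> = (32 * C + 8 * real n * C) / r\<^sup>2" by (simp add: add_divide_distrib)
    also have "\<dots> \<le> 19 * real n * C / r\<^sup>2"
    proof (rule divide_right_mono)
      have "3 * C \<le> real n * C" by (rule mult_right_mono[OF nn C0])
      then have "32 * C + 8 * (real n * C) \<le> 19 * (real n * C)" using C0 by linarith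
      then show "32 * C + 8 * real n * C \<le> 19 * real n * C" by (simp only: mult.assoc)
    qed simp
    finally show ?thesis .
  qed
  define wa where "wa = (sqrt a * r) powr (- \<mu>)"
  have wa: "wa \<ge> 0" by (simp add: wa_def)
  \<comment> \<open>Written with z = \<zeta> v instead of v, the majorant has compact support, and
    its gradient norm is an energy to which \<open>energy_limit\<close> applies.\<close>
  define G where "G k x = 19 * real n * C / r\<^sup>2 * \<bar>z k x\<bar> + 12 * C / r * gradn n (z k) x" for k x
  have G0: "G k x \<ge> 0" for k x unfolding G_def using C0 r by simp
  have pt: "\<bar>dist_n n x0 x powr (- \<mu>) * commutator ch k x\<bar> \<le> wa * G k x" if x: "x \<in> Rn n" for k x
  proof (cases "sqd n x0 r x \<le> a \<or> b \<le> sqd n x0 r x")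
    case True
    have "lap n ch x = 0"
      unfolding ch_def lap_cut[OF x less_imp_neq[OF r, symmetric]]
      using step_zero_sqd[OF ab(2) True, of 0] step_zero_sqd[OF ab(2) True, of 1] by (simp add: numeral_2_eq_2)
    moreover have "partial i ch x = 0" if "i < n" for i
      unfolding ch_def by (rule partial_cut_zero[OF ab(2) that x True])
    ultimately have "commutator ch k x = 0" by (simp add: commutator_def)
    then show ?thesis using wa G0[of k x] by simp
  next
    case False
    then have s: "a \<le> sqd n x0 r x" "sqd n x0 r x \<le> b" "sqd n x0 r x \<le> c" using ab by auto
    have z1: "\<zeta> x = 1" unfolding \<zeta>_def by (rule cut_one) (use s ab in auto)
    have vz: "v k x = z k x" by (simp add: z_def z1)
    have pv: "partial i (v k) x = partial i (z k) x" if "i < n" for i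
      using pz[OF that x] zp0[OF _ that x] s z1 by simp
    have "commutator ch k x = lap n ch x * z k x + 2 * (\<Sum>i<n. partial i ch x * partial i (z k) x)"
      by (simp add: commutator_def vz pv)
    then have "\<bar>commutator ch k x\<bar> \<le> \<bar>lap n ch x\<bar> * \<bar>z k x\<bar> + 2 * (gradn n ch x * gradn n (z k) x)"
      using gradn_Cauchy_Schwarz[where n = n and f = ch and x = x and g = "z k"]
        abs_triangle_ineq[of "lap n ch x * z k x" "2 * (\<Sum>i<n. partial i ch x * partial i (z k) x)"] by (simp add: abs_mult)
    also have "\<dots> \<le> 19 * real n * C / r\<^sup>2 * \<bar>z k x\<bar> + 2 * (6 * C / r * gradn n (z k) x)"
      by (intro add_mono mult_right_mono mult_left_mono lch gch x s) auto
    finally have cG: "\<bar>commutator ch k x\<bar> \<le> G k x" by (simp add: G_def)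
    have "sqrt a * r \<le> dist_n n x0 x" using sqd_ge[OF r, of "sqrt a" n x0 x] s ab by simp
    then have "dist_n n x0 x powr (- \<mu>) \<le> wa"
      unfolding wa_def using mu ab r by (intro powr_mono2') auto
    then show ?thesis unfolding abs_mult using cG wa by (intro mult_mono) auto
  qed
  have Gm: "G k \<in> Lq (bor n) 2" "L 2 (G k) \<le> 19 * real n * C / r\<^sup>2 * L 2 (z k) + 12 * C / r * L 2 (gradn n (z k))" for k
  proof -
    have 1: "(\<lambda>x. \<bar>z k x\<bar>) \<in> Lq (bor n) 2" "gradn n (z k) \<in> Lq (bor n) 2"
      using cc_Lq[OF test_fun_cc[OF tz[of k]], of 2] cc_Lq[OF cc_gradn[OF tz[of k]], of 2] by (auto simp: Lq_def)
    note M = Minkowski[of 2, OF _ Lq_cmult[OF 1(1), of "19 * real n * C / r\<^sup>2"] Lq_cmult[OF 1(2), of "12 * C / r"]]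
    have nz: "L 2 (\<lambda>x. \<bar>z k x\<bar>) = L 2 (z k)" by (rule nrm_cong) simp
    show "G k \<in> Lq (bor n) 2" unfolding G_def[abs_def] by (rule M) simp
    have "L 2 (G k) \<le> L 2 (\<lambda>x. 19 * real n * C / r\<^sup>2 * \<bar>z k x\<bar>) + L 2 (\<lambda>x. 12 * C / r * gradn n (z k) x)"
      unfolding G_def[abs_def] by (rule M) simp
    also have "\<dots> = 19 * real n * C / r\<^sup>2 * L 2 (z k) + 12 * C / r * L 2 (gradn n (z k))"
      using C0 r by (subst (1 2) nrm_cmult) (simp_all add: nz)
    finally show "L 2 (G k) \<le> 19 * real n * C / r\<^sup>2 * L 2 (z k) + 12 * C / r * L 2 (gradn n (z k))" .
  qed
  have Gs: "G k x = 0" if x: "x \<in> Rn n" "x \<notin> ball_n n x0 (3 * r)" for k x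
  proof -
    have d: "d \<le> sqd n x0 r x" using x \<rho> by (intro sd) (auto simp: ball_n_def)
    then have "z k x = 0" "gradn n (z k) x = 0"
      using pz[OF _ x(1)] z0 zp0[OF _ _ x(1)] by (auto simp: z_def gradn_def)
    then show ?thesis by (simp add: G_def)
  qed
  have Gp: "G k \<in> Lq (bor n) (exp_p n)" "L (exp_p n) (G k) \<le> 6 * r * L 2 (G k)" for k
  proof -
    note S = Lq_support_mono[OF Gm(1), of x0 "3 * r" k "exp_p n"]
    show "G k \<in> Lq (bor n) (exp_p n)" by (rule S) (use Gs e r in auto)
    have "L (exp_p n) (G k) \<le> ((2 * (3 * r)) ^ n) powr (1 / exp_p n - 1 / 2) * L 2 (G k)"
      by (rule S) (use Gs e r in auto)
    also have "((2 * (3 * r)) ^ n) powr (1 / exp_p n - 1 / 2) = 6 * r"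
      unfolding e(7) using power_root[of "2 * (3 * r)" n] r n by simp
    finally show "L (exp_p n) (G k) \<le> 6 * r * L 2 (G k)" .
  qed
  have cm: "(\<lambda>x. dist_n n x0 x powr (- \<mu>) * commutator ch k x) \<in> borel_measurable (bor n)" for k
    unfolding commutator_def
    by (intro borel_measurable_times measurable_weight borel_measurable_add borel_measurable_sum borel_measurable_const
        borel_measurable_continuous_Rn smooth_continuous smooth_lap sch v_smooth smooth_partial) auto
  have ae: "AE x in bor n. \<bar>dist_n n x0 x powr (- \<mu>) * commutator ch k x\<bar> \<le> wa * \<bar>G k x\<bar>" for k
    by (rule AE_I2) (use pt G0 in \<open>auto simp: space_bor\<close>)
  note Lb = Lq_bound[OF Gp(1) cm ae]
  \<comment> \<open>The root of the square puts the gradient norm into the form whose limit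
    \<open>energy_limit\<close> provides.\<close>
  define t where "t k = wa * (6 * r * (19 * real n * C / r\<^sup>2 * L 2 (z k) + 12 * C / r * sqrt ((L 2 (gradn n (z k)))\<^sup>2)))" for k
  obtain E where E: "(\<lambda>k. (L 2 (gradn n (z k)))\<^sup>2) \<longlonglongrightarrow> E" "E \<le> 2 * (L 2 (\<lambda>x. gradn n \<zeta> x * u x))\<^sup>2"
    unfolding z_def[abs_def] by (rule energy_limit[OF sz zz \<rho>])
  have cz: "cc n \<zeta>" by (rule cc_support[OF sz zz])
  define T where "T = wa * (6 * r * (19 * real n * C / r\<^sup>2 * L 2 (\<lambda>x. \<zeta> x * u x) + 12 * C / r * sqrt E))"
  have lim: "t \<longlonglongrightarrow> T"
    unfolding t_def T_def using E(1) nrm_mult_v_tendsto[OF _ u2 cz] by (intro tendsto_intros) (auto simp: z_def[abs_def])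
  have um: "u \<in> borel_measurable (bor n)" by (rule LqD(1)[OF u2])
  have X1: "L 2 (\<lambda>x. \<zeta> x * u x) \<le> 1 * L 2 u'"
  proof (rule Lq_bound(2)[OF X(2)])
    show "AE x in bor n. \<bar>\<zeta> x * u x\<bar> \<le> 1 * \<bar>u' x\<bar>"
    proof (rule AE_I2)
      fix x assume "x \<in> space (bor n)"
      then have x: "x \<in> Rn n" by (simp add: space_bor)
      show "\<bar>\<zeta> x * u x\<bar> \<le> 1 * \<bar>u' x\<bar>"
      proof (cases "sqd n x0 r x < d")
        case True
        have "\<bar>\<zeta> x\<bar> * \<bar>u x\<bar> \<le> 1 * \<bar>u' x\<bar>"
          using X(1)[OF x True] by (intro mult_mono) (auto simp: \<zeta>_def cut_01 abs_le_iff intro: order_trans[OF _ cut_01(1)])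
        then show ?thesis by (simp add: abs_mult)
      next
        case False then show ?thesis using z0 by simp
      qed
    qed
  qed (use um borel_measurable_continuous_Rn[OF ccD[OF cz]] in auto)
  have X2: "L 2 (\<lambda>x. gradn n \<zeta> x * u x) \<le> 12 * C / r * L 2 u'"
  proof (rule Lq_bound(2)[OF X(2)])
    show "AE x in bor n. \<bar>gradn n \<zeta> x * u x\<bar> \<le> 12 * C / r * \<bar>u' x\<bar>"
    proof (rule AE_I2)
      fix x assume "x \<in> space (bor n)"
      then have x: "x \<in> Rn n" by (simp add: space_bor)
      show "\<bar>gradn n \<zeta> x * u x\<bar> \<le> 12 * C / r * \<bar>u' x\<bar>"
      proof (cases "sqd n x0 r x < d")
        case True
        have "gradn n \<zeta> x * \<bar>u x\<bar> \<le> 12 * C / r * \<bar>u' x\<bar>"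
          using X(1)[OF x True] gz[OF x] C0 r by (intro mult_mono) auto
        then show ?thesis by (simp add: abs_mult)
      next
        case False
        then have "gradn n \<zeta> x = 0" using zp0[OF _ _ x] by (simp add: gradn_def)
        then show ?thesis using C0 r by simp
      qed
    qed
  qed (use um borel_measurable_continuous_Rn[OF continuous_gradn[OF sz]] C0 r in auto)
  define Y where "Y = L 2 u'"
  have Y0: "Y \<ge> 0" by (simp add: Y_def)
  \<comment> \<open>Twice the square of 12 is 288, rounded up to the square of 17.\<close>
  have sE: "sqrt E \<le> 17 * C / r * Y"
  proof (rule real_le_lsqrt)
    have "E \<le> 2 * (12 * C / r * Y)\<^sup>2"
      by (rule order_trans[OF E(2)]) (use X2 in \<open>auto simp: Y_def intro!: power_mono\<close>)
    also have "\<dots> = 288 * (C / r * Y)\<^sup>2" by (simp add: power_mult_distrib power_divide)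
    also have "\<dots> \<le> 289 * (C / r * Y)\<^sup>2" by (rule mult_right_mono) auto
    also have "\<dots> = (17 * C / r * Y)\<^sup>2" by (simp add: power_mult_distrib power_divide)
    finally show "E \<le> (17 * C / r * Y)\<^sup>2" .
  qed (use C0 r Y0 in auto)
  \<comment> \<open>12 times 17 is 204, and 19 + 204 = 223 is rounded up to 233; 6 times 233 is
    1398, rounded up to 1400.\<close>
  have TT: "T \<le> wa * (1400 * C\<^sup>2 * real n / r * Y)"
    unfolding T_def
  proof (rule mult_left_mono[OF _ wa])
    have "19 * real n * C / r\<^sup>2 * L 2 (\<lambda>x. \<zeta> x * u x) + 12 * C / r * sqrt E \<le> 19 * real n * C / r\<^sup>2 * Y + 12 * C / r * (17 * C / r * Y)"
      using X1 sE C0 r by (intro add_mono mult_left_mono) (auto simp: Y_def)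
    also have "\<dots> = (19 * (real n * C) + 204 * C\<^sup>2) * (Y / r\<^sup>2)" by (simp add: power2_eq_square field_simps add_divide_distrib)
    also have "\<dots> \<le> (233 * (C\<^sup>2 * real n)) * (Y / r\<^sup>2)"
    proof (rule mult_right_mono)
      have "real n * C \<le> C\<^sup>2 * real n"
        using mult_left_mono[OF mult_right_mono[OF C(1) C0], of "real n"] by (simp add: power2_eq_square mult_ac)
      moreover have "C\<^sup>2 * 1 \<le> C\<^sup>2 * real n" using nn by (intro mult_left_mono) auto
      ultimately have "19 * (real n * C) + 204 * C\<^sup>2 \<le> 223 * (C\<^sup>2 * real n)" by linarith
      moreover have "0 \<le> C\<^sup>2 * real n" by simp
      ultimately show "19 * (real n * C) + 204 * C\<^sup>2 \<le> 233 * (C\<^sup>2 * real n)" by linarith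
    qed (use Y0 in simp)
    finally have "6 * r * (19 * real n * C / r\<^sup>2 * L 2 (\<lambda>x. \<zeta> x * u x) + 12 * C / r * sqrt E) \<le> 6 * r * ((233 * (C\<^sup>2 * real n)) * (Y / r\<^sup>2))"
      using r by (intro mult_left_mono) auto
    also have "\<dots> = 1398 * (C\<^sup>2 * real n / r * Y)" using r by (simp add: power2_eq_square field_simps)
    also have "\<dots> \<le> 1400 * (C\<^sup>2 * real n / r * Y)" using Y0 r by (intro mult_right_mono) auto
    finally show "6 * r * (19 * real n * C / r\<^sup>2 * L 2 (\<lambda>x. \<zeta> x * u x) + 12 * C / r * sqrt E) \<le> 1400 * C\<^sup>2 * real n / r * Y"
      by (simp add: mult.assoc)
  qed
  have bd: "L (exp_p n) (\<lambda>x. dist_n n x0 x powr (- \<mu>) * commutator ch k x) \<le> t k" for k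
  proof -
    have "L (exp_p n) (\<lambda>x. dist_n n x0 x powr (- \<mu>) * commutator ch k x) \<le> wa * L (exp_p n) (G k)"
      by (rule Lb(2)) (use e wa in auto)
    also have "\<dots> \<le> wa * (6 * r * L 2 (G k))" by (rule mult_left_mono[OF Gp(2) wa])
    also have "\<dots> \<le> t k" unfolding t_def using Gm(2)[of k] r wa by (intro mult_left_mono) auto
    finally show ?thesis .
  qed
  have mem: "(\<lambda>x. dist_n n x0 x powr (- \<mu>) * commutator ch k x) \<in> Lq (bor n) (exp_p n)" for k
    by (rule Lb(1)) (use e wa in auto)
  show thesis
    by (rule that[of t T]) (use lim TT bd mem in \<open>simp_all add: ch_def wa_def Y_def\<close>)
qed

end

lemma lap_diff:
  assumes f: "smooth n f" and g: "smooth n g" and x: "x \<in> Rn n"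
  shows "lap n (\<lambda>x. f x - g x) x = lap n f x - lap n g x"
proof -
  have "partial i (partial i (\<lambda>x. f x - g x)) x = partial i (partial i f) x - partial i (partial i g) x" if i: "i < n" for i
  proof -
    have "partial i (partial i (\<lambda>x. f x - g x)) x = partial i (\<lambda>x. partial i f x - partial i g x) x"
      by (rule partial_cong[OF _ i x]) (rule partial_diff[OF f g i])
    then show ?thesis using partial_diff[OF smooth_partial[OF f i] smooth_partial[OF g i] i x] by simp
  qed
  then show ?thesis by (simp add: lap_def sum_subtractf)
qed

context ball_solution
begin

text \<open>The cutoff \<eta> is 1 for squared radii from 1/2 to 6 and vanishes near the centre and
  near the boundary. Multiplied by (2 r)^\<mu>, the weight is at least 1 on the annulus between r
  and 2 r, while on the two commutator shells it is at most 4^\<mu> and (2 / sqrt 6)^\<mu>. The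
  powers of r cancel: 6 r from Hoelder against 1 / r from the commutators.\<close>

lemma carleman_estimate:
  assumes car: "carleman n \<theta>" and \<theta>: "\<theta> \<ge> 1" "\<theta> * kap < 1" and mu: "\<mu> \<in> Lambda n"
    and C: "C \<ge> 1" "\<And>s. \<bar>step 1 s\<bar> \<le> C" "\<And>s. \<bar>step 2 s\<bar> \<le> C"
  shows "L 2 (\<lambda>x. indicator (ball_n n x0 (2 * r)) x * u x)
    \<le> 8401 * C\<^sup>2 * real n * (\<theta> / (1 - \<theta> * kap)) * (4 powr \<mu> * L 2 (\<lambda>x. indicator (ball_n n x0 r) x * u x) + (2 / sqrt 6) powr \<mu> * L 2 u)"
proof -
  note e = exponents[OF n]
  have m0: "\<mu> > 0" using mu by (simp add: Lambda_def)
  define ci where "ci = cutoff n x0 r (1/4) (1/2)"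
  define co where "co = cutoff n x0 r 6 8"
  define \<eta> where "\<eta> x = co x - ci x" for x
  define W where "W x = dist_n n x0 x powr (- \<mu>)" for x
  define h where "h x = W x * \<eta> x" for x
  define ur where "ur x = indicator (ball_n n x0 r) x * u x" for x
  have sci: "smooth n ci" and sco: "smooth n co" unfolding ci_def co_def by (rule smooth_cut)+
  have s\<eta>: "smooth n \<eta>" unfolding \<eta>_def[abs_def] by (intro smooth_diff sci sco)
  have um [measurable]: "u \<in> borel_measurable (bor n)" by (rule LqD(1)[OF u2])
  have Wm [measurable]: "W \<in> borel_measurable (bor n)" using measurable_weight by (simp add: W_def[abs_def])
  have etam [measurable]: "\<eta> \<in> borel_measurable (bor n)" by (rule borel_measurable_continuous_Rn[OF smooth_continuous[OF s\<eta>]])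
  have hm [measurable]: "h \<in> borel_measurable (bor n)" unfolding h_def[abs_def] by measurable
  have "sqrt 8 < 3" by (rule real_less_lsqrt) auto
  then have \<rho>: "sqrt 8 * r < 3 * r" "0 \<le> sqrt 8 * r" using r by auto
  have out: "\<eta> x = 0" if "dist_n n x0 x > sqrt 8 * r" for x
  proof -
    have "\<not> sqd n x0 r x \<le> (sqrt 8)\<^sup>2" using that sqd_le[OF r, of "sqrt 8" n x0 x] by simp
    then have s: "8 \<le> sqd n x0 r x" by simp
    have "co x = 0" unfolding co_def by (rule cut_zero) (use s in auto)
    moreover have "ci x = 0" unfolding ci_def by (rule cut_zero) (use s in auto)
    ultimately show ?thesis by (simp add: \<eta>_def)
  qed
  have inn: "\<eta> x = 0" if "dist_n n x0 x < 1/2 * r" for x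
  proof -
    have "sqd n x0 r x < (1/2)\<^sup>2" using that sqd_less[OF r, of "1/2" n x0 x] by simp
    then have s: "sqd n x0 r x < 1/4" by (simp add: power_divide)
    have "co x = 1" unfolding co_def by (rule cut_one) (use s in auto)
    moreover have "ci x = 1" unfolding ci_def by (rule cut_one) (use s in auto)
    ultimately show ?thesis by (simp add: \<eta>_def)
  qed
  \<comment> \<open>The singularity of the weight at x0 is cut away, so h is bounded and convergence
    in L^q survives multiplication by it.\<close>
  have hb: "\<bar>h x\<bar> \<le> (1/2 * r) powr (- \<mu>)" for x
  proof (cases "dist_n n x0 x < 1/2 * r")
    case False
    then have "W x \<le> (1/2 * r) powr (- \<mu>)" unfolding W_def using m0 r by (intro powr_mono2') auto
    moreover have "\<bar>\<eta> x\<bar> \<le> 1"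
      using cut_01[of n x0 r "1/4" "1/2" x] cut_01[of n x0 r 6 8 x] by (simp add: \<eta>_def co_def ci_def)
    ultimately have "W x * \<bar>\<eta> x\<bar> \<le> (1/2 * r) powr (- \<mu>) * 1" by (intro mult_mono) auto
    then show ?thesis by (simp add: h_def abs_mult W_def)
  qed (simp add: h_def inn)
  note hv = nrm_tendsto_mult[OF _ v_Lq[OF _ u(1)] u(1) conv_Lq_tendsto[OF _ u_int u(1)] hm hb]
  note hF = nrm_tendsto_mult[OF e(1) conv_Young(1)[OF e(1) F_int F(1)] F(1) conv_Lq_tendsto[OF e(1) F_int F(1)] hm hb]
  have p'1: "exp_p' n \<ge> 1" using e by simp
  \<comment> \<open>The auxiliary cutoff of the outer shell ends at squared radius 17/2 < 9. For the
    inner shell it will end at 1, so that only the restriction of u to the ball of radius r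
    enters.\<close>
  obtain to To where to: "to \<longlonglongrightarrow> To" "To \<le> (sqrt 6 * r) powr (- \<mu>) * (1400 * C\<^sup>2 * real n / r * L 2 u)"
    "\<And>k. L (exp_p n) (\<lambda>x. dist_n n x0 x powr (- \<mu>) * commutator (cutoff n x0 r 6 8) k x) \<le> to k"
    "\<And>k. (\<lambda>x. dist_n n x0 x powr (- \<mu>) * commutator (cutoff n x0 r 6 8) k x) \<in> Lq (bor n) (exp_p n)"
  proof (rule commutator_bound[where a = 6 and b = 8 and c = 8 and d = "17/2" and u' = u and \<mu> = \<mu> and C = C])
  qed (use C m0 u2 in \<open>auto simp: power2_eq_square\<close>)
  have ur2: "ur \<in> Lq (bor n) 2"
    by (rule Lq_bound(1)[OF u2, where C = 1]) (auto simp: ur_def[abs_def] indicator_def)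
  have urX: "\<bar>u x\<bar> \<le> \<bar>ur x\<bar>" if "x \<in> Rn n" "sqd n x0 r x < 1" for x
    using that sqd_less[OF r, of 1 n x0 x] by (simp add: ur_def ball_n_def)
  obtain ti Ti where ti: "ti \<longlonglongrightarrow> Ti" "Ti \<le> (sqrt (1/4) * r) powr (- \<mu>) * (1400 * C\<^sup>2 * real n / r * L 2 ur)"
    "\<And>k. L (exp_p n) (\<lambda>x. dist_n n x0 x powr (- \<mu>) * commutator (cutoff n x0 r (1/4) (1/2)) k x) \<le> ti k"
    "\<And>k. (\<lambda>x. dist_n n x0 x powr (- \<mu>) * commutator (cutoff n x0 r (1/4) (1/2)) k x) \<in> Lq (bor n) (exp_p n)"
  proof (rule commutator_bound[where a = "1/4" and b = "1/2" and c = "1/2" and d = 1 and u' = ur and \<mu> = \<mu> and C = C])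
  qed (use C m0 ur2 urX in \<open>auto simp: power2_eq_square\<close>)
  \<comment> \<open>This holds eventually, once the kernels fit between the support of \<eta> and
    the boundary of the ball.\<close>
  have ev: "\<forall>\<^sub>F k in sequentially. L (exp_p' n) (\<lambda>x. h x * v k x) \<le> \<theta> * (L (exp_p n) (\<lambda>x. h x * conv0 n k F x) + (to k + ti k))"
    using lap_v_eventually[OF \<rho>(1)]
  proof eventually_elim
    case (elim k)
    let ?w = "\<lambda>x. \<eta> x * v k x"
    let ?Co = "\<lambda>x. W x * commutator co k x" and ?Ci = "\<lambda>x. - 1 * (W x * commutator ci k x)"
    have Lo: "?Co \<in> Lq (bor n) (exp_p n)" "L (exp_p n) ?Co \<le> to k" using to(3,4)[of k] by (simp_all add: W_def co_def)
    have Li: "?Ci \<in> Lq (bor n) (exp_p n)" by (rule Lq_cmult) (use ti(4)[of k] in \<open>simp add: W_def ci_def\<close>)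
    have Li2: "L (exp_p n) ?Ci \<le> ti k"
    proof -
      have "L (exp_p n) ?Ci = \<bar>- 1\<bar> * L (exp_p n) (\<lambda>x. W x * commutator ci k x)" by (rule nrm_cmult) (use e in simp)
      then show ?thesis using ti(3)[of k] by (simp add: W_def ci_def)
    qed
    have lw: "W x * lap n ?w x = h x * conv0 n k F x + (?Co x + ?Ci x)" if x: "x \<in> Rn n" for x
    proof -
      have 1: "lap n \<eta> x = lap n co x - lap n ci x" unfolding \<eta>_def[abs_def] by (rule lap_diff[OF sco sci x])
      have 2: "(\<Sum>i<n. partial i \<eta> x * partial i (v k) x) = (\<Sum>i<n. partial i co x * partial i (v k) x) - (\<Sum>i<n. partial i ci x * partial i (v k) x)"
        unfolding sum_subtractf[symmetric]
      proof (rule sum.cong[OF refl])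
        fix i assume "i \<in> {..<n}"
        then have "partial i \<eta> x = partial i co x - partial i ci x"
          unfolding \<eta>_def[abs_def] by (intro partial_diff[OF sco sci _ x]) simp
        then show "partial i \<eta> x * partial i (v k) x = partial i co x * partial i (v k) x - partial i ci x * partial i (v k) x"
          by (simp only: left_diff_distrib)
      qed
      have 3: "\<eta> x * lap n (v k) x = \<eta> x * conv0 n k F x"
        using elim x out[of x] by (cases "dist_n n x0 x \<le> sqrt 8 * r") auto
      have "lap n ?w x = lap n \<eta> x * v k x + 2 * (\<Sum>i<n. partial i \<eta> x * partial i (v k) x) + \<eta> x * lap n (v k) x"
        by (rule lap_mult[OF s\<eta> v_smooth x])
      also have "\<dots> = commutator co k x - commutator ci k x + \<eta> x * conv0 n k F x"
        unfolding 1 2 3 commutator_def by (simp add: algebra_simps)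
      finally have lw': "lap n ?w x = commutator co k x - commutator ci k x + \<eta> x * conv0 n k F x" .
      show ?thesis unfolding lw' h_def by (simp add: algebra_simps)
    qed
    have "L (exp_p' n) (\<lambda>x. h x * v k x) = L (exp_p' n) (\<lambda>x. dist_n n x0 x powr (- \<mu>) * ?w x)"
      by (rule nrm_cong) (simp add: h_def W_def mult.assoc)
    also have "\<dots> \<le> \<theta> * L (exp_p n) (\<lambda>x. dist_n n x0 x powr (- \<mu>) * lap n ?w x)"
      by (rule carleman_test[OF car _ mu n, where \<rho> = "sqrt 8 * r" and R = "3 * r" and e = "1/2 * r"])
         (use \<theta> \<rho> r out inn in \<open>auto intro!: smooth_mult s\<eta> v_smooth\<close>)
    also have "L (exp_p n) (\<lambda>x. dist_n n x0 x powr (- \<mu>) * lap n ?w x) = L (exp_p n) (\<lambda>x. h x * conv0 n k F x + (?Co x + ?Ci x))"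
      by (rule nrm_cong) (use lw in \<open>simp add: space_bor W_def\<close>)
    also have "\<theta> * \<dots> \<le> \<theta> * (L (exp_p n) (\<lambda>x. h x * conv0 n k F x) + (to k + ti k))"
    proof (rule mult_left_mono)
      note M1 = Minkowski[OF e(1) Lo(1) Li]
      have "(\<lambda>x. h x * conv0 n k F x) \<in> Lq (bor n) (exp_p n)" by (rule hF(3))
      from Minkowski(2)[OF e(1) this M1(1)]
      show "L (exp_p n) (\<lambda>x. h x * conv0 n k F x + (?Co x + ?Ci x)) \<le> L (exp_p n) (\<lambda>x. h x * conv0 n k F x) + (to k + ti k)"
        using M1(2) Lo(2) Li2 by linarith
    qed (use \<theta> in simp)
    finally show ?case .
  qed
  define N where "N = L (exp_p' n) (\<lambda>x. h x * u x)"
  have hu: "(\<lambda>x. h x * u x) \<in> Lq (bor n) (exp_p' n)" using hv(2)[OF p'1 p'1 p'1] by simp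
  have "N \<le> \<theta> * (L (exp_p n) (\<lambda>x. h x * F x) + (To + Ti))"
  proof (rule tendsto_le[OF _ _ _ ev])
    show "(\<lambda>k. L (exp_p' n) (\<lambda>x. h x * v k x)) \<longlonglongrightarrow> N"
      unfolding N_def by (rule nrm_tendsto[OF p'1]) (use hv[OF p'1 p'1 p'1] in auto)
    have "(\<lambda>k. L (exp_p n) (\<lambda>x. h x * conv0 n k F x)) \<longlonglongrightarrow> L (exp_p n) (\<lambda>x. h x * F x)"
      by (rule nrm_tendsto[OF e(1)]) (use hF in auto)
    then show "(\<lambda>k. \<theta> * (L (exp_p n) (\<lambda>x. h x * conv0 n k F x) + (to k + ti k))) \<longlonglongrightarrow> \<theta> * (L (exp_p n) (\<lambda>x. h x * F x) + (To + Ti))"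
      using to(1) ti(1) by (intro tendsto_intros)
  qed simp
  also have "\<dots> \<le> \<theta> * (kap * N + (To + Ti))"
    unfolding N_def using nrm_mult_F[OF hm hu] \<theta> by (intro mult_left_mono add_right_mono) auto
  finally have "N * (1 - \<theta> * kap) \<le> \<theta> * (To + Ti)" by (simp add: algebra_simps)
  then have N: "N \<le> \<theta> / (1 - \<theta> * kap) * (To + Ti)" using \<theta> by (simp add: pos_le_divide_eq)
  define \<Theta> where "\<Theta> = \<theta> / (1 - \<theta> * kap)"
  have "0 \<le> \<theta> * kap" using \<theta> kap_nonneg by simp
  then have \<Theta>: "\<Theta> \<ge> 1" unfolding \<Theta>_def using \<theta> by (simp add: pos_le_divide_eq)
  define A where "A = L 2 ur"
  define B where "B = L 2 u"
  define K where "K = C\<^sup>2 * real n"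
  have AB: "A \<ge> 0" "B \<ge> 0" by (simp_all add: A_def B_def)
  have K1: "K \<ge> 1"
  proof -
    have "1 \<le> C\<^sup>2" using C(1) by simp
    then have "1 * 1 \<le> C\<^sup>2 * real n" using n by (intro mult_mono) auto
    then show ?thesis by (simp add: K_def)
  qed
  define g where "g x = (2 * r) powr \<mu> * (h x * u x)" for x
  have hu2: "(\<lambda>x. h x * u x) \<in> Lq (bor n) 2" "L 2 (\<lambda>x. h x * u x) \<le> 6 * r * N"
  proof -
    note S = Lq_support_mono[OF hu, of x0 "3 * r" 2]
    show "(\<lambda>x. h x * u x) \<in> Lq (bor n) 2" by (rule S) (use u(2) e r in auto)
    have "L 2 (\<lambda>x. h x * u x) \<le> ((2 * (3 * r)) ^ n) powr (1 / 2 - 1 / exp_p' n) * N"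
      unfolding N_def by (rule S) (use u(2) e r in auto)
    also have "((2 * (3 * r)) ^ n) powr (1 / 2 - 1 / exp_p' n) = 6 * r"
      unfolding e(6) using power_root[of "2 * (3 * r)" n] r n by simp
    finally show "L 2 (\<lambda>x. h x * u x) \<le> 6 * r * N" .
  qed
  have g2: "g \<in> Lq (bor n) 2" "L 2 g = (2 * r) powr \<mu> * L 2 (\<lambda>x. h x * u x)"
    unfolding g_def[abs_def] using Lq_cmult[OF hu2(1)] nrm_cmult[of 2 "bor n" "(2 * r) powr \<mu>" "\<lambda>x. h x * u x"] by simp_all
  have ab2: "(\<lambda>x. \<bar>f x\<bar>) \<in> Lq (bor n) 2" "L 2 (\<lambda>x. \<bar>f x\<bar>) = L 2 f" if "f \<in> Lq (bor n) 2" for f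
    using that by (auto simp: Lq_def nrm_def)
  have hu3: "L 2 (\<lambda>x. h x * u x) \<le> 6 * r * (\<Theta> * (To + Ti))"
    by (rule order_trans[OF hu2(2)], rule mult_left_mono[OF N[folded \<Theta>_def]]) (use r in simp)
  note Mk = Minkowski[of 2, OF _ ab2(1)[OF ur2] ab2(1)[OF g2(1)]]
  have "L 2 (\<lambda>x. indicator (ball_n n x0 (2 * r)) x * u x) \<le> 1 * L 2 (\<lambda>x. \<bar>ur x\<bar> + \<bar>g x\<bar>)"
  proof (rule Lq_bound(2)[OF Mk(1)])
    show "AE x in bor n. \<bar>indicator (ball_n n x0 (2 * r)) x * u x\<bar> \<le> 1 * \<bar>\<bar>ur x\<bar> + \<bar>g x\<bar>\<bar>"
    proof (rule AE_I2)
      fix x assume "x \<in> space (bor n)"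
      then have x: "x \<in> Rn n" by (simp add: space_bor)
      show "\<bar>indicator (ball_n n x0 (2 * r)) x * u x\<bar> \<le> 1 * \<bar>\<bar>ur x\<bar> + \<bar>g x\<bar>\<bar>"
      proof (cases "x \<in> ball_n n x0 (2 * r)")
        case b: True
        show ?thesis
        proof (cases "x \<in> ball_n n x0 r")
          case True then show ?thesis by (simp add: ur_def indicator_def)
        next
          case False
          then have d: "r \<le> dist_n n x0 x" "dist_n n x0 x < 2 * r" using b x by (auto simp: ball_n_def)
          have s: "1 \<le> sqd n x0 r x" "sqd n x0 r x \<le> 4"
            using d sqd_ge[OF r, of 1 n x0 x] sqd_le[OF r, of 2 n x0 x] by auto
          have "co x = 1" unfolding co_def by (rule cut_one) (use s in auto)
          moreover have "ci x = 0" unfolding ci_def by (rule cut_zero) (use s in auto)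
          ultimately have h: "h x = W x" by (simp add: h_def \<eta>_def)
          have "(2 * r) powr (- \<mu>) \<le> W x" unfolding W_def using m0 r d by (intro powr_mono2') auto
          then have "(2 * r) powr \<mu> * (2 * r) powr (- \<mu>) \<le> (2 * r) powr \<mu> * W x" by (rule mult_left_mono) simp
          then have "1 \<le> (2 * r) powr \<mu> * W x" using r by (simp add: powr_add[symmetric])
          then have "1 * \<bar>u x\<bar> \<le> ((2 * r) powr \<mu> * W x) * \<bar>u x\<bar>" by (rule mult_right_mono) simp
          then show ?thesis using b by (simp add: g_def h abs_mult W_def mult_ac)
        qed
      qed simp
    qed
  qed auto
  also have "\<dots> \<le> A + L 2 g" using Mk(2) ab2(2)[OF ur2] ab2(2)[OF g2(1)] by (simp add: A_def)
  also have "\<dots> \<le> A + (2 * r) powr \<mu> * (6 * r * (\<Theta> * (To + Ti)))"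
    unfolding g2(2) by (intro add_left_mono mult_left_mono hu3) auto
  also have "\<dots> \<le> A + (2 * r) powr \<mu> * (6 * r * (\<Theta> * ((sqrt 6 * r) powr (- \<mu>) * (1400 * C\<^sup>2 * real n / r * B) + (sqrt (1/4) * r) powr (- \<mu>) * (1400 * C\<^sup>2 * real n / r * A))))"
    using to(2) ti(2) r \<Theta> by (intro add_left_mono mult_left_mono add_mono) (auto simp: A_def B_def)
  also have "\<dots> = A + 8400 * K * \<Theta> * (((2 * r) powr \<mu> * (sqrt (1/4) * r) powr (- \<mu>)) * A + ((2 * r) powr \<mu> * (sqrt 6 * r) powr (- \<mu>)) * B)"
    using r by (simp add: K_def field_simps)
  also have "(2 * r) powr \<mu> * (sqrt (1/4) * r) powr (- \<mu>) = 4 powr \<mu>"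
    using r by (simp add: powr_minus_divide powr_divide[symmetric] real_sqrt_divide)
  also have "(2 * r) powr \<mu> * (sqrt 6 * r) powr (- \<mu>) = (2 / sqrt 6) powr \<mu>"
    using r by (simp add: powr_minus_divide powr_divide[symmetric])
  \<comment> \<open>The summand A, the part of u in the ball of radius r, is covered by raising
    8400, which is 6 times 1400, by one.\<close>
  also have "A + 8400 * K * \<Theta> * (4 powr \<mu> * A + (2 / sqrt 6) powr \<mu> * B) \<le> 8401 * K * \<Theta> * (4 powr \<mu> * A + (2 / sqrt 6) powr \<mu> * B)"
  proof -
    define Z where "Z = 4 powr \<mu> * A + (2 / sqrt 6) powr \<mu> * B"
    have "1 * A \<le> 4 powr \<mu> * A" using m0 AB by (intro mult_right_mono ge_one_powr_ge_zero) auto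
    moreover have "0 \<le> (2 / sqrt 6) powr \<mu> * B" using AB by simp
    ultimately have "A \<le> Z" unfolding Z_def by linarith
    with AB have "A \<le> Z" "0 \<le> Z" by linarith+
    moreover have "1 * 1 \<le> K * \<Theta>" using K1 \<Theta> by (intro mult_mono) auto
    then have "1 * Z \<le> K * \<Theta> * Z" using \<open>0 \<le> Z\<close> by (intro mult_right_mono) auto
    ultimately have "A + 8400 * (K * \<Theta> * Z) \<le> 8401 * (K * \<Theta> * Z)" by linarith
    then show ?thesis unfolding Z_def by (simp only: mult.assoc)
  qed
  finally show ?thesis by (simp add: A_def B_def ur_def[abs_def] K_def \<Theta>_def mult.assoc)
qed

end

section \<open>The three-ball inequality\<close>

text \<open>These are midpoints between consecutive points of the shifted natural numbers. Each m
  gives one, so admissible exponents are available in steps of 1.\<close>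

lemma Lambda_member:
  assumes "n \<ge> 3" shows "(real n - 1) / 2 + real m \<in> Lambda n"
proof -
  define S where "S = range (\<lambda>m::nat. real m + (real n - 2) / 2)"
  define x where "x = (real n - 1) / 2 + real m"
  have "infdist x S \<le> dist x (real m + (real n - 2) / 2)"
    by (rule infdist_le) (auto simp: S_def)
  also have "\<dots> = 1 / 2" by (simp add: x_def dist_real_def field_simps)
  finally have 1: "infdist x S \<le> 1 / 2" .
  have "1 / 2 \<le> infdist x S"
  proof -
    have "1 / 2 \<le> dist x a" if a: "a \<in> S" for a
    proof -
      obtain j :: nat where j: "a = real j + (real n - 2) / 2" using a by (auto simp: S_def)
      have e: "x - a = (real m - real j) + 1 / 2" unfolding x_def j by (simp add: field_simps)
      show ?thesis
      proof (cases "j \<le> m")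
        case True then show ?thesis unfolding dist_real_def e by simp
      next
        case False
        then have "real m + 1 \<le> real j" by linarith
        then show ?thesis unfolding dist_real_def e by linarith
      qed
    qed
    moreover have S: "S \<noteq> {}" by (simp add: S_def)
    ultimately have "1 / 2 \<le> (INF a\<in>S. dist x a)" by (intro cINF_greatest)
    then show ?thesis using S by (simp add: infdist_def)
  qed
  with 1 have "infdist x S = 1 / 2" by simp
  moreover have "x > 0" using assms by (simp add: x_def add_pos_nonneg)
  ultimately show ?thesis by (simp add: Lambda_def S_def x_def)
qed

text \<open>The parameter \<open>\<mu>\<close> balances the two terms of the Carleman bound if \<open>B / A\<close> is at least exponential in
  the dimension; the factor \<open>n\<close> is then absorbed by half of the decay. Otherwise the growth bound alone suffices.\<close>

lemma three_ball_optimisation: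
  fixes A B M K \<Theta> C D :: real
  assumes n: "n \<ge> (1::nat)" and A: "0 \<le> A" "A \<le> M" "M \<le> B" and K: "K \<ge> 1" and \<Theta>: "\<Theta> \<ge> 1" and C: "C \<ge> 0" and D: "D > 0"
    and car: "\<And>m::nat. M \<le> K * real n * \<Theta> * (exp (ln 4 * ((real n - 1) / 2 + real m)) * A + exp (- D * ((real n - 1) / 2 + real m)) * B)"
    and grow: "M \<le> 16 * C * exp (- (real n / 51)) * B"
    and \<alpha>: "0 < \<alpha>" "\<alpha> \<le> D / (2 * (ln 4 + D))" "\<alpha> \<le> 1 / (51 * (ln 4 + D))"
  shows "M \<le> (4 * K * exp D / D + 16 * C) * \<Theta> * (B powr (1 - \<alpha>) * A powr \<alpha>)"
proof -
  define k where "k = 4 * K * exp D / D + 16 * C"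
  have k: "4 * K * exp D / D \<le> k" "16 * C \<le> k" "0 \<le> k" using K C D by (auto simp: k_def)
  define Q where "Q = ln 4 + D"
  have l4: "ln 4 > (0::real)" by simp
  have Q: "Q > 0" unfolding Q_def by (rule add_pos_pos[OF l4 D])
  show ?thesis
  \<comment> \<open>If u vanishes on the small ball, only the decaying term is left, and m tending
    to infinity forces M <= 0; this is unique continuation.\<close>
  proof (cases "A = 0")
    case True
    have "(\<lambda>m::nat. exp (- D * ((real n - 1) / 2 + real m))) \<longlonglongrightarrow> 0"
    proof -
      have "filterlim (\<lambda>m::nat. - D * ((real n - 1) / 2 + real m)) at_bot sequentially"
        using D by (intro filterlim_tendsto_neg_mult_at_bot[where c = "- D"] filterlim_tendsto_add_at_top[OF tendsto_const filterlim_real_sequentially]) auto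
      then show ?thesis by (rule filterlim_compose[OF exp_at_bot])
    qed
    then have "(\<lambda>m::nat. K * real n * \<Theta> * (exp (ln 4 * ((real n - 1) / 2 + real m)) * 0 + exp (- D * ((real n - 1) / 2 + real m)) * B)) \<longlonglongrightarrow> K * real n * \<Theta> * (0 + 0 * B)"
      by (intro tendsto_intros) simp_all
    then have "M \<le> K * real n * \<Theta> * (0 + 0 * B)"
      by (rule LIMSEQ_le_const) (use car True in auto)
    then show ?thesis using True k \<Theta> by simp
  next
    case False
    then have pos: "A > 0" "B > 0" using A by auto
    define l where "l = ln (B / A)"
    have l0: "l \<ge> 0" using A pos by (simp add: l_def)
    have eB: "exp l = B / A" using pos by (simp add: l_def)
    have rhs: "B powr (1 - \<alpha>) * A powr \<alpha> = B * exp (- \<alpha> * l)"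
    proof -
      have "exp (- \<alpha> * l) = (B / A) powr (- \<alpha>)" using pos by (simp add: powr_def l_def)
      also have "\<dots> = B powr (- \<alpha>) * A powr \<alpha>"
        using pos by (simp add: powr_divide powr_minus_divide)
      finally show ?thesis using pos by (simp add: powr_diff powr_minus_divide)
    qed
    have "M \<le> k * \<Theta> * (B * exp (- \<alpha> * l))"
    \<comment> \<open>In the first case the balancing exponent l / Q is at least n, hence above the
      smallest available exponent (n - 1) / 2.\<close>
    proof (cases "real n * Q \<le> l")
      case True
      define c where "c = (real n - 1) / 2"
      define y where "y = l / Q"
      \<comment> \<open>Rounding down to an available exponent loses less than 1, which costs the
        factor exp D.\<close>
      define m where "m = nat \<lfloor>y - c\<rfloor>"
      define \<mu> where "\<mu> = c + real m"
      have ny: "real n \<le> y" using True Q by (simp add: y_def pos_le_divide_eq)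
      have "0 \<le> y - (t - 1) / 2" if "t \<le> y" "0 \<le> t" for t using that by (simp add: field_simps)
      from this[OF ny] have "0 \<le> y - c" by (simp add: c_def)
      then have mm: "real m \<le> y - c" "y - c < real m + 1"
        unfolding m_def by (simp_all add: of_nat_nat)
      then have mu: "\<mu> \<le> y" "y < \<mu> + 1" unfolding \<mu>_def by linarith+
      have "Q * \<mu> \<le> l" using mu(1) Q by (simp add: y_def pos_le_divide_eq mult.commute)
      then have "exp (ln 4 * \<mu>) \<le> exp (- D * \<mu> + l)" by (simp add: Q_def algebra_simps)
      then have "exp (ln 4 * \<mu>) * A \<le> exp (- D * \<mu> + l) * A" using pos by simp
      also have "\<dots> = exp (- D * \<mu>) * B" unfolding exp_add eB using pos by simp
      finally have 1: "exp (ln 4 * \<mu>) * A \<le> exp (- D * \<mu>) * B" .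
      have "M \<le> K * real n * \<Theta> * (exp (ln 4 * \<mu>) * A + exp (- D * \<mu>) * B)" unfolding \<mu>_def c_def by (rule car)
      also have "\<dots> \<le> K * real n * \<Theta> * (exp (- D * \<mu>) * B + exp (- D * \<mu>) * B)"
        using 1 K \<Theta> by (intro mult_left_mono add_right_mono) auto
      also have "\<dots> = (2 * K * \<Theta> * B) * (real n * exp (- D * \<mu>))" by (simp add: algebra_simps)
      also have "\<dots> \<le> (2 * K * \<Theta> * B) * (2 / D * exp D * exp (- \<alpha> * l))"
      proof (rule mult_left_mono)
        have "- D * \<mu> \<le> D + (- D * y)" using mult_left_mono[OF less_imp_le[OF mu(2)], of D] D by (simp add: algebra_simps)
        also have "- D * y = - (D * y / 2) + - (D * y / 2)" by simp
        also have "\<dots> \<le> - (D * real n / 2) + - \<alpha> * l"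
        proof (rule add_mono)
          show "- (D * y / 2) \<le> - (D * real n / 2)" using ny D by simp
          have "\<alpha> * l \<le> D / (2 * Q) * l" using \<alpha>(2) l0 by (intro mult_right_mono) (auto simp: Q_def)
          then show "- (D * y / 2) \<le> - \<alpha> * l" by (simp add: y_def)
        qed
        finally have "exp (- D * \<mu>) \<le> exp (D + (- (D * real n / 2) + - \<alpha> * l))" by simp
        also have "\<dots> = exp (- (D * real n / 2)) * (exp D * exp (- \<alpha> * l))" by (simp add: exp_add[symmetric])
        finally have "real n * exp (- D * \<mu>) \<le> (real n * exp (- (D * real n / 2))) * (exp D * exp (- \<alpha> * l))"
          using mult_left_mono[of "exp (- D * \<mu>)" _ "real n"] by (simp add: mult.assoc)
        also have "\<dots> \<le> 2 / D * (exp D * exp (- \<alpha> * l))"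
        proof (rule mult_right_mono)
          have "D * real n / 2 \<le> exp (D * real n / 2)" using exp_ge_add_one_self[of "D * real n / 2"] by linarith
          then have "D * real n / 2 * exp (- (D * real n / 2)) \<le> exp (D * real n / 2) * exp (- (D * real n / 2))" by (rule mult_right_mono) simp
          then have "D * real n / 2 * exp (- (D * real n / 2)) \<le> 1" by (simp add: exp_add[symmetric])
          then show "real n * exp (- (D * real n / 2)) \<le> 2 / D" using D by (simp add: field_simps)
        qed simp
        finally show "real n * exp (- D * \<mu>) \<le> 2 / D * exp D * exp (- \<alpha> * l)" by (simp only: mult.assoc)
      qed (use K \<Theta> pos in simp)
      also have "\<dots> = (4 * K * exp D / D) * (\<Theta> * (B * exp (- \<alpha> * l)))" by simp
      also have "\<dots> \<le> k * (\<Theta> * (B * exp (- \<alpha> * l)))" using k \<Theta> pos by (intro mult_right_mono) auto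
      finally show ?thesis by (simp only: mult.assoc)
    next
      case False
      \<comment> \<open>Here l < n Q, so \<alpha> <= 1 / (51 Q) makes \<alpha> l at most n / 51, the
        exponent of the growth bound.\<close>
      have "\<alpha> * l \<le> 1 / (51 * Q) * (real n * Q)" using \<alpha> False l0 Q by (intro mult_mono) (auto simp: Q_def)
      also have "\<dots> = real n / 51" using Q by simp
      finally have e: "exp (- (real n / 51)) \<le> exp (- \<alpha> * l)" by simp
      have "M \<le> 16 * C * exp (- (real n / 51)) * B" by (rule grow)
      also have "\<dots> \<le> k * exp (- \<alpha> * l) * B" using k e C pos by (intro mult_mono mult_right_mono) auto
      also have "\<dots> = (k * (B * exp (- \<alpha> * l))) * 1" by simp
      also have "\<dots> \<le> (k * (B * exp (- \<alpha> * l))) * \<Theta>" using \<Theta> k pos by (intro mult_left_mono) auto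
      finally show ?thesis by (simp only: mult_ac)
    qed
    then show ?thesis unfolding rhs k_def .
  qed
qed

text \<open>A point of the complement at distance less than R would push the infimum of the
  distances below R.\<close>

lemma inner_part_ball:
  assumes "x0 \<in> inner_part n U R"
  shows "x0 \<in> U" "ball_n n x0 R \<subseteq> U"
proof -
  show "x0 \<in> U" using assms by (simp add: inner_part_def)
  show "ball_n n x0 R \<subseteq> U"
  proof
    fix y assume y: "y \<in> ball_n n x0 R"
    show "y \<in> U"
    proof (rule ccontr)
      assume "y \<notin> U"
      then have "(INF y \<in> Rn n - U. dist_n n x0 y) \<le> dist_n n x0 y"
        using y by (intro cINF_lower bdd_belowI2[where m = 0]) (auto simp: ball_n_def)
      then show False using assms y by (simp add: inner_part_def ball_n_def)
    qed
  qed
qed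

lemma Lq_truncate:
  assumes "f \<in> Lq (bor n) q" "q > 1" "R > 0"
  shows "(\<lambda>x. indicator (ball_n n x0 R) x * f x) \<in> Lq (bor n) q" "integrable (bor n) (\<lambda>x. indicator (ball_n n x0 R) x * f x)"
proof -
  show 1: "(\<lambda>x. indicator (ball_n n x0 R) x * f x) \<in> Lq (bor n) q"
    by (rule Lq_bound(1)[OF assms(1), where C = 1]) (use assms LqD(1)[OF assms(1)] in \<open>auto simp: indicator_def\<close>)
  show "integrable (bor n) (\<lambda>x. indicator (ball_n n x0 R) x * f x)"
    unfolding Lq_1[symmetric] by (rule Lq_support_mono(1)[OF 1, of x0 R]) (use assms in auto)
qed

text \<open>Interior regularity is run on the ball of radius 4 r and yields u in L^p' on radius 3 r,
  as the locale demands. F is the sum of Borel representatives of the pure second weak derivatives,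
  so that the equation reads F = V u almost everywhere on the smaller ball.\<close>

lemma ball_solution_exists:
  assumes n: "n \<ge> 3" and r: "r > 0" and U: "openin (top_Rn n) U" and x0: "x0 \<in> inner_part n U (4 * r)"
    and V: "V \<in> Lp n (real n / 2) U" "2 * (sigma n U)\<^sup>2 * kappa n U V \<le> 1"
    and u: "u \<in> sobolev n 2 (exp_p n) U" and eq: "AE x in leb n. x \<in> U \<longrightarrow> - laplacian n U u x + V x * u x = 0"
  obtains v F V' where "ball_solution n x0 r U v F V' (kappa n U V)" "brep n (ball_n n x0 (3 * r)) u v"
proof -
  note e = exponents[OF n]
  have p1: "exp_p n > 1" using n by (simp add: exp_p_def field_simps)
  have p0: "exp_p n > 0" using p1 by simp
  have n0: "real n / 2 > 0" using n by simp
  have UR: "U \<subseteq> Rn n" using openin_subset[OF U] by (simp add: topspace_Rn)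
  have Us: "U \<in> sets (bor n)" by (rule openin_measurable[OF U])
  let ?B = "\<lambda>c. ball_n n x0 (c * r)"
  note ip = inner_part_ball[OF x0]
  have B34: "?B 3 \<subseteq> ?B 4" using r by (auto simp: ball_n_def)
  have B3: "?B 3 \<subseteq> U" using B34 ip(2) by (rule order_trans)
  have Lu: "u \<in> Lp n (exp_p n) U" using u by (simp add: sobolev_def)
  have ex: "\<exists>g\<in>Lp n (exp_p n) U. has_weak_deriv n U is u g" if "set is \<subseteq> {..<n}" "length is \<le> 2" for "is"
    using u that by (auto simp: sobolev_def)
  have rep: "\<exists>g'. brep n U g g' \<and> g' \<in> Lq (bor n) (exp_p n)" if g: "g \<in> Lp n (exp_p n) U" for g
  proof -
    have "set_borel_measurable (leb n) U g" using g by (simp add: Lp_def)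
    then obtain g' where g': "brep n U g g'" using brep_exists Us by blast
    then show ?thesis using brep_Lp[OF p0 g'] g by blast
  qed
  obtain u' where u': "brep n U u u'" "u' \<in> Lq (bor n) (exp_p n)" using rep[OF Lu] by blast
  have "\<exists>f. \<forall>i\<in>{..<n}. (\<exists>g. has_weak_deriv n U [i] u g \<and> brep n U g (f i)) \<and> f i \<in> Lq (bor n) (exp_p n)"
  proof (rule bchoice, rule ballI)
    fix i assume "i \<in> {..<n}"
    then obtain g where "g \<in> Lp n (exp_p n) U" "has_weak_deriv n U [i] u g" using ex[of "[i]"] by auto
    then show "\<exists>f. (\<exists>g. has_weak_deriv n U [i] u g \<and> brep n U g f) \<and> f \<in> Lq (bor n) (exp_p n)" using rep by blast
  qed
  then obtain f where f: "\<And>i. i < n \<Longrightarrow> \<exists>g. has_weak_deriv n U [i] u g \<and> brep n U g (f i)" "\<And>i. i < n \<Longrightarrow> f i \<in> Lq (bor n) (exp_p n)" by blast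
  have "\<exists>h. \<forall>i\<in>{..<n}. (\<exists>g. has_weak_deriv n U [i, i] u g \<and> brep n U g (h i)) \<and> h i \<in> Lq (bor n) (exp_p n)"
  proof (rule bchoice, rule ballI)
    fix i assume "i \<in> {..<n}"
    then obtain g where "g \<in> Lp n (exp_p n) U" "has_weak_deriv n U [i, i] u g" using ex[of "[i, i]"] by auto
    then show "\<exists>f. (\<exists>g. has_weak_deriv n U [i, i] u g \<and> brep n U g f) \<and> f \<in> Lq (bor n) (exp_p n)" using rep by blast
  qed
  then obtain h where h: "\<And>i. i < n \<Longrightarrow> \<exists>g. has_weak_deriv n U [i, i] u g \<and> brep n U g (h i)" "\<And>i. i < n \<Longrightarrow> h i \<in> Lq (bor n) (exp_p n)" by blast
  define F where "F x = (\<Sum>i<n. h i x)" for x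
  have LF: "F \<in> Lq (bor n) (exp_p n)"
    unfolding F_def[abs_def] using Minkowski_sum[OF e(1), of "{..<n}" h "bor n"] h(2) by auto
  \<comment> \<open>Truncation makes the data integrable on the whole space and leaves pairings with
    test functions supported in the ball unchanged.\<close>
  define T where "T c g x = indicator (?B c) x * g x" for c :: real and g :: "(nat \<Rightarrow> real) \<Rightarrow> real" and x
  have Tq: "T c g \<in> Lq (bor n) (exp_p n)" "integrable (bor n) (T c g)" if "g \<in> Lq (bor n) (exp_p n)" "c > 0" for c g
    using Lq_truncate[OF that(1) p1, of "c * r" x0] r that(2) by (simp_all add: T_def[abs_def])
  have Tint: "(LINT x|bor n. T c g x * \<psi> x) = (LINT x|bor n. g x * \<psi> x)" if "\<psi> \<in> test_fun n (?B c)" for c g \<psi>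
    by (rule Bochner_Integration.integral_cong) (use test_fun_outside[OF that] in \<open>auto simp: T_def indicator_def space_bor\<close>)
  have sub: "\<phi> \<in> test_fun n U" if "\<phi> \<in> test_fun n (?B c)" "c = 3 \<or> c = 4" for \<phi> c
    using test_fun_mono[OF B3, of \<phi>] test_fun_mono[OF ip(2), of \<phi>] that by blast
  have w1: "(LINT y|bor n. T c u' y * partial i \<phi> y) = - (LINT y|bor n. T c (f i) y * \<phi> y)"
    if i: "i < n" and t: "\<phi> \<in> test_fun n (?B c)" and c: "c = 3 \<or> c = 4" for i \<phi> c
  proof -
    obtain g where g: "has_weak_deriv n U [i] u g" "brep n U g (f i)" using f(1)[OF i] by blast
    have "(LINT x|bor n. u' x * partial i \<phi> x) = - (LINT x|bor n. f i x * \<phi> x)"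
      using weak_deriv_brep[OF U g(1) u'(1) g(2) sub[OF t c]] i by (simp add: partials_def)
    then show ?thesis unfolding Tint[OF t] Tint[OF test_fun_partial[OF t i]] .
  qed
  have w2: "(LINT y|bor n. T c u' y * lap n \<phi> y) = (LINT y|bor n. T c F y * \<phi> y)"
    if t: "\<phi> \<in> test_fun n (?B c)" and c: "c = 3 \<or> c = 4" for \<phi> c
  proof -
    have c0: "c > 0" using c by auto
    have each: "(LINT y|bor n. T c u' y * partial i (partial i \<phi>) y) = (LINT y|bor n. T c (h i) y * \<phi> y)" if i: "i < n" for i
    proof -
      obtain g where g: "has_weak_deriv n U [i, i] u g" "brep n U g (h i)" using h(1)[OF i] by blast
      have "(LINT x|bor n. u' x * partial i (partial i \<phi>) x) = (LINT x|bor n. h i x * \<phi> x)"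
        using weak_deriv_brep[OF U g(1) u'(1) g(2) sub[OF t c]] i by (simp add: partials_def)
      then show ?thesis unfolding Tint[OF t] Tint[OF test_fun_partial[OF test_fun_partial[OF t i] i]] .
    qed
    have "(LINT y|bor n. T c u' y * lap n \<phi> y) = (LINT y|bor n. (\<Sum>i<n. T c u' y * partial i (partial i \<phi>) y))"
      by (simp add: lap_def sum_distrib_left)
    also have "\<dots> = (\<Sum>i<n. (LINT y|bor n. T c u' y * partial i (partial i \<phi>) y))"
      by (rule Bochner_Integration.integral_sum)
         (use Tq(2)[OF u'(2) c0] test_fun_cc[OF test_fun_partial[OF test_fun_partial[OF t]]] in \<open>auto intro!: integrable_test_mult\<close>)
    also have "\<dots> = (\<Sum>i<n. (LINT y|bor n. T c (h i) y * \<phi> y))" using each by simp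
    also have "\<dots> = (LINT y|bor n. (\<Sum>i<n. T c (h i) y * \<phi> y))"
      by (rule Bochner_Integration.integral_sum[symmetric])
         (use Tq(2)[OF h(2) c0] test_fun_cc[OF t] in \<open>auto intro!: integrable_test_mult\<close>)
    also have "\<dots> = (LINT y|bor n. T c F y * \<phi> y)"
    proof (rule Bochner_Integration.integral_cong[OF refl])
      fix y show "(\<Sum>i<n. T c (h i) y * \<phi> y) = T c F y * \<phi> y"
        by (cases "y \<in> ?B c") (simp_all add: T_def F_def sum_distrib_right)
    qed
    finally show ?thesis .
  qed
  have Lp': "T 3 (T 4 u') \<in> Lq (bor n) (exp_p' n)"
    unfolding T_def[of 3, abs_def]
    by (rule interior_Lq[OF n r _ Tq[OF u'(2)] Tq[OF f(2)] Tq[OF LF] w1 w2]) (use ip(1) UR in auto)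
  have "T 3 (T 4 u') = T 3 u'" using B34 by (auto simp: T_def fun_eq_iff indicator_def)
  with Lp' have Lp': "T 3 u' \<in> Lq (bor n) (exp_p' n)" by simp
  have "set_borel_measurable (leb n) U V" using V(1) by (simp add: Lp_def)
  then obtain V' where V': "brep n U V V'" using brep_exists Us by blast
  have "AE x in bor n. \<forall>i\<in>{..<n}. x \<in> U \<longrightarrow> weak_deriv n U [i, i] u x = h i x"
  proof (rule AE_finite_allI[OF finite_lessThan])
    fix i assume "i \<in> {..<n}"
    then obtain g where g: "has_weak_deriv n U [i, i] u g" "brep n U g (h i)" using h(1) by blast
    show "AE x in bor n. x \<in> U \<longrightarrow> weak_deriv n U [i, i] u x = h i x"
      using weak_deriv_AE(1)[OF U g(1)] brepD(4)[OF g(2)] by eventually_elim auto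
  qed
  then have FV: "AE x in bor n. T 3 F x = V' x * T 3 u' x"
    using brepD(4)[OF u'(1)] brepD(4)[OF V'] eq[unfolded AE_leb_iff]
  proof eventually_elim
    case (elim x)
    show ?case
    proof (cases "x \<in> ?B 3")
      case True
      then have xU: "x \<in> U" using B3 by blast
      have "laplacian n U u x = F x" using elim(1) xU by (simp add: laplacian_def F_def)
      then show ?thesis using elim xU True by (simp add: T_def)
    qed (simp add: T_def)
  qed
  have "ball_solution n x0 r U (T 3 u') (T 3 F) V' (kappa n U V)"
  proof
    show "V' \<in> Lq (bor n) (real n / 2)" using brep_Lp[OF n0 V'] V(1) by simp
    show "nrm (bor n) (real n / 2) V' \<le> kappa n U V" using brep_nrm[OF n0 V'] by (simp add: kappa_def)
    show "(LINT y|bor n. T 3 u' y * lap n \<phi> y) = (LINT y|bor n. T 3 F y * \<phi> y)" if "\<phi> \<in> test_fun n (ball_n n x0 (3 * r))" for \<phi>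
      using that by (intro w2) auto
    show "T 3 F \<in> Lq (bor n) (exp_p n)" by (rule Tq[OF LF]) simp
    show "x0 \<in> Rn n" using ip(1) UR by blast
  qed (use n r U B3 Lp' FV V(2) in \<open>auto simp: T_def\<close>)
  moreover have "brep n (?B 3) u (T 3 u')"
    unfolding T_def[abs_def] by (rule brep_sub[OF u'(1) ball_measurable B3])
  ultimately show thesis using that by blast
qed

theorem theorem3p3:
  shows "\<exists>k::real. \<exists>\<alpha>::real. k \<ge> 1 \<and> 0 < \<alpha> \<and> \<alpha> < 1 \<and>
    (\<forall>n::nat. \<forall>\<theta>::real. \<forall>\<Omega>. \<forall>r0::real. \<forall>r::real.
       n \<ge> 3 \<longrightarrow> \<theta> \<ge> 1 \<longrightarrow> carleman n \<theta> \<longrightarrow> bounded_lipschitz_domain n \<Omega> \<longrightarrow>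
       0 < r0 \<longrightarrow> r0 \<le> 1 \<longrightarrow> inner_part n \<Omega> r0 \<noteq> {} \<longrightarrow> 0 < r \<longrightarrow> r < r0 / 4 \<longrightarrow>
       (\<forall>x0 \<in> inner_part n \<Omega> (4 * r). \<forall>V \<in> potentials n \<Omega> \<theta>. \<forall>u \<in> sobolev n 2 (exp_p n) \<Omega>.
          (AE x in leb n. x \<in> \<Omega> \<longrightarrow> - laplacian n \<Omega> u x + V x * u x = 0) \<longrightarrow>
          Lp_norm n 2 (ball_n n x0 (2 * r)) u
            \<le> (k * theta_V n \<Omega> \<theta> V * (1 + kappa1 n \<Omega> V)) * inverse r
              * Lp_norm n 2 (ball_n n x0 (3 * r)) u powr (1 - \<alpha>)
              * Lp_norm n 2 (ball_n n x0 r) u powr \<alpha>))"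
proof -
  obtain C1 where C1: "\<And>s. \<bar>step 1 s\<bar> \<le> C1" using step_bounded by blast
  obtain C2 where C2: "\<And>s. \<bar>step 2 s\<bar> \<le> C2" using step_bounded by blast
  define C where "C = max 1 (max C1 C2)"
  have C: "C \<ge> 1" "\<And>s. \<bar>step 1 s\<bar> \<le> C" "\<And>s. \<bar>step 2 s\<bar> \<le> C"
    using C1 C2 unfolding C_def by (auto intro: max.coboundedI2 max.coboundedI1)
  \<comment> \<open>The decay rate of the outer term: (2 / sqrt 6)^\<mu> = exp (-D \<mu>).\<close>
  define D where "D = - ln (2 / sqrt 6 :: real)"
  have "2 / sqrt 6 < (1 :: real)" by (simp add: real_less_rsqrt)
  then have D: "D > 0" unfolding D_def by (simp add: ln_less_zero_iff)
  define Q where "Q = ln 4 + D"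
  have "ln 4 > (0::real)" by simp
  then have "Q > D" unfolding Q_def by simp
  with D have Q: "Q > 0" "D < 2 * Q" by linarith+
  \<comment> \<open>One bound for each regime: D / (2 Q) spends half of the decay at the balancing
    exponent ln (B / A) / Q, and 1 / (51 Q) comes from the growth estimate.\<close>
  define \<alpha> where "\<alpha> = min (D / (2 * Q)) (1 / (51 * Q))"
  have \<alpha>: "0 < \<alpha>" "\<alpha> \<le> D / (2 * Q)" "\<alpha> \<le> 1 / (51 * Q)" using D Q by (auto simp: \<alpha>_def)
  have "D / (2 * Q) < 1" using Q by (simp add: divide_less_eq)
  with \<alpha>(2) have \<alpha>1: "\<alpha> < 1" by linarith
  define K where "K = 8401 * C\<^sup>2"
  have "1 \<le> C\<^sup>2" using C(1) by simp
  then have K: "K \<ge> 1" by (simp add: K_def)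
  define k where "k = 4 * K * exp D / D + 16 * C"
  have "0 \<le> 4 * K * exp D / D" using K D by simp
  then have k: "k \<ge> 1" using C(1) by (simp add: k_def)
  have main: "Lp_norm n 2 (ball_n n x0 (2 * r)) u
      \<le> (k * theta_V n \<Omega> \<theta> V * (1 + kappa1 n \<Omega> V)) * inverse r
        * Lp_norm n 2 (ball_n n x0 (3 * r)) u powr (1 - \<alpha>) * Lp_norm n 2 (ball_n n x0 r) u powr \<alpha>"
    if n: "n \<ge> 3" and \<theta>: "\<theta> \<ge> 1" and car: "carleman n \<theta>" and dom: "bounded_lipschitz_domain n \<Omega>"
      and r0: "r0 \<le> 1" and rr: "0 < r" "r < r0 / 4" and x0: "x0 \<in> inner_part n \<Omega> (4 * r)" and V: "V \<in> potentials n \<Omega> \<theta>"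
      and u: "u \<in> sobolev n 2 (exp_p n) \<Omega>" and eq: "AE x in leb n. x \<in> \<Omega> \<longrightarrow> - laplacian n \<Omega> u x + V x * u x = 0"
    for n \<theta> \<Omega> r0 r x0 V u
  proof -
    have dom': "openin (top_Rn n) \<Omega>" "\<Omega> \<noteq> {}" using dom by (auto simp: bounded_lipschitz_domain_def)
    define kap where "kap = kappa n \<Omega> V"
    have V': "V \<in> Lp n (real n / 2) \<Omega>" "2 * (sigma n \<Omega>)\<^sup>2 * kap \<le> 1" "\<theta> * kap < 1"
      using V by (auto simp: potentials_def kap_def)
    obtain v F W where sol: "ball_solution n x0 r \<Omega> v F W kap" and b: "brep n (ball_n n x0 (3 * r)) u v"
      using ball_solution_exists[OF n rr(1) dom'(1) x0 V'(1) _ u eq] V'(2) unfolding kap_def by blast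
    interpret ball_solution n x0 r \<Omega> v F W kap by (rule sol)
    have nb: "Lp_norm n 2 (ball_n n x0 (c * r)) u = nrm (bor n) 2 (\<lambda>x. indicator (ball_n n x0 (c * r)) x * v x)" if "c \<le> 3" for c
    proof (rule brep_nrm)
      have "c * r \<le> 3 * r" using that rr(1) by (rule mult_right_mono[OF _ less_imp_le])
      then show "brep n (ball_n n x0 (c * r)) u (\<lambda>x. indicator (ball_n n x0 (c * r)) x * v x)"
        by (intro brep_sub[OF b ball_measurable]) (auto simp: ball_n_def)
    qed simp
    define A where "A = Lp_norm n 2 (ball_n n x0 r) u"
    define B where "B = Lp_norm n 2 (ball_n n x0 (3 * r)) u"
    define M where "M = Lp_norm n 2 (ball_n n x0 (2 * r)) u"
    have AA: "A = nrm (bor n) 2 (\<lambda>x. indicator (ball_n n x0 r) x * v x)" unfolding A_def using nb[of 1] by simp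
    have MM: "M = nrm (bor n) 2 (\<lambda>x. indicator (ball_n n x0 (2 * r)) x * v x)" unfolding M_def using nb[of 2] by simp
    have BB: "B = nrm (bor n) 2 v" unfolding B_def by (rule brep_nrm[OF _ b]) simp
    have vm: "v \<in> borel_measurable (bor n)" by (rule LqD(1)[OF u2])
    have ind: "(\<lambda>x. indicator (ball_n n x0 (2 * r)) x * v x) \<in> Lq (bor n) 2" "M \<le> 1 * B"
      unfolding MM BB by (rule Lq_bound[OF u2, where C = 1]; use vm in \<open>auto simp: indicator_def\<close>)+
    have AM: "A \<le> 1 * M"
    proof -
      have vm1: "(\<lambda>x. indicator (ball_n n x0 r) x * v x) \<in> borel_measurable (bor n)" using vm by measurable
      show ?thesis unfolding AA MM
        by (rule Lq_bound(2)[OF ind(1) vm1]) (use r in \<open>auto simp: indicator_def ball_n_def\<close>)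
    qed
    define \<Theta> where "\<Theta> = theta_V n \<Omega> \<theta> V"
    have T: "\<Theta> = \<theta> / (1 - \<theta> * kap)" by (simp add: \<Theta>_def theta_V_def kap_def divide_inverse)
    have "0 \<le> \<theta> * kap" using \<theta> kap_nonneg by simp
    then have T1: "\<Theta> \<ge> 1" unfolding T using \<theta> V'(3) by (simp add: pos_le_divide_eq)
    have "M \<le> k * \<Theta> * (B powr (1 - \<alpha>) * A powr \<alpha>)"
      unfolding k_def
    proof (rule three_ball_optimisation)
      show "1 \<le> n" "0 \<le> A" "A \<le> M" "M \<le> B" "1 \<le> K" "1 \<le> \<Theta>" "0 \<le> C" "0 < D" "0 < \<alpha>"
        using n AM ind(2) K T1 C D \<alpha> by (auto simp: AA)
      show "\<alpha> \<le> D / (2 * (ln 4 + D))" "\<alpha> \<le> 1 / (51 * (ln 4 + D))" using \<alpha> by (simp_all add: Q_def)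
      show "M \<le> 16 * C * exp (- (real n / 51)) * B" unfolding MM BB by (rule growth[OF C(2)])
      fix m :: nat
      define \<mu> where "\<mu> = (real n - 1) / 2 + real m"
      have p: "4 powr \<mu> = exp (ln 4 * \<mu>)" "(2 / sqrt 6) powr \<mu> = exp (- D * \<mu>)"
        unfolding D_def powr_def by simp_all
      have "M \<le> K * real n * \<Theta> * (4 powr \<mu> * A + (2 / sqrt 6) powr \<mu> * B)"
        unfolding MM AA BB K_def T \<mu>_def by (rule carleman_estimate[OF car \<theta> V'(3) Lambda_member[OF n] C])
      then show "M \<le> K * real n * \<Theta> * (exp (ln 4 * ((real n - 1) / 2 + real m)) * A + exp (- D * ((real n - 1) / 2 + real m)) * B)"
        unfolding p unfolding \<mu>_def .
    qed
    \<comment> \<open>Both factors are at least 1: \<sigma> >= 0 makes \<open>kappa1\<close>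
      nonnegative, and r < r0 / 4 <= 1 / 4.\<close>
    also have "\<dots> \<le> ((1 + kappa1 n \<Omega> V) * inverse r) * (k * \<Theta> * (B powr (1 - \<alpha>) * A powr \<alpha>))"
    proof -
      have s: "sigma n \<Omega> \<ge> 0" by (rule sigma_nonneg[OF n dom'])
      have "0 \<le> kappa1 n \<Omega> V"
        unfolding kappa1_def using s kap_nonneg by (intro add_nonneg_nonneg mult_nonneg_nonneg divide_nonneg_nonneg) (auto simp: I_const_def kap_def)
      moreover have "r \<le> 1" using rr r0 by linarith
      then have "1 \<le> inverse r" using rr(1) by (simp add: one_le_inverse)
      ultimately have "1 * 1 \<le> (1 + kappa1 n \<Omega> V) * inverse r" by (intro mult_mono) auto
      moreover have "0 \<le> k * \<Theta> * (B powr (1 - \<alpha>) * A powr \<alpha>)" using k T1 by simp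
      ultimately have "1 * (k * \<Theta> * (B powr (1 - \<alpha>) * A powr \<alpha>)) \<le> ((1 + kappa1 n \<Omega> V) * inverse r) * (k * \<Theta> * (B powr (1 - \<alpha>) * A powr \<alpha>))"
        by (intro mult_right_mono) auto
      then show ?thesis by simp
    qed
    finally show ?thesis unfolding M_def A_def B_def \<Theta>_def by (simp only: mult_ac)
  qed
  show ?thesis
    by (rule exI[of _ k], rule exI[of _ \<alpha>]) (use k \<alpha>(1) \<alpha>1 main in blast)
qed

end
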